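(* Suppose that $\theta,\lambda,\kappa,\mu$ are infinite cardinals with $\theta<\lambda<\mathrm{cf}(\mu)<\kappa<\mu$, that $\theta$ is regular, and that $2^{<\theta}=\theta$. Assume also that $\mu$ is a strong limit cardinal and that $\lambda^{<\lambda}=\lambda$. Suppose moreover that $\kappa$ is measurable and $\mathcal{D}$ is a normal measure on $\kappa$. Then there is a cofinality preserving forcing extension in which $2^{\theta}=\kappa$, $\mathfrak{u}(\kappa)\le\mu$, and $2^{\kappa}=\mu^{\kappa}>\mu$.
   Context: An ultrafilter $\mathcal{U}$ on a regular cardinal $\kappa$ is uniform if every member has size $\kappa$; a set $\mathcal{X}\subseteq\mathcal{U}$ generates $\mathcal{U}$ if $\mathcal{U}=\{A\subseteq\kappa:\exists B\in\mathcal{X}\,(B\subseteq A)\}$. $\mathfrak{u}(\kappa)$ is the least cardinality of a family generating some uniform ultrafilter on $\kappa$. *)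

theory Defs
  imports "HOL-Library.Countable_Set_Type"
begin

text \<open>
  Forcing extensions are generic extensions of countable transitive models of ZFC. Every such
  model consists of hereditarily countable sets, and so does each of its generic extensions, so
  all of them live in the following type. Countable sets form a bounded functor with
  extensional equality, hence the elements of the type are well-founded extensional sets.
\<close>

datatype hc = HC "hc cset"

primrec elts :: "hc \<Rightarrow> hc set" where
  "elts (HC c) = rcset c"

text \<open>Meaningful only for countable arguments.\<close>

definition mk :: "hc set \<Rightarrow> hc" where
  "mk A = HC (acset A)"

lemma elts_mk [simp]: "countable A \<Longrightarrow> elts (mk A) = A"
  by (simp add: mk_def)

lemma countable_elts [simp]: "countable (elts x)"
  by (cases x) simp

lemma mk_elts [simp]: "mk (elts x) = x"
  by (cases x) (simp add: mk_def)

lemma hc_eqI: "elts x = elts y \<Longrightarrow> x = y"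
  by (metis mk_elts)

lemma wf_elts: "wf {(x, y). x \<in> elts y}"
proof (rule wfUNIVI)
  fix P :: "hc \<Rightarrow> bool" and x
  assume *: "\<forall>x. (\<forall>y. (y, x) \<in> {(x, y). x \<in> elts y} \<longrightarrow> P y) \<longrightarrow> P x"
  show "P x"
    by (induction x) (use * in auto)
qed

definition hpair :: "hc \<Rightarrow> hc \<Rightarrow> hc" where
  "hpair x y = mk {mk {x}, mk {x, y}}"

lemma mk_eq_iff: "countable A \<Longrightarrow> countable B \<Longrightarrow> mk A = mk B \<longleftrightarrow> A = B"
  using elts_mk by fastforce

lemma hpair_inject [simp]: "hpair a b = hpair c d \<longleftrightarrow> a = c \<and> b = d"
  by (auto simp: hpair_def mk_eq_iff doubleton_eq_iff)

lemma hpair_fst: "\<exists>y\<in>elts (hpair a b). a \<in> elts y"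
  by (simp add: hpair_def)

text \<open>First-order formulas of set theory, used in the two axiom schemes.\<close>

datatype fm = FMem nat nat | FEq nat nat | FNeg fm | FConj fm fm | FAll nat fm

primrec sat :: "hc set \<Rightarrow> (nat \<Rightarrow> hc) \<Rightarrow> fm \<Rightarrow> bool" where
  "sat M e (FMem i j) \<longleftrightarrow> e i \<in> elts (e j)"
| "sat M e (FEq i j) \<longleftrightarrow> e i = e j"
| "sat M e (FNeg \<phi>) \<longleftrightarrow> \<not> sat M e \<phi>"
| "sat M e (FConj \<phi> \<psi>) \<longleftrightarrow> sat M e \<phi> \<and> sat M e \<psi>"
| "sat M e (FAll n \<phi>) \<longleftrightarrow> (\<forall>x\<in>M. sat M (e(n := x)) \<phi>)"

definition extensionality_ax :: "hc set \<Rightarrow> bool" where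
  "extensionality_ax M \<longleftrightarrow>
    (\<forall>x\<in>M. \<forall>y\<in>M. (\<forall>z\<in>M. z \<in> elts x \<longleftrightarrow> z \<in> elts y) \<longrightarrow> x = y)"

definition foundation_ax :: "hc set \<Rightarrow> bool" where
  "foundation_ax M \<longleftrightarrow>
    (\<forall>x\<in>M. (\<exists>y\<in>M. y \<in> elts x) \<longrightarrow>
        (\<exists>y\<in>M. y \<in> elts x \<and> \<not> (\<exists>z\<in>M. z \<in> elts x \<and> z \<in> elts y)))"

definition pairing_ax :: "hc set \<Rightarrow> bool" where
  "pairing_ax M \<longleftrightarrow>
    (\<forall>x\<in>M. \<forall>y\<in>M. \<exists>z\<in>M. \<forall>w\<in>M. w \<in> elts z \<longleftrightarrow> w = x \<or> w = y)"

definition union_ax :: "hc set \<Rightarrow> bool" where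
  "union_ax M \<longleftrightarrow>
    (\<forall>x\<in>M. \<exists>u\<in>M. \<forall>z\<in>M. z \<in> elts u \<longleftrightarrow> (\<exists>y\<in>M. y \<in> elts x \<and> z \<in> elts y))"

definition powerset_ax :: "hc set \<Rightarrow> bool" where
  "powerset_ax M \<longleftrightarrow>
    (\<forall>x\<in>M. \<exists>p\<in>M. \<forall>y\<in>M. y \<in> elts p \<longleftrightarrow> (\<forall>z\<in>M. z \<in> elts y \<longrightarrow> z \<in> elts x))"

definition infinity_ax :: "hc set \<Rightarrow> bool" where
  "infinity_ax M \<longleftrightarrow>
    (\<exists>x\<in>M. (\<exists>e\<in>M. e \<in> elts x \<and> (\<forall>z\<in>M. z \<notin> elts e)) \<and>
        (\<forall>y\<in>M. y \<in> elts x \<longrightarrow>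
          (\<exists>s\<in>M. s \<in> elts x \<and> (\<forall>z\<in>M. z \<in> elts s \<longleftrightarrow> z \<in> elts y \<or> z = y))))"

definition separation_ax :: "hc set \<Rightarrow> bool" where
  "separation_ax M \<longleftrightarrow>
    (\<forall>\<phi> e. range e \<subseteq> M \<longrightarrow>
        (\<forall>a\<in>M. \<exists>b\<in>M. \<forall>x\<in>M. x \<in> elts b \<longleftrightarrow> x \<in> elts a \<and> sat M (e(0 := x)) \<phi>))"

definition replacement_ax :: "hc set \<Rightarrow> bool" where
  "replacement_ax M \<longleftrightarrow>
    (\<forall>\<phi> e. range e \<subseteq> M \<longrightarrow>
        (\<forall>a\<in>M.
          (\<forall>x\<in>M. \<forall>y\<in>M. \<forall>y'\<in>M. x \<in> elts a \<and> sat M (e(0 := x, 1 := y)) \<phi> \<and>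
             sat M (e(0 := x, 1 := y')) \<phi> \<longrightarrow> y = y') \<longrightarrow>
          (\<exists>b\<in>M. \<forall>y\<in>M. y \<in> elts b \<longleftrightarrow>
             (\<exists>x\<in>M. x \<in> elts a \<and> sat M (e(0 := x, 1 := y)) \<phi>))))"

text \<open>Every family of nonempty, pairwise disjoint sets has a transversal.\<close>

definition choice_ax :: "hc set \<Rightarrow> bool" where
  "choice_ax M \<longleftrightarrow>
    (\<forall>a\<in>M.
        (\<forall>x\<in>M. x \<in> elts a \<longrightarrow> (\<exists>z\<in>M. z \<in> elts x)) \<and>
        (\<forall>x\<in>M. \<forall>y\<in>M. x \<in> elts a \<and> y \<in> elts a \<and> x \<noteq> y \<longrightarrow>
           \<not> (\<exists>z\<in>M. z \<in> elts x \<and> z \<in> elts y)) \<longrightarrow>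
        (\<exists>c\<in>M. \<forall>x\<in>M. x \<in> elts a \<longrightarrow> (\<exists>!z. z \<in> M \<and> z \<in> elts x \<and> z \<in> elts c)))"

definition ZFC :: "hc set \<Rightarrow> bool" where
  "ZFC M \<longleftrightarrow> extensionality_ax M \<and> foundation_ax M \<and> pairing_ax M \<and>
     union_ax M \<and> powerset_ax M \<and> infinity_ax M \<and>
     separation_ax M \<and> replacement_ax M \<and> choice_ax M"

definition ctm :: "hc set \<Rightarrow> bool" where
  "ctm M \<longleftrightarrow> countable M \<and> (\<forall>x\<in>M. elts x \<subseteq> M) \<and> ZFC M"

text \<open>
  The notions without argument \<open>M\<close> are absolute for transitive models. The others are their
  relativizations to \<open>M\<close>: functions, sets of ordinals, families and ultrafilters range over
  elements of \<open>M\<close> only.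
\<close>

definition ordinal :: "hc \<Rightarrow> bool" where
  "ordinal \<alpha> \<longleftrightarrow> (\<forall>x\<in>elts \<alpha>. elts x \<subseteq> elts \<alpha> \<and> (\<forall>y\<in>elts x. elts y \<subseteq> elts x))"

definition least_ord :: "(hc \<Rightarrow> bool) \<Rightarrow> hc" where
  "least_ord Q = (THE \<alpha>. ordinal \<alpha> \<and> Q \<alpha> \<and> (\<forall>\<beta>. ordinal \<beta> \<and> Q \<beta> \<longrightarrow> elts \<alpha> \<subseteq> elts \<beta>))"

definition two :: hc where
  "two = mk {mk {}, mk {mk {}}}"

definition is_fun :: "hc \<Rightarrow> hc \<Rightarrow> hc \<Rightarrow> bool" where
  "is_fun f A B \<longleftrightarrow>
     (\<forall>z\<in>elts f. \<exists>a\<in>elts A. \<exists>b\<in>elts B. z = hpair a b) \<and>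
     (\<forall>a\<in>elts A. \<exists>!b. hpair a b \<in> elts f)"

definition app :: "hc \<Rightarrow> hc \<Rightarrow> hc" where
  "app f a = (THE b. hpair a b \<in> elts f)"

definition is_bij :: "hc \<Rightarrow> hc \<Rightarrow> hc \<Rightarrow> bool" where
  "is_bij f A B \<longleftrightarrow> is_fun f A B \<and> bij_betw (app f) (elts A) (elts B)"

definition card_in :: "hc set \<Rightarrow> hc \<Rightarrow> hc" where
  "card_in M A = least_ord (\<lambda>\<alpha>. \<alpha> \<in> M \<and> (\<exists>f\<in>M. is_bij f \<alpha> A))"

definition cardinal :: "hc set \<Rightarrow> hc \<Rightarrow> bool" where
  "cardinal M \<kappa> \<longleftrightarrow> \<kappa> \<in> M \<and> ordinal \<kappa> \<and> card_in M \<kappa> = \<kappa>"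

definition infinite_cardinal :: "hc set \<Rightarrow> hc \<Rightarrow> bool" where
  "infinite_cardinal M \<kappa> \<longleftrightarrow> cardinal M \<kappa> \<and> infinite (elts \<kappa>)"

definition cof :: "hc set \<Rightarrow> hc \<Rightarrow> hc" where
  "cof M \<alpha> = least_ord (\<lambda>\<delta>. \<delta> \<in> M \<and>
     (\<exists>f\<in>M. is_fun f \<delta> \<alpha> \<and> (\<forall>\<beta>\<in>elts \<alpha>. \<exists>\<xi>\<in>elts \<delta>. elts \<beta> \<subseteq> elts (app f \<xi>))))"

definition regular_cardinal :: "hc set \<Rightarrow> hc \<Rightarrow> bool" where
  "regular_cardinal M \<kappa> \<longleftrightarrow> infinite_cardinal M \<kappa> \<and> cof M \<kappa> = \<kappa>"

definition cexp :: "hc set \<Rightarrow> hc \<Rightarrow> hc \<Rightarrow> hc" where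
  "cexp M \<kappa> \<nu> = card_in M (mk {f \<in> M. is_fun f \<nu> \<kappa>})"

text \<open>The supremum of \<open>\<kappa>\<^sup>\<nu>\<close> over all cardinals \<open>\<nu> < \<lambda>\<close>.\<close>

definition cexp_less :: "hc set \<Rightarrow> hc \<Rightarrow> hc \<Rightarrow> hc" where
  "cexp_less M \<kappa> l = mk (\<Union>\<nu>\<in>{\<nu> \<in> elts l. cardinal M \<nu>}. elts (cexp M \<kappa> \<nu>))"

definition strong_limit :: "hc set \<Rightarrow> hc \<Rightarrow> bool" where
  "strong_limit M \<mu> \<longleftrightarrow> infinite_cardinal M \<mu> \<and>
     (\<forall>\<nu>\<in>elts \<mu>. cardinal M \<nu> \<longrightarrow> cexp M two \<nu> \<in> elts \<mu>)"

definition ultrafilter_on :: "hc set \<Rightarrow> hc \<Rightarrow> hc \<Rightarrow> bool" where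
  "ultrafilter_on M \<kappa> U \<longleftrightarrow> U \<in> M \<and>
     (\<forall>A\<in>elts U. elts A \<subseteq> elts \<kappa>) \<and>
     \<kappa> \<in> elts U \<and> mk {} \<notin> elts U \<and>
     (\<forall>A\<in>elts U. \<forall>B\<in>elts U. mk (elts A \<inter> elts B) \<in> elts U) \<and>
     (\<forall>A\<in>elts U. \<forall>B\<in>M. elts A \<subseteq> elts B \<and> elts B \<subseteq> elts \<kappa> \<longrightarrow> B \<in> elts U) \<and>
     (\<forall>A\<in>M. elts A \<subseteq> elts \<kappa> \<longrightarrow> A \<in> elts U \<or> mk (elts \<kappa> - elts A) \<in> elts U)"

definition nonprincipal :: "hc \<Rightarrow> hc \<Rightarrow> bool" where
  "nonprincipal \<kappa> U \<longleftrightarrow> (\<forall>\<xi>\<in>elts \<kappa>. mk {\<xi>} \<notin> elts U)"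

definition complete_filter :: "hc set \<Rightarrow> hc \<Rightarrow> hc \<Rightarrow> bool" where
  "complete_filter M \<kappa> U \<longleftrightarrow>
     (\<forall>\<beta>\<in>elts \<kappa>. \<forall>f\<in>M. is_fun f \<beta> U \<longrightarrow>
        mk {\<xi> \<in> elts \<kappa>. \<forall>\<eta>\<in>elts \<beta>. \<xi> \<in> elts (app f \<eta>)} \<in> elts U)"

definition normal_filter :: "hc set \<Rightarrow> hc \<Rightarrow> hc \<Rightarrow> bool" where
  "normal_filter M \<kappa> U \<longleftrightarrow>
     (\<forall>f\<in>M. is_fun f \<kappa> U \<longrightarrow>
        mk {\<xi> \<in> elts \<kappa>. \<forall>\<eta>\<in>elts \<xi>. \<xi> \<in> elts (app f \<eta>)} \<in> elts U)"

definition measure_on :: "hc set \<Rightarrow> hc \<Rightarrow> hc \<Rightarrow> bool" where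
  "measure_on M \<kappa> U \<longleftrightarrow> ultrafilter_on M \<kappa> U \<and> nonprincipal \<kappa> U \<and> complete_filter M \<kappa> U"

text \<open>The second conjunct says that \<open>\<omega> < \<kappa>\<close>.\<close>

definition measurable_cardinal :: "hc set \<Rightarrow> hc \<Rightarrow> bool" where
  "measurable_cardinal M \<kappa> \<longleftrightarrow>
     cardinal M \<kappa> \<and> (\<exists>\<alpha>\<in>elts \<kappa>. infinite (elts \<alpha>)) \<and> (\<exists>U. measure_on M \<kappa> U)"

definition normal_measure :: "hc set \<Rightarrow> hc \<Rightarrow> hc \<Rightarrow> bool" where
  "normal_measure M \<kappa> U \<longleftrightarrow> measure_on M \<kappa> U \<and> normal_filter M \<kappa> U"

definition uniform :: "hc set \<Rightarrow> hc \<Rightarrow> hc \<Rightarrow> bool" where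
  "uniform M \<kappa> U \<longleftrightarrow> (\<forall>A\<in>elts U. card_in M A = \<kappa>)"

definition generates :: "hc set \<Rightarrow> hc \<Rightarrow> hc \<Rightarrow> hc \<Rightarrow> bool" where
  "generates M \<kappa> X U \<longleftrightarrow> X \<in> M \<and> elts X \<subseteq> elts U \<and>
     elts U = {A \<in> M. elts A \<subseteq> elts \<kappa> \<and> (\<exists>B\<in>elts X. elts B \<subseteq> elts A)}"

definition ultrafilter_number :: "hc set \<Rightarrow> hc \<Rightarrow> hc" where
  "ultrafilter_number M \<kappa> = least_ord (\<lambda>\<rho>. cardinal M \<rho> \<and>
     (\<exists>U X. ultrafilter_on M \<kappa> U \<and> uniform M \<kappa> U \<and> generates M \<kappa> X U \<and> card_in M X = \<rho>))"

definition forcing_notion :: "hc set \<Rightarrow> hc \<Rightarrow> hc \<Rightarrow> hc \<Rightarrow> bool" where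
  "forcing_notion M P leq one \<longleftrightarrow> P \<in> M \<and> leq \<in> M \<and> one \<in> elts P \<and>
     (\<forall>z\<in>elts leq. \<exists>p\<in>elts P. \<exists>q\<in>elts P. z = hpair p q) \<and>
     (\<forall>p\<in>elts P. hpair p p \<in> elts leq) \<and>
     (\<forall>p q r. hpair p q \<in> elts leq \<and> hpair q r \<in> elts leq \<longrightarrow> hpair p r \<in> elts leq) \<and>
     (\<forall>p\<in>elts P. hpair p one \<in> elts leq)"

definition dense_in :: "hc \<Rightarrow> hc \<Rightarrow> hc \<Rightarrow> bool" where
  "dense_in P leq E \<longleftrightarrow> elts E \<subseteq> elts P \<and> (\<forall>p\<in>elts P. \<exists>d\<in>elts E. hpair d p \<in> elts leq)"

definition generic :: "hc set \<Rightarrow> hc \<Rightarrow> hc \<Rightarrow> hc \<Rightarrow> hc set \<Rightarrow> bool" where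
  "generic M P leq one G \<longleftrightarrow> G \<subseteq> elts P \<and> one \<in> G \<and>
     (\<forall>p\<in>G. \<forall>q\<in>elts P. hpair p q \<in> elts leq \<longrightarrow> q \<in> G) \<and>
     (\<forall>p\<in>G. \<forall>q\<in>G. \<exists>r\<in>G. hpair r p \<in> elts leq \<and> hpair r q \<in> elts leq) \<and>
     (\<forall>E\<in>M. dense_in P leq E \<longrightarrow> G \<inter> elts E \<noteq> {})"

inductive pname :: "hc \<Rightarrow> hc \<Rightarrow> bool" for P where
  "(\<And>z. z \<in> elts \<tau> \<Longrightarrow> \<exists>\<sigma> p. z = hpair \<sigma> p \<and> p \<in> elts P \<and> pname P \<sigma>) \<Longrightarrow> pname P \<tau>"

function val :: "hc set \<Rightarrow> hc \<Rightarrow> hc" where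
  "val G \<tau> = mk (val G ` {\<sigma>. \<exists>p\<in>G. hpair \<sigma> p \<in> elts \<tau>})"
  by pat_completeness auto
termination
proof (relation "inv_image ({(x, y). x \<in> elts y}\<^sup>+) snd")
  show "wf (inv_image ({(x, y). x \<in> elts y}\<^sup>+) snd)"
    by (intro wf_inv_image wf_trancl wf_elts)
next
  fix G \<tau> \<sigma>
  assume "\<sigma> \<in> {\<sigma>. \<exists>p\<in>G. hpair \<sigma> p \<in> elts \<tau>}"
  then obtain p where "hpair \<sigma> p \<in> elts \<tau>" by auto
  moreover obtain y where "y \<in> elts (hpair \<sigma> p)" "\<sigma> \<in> elts y"
    using hpair_fst by blast
  ultimately have "(\<sigma>, y) \<in> {(x, y). x \<in> elts y}" "(y, hpair \<sigma> p) \<in> {(x, y). x \<in> elts y}"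
    "(hpair \<sigma> p, \<tau>) \<in> {(x, y). x \<in> elts y}"
    by auto
  then have "(\<sigma>, \<tau>) \<in> {(x, y). x \<in> elts y}\<^sup>+"
    by (rule trancl_into_trancl[OF trancl_into_trancl[OF r_into_trancl]])
  then show "((G, \<sigma>), G, \<tau>) \<in> inv_image ({(x, y). x \<in> elts y}\<^sup>+) snd"
    by simp
qed

declare val.simps [simp del]

lemma elts_val: "elts (val G \<tau>) = {val G \<sigma> |\<sigma>. \<exists>p\<in>G. hpair \<sigma> p \<in> elts \<tau>}"
proof -
  let ?S = "{\<sigma>. \<exists>p\<in>G. hpair \<sigma> p \<in> elts \<tau>}"
  have "?S \<subseteq> (\<Union>z\<in>elts \<tau>. \<Union>y\<in>elts z. elts y)"
  proof
    fix \<sigma> assume "\<sigma> \<in> ?S"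
    then obtain p where "hpair \<sigma> p \<in> elts \<tau>" by blast
    with hpair_fst[of \<sigma> p] show "\<sigma> \<in> (\<Union>z\<in>elts \<tau>. \<Union>y\<in>elts z. elts y)" by blast
  qed
  then have "countable ?S"
    by (rule countable_subset) (intro countable_UN countable_elts)
  then have "elts (val G \<tau>) = val G ` ?S"
    by (subst val.simps) (rule elts_mk, rule countable_image)
  then show ?thesis by (simp add: setcompr_eq_image)
qed

definition generic_ext :: "hc set \<Rightarrow> hc \<Rightarrow> hc set \<Rightarrow> hc set" where
  "generic_ext M P G = {val G \<tau> |\<tau>. \<tau> \<in> M \<and> pname P \<tau>}"

definition same_cofinalities :: "hc set \<Rightarrow> hc set \<Rightarrow> bool" where
  "same_cofinalities M N \<longleftrightarrow> (\<forall>\<alpha>\<in>M. ordinal \<alpha> \<longrightarrow> cof N \<alpha> = cof M \<alpha>)"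

text \<open>Over a countable model, quantification over all generic filters is never vacuous.\<close>

lemma generic_exists:
  assumes M: "countable M" and F: "forcing_notion M P leq one"
  shows "\<exists>G. generic M P leq one G"
proof -
  let ?le = "\<lambda>p q. hpair p q \<in> elts leq"
  let ?D = "{E \<in> M. dense_in P leq E}"
  have P: "P \<in> M" "one \<in> elts P" and refl: "\<And>p. p \<in> elts P \<Longrightarrow> ?le p p"
    and trans: "\<And>p q r. ?le p q \<Longrightarrow> ?le q r \<Longrightarrow> ?le p r"
    and top: "\<And>p. p \<in> elts P \<Longrightarrow> ?le p one"
    using F unfolding forcing_notion_def by blast+
  have "P \<in> ?D" using P refl by (auto simp: dense_in_def)
  then have ne: "?D \<noteq> {}" by blast
  have cD: "countable ?D" using M by simp
  define d where "d = from_nat_into ?D"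
  have d: "range d = ?D" unfolding d_def using ne cD by (rule range_from_nat_into)
  have "\<exists>s. \<forall>n. s n \<in> elts P \<and> (s (Suc n) \<in> elts (d n) \<and> ?le (s (Suc n)) (s n))"
  proof (rule dependent_nat_choice)
    show "\<exists>x. x \<in> elts P" using P by blast
    fix x n assume "x \<in> elts P"
    moreover have "dense_in P leq (d n)" using d by blast
    ultimately show "\<exists>y. y \<in> elts P \<and> y \<in> elts (d n) \<and> ?le y x"
      unfolding dense_in_def by blast
  qed
  then obtain s where s: "\<And>n. s n \<in> elts P" "\<And>n. s (Suc n) \<in> elts (d n)"
    "\<And>n. ?le (s (Suc n)) (s n)" by blast
  have dec: "?le (s n) (s m)" if "m \<le> n" for m n
    using that
  proof (induction rule: dec_induct)
    case base
    then show ?case using s(1) refl by simp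
  next
    case (step n)
    then show ?case using s(3) trans by blast
  qed
  let ?G = "{q \<in> elts P. \<exists>n. ?le (s n) q}"
  have "generic M P leq one ?G"
    unfolding generic_def
  proof (intro conjI ballI impI)
    show "?G \<subseteq> elts P" by blast
    show "one \<in> ?G" using P top s(1) by blast
  next
    fix p q assume "p \<in> ?G" "q \<in> elts P" "?le p q"
    then show "q \<in> ?G" using trans by blast
  next
    fix p q assume "p \<in> ?G" "q \<in> ?G"
    then obtain m n where mn: "?le (s m) p" "?le (s n) q" by blast
    have "?le (s (max m n)) p" using trans[OF dec mn(1)] by simp
    moreover have "?le (s (max m n)) q" using trans[OF dec mn(2)] by simp
    moreover have "s (max m n) \<in> ?G" using s(1) refl by blast
    ultimately show "\<exists>r\<in>?G. ?le r p \<and> ?le r q" by blast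
  next
    fix E assume "E \<in> M" "dense_in P leq E"
    then have "E \<in> range d" using d by simp
    then obtain n where "E = d n" by blast
    then have "s (Suc n) \<in> ?G \<inter> elts E" using s(1)[of "Suc n"] s(2)[of n] refl by auto
    then show "?G \<inter> elts E \<noteq> {}" by blast
  qed
  then show ?thesis by blast
qed

end

theory Submission
  imports Defs
begin

text \<open>
  Force with the product of Add(\<open>\<theta>\<close>, \<open>\<kappa>\<close>) and Add(\<open>\<lambda>\<close>, \<open>\<mu>\<close>). By a closing-off argument
  (in place of the \<open>\<Delta>\<close>-system lemma) every family of conditions has a predense subfamily of size
  at most \<open>\<lambda>\<close>, and by Easton's argument a function on a set of size less than \<open>\<lambda>\<close> with values in the ground model
  is already read off from fewer than \<open>\<lambda>\<close> conditions in the first factor. Hence cofinalities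
  are preserved, and since \<open>\<kappa>\<close> is inaccessible, \<open>2\<^sup>\<theta> = \<kappa>\<close>. The second factor adds \<open>\<mu>\<close>
  subsets of \<open>\<lambda>\<close>, so \<open>2\<^sup>\<kappa> = \<mu>\<^sup>\<kappa>\<close>, and this exceeds \<open>\<mu>\<close> by Koenig's theorem.

  For the ultrafilter number, extend \<open>D\<close> to any ultrafilter \<open>U\<close> in the extension. A set
  \<open>A \<subseteq> \<kappa>\<close> is decided by \<open>\<kappa>\<close> many predense sets of size at most \<open>\<lambda>\<close>, each of which uses a bounded
  set of coordinates below \<open>\<mu>\<close>, as \<open>\<lambda> < cf(\<mu>)\<close>. Since \<open>cf(\<mu>) < \<kappa>\<close> and \<open>D\<close> is \<open>\<kappa>\<close>-complete, one
  bound \<open>\<zeta> < \<mu>\<close> works for all \<open>\<xi>\<close> in some \<open>B \<in> D\<close>. So \<open>A \<inter> B\<close> has a name using coordinates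
  below \<open>\<zeta>\<close> only, and as \<open>\<mu>\<close> is a strong limit there are at most \<open>\<mu>\<close> such names. The sets with
  such names generate \<open>U\<close>.
\<close>

section \<open>Definability with parameters\<close>

text \<open>A set that HOL provides need not be an element of the model, so every set used has to be
  produced inside it. Hence the calculus of definable relations and class functions, the recursion
  theorem, and cardinal arithmetic relative to a model. All of it is proved for an arbitrary
  countable transitive model, so it applies verbatim to the generic extension once that is known to
  satisfy the axioms. The ultrafilter needs a detour because \<kappa> has more than \<mu> subsets in
  the extension: the sets with a code of bounded support cannot be all of them. Every subset does
  acquire such a code after intersection with a suitable ground model set from \<open>D\<close>, and
  \<open>D\<close> \<subseteq> \<open>U\<close> is all that must be known about \<open>U\<close>; no
  property of \<open>U\<close> is controlled by the forcing. The chain of inequalities enters here: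
  \<lambda> < cf(\<mu>) bounds the support of one antichain, and cf(\<mu>) < \<kappa> leaves so few
  candidate bounds that completeness can fix one of them. The same inequality cf(\<mu>) < \<kappa>
  makes Koenig's theorem apply to exponent \<kappa>. That \<mu> is still a cardinal has to be argued
  separately, since it is singular and cofinalities alone do not show it.\<close>

primrec ren :: "(nat \<Rightarrow> nat) \<Rightarrow> fm \<Rightarrow> fm" where
  "ren f (FMem i j) = FMem (f i) (f j)"
| "ren f (FEq i j) = FEq (f i) (f j)"
| "ren f (FNeg \<phi>) = FNeg (ren f \<phi>)"
| "ren f (FConj \<phi> \<psi>) = FConj (ren f \<phi>) (ren f \<psi>)"
| "ren f (FAll n \<phi>) = FAll (f n) (ren f \<phi>)"

text \<open>Bound variables are renamed by the same map as free ones, so injectivity is what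
  excludes capture.\<close>

lemma sat_ren: "inj f \<Longrightarrow> sat M e (ren f \<phi>) = sat M (\<lambda>i. e (f i)) \<phi>"
proof (induction \<phi> arbitrary: e)
  case (FAll n \<phi>)
  have "(\<lambda>i. (e(f n := x)) (f i)) = (\<lambda>i. e (f i))(n := x)" for x
    using FAll.prems by (auto simp: fun_eq_iff inj_eq)
  with FAll show ?case by simp
qed auto

definition merge :: "(nat \<Rightarrow> 'a) \<Rightarrow> (nat \<Rightarrow> 'a) \<Rightarrow> nat \<Rightarrow> 'a" where
  "merge e c i = (if even i then e (i div 2) else c (i div 2))"

lemma merge_simps [simp]: "merge e c 0 = e 0" "merge e c (Suc 0) = c 0"
  "merge e c (2 * n) = e n" "merge e c (Suc (2 * n)) = c n"
  by (auto simp: merge_def)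

lemma even_odd_cases: obtains n where "i = 2 * n" | n where "i = Suc (2 * n)"
  by (metis evenE oddE Suc_eq_plus1)

lemma inj_merge: "inj a \<Longrightarrow> inj b \<Longrightarrow> (\<And>i j. a i \<noteq> b j) \<Longrightarrow> inj (merge a b)"
  by (rule injI, rename_tac x y, rule_tac i = x in even_odd_cases; rule_tac i = y in even_odd_cases)
    (auto simp: inj_eq dest: sym)

lemma range_merge: "range e \<subseteq> M \<Longrightarrow> range c \<subseteq> M \<Longrightarrow> range (merge e c) \<subseteq> M"
  by (auto simp: merge_def)

lemma range_case_nat: "x \<in> M \<Longrightarrow> range e \<subseteq> M \<Longrightarrow> range (case_nat x e) \<subseteq> M"
  by (auto split: nat.splits simp: image_subset_iff)

lemma range_const: "x \<in> M \<Longrightarrow> range (\<lambda>_. x) \<subseteq> M"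
  by auto

named_theorems dfn_intros

text \<open>Choice is kept out: the extension is first shown to be such a model, and the tools
  obtained from that are then used to prove choice in it.\<close>

locale zf_model =
  fixes M :: "hc set"
  assumes countable_M: "countable M" and transitive_M: "\<And>x. x \<in> M \<Longrightarrow> elts x \<subseteq> M"
    and zf_axioms: "extensionality_ax M" "foundation_ax M" "pairing_ax M" "union_ax M" "powerset_ax M"
      "infinity_ax M" "separation_ax M" "replacement_ax M"
begin

text \<open>
  \<open>dfn\<close> and \<open>dft\<close> are definability in the model, with parameters, of a relation and of a class function:
  the even variables of the formula receive the arguments, the odd ones a sequence of parameters.
\<close>

definition dfn :: "((nat \<Rightarrow> hc) \<Rightarrow> bool) \<Rightarrow> bool" where
  "dfn R \<longleftrightarrow> (\<exists>\<phi> c. range c \<subseteq> M \<and> (\<forall>e. range e \<subseteq> M \<longrightarrow> R e = sat M (merge e c) \<phi>))"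

definition dft :: "((nat \<Rightarrow> hc) \<Rightarrow> hc) \<Rightarrow> bool" where
  "dft t \<longleftrightarrow> (\<forall>e. range e \<subseteq> M \<longrightarrow> t e \<in> M) \<and> dfn (\<lambda>e. e 0 = t (\<lambda>i. e (Suc i)))"

lemma M_trans: "x \<in> elts y \<Longrightarrow> y \<in> M \<Longrightarrow> x \<in> M"
  using transitive_M by blast

lemma M_ne: "\<exists>x. x \<in> M"
  using zf_axioms(6) unfolding infinity_ax_def by blast

lemma dfn_neg [dfn_intros]: assumes "dfn R" shows "dfn (\<lambda>e. \<not> R e)"
proof -
  obtain \<phi> c where "range c \<subseteq> M" "\<And>e. range e \<subseteq> M \<Longrightarrow> R e = sat M (merge e c) \<phi>"
    using assms unfolding dfn_def by blast
  then show ?thesis unfolding dfn_def by (intro exI[of _ "FNeg \<phi>"] exI[of _ c]) auto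
qed

lemma dfn_conj [dfn_intros]: assumes "dfn R" "dfn S" shows "dfn (\<lambda>e. R e \<and> S e)"
proof -
  obtain \<phi> c where 1: "range c \<subseteq> M" "\<And>e. range e \<subseteq> M \<Longrightarrow> R e = sat M (merge e c) \<phi>"
    using assms unfolding dfn_def by blast
  obtain \<psi> d where 2: "range d \<subseteq> M" "\<And>e. range e \<subseteq> M \<Longrightarrow> S e = sat M (merge e d) \<psi>"
    using assms unfolding dfn_def by blast
  \<comment> \<open>Both formulas keep their even variables. The parameters of the first go to the
    even-numbered parameter slots and those of the second to the odd-numbered ones, so one merged
    parameter sequence serves both.\<close>
  define f where "f = merge (\<lambda>i. 2 * i) (\<lambda>i. Suc (2 * (2 * i)))"
  define g where "g = merge (\<lambda>i. 2 * i) (\<lambda>i. Suc (2 * (Suc (2 * i))))"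
  have f: "inj f" unfolding f_def by (rule inj_merge) (auto simp: inj_def, presburger)
  have g: "inj g" unfolding g_def by (rule inj_merge) (auto simp: inj_def, presburger)
  have ff: "(\<lambda>i. merge e (merge c d) (f i)) = merge e c" for e
  proof fix i show "merge e (merge c d) (f i) = merge e c i"
      by (cases i rule: even_odd_cases) (simp_all only: f_def merge_simps)
  qed
  have gg: "(\<lambda>i. merge e (merge c d) (g i)) = merge e d" for e
  proof fix i show "merge e (merge c d) (g i) = merge e d i"
      by (cases i rule: even_odd_cases) (simp_all only: g_def merge_simps)
  qed
  have "range (merge c d) \<subseteq> M" using 1(1) 2(1) by (rule range_merge)
  moreover have "(R e \<and> S e) = sat M (merge e (merge c d)) (FConj (ren f \<phi>) (ren g \<psi>))" if "range e \<subseteq> M" for e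
    using that by (simp add: sat_ren f g ff gg 1 2)
  ultimately show ?thesis unfolding dfn_def by blast
qed

lemma dfn_ren: assumes "dfn R" "inj g" shows "dfn (\<lambda>e. R (\<lambda>i. e (g i)))"
proof -
  obtain \<phi> c where 1: "range c \<subseteq> M" "\<And>e. range e \<subseteq> M \<Longrightarrow> R e = sat M (merge e c) \<phi>"
    using assms unfolding dfn_def by blast
  define f where "f = merge (\<lambda>i. 2 * g i) (\<lambda>i. Suc (2 * i))"
  have f: "inj f" unfolding f_def using assms(2) by (intro inj_merge) (auto simp: inj_def, presburger)
  have ff: "(\<lambda>i. merge e c (f i)) = merge (\<lambda>i. e (g i)) c" for e
  proof fix i show "merge e c (f i) = merge (\<lambda>i. e (g i)) c i"
      by (cases i rule: even_odd_cases) (simp_all only: f_def merge_simps)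
  qed
  have "R (\<lambda>i. e (g i)) = sat M (merge e c) (ren f \<phi>)" if "range e \<subseteq> M" for e
    using that by (subst 1(2)) (auto simp: sat_ren f ff)
  with 1(1) show ?thesis unfolding dfn_def by blast
qed

text \<open>Arguments are handled in de Bruijn style: under the quantifier the bound element is
  argument 0 and all others are shifted by one. Iterated quantifiers then need no named
  variables.\<close>

lemma dfn_all_M [dfn_intros]:
  assumes "dfn (\<lambda>e. R (e 0) (\<lambda>i. e (Suc i)))" shows "dfn (\<lambda>e. \<forall>x\<in>M. R x e)"
proof -
  obtain \<phi> c where 1: "range c \<subseteq> M" "\<And>e. range e \<subseteq> M \<Longrightarrow> R (e 0) (\<lambda>i. e (Suc i)) = sat M (merge e c) \<phi>"
    using assms unfolding dfn_def by blast
  \<comment> \<open>The bound element is placed in variable 1, the first parameter slot. The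
    parameters move up by one slot to vacate it, with \<open>c 0\<close> as a filler, and the
    arguments move down because argument 0 has become bound.\<close>
  define f where "f = merge (case_nat 1 (\<lambda>i. 2 * i)) (\<lambda>i. Suc (2 * Suc i))"
  have f0: "f 0 = 1" "f (2 * Suc i) = 2 * i" "f (Suc (2 * i)) = Suc (2 * Suc i)" for i
    by (simp_all only: f_def merge_simps nat.case)
  have f: "inj f" unfolding f_def
    by (rule inj_merge) (auto simp: inj_def split: nat.splits, presburger)
  define d where "d = case_nat (c 0) c"
  have d: "range d \<subseteq> M" using 1(1) by (auto simp: d_def split: nat.splits)
  have ff: "(\<lambda>i. ((merge e d)(1 := x)) (f i)) = merge (case_nat x e) c" for e x
  proof fix i
    have "\<exists>j. i = 0 \<or> i = 2 * Suc j \<or> i = Suc (2 * j)" by presburger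
    then obtain j where j: "i = 0 \<or> i = 2 * Suc j \<or> i = Suc (2 * j)" by blast
    have n: "2 * j \<noteq> 1" "Suc (2 * Suc j) \<noteq> 1" by presburger+
    show "((merge e d)(1 := x)) (f i) = merge (case_nat x e) c i"
      using j n by (elim disjE) (simp_all only: f0 merge_simps d_def nat.case fun_upd_apply n if_True if_False refl)
  qed
  have "(\<forall>x\<in>M. R x e) = sat M (merge e d) (FAll 1 (ren f \<phi>))" if e: "range e \<subseteq> M" for e
  proof -
    have "R x e = sat M (merge (case_nat x e) c) \<phi>" if "x \<in> M" for x
      using 1(2)[OF range_case_nat[OF that e]] by simp
    then show ?thesis by (simp add: sat_ren f ff[simplified])
  qed
  with d show ?thesis unfolding dfn_def by blast
qed

lemma dfn_const [dfn_intros]: "dfn (\<lambda>e. Q)"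
proof -
  obtain x where "x \<in> M" using M_ne by blast
  then have "range (\<lambda>_::nat. x) \<subseteq> M" by auto
  then show ?thesis unfolding dfn_def
    by (intro exI[of _ "if Q then FEq 0 0 else FNeg (FEq 0 0)"] exI[of _ "\<lambda>_. x"]) auto
qed

lemma dfn_mem0: "dfn (\<lambda>e. e m \<in> elts (e n))"
proof -
  obtain x where "x \<in> M" using M_ne by blast
  then have "range (\<lambda>_::nat. x) \<subseteq> M" by auto
  then show ?thesis unfolding dfn_def
    by (intro exI[of _ "FMem (2*m) (2*n)"] exI[of _ "\<lambda>_. x"]) auto
qed

lemma dfn_eq0: "dfn (\<lambda>e. e m = e n)"
proof -
  obtain x where "x \<in> M" using M_ne by blast
  then have "range (\<lambda>_::nat. x) \<subseteq> M" by auto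
  then show ?thesis unfolding dfn_def
    by (intro exI[of _ "FEq (2*m) (2*n)"] exI[of _ "\<lambda>_. x"]) auto
qed

lemma dft_var [dfn_intros]: "dft (\<lambda>e. e n)"
  unfolding dft_def using dfn_eq0[of 0 "Suc n"] by auto

lemma dft_const [dfn_intros]: "c \<in> M \<Longrightarrow> dft (\<lambda>e. c)"
  unfolding dft_def dfn_def
  by (intro conjI exI[of _ "FEq 0 1"] exI[of _ "\<lambda>_. c"]) auto

lemma dft_constD: assumes "dft (\<lambda>e. c)" shows "c \<in> M"
proof -
  obtain x where "x \<in> M" using M_ne by blast
  from range_const[OF this] show ?thesis using assms unfolding dft_def by blast
qed

lemma dft_D: "dft t \<Longrightarrow> range e \<subseteq> M \<Longrightarrow> t e \<in> M"
  unfolding dft_def by blast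

lemma dfn_cong: "dfn R \<Longrightarrow> (\<And>e. range e \<subseteq> M \<Longrightarrow> R e = S e) \<Longrightarrow> dfn S"
  unfolding dfn_def by simp

lemma dfn_imp [dfn_intros]: assumes "dfn R" "dfn S" shows "dfn (\<lambda>e. R e \<longrightarrow> S e)"
proof -
  have "dfn (\<lambda>e. \<not> (R e \<and> \<not> S e))" by (intro dfn_neg dfn_conj assms)
  then show ?thesis by simp
qed

lemma dfn_disj [dfn_intros]: assumes "dfn R" "dfn S" shows "dfn (\<lambda>e. R e \<or> S e)"
proof -
  have "dfn (\<lambda>e. \<not> (\<not> R e \<and> \<not> S e))" by (intro dfn_neg dfn_conj assms)
  then show ?thesis by simp
qed

lemma dfn_iff [dfn_intros]: assumes "dfn R" "dfn S" shows "dfn (\<lambda>e. R e = S e)"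
proof -
  have "dfn (\<lambda>e. (R e \<longrightarrow> S e) \<and> (S e \<longrightarrow> R e))" by (intro dfn_imp dfn_conj assms)
  then show ?thesis by (rule dfn_cong) auto
qed

lemma dfn_ex_M [dfn_intros]:
  assumes "dfn (\<lambda>e. R (e 0) (\<lambda>i. e (Suc i)))" shows "dfn (\<lambda>e. \<exists>x\<in>M. R x e)"
proof -
  have "dfn (\<lambda>e. \<not> (\<forall>x\<in>M. \<not> R x e))" by (intro dfn_neg dfn_all_M assms)
  then show ?thesis by simp
qed

text \<open>The language has no function symbols, so a term is eliminated by an existential
  quantifier: some element equals its value and satisfies \<open>R\<close>.\<close>

lemma dfn_subst:
  assumes R: "dfn R" and t: "dft t" shows "dfn (\<lambda>e. R (case_nat (t e) e))"
proof -
  have [simp]: "case_nat (e 0) (\<lambda>i. e (Suc i)) = e" for e :: "nat \<Rightarrow> hc"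
    by (auto simp: fun_eq_iff split: nat.splits)
  have "dfn (\<lambda>e. \<exists>x\<in>M. x = t e \<and> R (case_nat x e))"
    by (rule dfn_ex_M, rule dfn_conj) (use R t in \<open>simp_all add: dft_def\<close>)
  then show ?thesis
    by (rule dfn_cong) (use t in \<open>auto simp: dft_def\<close>)
qed

lemma dft_ren: assumes t: "dft t" and g: "inj g" shows "dft (\<lambda>e. t (\<lambda>i. e (g i)))"
proof -
  define h where "h = case_nat 0 (\<lambda>i. Suc (g i))"
  have "inj h"
  proof (rule injI)
    fix x y assume "h x = h y"
    then show "x = y" using g by (cases x; cases y) (auto simp: h_def inj_eq)
  qed
  moreover have "dfn (\<lambda>e. e 0 = t (\<lambda>i. e (Suc i)))" using t by (simp add: dft_def)
  ultimately have "dfn (\<lambda>e. e (h 0) = t (\<lambda>i. e (h (Suc i))))" by (rule dfn_ren[rotated])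
  then have "dfn (\<lambda>e. e 0 = t (\<lambda>i. e (Suc (g i))))" unfolding h_def by simp
  moreover have "t (\<lambda>i. e (g i)) \<in> M" if "range e \<subseteq> M" for e
    proof -
    have "range (\<lambda>i. e (g i)) \<subseteq> M" using that by auto
    then show ?thesis using t unfolding dft_def by blast
  qed
  ultimately show ?thesis unfolding dft_def by blast
qed

lemma dft_tl: "dft t \<Longrightarrow> dft (\<lambda>e. t (\<lambda>i. e (Suc i)))"
  by (rule dft_ren) auto

lemma dfn1: "dfn (\<lambda>e. Q (e 0)) \<Longrightarrow> dft t \<Longrightarrow> dfn (\<lambda>e. Q (t e))"
  using dfn_subst[of "\<lambda>e. Q (e 0)" t] by simp

text \<open>Terms are substituted one at a time; each substitution puts the newest value at argument
  0 and pushes the rest up. A relation thus has to be shown definable only for variables before it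
  may be applied to arbitrary definable terms.\<close>

lemma dfn2:
  assumes "dfn (\<lambda>e. Q (e 0) (e 1))" and t: "dft t" and s: "dft s"
  shows "dfn (\<lambda>e. Q (t e) (s e))"
proof -
  have "dfn (\<lambda>e. Q (t (\<lambda>i. e (Suc i))) (e 0))"
    using dfn_subst[OF assms(1) dft_tl[OF t]] by simp
  from dfn_subst[OF this s] show ?thesis by simp
qed

lemma dfn3:
  assumes "dfn (\<lambda>e. Q (e 0) (e 1) (e 2))" and t: "dft t" and s: "dft s" and r: "dft r"
  shows "dfn (\<lambda>e. Q (t e) (s e) (r e))"
proof -
  have "dfn (\<lambda>e. Q (t (\<lambda>i. e (Suc (Suc i)))) (e 0) (e 1))"
    using dfn_subst[OF assms(1) dft_tl[OF dft_tl[OF t]]] by (simp add: numeral_2_eq_2)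
  from dfn_subst[OF this dft_tl[OF s]]
  have "dfn (\<lambda>e. Q (t (\<lambda>i. e (Suc i))) (s (\<lambda>i. e (Suc i))) (e 0))" by simp
  from dfn_subst[OF this r] show ?thesis by simp
qed

lemma dft1: assumes h: "dft (\<lambda>e. h (e 0))" and t: "dft t" shows "dft (\<lambda>e. h (t e))"
proof -
  have "h x \<in> M" if "x \<in> M" for x
    using dft_D[OF h, of "\<lambda>_. x"] that by auto
  moreover have "dfn (\<lambda>e. e 0 = h (t (\<lambda>i. e (Suc i))))"
    by (rule dfn2[of "\<lambda>x y. x = h y", OF _ dft_var dft_tl[OF t]]) (use h in \<open>simp add: dft_def\<close>)
  ultimately show ?thesis unfolding dft_def[of "\<lambda>e. h (t e)"] using dft_D[OF t] by blast
qed

lemma dft2: assumes h: "dft (\<lambda>e. h (e 0) (e 1))" and t: "dft t" and s: "dft s" shows "dft (\<lambda>e. h (t e) (s e))"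
proof -
  have "h x y \<in> M" if "x \<in> M" "y \<in> M" for x y
    using dft_D[OF h range_case_nat[OF that(1) range_const[OF that(2)]]] by simp
  moreover have "dfn (\<lambda>e. e 0 = h (t (\<lambda>i. e (Suc i))) (s (\<lambda>i. e (Suc i))))"
    by (rule dfn3[of "\<lambda>x y z. x = h y z", OF _ dft_var dft_tl[OF t] dft_tl[OF s]])
      (use h in \<open>simp add: dft_def numeral_2_eq_2\<close>)
  ultimately show ?thesis unfolding dft_def[of "\<lambda>e. h (t e) (s e)"] using dft_D[OF t] dft_D[OF s] by blast
qed

lemma dfn_mem [dfn_intros]: "dft t \<Longrightarrow> dft s \<Longrightarrow> dfn (\<lambda>e. t e \<in> elts (s e))"
  by (rule dfn2[of "\<lambda>x y. x \<in> elts y", OF dfn_mem0])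

lemma dfn_eq [dfn_intros]: "dft t \<Longrightarrow> dft s \<Longrightarrow> dfn (\<lambda>e. t e = s e)"
  by (rule dfn2[of "(=)", OF dfn_eq0])

text \<open>Transitivity of the model makes a bounded quantifier a special case of the quantifier
  over all of \<open>M\<close>.\<close>

lemma dfn_all_elts [dfn_intros]:
  assumes t: "dft t" and R: "dfn (\<lambda>e. R (e 0) (\<lambda>i. e (Suc i)))"
  shows "dfn (\<lambda>e. \<forall>x\<in>elts (t e). R x e)"
proof -
  have "dfn (\<lambda>e. \<forall>x\<in>M. x \<in> elts (t e) \<longrightarrow> R x e)"
    by (intro dfn_all_M dfn_imp dfn_mem dft_var dft_tl t R)
  then show ?thesis by (rule dfn_cong) (use dft_D[OF t] M_trans in blast)
qed

lemma dfn_ex_elts [dfn_intros]: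
  assumes t: "dft t" and R: "dfn (\<lambda>e. R (e 0) (\<lambda>i. e (Suc i)))"
  shows "dfn (\<lambda>e. \<exists>x\<in>elts (t e). R x e)"
proof -
  have "dfn (\<lambda>e. \<exists>x\<in>M. x \<in> elts (t e) \<and> R x e)"
    by (intro dfn_ex_M dfn_conj dfn_mem dft_var dft_tl t R)
  then show ?thesis by (rule dfn_cong) (use dft_D[OF t] M_trans in blast)
qed

lemma dfn_subset [dfn_intros]: "dft t \<Longrightarrow> dft s \<Longrightarrow> dfn (\<lambda>e. elts (t e) \<subseteq> elts (s e))"
  unfolding subset_eq by (rule dfn2[of "\<lambda>x y. \<forall>z\<in>elts x. z \<in> elts y"]) (intro dfn_intros)

lemma dft_intro:
  assumes "\<And>e. range e \<subseteq> M \<Longrightarrow> t e \<in> M" "dfn (\<lambda>e. R (e 0) (\<lambda>i. e (Suc i)))"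
    and "\<And>x e. range e \<subseteq> M \<Longrightarrow> x \<in> M \<Longrightarrow> R x e \<longleftrightarrow> x = t e"
  shows "dft t"
  unfolding dft_def using assms(1)
  by (intro conjI allI impI dfn_cong[OF assms(2)] assms(3)) auto

lemma separation:
  assumes A: "A \<in> M" and R: "dfn (\<lambda>e. R (e 0) (\<lambda>i. e (Suc i)))" and e: "range e \<subseteq> M"
  shows "mk {x \<in> elts A. R x e} \<in> M"
proof -
  obtain \<phi> c where 1: "range c \<subseteq> M" "\<And>e. range e \<subseteq> M \<Longrightarrow> R (e 0) (\<lambda>i. e (Suc i)) = sat M (merge e c) \<phi>"
    using R unfolding dfn_def by blast
  \<comment> \<open>Here \<open>A\<close> is a placeholder for argument 0; the axiom overwrites that
    variable with the candidate element.\<close>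
  have "range (merge (case_nat A e) c) \<subseteq> M" using A e 1(1) by (intro range_merge range_case_nat)
  moreover note zf_axioms(7)
  ultimately have "\<exists>b\<in>M. \<forall>x\<in>M. x \<in> elts b \<longleftrightarrow> x \<in> elts A \<and> sat M ((merge (case_nat A e) c)(0 := x)) \<phi>"
    using A unfolding separation_ax_def by metis
  then obtain b where b: "b \<in> M" "\<And>x. x \<in> M \<Longrightarrow> x \<in> elts b \<longleftrightarrow> x \<in> elts A \<and> sat M ((merge (case_nat A e) c)(0 := x)) \<phi>"
    by blast
  have 2: "(merge (case_nat A e) c)(0 := x) = merge (case_nat x e) c" for x
  proof
    fix i show "((merge (case_nat A e) c)(0 := x)) i = merge (case_nat x e) c i"
    proof (cases i rule: even_odd_cases)
      case (1 n) then show ?thesis by (cases n) (simp_all only: merge_simps fun_upd_apply nat.case, simp_all)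
    qed (simp only: merge_simps fun_upd_apply, simp)
  qed
  have 3: "R x e = sat M (merge (case_nat x e) c) \<phi>" if "x \<in> M" for x
    using 1(2)[OF range_case_nat[OF that e]] by simp
  have "x \<in> elts b \<longleftrightarrow> x \<in> elts A \<and> R x e" for x
    using b(2)[of x] 3[of x] M_trans[OF _ b(1)] M_trans[OF _ A] unfolding 2 by blast
  then have "elts b = {x \<in> elts A. R x e}" by blast
  then show ?thesis using b(1) by (metis mk_elts)
qed

lemma replacement:
  assumes A: "A \<in> M" and F: "dft (\<lambda>e. F (e 0) (\<lambda>i. e (Suc i)))" and e: "range e \<subseteq> M"
  shows "mk ((\<lambda>x. F x e) ` elts A) \<in> M"
proof -
  obtain \<phi> c where 1: "range c \<subseteq> M" "\<And>e. range e \<subseteq> M \<Longrightarrow> (e 0 = F (e 1) (\<lambda>i. e (Suc (Suc i)))) = sat M (merge e c) \<phi>"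
    using F unfolding dft_def dfn_def by auto
  \<comment> \<open>In the graph of a class function the value is argument 0 and the input argument
    1, that is, variables 0 and 2, while the axiom puts input and value in variables 0 and 1. So 0
    goes to 1 and 2 goes to 0, and the parameters move up by one slot to free variable 1.\<close>
  define f where "f = merge (case_nat 1 (case_nat 0 (\<lambda>i. 2 * Suc (Suc i)))) (\<lambda>i. Suc (2 * Suc i))"
  have f: "inj f" unfolding f_def
    by (rule inj_merge) (auto simp: inj_def split: nat.splits, presburger)
  have f0: "f 0 = 1" "f 2 = 0" "f (2 * Suc (Suc i)) = 2 * Suc (Suc i)" "f (Suc (2 * i)) = Suc (2 * Suc i)" for i
    by (simp_all only: f_def merge_simps nat.case) (simp add: merge_def)
  define d where "d = case_nat (c 0) c"
  have d: "range d \<subseteq> M" using 1(1) by (auto simp: d_def split: nat.splits)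
  define E where "E = merge (case_nat A (case_nat A e)) d"
  have E: "range E \<subseteq> M" using A e d unfolding E_def by (intro range_merge range_case_nat)
  have ff: "(\<lambda>i. (E(0 := x, 1 := y)) (f i)) = merge (case_nat y (case_nat x e)) c" for x y
  proof fix i
    have "\<exists>j. i = 0 \<or> i = 2 \<or> i = 2 * Suc (Suc j) \<or> i = Suc (2 * j)" by presburger
    then obtain j where j: "i = 0 \<or> i = 2 \<or> i = 2 * Suc (Suc j) \<or> i = Suc (2 * j)" by blast
    have "merge e c 2 = e 1" for e c :: "nat \<Rightarrow> hc" by (simp add: merge_def)
    note n = this
    have n': "2 * Suc (Suc j) \<noteq> 1" "2 * Suc (Suc j) \<noteq> 0" "Suc (2 * Suc j) \<noteq> 1" "Suc (2 * Suc j) \<noteq> 0" "(0::nat) \<noteq> 1" by presburger+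
    show "(E(0 := x, 1 := y)) (f i) = merge (case_nat y (case_nat x e)) c i"
      using j by (elim disjE) (simp_all only: f0 E_def merge_simps d_def nat.case fun_upd_apply n n' n'[symmetric] One_nat_def[symmetric] if_True if_False refl, simp?)
  qed
  have S: "sat M (E(0 := x, 1 := y)) (ren f \<phi>) \<longleftrightarrow> y = F x e" if "x \<in> M" "y \<in> M" for x y
    using 1(2)[OF range_case_nat[OF that(2) range_case_nat[OF that(1) e]]]
    by (subst sat_ren[OF f], subst ff) simp
  have FM: "F x e \<in> M" if "x \<in> M" for x
    using dft_D[OF F range_case_nat[OF that e]] by simp
  have fn: "\<forall>x\<in>M. \<forall>y\<in>M. \<forall>y'\<in>M. x \<in> elts A \<and> sat M (E(0 := x, 1 := y)) (ren f \<phi>) \<and>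
             sat M (E(0 := x, 1 := y')) (ren f \<phi>) \<longrightarrow> y = y'" using S by simp
  from mp[OF bspec[OF mp[OF spec[OF spec[OF zf_axioms(8)[unfolded replacement_ax_def], of "ren f \<phi>"], of E] E] A] fn]
  have "\<exists>b\<in>M. \<forall>y\<in>M. y \<in> elts b \<longleftrightarrow> (\<exists>x\<in>M. x \<in> elts A \<and> sat M (E(0 := x, 1 := y)) (ren f \<phi>))" .
  then obtain b where b: "b \<in> M" "\<And>y. y \<in> M \<Longrightarrow> y \<in> elts b \<longleftrightarrow> (\<exists>x\<in>M. x \<in> elts A \<and> sat M (E(0 := x, 1 := y)) (ren f \<phi>))" by blast
  have "elts b = (\<lambda>x. F x e) ` elts A"
  proof (intro equalityI subsetI)
    fix y assume y: "y \<in> elts b"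
    then have "y \<in> M" using b(1) M_trans by blast
    then show "y \<in> (\<lambda>x. F x e) ` elts A" using b(2) S y by blast
  next
    fix y assume "y \<in> (\<lambda>x. F x e) ` elts A"
    then obtain x where x: "x \<in> elts A" "y = F x e" by blast
    then have "x \<in> M" "y \<in> M" using A M_trans FM by blast+
    then show "y \<in> elts b" using b(2) S x by blast
  qed
  then show ?thesis using b(1) by (metis mk_elts)
qed

lemma dft_sep [dfn_intros]:
  assumes t: "dft t" and R: "dfn (\<lambda>e. R (e 0) (\<lambda>i. e (Suc i)))"
  shows "dft (\<lambda>e. mk {x \<in> elts (t e). R x e})"
proof (rule dft_intro)
  show "mk {x \<in> elts (t e). R x e} \<in> M" if "range e \<subseteq> M" for e
    using separation[OF dft_D[OF t that] R that] .
  \<comment> \<open>In the formula below, argument 0 is the tested element and argument 1 the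
    candidate for the value, so \<open>R\<close> has to skip one position.\<close>
  have 1: "dfn (\<lambda>e. R (e 0) (\<lambda>i. e (Suc (Suc i))))"
    using dfn_ren[OF R, of "\<lambda>i. if i = 0 then 0 else Suc i"] by (simp add: inj_def)
  have 2: "dft (\<lambda>e. t (\<lambda>i. e (Suc (Suc i))))" using dft_tl[OF dft_tl[OF t]] by simp
  show "dfn (\<lambda>e. \<forall>z\<in>M. z \<in> elts (e 0) \<longleftrightarrow> z \<in> elts (t (\<lambda>i. e (Suc i))) \<and> R z (\<lambda>i. e (Suc i)))"
    by (intro dfn_intros 1 2)
  show "(\<forall>z\<in>M. z \<in> elts x \<longleftrightarrow> z \<in> elts (t e) \<and> R z e) \<longleftrightarrow> x = mk {x \<in> elts (t e). R x e}" if "range e \<subseteq> M" "x \<in> M" for x e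
  proof -
    have "countable {x \<in> elts (t e). R x e}" by simp
    then show ?thesis using M_trans that dft_D[OF t that(1)] by (auto intro!: hc_eqI)
  qed
qed

lemma dft_repl [dfn_intros]:
  assumes t: "dft t" and F: "dft (\<lambda>e. F (e 0) (\<lambda>i. e (Suc i)))"
  shows "dft (\<lambda>e. mk ((\<lambda>x. F x e) ` elts (t e)))"
proof (rule dft_intro)
  show "mk ((\<lambda>x. F x e) ` elts (t e)) \<in> M" if "range e \<subseteq> M" for e
    using replacement[OF dft_D[OF t that] F that] .
  have 1: "dft (\<lambda>e. F (e 0) (\<lambda>i. e (Suc (Suc (Suc i)))))"
    using dft_ren[OF F, of "\<lambda>i. if i = 0 then 0 else Suc (Suc i)"] by (simp add: inj_def)
  have 2: "dft (\<lambda>e. t (\<lambda>i. e (Suc (Suc i))))" using dft_tl[OF dft_tl[OF t]] by simp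
  show "dfn (\<lambda>e. \<forall>z\<in>M. z \<in> elts (e 0) \<longleftrightarrow> (\<exists>x\<in>elts (t (\<lambda>i. e (Suc i))). z = F x (\<lambda>i. e (Suc i))))"
    by (intro dfn_intros 1 2)
  have FM: "F x e \<in> M" if "x \<in> M" "range e \<subseteq> M" for x e
    using dft_D[OF F range_case_nat[OF that]] by simp
  show "(\<forall>z\<in>M. z \<in> elts x \<longleftrightarrow> (\<exists>x\<in>elts (t e). z = F x e)) \<longleftrightarrow> x = mk ((\<lambda>x. F x e) ` elts (t e))" if "range e \<subseteq> M" "x \<in> M" for x e
  proof -
    have te: "t e \<in> M" using dft_D[OF t that(1)] .
    show ?thesis
    proof
      assume *: "\<forall>z\<in>M. z \<in> elts x \<longleftrightarrow> (\<exists>x\<in>elts (t e). z = F x e)"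
      have "elts x = (\<lambda>x. F x e) ` elts (t e)"
        using * M_trans[OF _ that(2)] M_trans[OF _ te] FM that(1) by auto
      then show "x = mk ((\<lambda>x. F x e) ` elts (t e))" by (metis mk_elts)
    qed auto
  qed
qed

end

text \<open>
  \<open>hfst\<close>, \<open>hsnd\<close> and \<open>ap\<close> (a variant of \<open>app\<close>) return the empty set on junk arguments, so that they are definable class functions.
\<close>

definition Un1 :: "hc \<Rightarrow> hc" where "Un1 x = mk (\<Union>y\<in>elts x. elts y)"
definition hfst :: "hc \<Rightarrow> hc" where "hfst z = (if \<exists>a b. z = hpair a b then THE a. \<exists>b. z = hpair a b else mk {})"
definition hsnd :: "hc \<Rightarrow> hc" where "hsnd z = (if \<exists>a b. z = hpair a b then THE b. \<exists>a. z = hpair a b else mk {})"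
definition lam :: "hc \<Rightarrow> (hc \<Rightarrow> hc) \<Rightarrow> hc" where "lam A F = mk ((\<lambda>x. hpair x (F x)) ` elts A)"
definition ap :: "hc \<Rightarrow> hc \<Rightarrow> hc" where
  "ap f x = (if \<exists>!b. hpair x b \<in> elts f then THE b. hpair x b \<in> elts f else mk {})"
text \<open>Written as a union of images, so that definability follows from the rules for
  replacement and union.\<close>

definition hprod :: "hc \<Rightarrow> hc \<Rightarrow> hc" where
  "hprod A B = mk (\<Union>a\<in>elts A. elts (mk ((\<lambda>b. hpair a b) ` elts B)))"
text \<open>Both entries of a Kuratowski pair in \<open>f\<close> lie in the double union of
  \<open>f\<close>, which serves as the bound for separation.\<close>

definition hdom :: "hc \<Rightarrow> hc" where "hdom f = mk {a \<in> elts (Un1 (Un1 f)). \<exists>b\<in>elts (Un1 (Un1 f)). hpair a b \<in> elts f}"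
definition hsucc :: "hc \<Rightarrow> hc" where "hsucc x = mk (insert x (elts x))"

lemma elts_Un1 [simp]: "elts (Un1 x) = (\<Union>y\<in>elts x. elts y)" by (simp add: Un1_def)
lemma hfst_hpair [simp]: "hfst (hpair a b) = a" by (auto simp: hfst_def)
lemma hsnd_hpair [simp]: "hsnd (hpair a b) = b" by (auto simp: hsnd_def)
lemma elts_lam: "elts (lam A F) = (\<lambda>x. hpair x (F x)) ` elts A" by (simp add: lam_def)
lemma hpair_in_lam [simp]: "hpair x y \<in> elts (lam A F) \<longleftrightarrow> x \<in> elts A \<and> y = F x" by (auto simp: elts_lam)
lemma ap_lam [simp]: "x \<in> elts A \<Longrightarrow> ap (lam A F) x = F x" by (auto simp: ap_def)
lemma elts_hprod [simp]: "elts (hprod A B) = {hpair a b |a b. a \<in> elts A \<and> b \<in> elts B}" by (auto simp: hprod_def)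
lemma hprod_intro: "a \<in> elts A \<Longrightarrow> b \<in> elts B \<Longrightarrow> hpair a b \<in> elts (hprod A B)" by simp
lemma elts_hsucc [simp]: "elts (hsucc x) = insert x (elts x)" by (simp add: hsucc_def)
lemma elts_hdom [simp]: "elts (hdom f) = {a. \<exists>b. hpair a b \<in> elts f}"
proof -
  have "a \<in> elts (Un1 (Un1 f)) \<and> b \<in> elts (Un1 (Un1 f))" if "hpair a b \<in> elts f" for a b
  proof -
    have "mk {a, b} \<in> elts (hpair a b)" "a \<in> elts (mk {a, b})" "b \<in> elts (mk {a, b})" by (auto simp: hpair_def)
    then show ?thesis using that unfolding elts_Un1 by blast
  qed
  then show ?thesis unfolding hdom_def by (auto simp del: elts_Un1)
qed
lemma lam_cong: "A = B \<Longrightarrow> (\<And>x. x \<in> elts A \<Longrightarrow> F x = G x) \<Longrightarrow> lam A F = lam B G"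
  by (simp add: lam_def)
lemma apI: "hpair x b \<in> elts f \<Longrightarrow> (\<And>c. hpair x c \<in> elts f \<Longrightarrow> c = b) \<Longrightarrow> ap f x = b"
  unfolding ap_def by (metis (mono_tags, lifting) the_equality)
lemma is_fun_ap: assumes "is_fun f A B" "a \<in> elts A"
  shows "app f a = ap f a" "ap f a \<in> elts B" "hpair a b \<in> elts f \<longleftrightarrow> b = ap f a"
proof -
  have 1: "\<exists>!b. hpair a b \<in> elts f" using assms unfolding is_fun_def by blast
  then show "app f a = ap f a" by (simp add: app_def ap_def)
  have 2: "hpair a (ap f a) \<in> elts f" using theI'[OF 1] 1 by (simp add: ap_def)
  then show "hpair a b \<in> elts f \<longleftrightarrow> b = ap f a" using 1 by blast
  show "ap f a \<in> elts B" using 2 assms unfolding is_fun_def by fastforce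
qed
lemma is_fun_lam: "(\<And>x. x \<in> elts A \<Longrightarrow> F x \<in> elts B) \<Longrightarrow> is_fun (lam A F) A B"
  unfolding is_fun_def by (auto simp: elts_lam)
lemma is_fun_eq_lam: assumes "is_fun f A B" shows "f = lam A (ap f)"
proof (rule hc_eqI)
  show "elts f = elts (lam A (ap f))"
    using is_fun_ap(3)[OF assms] assms unfolding is_fun_def elts_lam by (auto simp: image_iff)
qed
lemma foundation_hc: "x \<in> elts y \<Longrightarrow> y \<in> elts x \<Longrightarrow> False"
  using wf_elts wf_not_sym by fastforce
lemma foundation_hc_irrefl [simp]: "x \<notin> elts x"
  using foundation_hc by blast
lemma hc_induct [case_names step]: "(\<And>x. (\<And>y. y \<in> elts x \<Longrightarrow> P y) \<Longrightarrow> P x) \<Longrightarrow> P x"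
  by (rule wf_induct[OF wf_elts, of P]) auto

section \<open>Definability of the elementary set operations\<close>

context zf_model begin

definition PowM :: "hc \<Rightarrow> hc" where "PowM x = mk {y \<in> M. elts y \<subseteq> elts x}"

lemma elts_PowM [simp]: "elts (PowM x) = {y \<in> M. elts y \<subseteq> elts x}"
  unfolding PowM_def using countable_M by simp

lemma M_sub: "x \<in> M \<Longrightarrow> elts x \<subseteq> M"
  using M_trans by blast

lemma dfn_tl: "dfn R \<Longrightarrow> dfn (\<lambda>e. R (\<lambda>i. e (Suc i)))"
  by (rule dfn_ren) auto

lemma M_eqI: "x \<in> M \<Longrightarrow> y \<in> M \<Longrightarrow> (\<And>z. z \<in> M \<Longrightarrow> z \<in> elts x \<longleftrightarrow> z \<in> elts y) \<Longrightarrow> x = y"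
  using M_sub[of x] M_sub[of y] by (intro hc_eqI) blast

lemma dft_cong: "dft t \<Longrightarrow> (\<And>e. range e \<subseteq> M \<Longrightarrow> t e = s e) \<Longrightarrow> dft s"
proof (rule dft_intro)
  assume t: "dft t" and eq: "\<And>e. range e \<subseteq> M \<Longrightarrow> t e = s e"
  show "s e \<in> M" if "range e \<subseteq> M" for e using dft_D[OF t that] eq[OF that] by simp
  show "dfn (\<lambda>e. e 0 = t (\<lambda>i. e (Suc i)))" using t by (simp add: dft_def)
  show "(x = t e) = (x = s e)" if "range e \<subseteq> M" for x e using eq[OF that] by simp
qed

text \<open>Extensionality turns a definition of the elements of the value into a definition of its
  graph; that the value lies in the model is a separate premise.\<close>

lemma dft_setI:
  assumes c: "\<And>e. range e \<subseteq> M \<Longrightarrow> t e \<in> M" and R: "dfn (\<lambda>e. R (e 0) (\<lambda>i. e (Suc i)))"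
    and eq: "\<And>e z. range e \<subseteq> M \<Longrightarrow> z \<in> M \<Longrightarrow> R z e \<longleftrightarrow> z \<in> elts (t e)"
  shows "dft t"
proof (rule dft_intro)
  show "t e \<in> M" if "range e \<subseteq> M" for e using c[OF that] .
  have 1: "dfn (\<lambda>e. R (e 0) (\<lambda>i. e (Suc (Suc i))))"
    using dfn_ren[OF R, of "\<lambda>i. if i = 0 then 0 else Suc i"] by (simp add: inj_def)
  show "dfn (\<lambda>e. \<forall>z\<in>M. z \<in> elts (e 0) \<longleftrightarrow> R z (\<lambda>i. e (Suc i)))"
    by (intro dfn_intros 1)
  show "(\<forall>z\<in>M. (z \<in> elts x) = R z e) = (x = t e)" if "range e \<subseteq> M" "x \<in> M" for x e
    using eq[OF that(1)] M_eqI[OF that(2) c[OF that(1)]] by blast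
qed

lemma empty_in_M [simp, intro]: "mk {} \<in> M"
proof -
  obtain A where "A \<in> M" using M_ne by blast
  from separation[OF this, of "\<lambda>x e. False", OF dfn_const range_const[OF this]] show ?thesis by simp
qed

lemma upair_in_M: assumes "x \<in> M" "y \<in> M" shows "mk {x, y} \<in> M"
proof -
  note zf_axioms(3)
  then obtain z where z: "z \<in> M" "\<And>w. w \<in> M \<Longrightarrow> w \<in> elts z \<longleftrightarrow> w = x \<or> w = y" using assms unfolding pairing_ax_def by metis
  then have "elts z = {x, y}" using M_trans assms by blast
  then show ?thesis using z(1) by (metis mk_elts)
qed

lemma dft_upair [dfn_intros]: "dft t \<Longrightarrow> dft s \<Longrightarrow> dft (\<lambda>e. mk {t e, s e})"
proof (rule dft2[of "\<lambda>x y. mk {x, y}"])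
  show "dft (\<lambda>e. mk {e 0, e 1})"
  proof (rule dft_setI)
    show "mk {e 0, e 1} \<in> M" if "range e \<subseteq> M" for e using that by (auto intro!: upair_in_M)
    show "dfn (\<lambda>e. e 0 = e (Suc 0) \<or> e 0 = e (Suc 1))" by (intro dfn_intros)
  qed simp
qed

lemma dft_sing [dfn_intros]: "dft t \<Longrightarrow> dft (\<lambda>e. mk {t e})"
  using dft_upair[of t t] by simp

lemma dft_hpair [dfn_intros]: "dft t \<Longrightarrow> dft s \<Longrightarrow> dft (\<lambda>e. hpair (t e) (s e))"
  unfolding hpair_def by (intro dft_upair dft_sing)

lemma Un1_in_M: assumes "x \<in> M" shows "Un1 x \<in> M"
proof -
  note zf_axioms(4)
  then obtain u where u: "u \<in> M" "\<And>z. z \<in> M \<Longrightarrow> z \<in> elts u \<longleftrightarrow> (\<exists>y\<in>M. y \<in> elts x \<and> z \<in> elts y)" using assms unfolding union_ax_def by metis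
  then have "elts u = elts (Un1 x)" unfolding elts_Un1 using M_trans assms by blast
  then show ?thesis using u(1) by (metis mk_elts)
qed

lemma dft_Un1 [dfn_intros]: "dft t \<Longrightarrow> dft (\<lambda>e. Un1 (t e))"
proof (rule dft1[of Un1])
  show "dft (\<lambda>e. Un1 (e 0))"
  proof (rule dft_setI)
    show "Un1 (e 0) \<in> M" if "range e \<subseteq> M" for e using that by (auto intro!: Un1_in_M)
    show "dfn (\<lambda>e. \<exists>y\<in>elts (e (Suc 0)). e 0 \<in> elts y)" by (intro dfn_intros)
  qed simp
qed

lemma PowM_in_M: assumes "x \<in> M" shows "PowM x \<in> M"
proof -
  note zf_axioms(5)
  then obtain u where u: "u \<in> M" "\<And>y. y \<in> M \<Longrightarrow> y \<in> elts u \<longleftrightarrow> (\<forall>z\<in>M. z \<in> elts y \<longrightarrow> z \<in> elts x)" using assms unfolding powerset_ax_def by metis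
  have "y \<in> elts u \<longleftrightarrow> y \<in> M \<and> elts y \<subseteq> elts x" for y
  proof (cases "y \<in> M")
    case True then show ?thesis using u(2)[OF True] M_sub[OF True] by blast
  next
    case False then show ?thesis using M_trans[OF _ u(1)] by blast
  qed
  then have "elts u = elts (PowM x)" unfolding elts_PowM by blast
  then show ?thesis using u(1) by (metis mk_elts)
qed

lemma dft_PowM [dfn_intros]: "dft t \<Longrightarrow> dft (\<lambda>e. PowM (t e))"
proof (rule dft1[of PowM])
  show "dft (\<lambda>e. PowM (e 0))"
  proof (rule dft_setI)
    show "PowM (e 0) \<in> M" if "range e \<subseteq> M" for e using that by (auto intro!: PowM_in_M)
    show "dfn (\<lambda>e. elts (e 0) \<subseteq> elts (e (Suc 0)))" by (intro dfn_intros)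
  qed simp
qed

lemma dft_if [dfn_intros]: assumes R: "dfn R" and t: "dft t" and s: "dft s" shows "dft (\<lambda>e. if R e then t e else s e)"
proof (rule dft_intro)
  show "(if R e then t e else s e) \<in> M" if "range e \<subseteq> M" for e using dft_D[OF t that] dft_D[OF s that] by simp
  show "dfn (\<lambda>e. (R (\<lambda>i. e (Suc i)) \<and> e 0 = t (\<lambda>i. e (Suc i))) \<or> (\<not> R (\<lambda>i. e (Suc i)) \<and> e 0 = s (\<lambda>i. e (Suc i))))"
    by (intro dfn_disj dfn_conj dfn_neg dfn_tl[OF R] dfn_eq dft_var dft_tl[OF t] dft_tl[OF s])
qed auto

lemma dft_UN [dfn_intros]:
  assumes "dft t" and "dft (\<lambda>e. F (e 0) (\<lambda>i. e (Suc i)))"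
  shows "dft (\<lambda>e. mk (\<Union>x\<in>elts (t e). elts (F x e)))"
proof -
  have "dft (\<lambda>e. Un1 (mk ((\<lambda>x. F x e) ` elts (t e))))" by (intro dft_Un1 dft_repl assms)
  moreover have "Un1 (mk ((\<lambda>x. F x e) ` elts (t e))) = mk (\<Union>x\<in>elts (t e). elts (F x e))" for e
    by (rule hc_eqI) simp
  ultimately show ?thesis by simp
qed

lemma dft_lam [dfn_intros]:
  assumes "dft t" and "dft (\<lambda>e. F (e 0) (\<lambda>i. e (Suc i)))"
  shows "dft (\<lambda>e. lam (t e) (\<lambda>x. F x e))"
  unfolding lam_def by (intro dft_repl dft_hpair dft_var assms)

lemma dft_cup [dfn_intros]: "dft t \<Longrightarrow> dft s \<Longrightarrow> dft (\<lambda>e. mk (elts (t e) \<union> elts (s e)))"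
proof -
  assume "dft t" "dft s"
  then have "dft (\<lambda>e. Un1 (mk {t e, s e}))" by (intro dfn_intros)
  moreover have "Un1 (mk {t e, s e}) = mk (elts (t e) \<union> elts (s e))" for e
    by (rule hc_eqI) simp
  ultimately show ?thesis by simp
qed

lemma dft_cap [dfn_intros]: "dft t \<Longrightarrow> dft s \<Longrightarrow> dft (\<lambda>e. mk (elts (t e) \<inter> elts (s e)))"
proof (rule dft2[of "\<lambda>x y. mk (elts x \<inter> elts y)"])
  have "dft (\<lambda>e. mk {z \<in> elts (e 0). z \<in> elts (e 1)})" by (intro dfn_intros)
  then show "dft (\<lambda>e. mk (elts (e 0) \<inter> elts (e 1)))" by (simp add: Int_def)
qed

lemma dft_diff [dfn_intros]: "dft t \<Longrightarrow> dft s \<Longrightarrow> dft (\<lambda>e. mk (elts (t e) - elts (s e)))"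
proof (rule dft2[of "\<lambda>x y. mk (elts x - elts y)"])
  have "dft (\<lambda>e. mk {z \<in> elts (e 0). z \<notin> elts (e 1)})" by (intro dfn_intros)
  then show "dft (\<lambda>e. mk (elts (e 0) - elts (e 1)))" by (simp add: set_diff_eq)
qed

lemma dft_insert [dfn_intros]: "dft t \<Longrightarrow> dft s \<Longrightarrow> dft (\<lambda>e. mk (insert (t e) (elts (s e))))"
  using dft_cup[OF dft_sing, of t s] by simp

lemma dft_hsucc [dfn_intros]: "dft t \<Longrightarrow> dft (\<lambda>e. hsucc (t e))"
  unfolding hsucc_def by (intro dft_insert)

lemma dft_hprod [dfn_intros]: "dft t \<Longrightarrow> dft s \<Longrightarrow> dft (\<lambda>e. hprod (t e) (s e))"
  unfolding hprod_def by (rule dft2[of "\<lambda>A B. mk (\<Union>a\<in>elts A. elts (mk ((\<lambda>b. hpair a b) ` elts B)))"]) (intro dfn_intros)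

lemma dft_hdom [dfn_intros]: "dft t \<Longrightarrow> dft (\<lambda>e. hdom (t e))"
  unfolding hdom_def by (rule dft1[of "\<lambda>f. mk {a \<in> elts (Un1 (Un1 f)). \<exists>b\<in>elts (Un1 (Un1 f)). hpair a b \<in> elts f}"]) (intro dfn_intros)

lemma hpair_in_M [simp]: "hpair a b \<in> M \<longleftrightarrow> a \<in> M \<and> b \<in> M"
proof
  assume "hpair a b \<in> M"
  moreover have "mk {a, b} \<in> elts (hpair a b)" "a \<in> elts (mk {a, b})" "b \<in> elts (mk {a, b})" by (auto simp: hpair_def)
  ultimately show "a \<in> M \<and> b \<in> M" by (meson M_trans)
next
  assume "a \<in> M \<and> b \<in> M" then show "hpair a b \<in> M" by (auto intro: dft_constD[OF dft_hpair[OF dft_const dft_const]])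
qed

lemma M_trans_pair: "hpair a b \<in> elts x \<Longrightarrow> x \<in> M \<Longrightarrow> a \<in> M \<and> b \<in> M"
  by (meson M_trans hpair_in_M)

lemma dft_hfst [dfn_intros]: "dft t \<Longrightarrow> dft (\<lambda>e. hfst (t e))"
proof (rule dft1[of hfst])
  show "dft (\<lambda>e. hfst (e 0))"
  proof (rule dft_intro)
    show "hfst (e 0) \<in> M" if "range e \<subseteq> M" for e
    proof (cases "\<exists>a b. e 0 = hpair a b")
      case True
      then obtain a b where ab: "e 0 = hpair a b" by blast
      have "e 0 \<in> M" using that by auto
      then show ?thesis using ab by simp
    qed (simp add: hfst_def)
    show "dfn (\<lambda>e. (\<exists>b\<in>M. e (Suc 0) = hpair (e 0) b) \<or> (\<not> (\<exists>a\<in>M. \<exists>b\<in>M. e (Suc 0) = hpair a b) \<and> e 0 = mk {}))"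
      by (intro dfn_intros empty_in_M)
    show "((\<exists>b\<in>M. e 0 = hpair x b) \<or> \<not> (\<exists>a\<in>M. \<exists>b\<in>M. e 0 = hpair a b) \<and> x = mk {}) = (x = hfst (e 0))" if "range e \<subseteq> M" "x \<in> M" for x e
    proof (cases "\<exists>a b. e 0 = hpair a b")
      case True
      then obtain a b where ab: "e 0 = hpair a b" by blast
      have "e 0 \<in> M" using that by auto
      then show ?thesis using ab by auto
    qed (auto simp add: hfst_def)
  qed
qed

lemma dft_hsnd [dfn_intros]: "dft t \<Longrightarrow> dft (\<lambda>e. hsnd (t e))"
proof (rule dft1[of hsnd])
  show "dft (\<lambda>e. hsnd (e 0))"
  proof (rule dft_intro)
    show "hsnd (e 0) \<in> M" if "range e \<subseteq> M" for e
    proof (cases "\<exists>a b. e 0 = hpair a b")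
      case True
      then obtain a b where ab: "e 0 = hpair a b" by blast
      have "e 0 \<in> M" using that by auto
      then show ?thesis using ab by simp
    qed (simp add: hsnd_def)
    show "dfn (\<lambda>e. (\<exists>b\<in>M. e (Suc 0) = hpair b (e 0)) \<or> (\<not> (\<exists>a\<in>M. \<exists>b\<in>M. e (Suc 0) = hpair a b) \<and> e 0 = mk {}))"
      by (intro dfn_intros empty_in_M)
    show "((\<exists>b\<in>M. e 0 = hpair b x) \<or> \<not> (\<exists>a\<in>M. \<exists>b\<in>M. e 0 = hpair a b) \<and> x = mk {}) = (x = hsnd (e 0))" if "range e \<subseteq> M" "x \<in> M" for x e
    proof (cases "\<exists>a b. e 0 = hpair a b")
      case True
      then obtain a b where ab: "e 0 = hpair a b" by blast
      have "e 0 \<in> M" using that by auto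
      then show ?thesis using ab by auto
    qed (auto simp add: hsnd_def)
  qed
qed


text \<open>Definite description inside the model, with the empty set as default. Objects are picked
  by description wherever possible because, unlike a choice made in HOL, this is a definable
  operation.\<close>

definition theM :: "(hc \<Rightarrow> bool) \<Rightarrow> hc" where
  "theM Q = (if \<exists>!x. x \<in> M \<and> Q x then THE x. x \<in> M \<and> Q x else mk {})"

lemma theM_eq: "x \<in> M \<Longrightarrow> Q x \<Longrightarrow> (\<And>y. y \<in> M \<Longrightarrow> Q y \<Longrightarrow> y = x) \<Longrightarrow> theM Q = x"
  unfolding theM_def by (metis (mono_tags, lifting) the_equality)

lemma dft_theM [dfn_intros]:
  assumes R: "dfn (\<lambda>e. R (e 0) (\<lambda>i. e (Suc i)))"
  shows "dft (\<lambda>e. theM (\<lambda>x. R x e))"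
proof (rule dft_intro)
  have 1: "theM Q \<in> M" for Q
  proof (cases "\<exists>!x. x \<in> M \<and> Q x")
    case True from theI'[OF True] show ?thesis unfolding theM_def if_P[OF True] by blast
  qed (simp only: theM_def if_False empty_in_M)
  then show "theM (\<lambda>x. R x e) \<in> M" for e .
  have 1: "dfn (\<lambda>e. R (e 0) (\<lambda>i. e (Suc (Suc i))))"
    using dfn_ren[OF R, of "\<lambda>i. if i = 0 then 0 else Suc i"] by (simp add: inj_def)
  have 2: "dfn (\<lambda>e. R (e 0) (\<lambda>i. e (Suc (Suc (Suc i)))))"
    using dfn_ren[OF R, of "\<lambda>i. if i = 0 then 0 else Suc (Suc i)"] by (simp add: inj_def)
  have 3: "dfn (\<lambda>e. R (e 1) (\<lambda>i. e (Suc (Suc (Suc i)))))"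
    using dfn_ren[OF R, of "\<lambda>i. if i = 0 then 1 else Suc (Suc i)"] by (simp add: inj_def)
  show "dfn (\<lambda>e. (R (e 0) (\<lambda>i. e (Suc i)) \<and> (\<forall>y\<in>M. R y (\<lambda>i. e (Suc i)) \<longrightarrow> y = e 0)) \<or>
      (\<not> (\<exists>y\<in>M. R y (\<lambda>i. e (Suc i)) \<and> (\<forall>z\<in>M. R z (\<lambda>i. e (Suc i)) \<longrightarrow> z = y)) \<and> e 0 = mk {}))"
    by (intro dfn_intros empty_in_M R) (use 1 2 3 in simp_all)
  show "(R x e \<and> (\<forall>y\<in>M. R y e \<longrightarrow> y = x) \<or> \<not> (\<exists>y\<in>M. R y e \<and> (\<forall>z\<in>M. R z e \<longrightarrow> z = y)) \<and> x = mk {}) =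
      (x = theM (\<lambda>x. R x e))" if "x \<in> M" for x e
  proof (cases "\<exists>!x. x \<in> M \<and> R x e")
    case True
    then obtain y where y: "y \<in> M" "R y e" "\<And>z. z \<in> M \<Longrightarrow> R z e \<Longrightarrow> z = y" by auto
    then have "theM (\<lambda>x. R x e) = y" by (rule theM_eq)
    then show ?thesis using y that by blast
  next
    case False
    then have "theM (\<lambda>x. R x e) = mk {}" by (auto simp: theM_def)
    moreover have "\<not> (\<exists>y\<in>M. R y e \<and> (\<forall>z\<in>M. R z e \<longrightarrow> z = y))" using False by auto
    ultimately show ?thesis using that by auto
  qed
qed

lemma ap_eq_theM: "f \<in> M \<Longrightarrow> ap f x = theM (\<lambda>b. hpair x b \<in> elts f)"
proof -
  assume f: "f \<in> M"
  have *: "(\<lambda>b. b \<in> M \<and> hpair x b \<in> elts f) = (\<lambda>b. hpair x b \<in> elts f)"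
    using M_trans_pair f by blast
  show ?thesis unfolding ap_def theM_def * ..
qed

lemma dft_ap [dfn_intros]: "dft t \<Longrightarrow> dft s \<Longrightarrow> dft (\<lambda>e. ap (t e) (s e))"
proof (rule dft2[of ap])
  have "dft (\<lambda>e. theM (\<lambda>b. hpair (e 1) b \<in> elts (e 0)))" by (intro dfn_intros)
  then show "dft (\<lambda>e. ap (e 0) (e 1))"
    by (rule dft_cong) (subst ap_eq_theM, auto)
qed

end

section \<open>Recursion, ordinals and choice in the model\<close>

text \<open>The step function receives the earlier values as a set of pairs over the set
  \<open>pre x\<close> of predecessors. Both being sets, the recursion can be carried out inside the
  model. With the identity for \<open>pre\<close> this is \<in>-recursion.\<close>

definition hrec :: "(hc \<Rightarrow> hc) \<Rightarrow> (hc \<Rightarrow> hc \<Rightarrow> hc) \<Rightarrow> hc \<Rightarrow> hc" where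
  "hrec pre H = wfrec {(y, x). y \<in> elts (pre x)} (\<lambda>f x. H x (lam (pre x) f))"

lemma hrec_unfold:
  assumes "wf {(y, x). y \<in> elts (pre x)}"
  shows "hrec pre H x = H x (lam (pre x) (hrec pre H))"
proof -
  have "hrec pre H x = H x (lam (pre x) (cut (hrec pre H) {(y, x). y \<in> elts (pre x)} x))"
    unfolding hrec_def by (subst wfrec[OF assms]) (rule refl)
  also have "lam (pre x) (cut (hrec pre H) {(y, x). y \<in> elts (pre x)} x) = lam (pre x) (hrec pre H)"
    by (rule lam_cong) (auto simp: cut_apply)
  finally show ?thesis .
qed

lemma ordinal_elem: "ordinal \<alpha> \<Longrightarrow> x \<in> elts \<alpha> \<Longrightarrow> ordinal x"
  unfolding ordinal_def by blast

lemma ordinal_trans: "x \<in> elts y \<Longrightarrow> y \<in> elts \<alpha> \<Longrightarrow> ordinal \<alpha> \<Longrightarrow> x \<in> elts \<alpha>"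
  unfolding ordinal_def by blast

lemma ordinal_sub: "y \<in> elts \<alpha> \<Longrightarrow> ordinal \<alpha> \<Longrightarrow> elts y \<subseteq> elts \<alpha>"
  unfolding ordinal_def by blast

lemma ordinal_linear: "ordinal \<alpha> \<Longrightarrow> ordinal \<beta> \<Longrightarrow> \<alpha> \<in> elts \<beta> \<or> \<alpha> = \<beta> \<or> \<beta> \<in> elts \<alpha>"
proof (induction \<alpha> arbitrary: \<beta> rule: hc_induct)
  case (step \<alpha>)
  note IH = step.IH and \<alpha> = step.prems(1)
  show ?case using step.prems(2)
  proof (induction \<beta> rule: hc_induct)
    case (step \<beta>)
    show ?case
    proof (rule ccontr)
      assume n: "\<not> ?case"
      have "elts \<alpha> \<subseteq> elts \<beta>"
      proof
        fix x assume x: "x \<in> elts \<alpha>"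
        from IH[OF x ordinal_elem[OF \<alpha> x] step.prems] n x show "x \<in> elts \<beta>"
          using ordinal_trans[OF _ x \<alpha>] by blast
      qed
      moreover have "elts \<beta> \<subseteq> elts \<alpha>"
      proof
        fix x assume x: "x \<in> elts \<beta>"
        from step.IH[OF x ordinal_elem[OF step.prems x]] n x show "x \<in> elts \<alpha>"
          using ordinal_trans[OF _ x step.prems] by blast
      qed
      ultimately have "\<alpha> = \<beta>" by (intro hc_eqI) blast
      then show False using n by blast
    qed
  qed
qed

lemma ordinal_subset_iff: "ordinal \<alpha> \<Longrightarrow> ordinal \<beta> \<Longrightarrow> elts \<alpha> \<subseteq> elts \<beta> \<longleftrightarrow> \<alpha> \<in> elts \<beta> \<or> \<alpha> = \<beta>"
  using ordinal_linear[of \<alpha> \<beta>] ordinal_sub[of \<alpha> \<beta>] foundation_hc_irrefl[of \<beta>] by blast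

lemma ordinal_not_subset: "ordinal \<alpha> \<Longrightarrow> ordinal \<beta> \<Longrightarrow> \<not> elts \<alpha> \<subseteq> elts \<beta> \<longleftrightarrow> \<beta> \<in> elts \<alpha>"
  using ordinal_linear[of \<alpha> \<beta>] ordinal_sub[of \<alpha> \<beta>] foundation_hc_irrefl[of \<beta>] by blast

lemma ordinal_empty [simp]: "ordinal (mk {})" by (simp add: ordinal_def)

lemma ordinal_hsucc: "ordinal \<alpha> \<Longrightarrow> ordinal (hsucc \<alpha>)"
  unfolding ordinal_def by auto

lemma ordinal_UN: "(\<And>x. x \<in> elts A \<Longrightarrow> ordinal (F x)) \<Longrightarrow> ordinal (mk (\<Union>x\<in>elts A. elts (F x)))"
  unfolding ordinal_def by simp blast

lemma ordinal_set: "(\<And>x. x \<in> elts A \<Longrightarrow> ordinal x) \<Longrightarrow> (\<And>x y. x \<in> elts A \<Longrightarrow> y \<in> elts x \<Longrightarrow> y \<in> elts A) \<Longrightarrow> ordinal A"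
  unfolding ordinal_def by blast

lemma ordinal_least: assumes "ordinal \<alpha>" "Q \<alpha>"
  obtains \<beta> where "ordinal \<beta>" "Q \<beta>" "\<And>\<gamma>. ordinal \<gamma> \<Longrightarrow> Q \<gamma> \<Longrightarrow> elts \<beta> \<subseteq> elts \<gamma>"
proof -
  have "wf {(x, y). x \<in> elts y}" by (rule wf_elts)
  from wfE_min[OF this, of \<alpha> "{\<alpha>. ordinal \<alpha> \<and> Q \<alpha>}"] assms
  obtain \<beta> where \<beta>: "ordinal \<beta>" "Q \<beta>" "\<And>\<gamma>. \<gamma> \<in> elts \<beta> \<Longrightarrow> \<not> (ordinal \<gamma> \<and> Q \<gamma>)" by auto
  show thesis
  proof (rule that[OF \<beta>(1,2)])
    fix \<gamma> assume "ordinal \<gamma>" "Q \<gamma>"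
    then show "elts \<beta> \<subseteq> elts \<gamma>" using \<beta>(3) ordinal_not_subset[OF \<beta>(1)] by blast
  qed
qed

lemma least_ord: assumes "ordinal \<alpha>" "Q \<alpha>"
  shows "ordinal (least_ord Q)" "Q (least_ord Q)" "\<And>\<gamma>. ordinal \<gamma> \<Longrightarrow> Q \<gamma> \<Longrightarrow> elts (least_ord Q) \<subseteq> elts \<gamma>"
proof -
  obtain \<beta> where \<beta>: "ordinal \<beta>" "Q \<beta>" "\<And>\<gamma>. ordinal \<gamma> \<Longrightarrow> Q \<gamma> \<Longrightarrow> elts \<beta> \<subseteq> elts \<gamma>"
    using ordinal_least[of \<alpha> Q, OF assms] by metis
  have "least_ord Q = \<beta>" unfolding least_ord_def
  proof (rule the_equality)
    show "ordinal \<beta> \<and> Q \<beta> \<and> (\<forall>\<gamma>. ordinal \<gamma> \<and> Q \<gamma> \<longrightarrow> elts \<beta> \<subseteq> elts \<gamma>)" using \<beta> by blast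
    fix \<delta> assume "ordinal \<delta> \<and> Q \<delta> \<and> (\<forall>\<gamma>. ordinal \<gamma> \<and> Q \<gamma> \<longrightarrow> elts \<delta> \<subseteq> elts \<gamma>)"
    then show "\<delta> = \<beta>" using \<beta> by (intro hc_eqI) blast
  qed
  then show "ordinal (least_ord Q)" "Q (least_ord Q)" "\<And>\<gamma>. ordinal \<gamma> \<Longrightarrow> Q \<gamma> \<Longrightarrow> elts (least_ord Q) \<subseteq> elts \<gamma>"
    using \<beta> by auto
qed

lemma wf_elts': "wf {(y, x). y \<in> elts ((\<lambda>x. x) x)}" using wf_elts by simp

context zf_model begin

lemma lam_in_M: "A \<in> M \<Longrightarrow> dft (\<lambda>e. F (e 0)) \<Longrightarrow> lam A F \<in> M"
  by (rule dft_constD, rule dft_lam[of "\<lambda>e. A" "\<lambda>x e. F x"]) (auto intro: dft_const)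

lemma ap_in_M [simp]: "f \<in> M \<Longrightarrow> x \<in> M \<Longrightarrow> ap f x \<in> M"
  by (rule dft_constD, rule dft_ap) (auto intro: dft_const)

lemma hprod_in_M [simp]: "A \<in> M \<Longrightarrow> B \<in> M \<Longrightarrow> hprod A B \<in> M"
  by (rule dft_constD, rule dft_hprod) (auto intro: dft_const)

lemma hsucc_in_M [simp]: "A \<in> M \<Longrightarrow> hsucc A \<in> M"
  by (rule dft_constD, rule dft_hsucc) (auto intro: dft_const)

lemma cup_in_M [simp]: "A \<in> M \<Longrightarrow> B \<in> M \<Longrightarrow> mk (elts A \<union> elts B) \<in> M"
  by (rule dft_constD, rule dft_cup) (auto intro: dft_const)

lemma cap_in_M [simp]: "A \<in> M \<Longrightarrow> B \<in> M \<Longrightarrow> mk (elts A \<inter> elts B) \<in> M"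
  by (rule dft_constD, rule dft_cap) (auto intro: dft_const)

lemma diff_in_M [simp]: "A \<in> M \<Longrightarrow> B \<in> M \<Longrightarrow> mk (elts A - elts B) \<in> M"
  by (rule dft_constD, rule dft_diff) (auto intro: dft_const)

lemma upair_in_M' [simp]: "A \<in> M \<Longrightarrow> B \<in> M \<Longrightarrow> mk {A, B} \<in> M"
  by (rule upair_in_M)

lemma sing_in_M [simp]: "A \<in> M \<Longrightarrow> mk {A} \<in> M"
  using upair_in_M[of A A] by simp

lemma insert_in_M [simp]: "A \<in> M \<Longrightarrow> B \<in> M \<Longrightarrow> mk (insert A (elts B)) \<in> M"
  by (rule dft_constD, rule dft_insert) (auto intro: dft_const)

lemma hdom_in_M [simp]: "A \<in> M \<Longrightarrow> hdom A \<in> M"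
  by (rule dft_constD, rule dft_hdom) (auto intro: dft_const)

declare Un1_in_M [simp] PowM_in_M [simp]

lemma two_in_M [simp]: "two \<in> M" by (simp add: two_def)

lemma sep_in_M: assumes "A \<in> M" and "dfn (\<lambda>e. Q (e 0))" shows "mk {x \<in> elts A. Q x} \<in> M"
  by (rule dft_constD, rule dft_sep[of "\<lambda>e. A" "\<lambda>x e. Q x"]) (use assms in \<open>auto intro: dft_const\<close>)

lemma repl_in_M: assumes "A \<in> M" and "dft (\<lambda>e. F (e 0))" shows "mk (F ` elts A) \<in> M"
  by (rule dft_constD, rule dft_repl[of "\<lambda>e. A" "\<lambda>x e. F x"]) (use assms in \<open>auto intro: dft_const\<close>)

lemma UN_in_M: assumes "A \<in> M" and "dft (\<lambda>e. F (e 0))" shows "mk (\<Union>x\<in>elts A. elts (F x)) \<in> M"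
  by (rule dft_constD, rule dft_UN[of "\<lambda>e. A" "\<lambda>x e. F x"]) (use assms in \<open>auto intro: dft_const\<close>)

lemma dft1_M: "dft (\<lambda>e. h (e 0)) \<Longrightarrow> x \<in> M \<Longrightarrow> h x \<in> M"
  by (rule dft_constD, rule dft1[of h]) (auto intro: dft_const)

text \<open>The recursion theorem in the model: a value is read off from attempts, sets of the model
  closed under predecessors that obey the recursion equation. The work lies in showing that attempts
  exist, for they must be glued together without choice.\<close>

lemma dft_hrec:
  assumes pre: "dft (\<lambda>e. pre (e 0))" and H: "dft (\<lambda>e. H (e 0) (e 1))"
    and wf: "wf {(y, x). y \<in> elts (pre x)}" and t: "dft t"
  shows "dft (\<lambda>e. hrec pre H (t e))"
proof (rule dft1[of "hrec pre H", OF _ t])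
  note pre' = dft1[of pre, OF pre] and H' = dft2[of H, OF H]
  let ?F = "hrec pre H"
  have F: "?F x = H x (lam (pre x) ?F)" for x by (rule hrec_unfold[OF wf])
  have preM: "pre x \<in> M" if "x \<in> M" for x using dft1_M[OF pre that] .
  have HM: "H x y \<in> M" if "x \<in> M" "y \<in> M" for x y
    by (rule dft_constD, rule H') (use that in \<open>auto intro: dft_const\<close>)
  \<comment> \<open>Single-valuedness is not demanded; it follows from well-foundedness, as
    \<open>attval\<close> shows.\<close>
  define att where "att g \<longleftrightarrow> (\<forall>w\<in>elts g. \<exists>z\<in>M. \<exists>v\<in>M. w = hpair z v \<and> elts (pre z) \<subseteq> elts (hdom g) \<and> v = H z (lam (pre z) (\<lambda>y. ap g y)))" for g
  have att0: "dfn (\<lambda>e. att (e 0))" unfolding att_def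
    by (intro dfn_intros pre' H')
  note att' = dfn1[of att, OF att0]
  have attval: "v = ?F z" if ag: "att g" and zg: "hpair z v \<in> elts g" for g z v
    using zg
  proof (induction z arbitrary: v rule: wf_induct_rule[OF wf])
    case (1 z)
    obtain z' v' where zv: "hpair z v = hpair z' v'" "elts (pre z') \<subseteq> elts (hdom g)" "v' = H z' (lam (pre z') (\<lambda>y. ap g y))"
      using ag 1(2) unfolding att_def by blast
    then have *: "elts (pre z) \<subseteq> elts (hdom g)" "v = H z (lam (pre z) (\<lambda>y. ap g y))" by auto
    have "ap g y = ?F y" if y: "y \<in> elts (pre z)" for y
    proof -
      obtain u where u: "hpair y u \<in> elts g" using * y by auto
      have "\<And>c. hpair y c \<in> elts g \<Longrightarrow> c = ?F y" using 1(1) y by blast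
      then show ?thesis using u by (intro apI) auto
    qed
    then have "lam (pre z) (\<lambda>y. ap g y) = lam (pre z) ?F" by (intro lam_cong) auto
    then show ?case using * F[of z] by simp
  qed
  have attD: "\<exists>z. w = hpair z (?F z) \<and> (\<forall>u\<in>elts (pre z). hpair u (?F u) \<in> elts g)" if ag: "att g" and wg: "w \<in> elts g" for g w
  proof -
    obtain z v where zv: "w = hpair z v" "elts (pre z) \<subseteq> elts (hdom g)"
      using ag wg unfolding att_def by blast
    have "hpair u (?F u) \<in> elts g" if u: "u \<in> elts (pre z)" for u
    proof -
      obtain b where "hpair u b \<in> elts g" using zv(2) u by auto
      then show ?thesis using attval[OF \<open>att g\<close>] by metis
    qed
    then show ?thesis using attval[OF ag] wg zv(1) by metis
  qed
  have attI: "att g" if g: "g \<in> M" "\<And>w. w \<in> elts g \<Longrightarrow> \<exists>z. w = hpair z (?F z) \<and> (\<forall>u\<in>elts (pre z). hpair u (?F u) \<in> elts g)" for g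
    unfolding att_def
  proof
    fix w assume w: "w \<in> elts g"
    from g(2)[OF this] obtain z where z: "w = hpair z (?F z)" "\<And>u. u \<in> elts (pre z) \<Longrightarrow> hpair u (?F u) \<in> elts g" by blast
    have "z \<in> M" "?F z \<in> M" using M_trans_pair g(1) w z(1) by metis+
    moreover have "elts (pre z) \<subseteq> elts (hdom g)" using z(2) by auto
    moreover have "ap g y = ?F y" if y: "y \<in> elts (pre z)" for y
    proof (rule apI)
      show "hpair y (?F y) \<in> elts g" using z(2)[OF y] .
      fix c assume "hpair y c \<in> elts g"
      from g(2)[OF this] show "c = ?F y" by auto
    qed
    then have "lam (pre z) (\<lambda>y. ap g y) = lam (pre z) ?F" by (intro lam_cong) auto
    then have "?F z = H z (lam (pre z) (\<lambda>y. ap g y))" using F[of z] by simp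
    ultimately show "\<exists>z\<in>M. \<exists>v\<in>M. w = hpair z v \<and> elts (pre z) \<subseteq> elts (hdom g) \<and> v = H z (lam (pre z) (\<lambda>y. ap g y))"
      using z(1) by blast
  qed
  \<comment> \<open>The intersection of all attempts defined at \<open>x\<close>. Being canonical,
    it can be collected over all predecessors by replacement, which arbitrary attempts could
    not.\<close>
  define L where "L x = theM (\<lambda>l. \<forall>w\<in>M. w \<in> elts l \<longleftrightarrow> (\<forall>g\<in>M. att g \<and> x \<in> elts (hdom g) \<longrightarrow> w \<in> elts g))" for x
  have L0: "dft (\<lambda>e. L (e 0))" unfolding L_def by (intro dfn_intros att')
  have LM: "L x \<in> M" if "x \<in> M" for x using dft1_M[OF L0 that] .
  have Lmem: "w \<in> elts (L x) \<longleftrightarrow> (\<forall>g\<in>M. att g \<and> x \<in> elts (hdom g) \<longrightarrow> w \<in> elts g)"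
    if x: "x \<in> M" and g0: "g0 \<in> M" "att g0" "x \<in> elts (hdom g0)" for x g0 w
  proof -
    define l where "l = mk {w \<in> elts g0. \<forall>g\<in>M. att g \<and> x \<in> elts (hdom g) \<longrightarrow> w \<in> elts g}"
    have l: "l \<in> M" unfolding l_def by (rule sep_in_M[OF g0(1)], intro dfn_intros att' x)
    have l': "w \<in> elts l \<longleftrightarrow> (\<forall>g\<in>M. att g \<and> x \<in> elts (hdom g) \<longrightarrow> w \<in> elts g)" for w
      unfolding l_def using g0 by auto
    have "L x = l" unfolding L_def
    proof (rule theM_eq[OF l])
      show "\<forall>w\<in>M. (w \<in> elts l) = (\<forall>g\<in>M. att g \<and> x \<in> elts (hdom g) \<longrightarrow> w \<in> elts g)"
        by (rule ballI, rule l')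
      fix y assume y: "y \<in> M" and *: "\<forall>w\<in>M. (w \<in> elts y) = (\<forall>g\<in>M. att g \<and> x \<in> elts (hdom g) \<longrightarrow> w \<in> elts g)"
      show "y = l"
      proof (rule M_eqI[OF y l])
        fix z assume "z \<in> M"
        show "(z \<in> elts y) = (z \<in> elts l)" by (rule trans[OF bspec[OF * \<open>z \<in> M\<close>] l'[symmetric]])
      qed
    qed
    then show ?thesis by (simp only: l')
  qed
  have ex: "\<exists>g\<in>M. att g \<and> x \<in> elts (hdom g)" if "x \<in> M" for x
    using that
  proof (induction x rule: wf_induct_rule[OF wf])
    case (1 x)
    have pM: "pre x \<in> M" by (rule preM[OF 1(2)])
    have *: "hpair y (?F y) \<in> elts (L y) \<and> (\<forall>w\<in>elts (L y). \<exists>z. w = hpair z (?F z) \<and> (\<forall>u\<in>elts (pre z). hpair u (?F u) \<in> elts (L y)))"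
      if y: "y \<in> elts (pre x)" for y
    proof -
      have yM: "y \<in> M" using M_trans[OF y pM] .
      obtain g0 where g0: "g0 \<in> M" "att g0" "y \<in> elts (hdom g0)" using 1(1)[of y] y yM by blast
      note Lm = Lmem[OF yM g0]
      have "hpair y (?F y) \<in> elts g" if "att g" "y \<in> elts (hdom g)" for g
        using that attval[OF that(1)] unfolding elts_hdom by force
      moreover have "\<exists>z. w = hpair z (?F z) \<and> (\<forall>u\<in>elts (pre z). hpair u (?F u) \<in> elts (L y))" if w: "w \<in> elts (L y)" for w
      proof -
        have "w \<in> elts g0" using w g0 Lm by blast
        from attD[OF g0(2) this] obtain z where z: "w = hpair z (?F z)" by blast
        have "hpair u (?F u) \<in> elts (L y)" if u: "u \<in> elts (pre z)" for u
          unfolding Lm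
        proof (intro ballI impI)
          fix g assume g: "g \<in> M" "att g \<and> y \<in> elts (hdom g)"
          then have "w \<in> elts g" using w Lm by blast
          from attD[OF _ this] g z u show "hpair u (?F u) \<in> elts g" by auto
        qed
        then show ?thesis using z by blast
      qed
      ultimately show ?thesis using Lm by blast
    qed
    define U where "U = mk (\<Union>y\<in>elts (pre x). elts (L y))"
    have UM: "U \<in> M" unfolding U_def by (rule UN_in_M[OF pM L0])
    have eU: "elts U = (\<Union>y\<in>elts (pre x). elts (L y))" by (simp add: U_def)
    have Uap: "ap U y = ?F y" if "y \<in> elts (pre x)" for y
    proof (rule apI)
      show "hpair y (?F y) \<in> elts U" using * that unfolding eU by blast
      fix c assume "hpair y c \<in> elts U"
      then show "c = ?F y" using * unfolding eU by fastforce
    qed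
    have "lam (pre x) (\<lambda>y. ap U y) \<in> M" by (rule lam_in_M[OF pM]) (intro dfn_intros UM)
    moreover have "lam (pre x) (\<lambda>y. ap U y) = lam (pre x) ?F" using Uap by (intro lam_cong) auto
    ultimately have "?F x \<in> M" using HM[OF 1(2)] F[of x] by simp
    then have wM: "hpair x (?F x) \<in> M" using 1(2) by simp
    define U' where "U' = mk (insert (hpair x (?F x)) (elts U))"
    have U'M: "U' \<in> M" unfolding U'_def by (rule insert_in_M[OF wM UM])
    have eU': "elts U' = insert (hpair x (?F x)) (elts U)" by (simp add: U'_def)
    have "att U'"
    proof (rule attI[OF U'M])
      fix w assume "w \<in> elts U'"
      then consider "w = hpair x (?F x)" | y where "y \<in> elts (pre x)" "w \<in> elts (L y)" unfolding eU' eU by blast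
      then show "\<exists>z. w = hpair z (?F z) \<and> (\<forall>u\<in>elts (pre z). hpair u (?F u) \<in> elts U')"
      proof cases
        case 1
        have "\<forall>u\<in>elts (pre x). hpair u (?F u) \<in> elts U'" using * unfolding eU' eU by blast
        then show ?thesis using 1 by blast
      next
        case 2
        then show ?thesis using * unfolding eU' eU by blast
      qed
    qed
    moreover have "x \<in> elts (hdom U')" using eU' by auto
    ultimately show ?case using U'M by blast
  qed
  have "dft (\<lambda>e. theM (\<lambda>v. \<exists>g\<in>M. att g \<and> hpair (e 0) v \<in> elts g))" by (intro dfn_intros att')
  then show "dft (\<lambda>e. ?F (e 0))"
  proof (rule dft_cong)
    fix e :: "nat \<Rightarrow> hc" assume "range e \<subseteq> M"
    then have "e 0 \<in> M" by auto
    from ex[OF this] obtain g b where g: "g \<in> M" "att g" "hpair (e 0) b \<in> elts g" by auto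
    then have b: "b = ?F (e 0)" using attval by blast
    show "theM (\<lambda>v. \<exists>g\<in>M. att g \<and> hpair (e 0) v \<in> elts g) = ?F (e 0)"
    proof (rule theM_eq)
      show "?F (e 0) \<in> M" using M_trans_pair[OF g(3) g(1)] b by blast
      show "\<exists>ga\<in>M. att ga \<and> hpair (e 0) (?F (e 0)) \<in> elts ga" using g b by blast
    qed (use attval in blast)
  qed
qed

lemma countable_sep_M [simp]: "countable {x \<in> M. Q x}"
  using countable_M by simp

lemma dfn_ordinal [dfn_intros]: "dft t \<Longrightarrow> dfn (\<lambda>e. ordinal (t e))"
  unfolding ordinal_def
  by (rule dfn1[of "\<lambda>\<alpha>. \<forall>x\<in>elts \<alpha>. elts x \<subseteq> elts \<alpha> \<and> (\<forall>y\<in>elts x. elts y \<subseteq> elts x)"]) (intro dfn_intros)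

definition rk :: "hc \<Rightarrow> hc" where "rk = hrec (\<lambda>x. x) (\<lambda>x f. mk (\<Union>y\<in>elts x. elts (hsucc (ap f y))))"
text \<open>The cumulative hierarchy of the model. Arbitrary sets serve as indices, so that plain
  \<in>-recursion applies.\<close>

definition Vr :: "hc \<Rightarrow> hc" where "Vr = hrec (\<lambda>x. x) (\<lambda>x f. mk (\<Union>y\<in>elts x. elts (PowM (ap f y))))"

lemma rk_unfold: "elts (rk x) = (\<Union>y\<in>elts x. elts (hsucc (rk y)))"
  unfolding rk_def by (subst hrec_unfold[OF wf_elts']) simp

lemma Vr_unfold: "elts (Vr x) = (\<Union>y\<in>elts x. elts (PowM (Vr y)))"
  unfolding Vr_def by (subst hrec_unfold[OF wf_elts']) (simp del: elts_PowM)

lemma dft_rk [dfn_intros]: "dft t \<Longrightarrow> dft (\<lambda>e. rk (t e))"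
  unfolding rk_def by (rule dft_hrec[OF _ _ wf_elts']) (intro dfn_intros | assumption)+

lemma dft_Vr [dfn_intros]: "dft t \<Longrightarrow> dft (\<lambda>e. Vr (t e))"
  unfolding Vr_def by (rule dft_hrec[OF _ _ wf_elts']) (intro dfn_intros | assumption)+

lemma rk_in_M [simp]: "x \<in> M \<Longrightarrow> rk x \<in> M" by (rule dft1_M, rule dft_rk) (intro dfn_intros)

lemma ordinal_rk: "ordinal (rk x)"
proof (induction x rule: hc_induct)
  case (step x)
  have "ordinal (mk (\<Union>y\<in>elts x. elts (hsucc (rk y))))" by (intro ordinal_UN ordinal_hsucc step)
  moreover have "mk (\<Union>y\<in>elts x. elts (hsucc (rk y))) = rk x" using rk_unfold[of x] by (metis mk_elts)
  ultimately show ?case by simp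
qed

lemma subset_Vr_rk: "x \<in> M \<Longrightarrow> elts x \<subseteq> elts (Vr (rk x))"
proof (induction x rule: hc_induct)
  case (step x)
  show ?case
  proof
    fix y assume y: "y \<in> elts x"
    have yM: "y \<in> M" using M_trans[OF y step.prems] .
    then have "y \<in> elts (PowM (Vr (rk y)))" using step.IH[OF y yM] by simp
    moreover have "rk y \<in> elts (rk x)" using y by (subst rk_unfold) auto
    ultimately show "y \<in> elts (Vr (rk x))" unfolding Vr_unfold[of "rk x"] by blast
  qed
qed

lemma in_Vr: "x \<in> M \<Longrightarrow> \<exists>\<alpha>\<in>M. ordinal \<alpha> \<and> x \<in> elts (Vr \<alpha>)"
  using subset_Vr_rk[of "mk {x}"] ordinal_rk[of "mk {x}"] by (intro bexI[of _ "rk (mk {x})"]) auto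

text \<open>Scott's trick: each \<open>x\<close> is sent to the least ordinal whose level contains a
  witness, and replacement collects these levels.\<close>

lemma collection:
  assumes A: "A \<in> M" and Q: "dfn (\<lambda>e. Q (e 0) (e 1))" and ex: "\<And>x. x \<in> elts A \<Longrightarrow> \<exists>y\<in>M. Q x y"
  shows "\<exists>B\<in>M. \<forall>x\<in>elts A. \<exists>y\<in>elts B. Q x y"
proof -
  note Q' = dfn2[of Q, OF Q]
  define G where "G x = theM (\<lambda>\<alpha>. ordinal \<alpha> \<and> (\<exists>y\<in>elts (Vr \<alpha>). Q x y) \<and> (\<forall>\<beta>\<in>elts \<alpha>. \<not> (\<exists>y\<in>elts (Vr \<beta>). Q x y)))" for x
  have G: "dft (\<lambda>e. G (e 0))" unfolding G_def by (intro dfn_intros Q')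
  have "\<exists>y\<in>elts (Vr (G x)). Q x y" if x: "x \<in> elts A" for x
  proof -
    obtain y \<alpha> where y: "y \<in> M" "Q x y" "\<alpha> \<in> M" "ordinal \<alpha>" "y \<in> elts (Vr \<alpha>)"
      using ex[OF x] in_Vr by metis
    obtain \<beta> where \<beta>: "ordinal \<beta>" "\<beta> \<in> M \<and> (\<exists>y\<in>elts (Vr \<beta>). Q x y)"
      "\<And>\<gamma>. ordinal \<gamma> \<Longrightarrow> \<gamma> \<in> M \<and> (\<exists>y\<in>elts (Vr \<gamma>). Q x y) \<Longrightarrow> elts \<beta> \<subseteq> elts \<gamma>"
      using ordinal_least[of \<alpha> "\<lambda>\<beta>. \<beta> \<in> M \<and> (\<exists>y\<in>elts (Vr \<beta>). Q x y)"] y by metis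
    have nb: "\<not> (\<exists>y\<in>elts (Vr \<gamma>). Q x y)" if g: "\<gamma> \<in> elts \<beta>" for \<gamma>
    proof
      assume "\<exists>y\<in>elts (Vr \<gamma>). Q x y"
      moreover have "ordinal \<gamma>" "\<gamma> \<in> M" using ordinal_elem[OF \<beta>(1) g] M_trans[OF g] \<beta>(2) by auto
      ultimately have "elts \<beta> \<subseteq> elts \<gamma>" using \<beta>(3) by blast
      then show False using g foundation_hc_irrefl[of \<gamma>] by blast
    qed
    have "G x = \<beta>" unfolding G_def
    proof (rule theM_eq)
      fix \<gamma> assume \<gamma>: "\<gamma> \<in> M" "ordinal \<gamma> \<and> (\<exists>y\<in>elts (Vr \<gamma>). Q x y) \<and> (\<forall>\<beta>\<in>elts \<gamma>. \<not> (\<exists>y\<in>elts (Vr \<beta>). Q x y))"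
      then show "\<gamma> = \<beta>" using ordinal_linear[of \<gamma> \<beta>] \<beta>(1,2) nb by blast
    qed (use \<beta> nb in blast)+
    then show ?thesis using \<beta> by blast
  qed
  moreover have "mk (\<Union>x\<in>elts A. elts (Vr (G x))) \<in> M"
    by (rule UN_in_M[OF A]) (intro dft_Vr G)
  moreover have "elts (mk (\<Union>x\<in>elts A. elts (Vr (G x)))) = (\<Union>x\<in>elts A. elts (Vr (G x)))" by simp
  ultimately show ?thesis by blast
qed

end

section \<open>Consequences of the axiom of choice\<close>

locale ctm_model = zf_model + assumes choice_axiom: "choice_ax M"
begin

text \<open>The axiom concerns disjoint families, so each nonempty subset \<open>x\<close> of
  \<open>A\<close> is replaced by its disjoint copy \<open>hprod (mk {x}) x\<close>. A transversal
  of the copies codes a choice function.\<close>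

lemma choice_fun:
  assumes A: "A \<in> M"
  shows "\<exists>c\<in>M. \<forall>x\<in>M. elts x \<subseteq> elts A \<and> elts x \<noteq> {} \<longrightarrow> ap c x \<in> elts x"
proof -
  define P where "P = mk {x \<in> elts (PowM A). \<exists>y\<in>elts x. y = y}"
  have P: "P \<in> M" unfolding P_def by (rule sep_in_M) (use A in simp, intro dfn_intros)
  have eP: "x \<in> elts P \<longleftrightarrow> x \<in> M \<and> elts x \<subseteq> elts A \<and> elts x \<noteq> {}" for x unfolding P_def by auto
  define a where "a = mk ((\<lambda>x. hprod (mk {x}) x) ` elts P)"
  have a: "a \<in> M" unfolding a_def by (rule repl_in_M[OF P]) (intro dfn_intros)
  have ea: "elts a = (\<lambda>x. hprod (mk {x}) x) ` elts P" by (simp add: a_def)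
  have M1: "\<And>x. x \<in> elts P \<Longrightarrow> elts x \<subseteq> M" using eP M_sub by blast
  have ne: "\<forall>x\<in>M. x \<in> elts a \<longrightarrow> (\<exists>z\<in>M. z \<in> elts x)"
  proof (intro ballI impI)
    fix u assume "u \<in> elts a"
    then obtain x where x: "x \<in> elts P" "u = hprod (mk {x}) x" unfolding ea by blast
    then obtain y where "y \<in> elts x" using eP by blast
    then have "hpair x y \<in> elts u" "hpair x y \<in> M" using x eP M1 by auto
    then show "\<exists>z\<in>M. z \<in> elts u" by blast
  qed
  have dj: "\<forall>x\<in>M. \<forall>y\<in>M. x \<in> elts a \<and> y \<in> elts a \<and> x \<noteq> y \<longrightarrow> \<not> (\<exists>z\<in>M. z \<in> elts x \<and> z \<in> elts y)"
    unfolding ea by auto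
  from mp[OF bspec[OF choice_axiom[unfolded choice_ax_def] a] conjI[OF ne dj]]
  obtain c where c: "c \<in> M" "\<And>x. x \<in> M \<Longrightarrow> x \<in> elts a \<Longrightarrow> \<exists>!z. z \<in> M \<and> z \<in> elts x \<and> z \<in> elts c" by blast
  define f where "f = lam P (\<lambda>x. theM (\<lambda>y. y \<in> elts x \<and> hpair x y \<in> elts c))"
  have "f \<in> M" unfolding f_def by (rule lam_in_M[OF P]) (intro dfn_intros c)
  moreover have "ap f x \<in> elts x" if "x \<in> M" "elts x \<subseteq> elts A \<and> elts x \<noteq> {}" for x
  proof -
    have x: "x \<in> elts P" using that eP by blast
    then have "hprod (mk {x}) x \<in> elts a" unfolding ea by blast
    from c(2)[OF M_trans[OF this a] this]
    obtain z where z: "z \<in> elts (hprod (mk {x}) x)" "z \<in> elts c"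
      "\<And>z'. z' \<in> M \<Longrightarrow> z' \<in> elts (hprod (mk {x}) x) \<Longrightarrow> z' \<in> elts c \<Longrightarrow> z' = z" by auto
    then obtain y where y: "z = hpair x y" "y \<in> elts x" by auto
    have "theM (\<lambda>y. y \<in> elts x \<and> hpair x y \<in> elts c) = y"
    proof (rule theM_eq)
      show "y \<in> M" using M_trans[OF y(2) that(1)] .
      fix y' assume "y' \<in> M" "y' \<in> elts x \<and> hpair x y' \<in> elts c"
      then have "hpair x y' = z" using that(1) by (intro z(3)) auto
      then show "y' = y" using y by simp
    qed (use y z in auto)
    then show ?thesis unfolding f_def using x y by simp
  qed
  ultimately show ?thesis by blast
qed

text \<open>Burali-Forti: a set containing all ordinals of the model would yield an ordinal that is
  its own element.\<close>

lemma ordinals_not_set: assumes "B \<in> M" shows "\<exists>\<alpha>\<in>M. ordinal \<alpha> \<and> \<alpha> \<notin> elts B"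
proof (rule ccontr)
  assume *: "\<not> ?thesis"
  define O' where "O' = mk {x \<in> elts B. ordinal x}"
  have O: "O' \<in> M" unfolding O'_def by (rule sep_in_M[OF assms]) (intro dfn_intros)
  have eO: "x \<in> elts O' \<longleftrightarrow> x \<in> M \<and> ordinal x" for x
    using * M_trans[OF _ assms] unfolding O'_def by auto
  have "ordinal O'"
  proof (rule ordinal_set)
    fix x y assume x: "x \<in> elts O'" "y \<in> elts x"
    then show "y \<in> elts O'" using eO M_trans[OF x(2)] ordinal_elem[OF _ x(2)] by blast
  qed (use eO in blast)
  then have "O' \<in> elts O'" using O eO by blast
  then show False by simp
qed

text \<open>Zermelo's enumeration: keep choosing from what is left of \<open>A\<close>. If
  \<open>A\<close> were never exhausted, the inverse of the enumeration would, by replacement, map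
  \<open>A\<close> onto a set containing all ordinals.\<close>

lemma well_ordering:
  assumes A: "A \<in> M"
  shows "\<exists>\<alpha>\<in>M. ordinal \<alpha> \<and> (\<exists>f\<in>M. bij_betw (ap f) (elts \<alpha>) (elts A))"
proof -
  obtain c where c: "c \<in> M" "\<And>x. x \<in> M \<Longrightarrow> elts x \<subseteq> elts A \<Longrightarrow> elts x \<noteq> {} \<Longrightarrow> ap c x \<in> elts x"
    using choice_fun[OF A] by metis
  define R where "R x f = mk (elts A - elts (mk ((\<lambda>y. ap f y) ` elts x)))" for x f
  have R: "dft (\<lambda>e. R (e 0) (e 1))" unfolding R_def by (intro dfn_intros A)
  note R' = dft2[of R, OF R]
  \<comment> \<open>The value \<open>A\<close> after exhaustion is a dummy; only stages before
    exhaustion are used below.\<close>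
  define H where "H x f = (if R x f = mk {} then A else ap c (R x f))" for x f
  have H: "dft (\<lambda>e. H (e 0) (e 1))" unfolding H_def by (intro dfn_intros R' A c empty_in_M)
  define F where "F = hrec (\<lambda>x. x) H"
  have dF: "dft t \<Longrightarrow> dft (\<lambda>e. F (t e))" for t unfolding F_def
    by (rule dft_hrec[OF _ H wf_elts']) (intro dfn_intros)
  have dF0: "dft (\<lambda>e. F (e 0))" by (rule dF) (intro dfn_intros)
  have FM: "F x \<in> M" if "x \<in> M" for x using dft1_M[OF dF0 that] .
  define S where "S x = mk (elts A - F ` elts x)" for x
  have eS: "elts (S x) = elts A - F ` elts x" for x by (simp add: S_def)
  have SM: "S x \<in> M" if "x \<in> M" for x
  proof -
    have "mk (elts A - elts (mk (F ` elts x))) \<in> M" by (rule diff_in_M[OF A repl_in_M[OF that dF0]])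
    then show ?thesis by (simp add: S_def)
  qed
  have F: "F x = (if S x = mk {} then A else ap c (S x))" for x
  proof -
    have "R x (lam x F) = S x" unfolding R_def S_def by simp
    then show ?thesis unfolding F_def by (subst hrec_unfold[OF wf_elts']) (simp add: H_def F_def)
  qed
  have Fin: "F x \<in> elts A - F ` elts x" if "x \<in> M" "\<not> elts A \<subseteq> F ` elts x" for x
  proof -
    have "S x \<noteq> mk {}" using that(2) eS[of x] by auto
    moreover have "elts (S x) \<noteq> {}" using that(2) eS[of x] by auto
    ultimately have "F x \<in> elts (S x)" using c(2)[OF SM[OF that(1)]] eS[of x] by (subst F) auto
    then show ?thesis using eS by blast
  qed
  have inj: "x = y" if "ordinal x" "ordinal y" "x \<in> M" "y \<in> M" "\<not> elts A \<subseteq> F ` elts x" "\<not> elts A \<subseteq> F ` elts y" "F x = F y" for x y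
    using ordinal_linear[OF that(1,2)] Fin[OF that(3,5)] Fin[OF that(4,6)] that(7) by (metis DiffD2 imageI)
  have "\<exists>\<alpha>\<in>M. ordinal \<alpha> \<and> elts A \<subseteq> F ` elts \<alpha>"
  proof (rule ccontr)
    assume "\<not> ?thesis"
    then have no: "\<And>\<alpha>. \<alpha> \<in> M \<Longrightarrow> ordinal \<alpha> \<Longrightarrow> \<not> elts A \<subseteq> F ` elts \<alpha>" by blast
    note dF1 = dft1[of F, OF dF0]
    define I where "I a = theM (\<lambda>\<alpha>. ordinal \<alpha> \<and> F \<alpha> = a)" for a
    have I: "dft (\<lambda>e. I (e 0))" unfolding I_def by (intro dfn_intros dF1)
    obtain \<alpha> where \<alpha>: "\<alpha> \<in> M" "ordinal \<alpha>" "\<alpha> \<notin> elts (mk (I ` elts A))"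
      using ordinals_not_set[OF repl_in_M[OF A I]] by metis
    have "I (F \<alpha>) = \<alpha>" unfolding I_def
    proof (rule theM_eq)
      fix \<beta> assume \<beta>: "\<beta> \<in> M" "ordinal \<beta> \<and> F \<beta> = F \<alpha>"
      show "\<beta> = \<alpha>" using inj[of \<beta> \<alpha>] no[OF \<beta>(1)] no[OF \<alpha>(1,2)] \<alpha>(1,2) \<beta> by blast
    qed (use \<alpha> in simp_all)
    moreover have "F \<alpha> \<in> elts A" using Fin[OF \<alpha>(1) no[OF \<alpha>(1,2)]] by blast
    ultimately have "\<alpha> \<in> I ` elts A" by (metis imageI)
    then show False using \<alpha>(3) by simp
  qed
  then obtain \<alpha>0 where "\<alpha>0 \<in> M" "ordinal \<alpha>0" "elts A \<subseteq> F ` elts \<alpha>0" by blast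
  then obtain \<alpha> where \<alpha>: "ordinal \<alpha>" "\<alpha> \<in> M \<and> elts A \<subseteq> F ` elts \<alpha>" "\<And>\<gamma>. ordinal \<gamma> \<Longrightarrow> \<gamma> \<in> M \<and> elts A \<subseteq> F ` elts \<gamma> \<Longrightarrow> elts \<alpha> \<subseteq> elts \<gamma>"
    using ordinal_least[of \<alpha>0 "\<lambda>\<alpha>. \<alpha> \<in> M \<and> elts A \<subseteq> F ` elts \<alpha>"] by metis
  have below: "\<not> elts A \<subseteq> F ` elts x" "ordinal x" "x \<in> M" if x: "x \<in> elts \<alpha>" for x
  proof -
    show o: "ordinal x" "x \<in> M" using ordinal_elem[OF \<alpha>(1) x] M_trans[OF x] \<alpha>(2) by auto
    show "\<not> elts A \<subseteq> F ` elts x"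
    proof
      assume "elts A \<subseteq> F ` elts x"
      then have "elts \<alpha> \<subseteq> elts x" using \<alpha>(3) o by blast
      then show False using x foundation_hc_irrefl[of x] by blast
    qed
  qed
  have "bij_betw F (elts \<alpha>) (elts A)"
    unfolding bij_betw_def
  proof
    show "inj_on F (elts \<alpha>)"
    proof (rule inj_onI)
      fix x y assume xy: "x \<in> elts \<alpha>" "y \<in> elts \<alpha>" "F x = F y"
      show "x = y" by (rule inj[OF below(2)[OF xy(1)] below(2)[OF xy(2)] below(3)[OF xy(1)] below(3)[OF xy(2)] below(1)[OF xy(1)] below(1)[OF xy(2)] xy(3)])
    qed
    have "F x \<in> elts A" if "x \<in> elts \<alpha>" for x using Fin[OF below(3)[OF that] below(1)[OF that]] by simp
    then show "F ` elts \<alpha> = elts A" using \<alpha>(2) by blast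
  qed
  then have "bij_betw (ap (lam \<alpha> F)) (elts \<alpha>) (elts A)" by (subst bij_betw_cong[of _ _ F]) simp_all
  moreover have "lam \<alpha> F \<in> M" using lam_in_M[OF _ dF0] \<alpha>(2) by blast
  ultimately show ?thesis using \<alpha>(1,2) by blast
qed

text \<open>Collection puts witnesses into a set \<open>B\<close>, and a well-ordering of
  \<open>B\<close> selects the one of least index definably.\<close>

lemma AC:
  assumes A: "A \<in> M" and Q: "dfn (\<lambda>e. Q (e 0) (e 1))" and ex: "\<And>x. x \<in> elts A \<Longrightarrow> \<exists>y\<in>M. Q x y"
  shows "\<exists>f\<in>M. \<forall>x\<in>elts A. Q x (ap f x)"
proof -
  note Q' = dfn2[of Q, OF Q]
  obtain B where B: "B \<in> M" "\<And>x. x \<in> elts A \<Longrightarrow> \<exists>y\<in>elts B. Q x y" using collection[OF A Q ex] by blast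
  obtain \<alpha> g where g: "\<alpha> \<in> M" "ordinal \<alpha>" "g \<in> M" "bij_betw (ap g) (elts \<alpha>) (elts B)" using well_ordering[OF B(1)] by blast
  define f where "f = lam A (\<lambda>x. ap g (theM (\<lambda>\<xi>. \<xi> \<in> elts \<alpha> \<and> Q x (ap g \<xi>) \<and> (\<forall>\<eta>\<in>elts \<xi>. \<not> Q x (ap g \<eta>)))))"
  have "f \<in> M" unfolding f_def by (rule lam_in_M[OF A]) (intro dfn_intros Q' g)
  moreover have "Q x (ap f x)" if x: "x \<in> elts A" for x
  proof -
    obtain y where "y \<in> elts B" "Q x y" using B(2)[OF x] by blast
    moreover have "elts B = ap g ` elts \<alpha>" using g(4) by (simp add: bij_betw_def)
    ultimately obtain \<xi> where \<xi>: "\<xi> \<in> elts \<alpha>" "Q x (ap g \<xi>)" by auto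
    have "ordinal \<xi>" using ordinal_elem[OF g(2) \<xi>(1)] .
    then obtain \<beta> where \<beta>: "ordinal \<beta>" "\<beta> \<in> elts \<alpha> \<and> Q x (ap g \<beta>)" "\<And>\<gamma>. ordinal \<gamma> \<Longrightarrow> \<gamma> \<in> elts \<alpha> \<and> Q x (ap g \<gamma>) \<Longrightarrow> elts \<beta> \<subseteq> elts \<gamma>"
      using ordinal_least[of \<xi> "\<lambda>\<xi>. \<xi> \<in> elts \<alpha> \<and> Q x (ap g \<xi>)"] \<xi> by metis
    have nb: "\<not> Q x (ap g \<gamma>)" if \<gamma>: "\<gamma> \<in> elts \<beta>" for \<gamma>
    proof
      assume "Q x (ap g \<gamma>)"
      moreover have "ordinal \<gamma>" "\<gamma> \<in> elts \<alpha>" using ordinal_elem[OF \<beta>(1) \<gamma>] ordinal_trans[OF \<gamma> _ g(2)] \<beta>(2) by auto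
      ultimately have "elts \<beta> \<subseteq> elts \<gamma>" using \<beta>(3) by blast
      then show False using \<gamma> foundation_hc_irrefl[of \<gamma>] by blast
    qed
    have "theM (\<lambda>\<xi>. \<xi> \<in> elts \<alpha> \<and> Q x (ap g \<xi>) \<and> (\<forall>\<eta>\<in>elts \<xi>. \<not> Q x (ap g \<eta>))) = \<beta>"
    proof (rule theM_eq)
      show "\<beta> \<in> M" using \<beta>(2) M_trans[OF _ g(1)] by blast
      fix \<gamma> assume "\<gamma> \<in> M" "\<gamma> \<in> elts \<alpha> \<and> Q x (ap g \<gamma>) \<and> (\<forall>\<eta>\<in>elts \<gamma>. \<not> Q x (ap g \<eta>))"
      then show "\<gamma> = \<beta>" using ordinal_linear[OF ordinal_elem[OF g(2), of \<gamma>] \<beta>(1)] \<beta>(2) nb[of \<gamma>] by blast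
    qed (use \<beta> nb in blast)
    then show ?thesis unfolding f_def using x \<beta>(2) by simp
  qed
  ultimately show ?thesis by blast
qed

end
lemma ctm_modelI: "ctm M \<Longrightarrow> ctm_model M"
  unfolding ctm_def ZFC_def by unfold_locales auto

context ctm_model begin

section \<open>Cardinals in the model\<close>

text \<open>\<open>lss A \<nu>\<close> means \<open>|A| < \<nu>\<close> for a cardinal \<open>\<nu>\<close>.\<close>

definition injf :: "hc \<Rightarrow> hc \<Rightarrow> hc \<Rightarrow> bool" where
  "injf f A B \<longleftrightarrow> (\<forall>x\<in>elts A. ap f x \<in> elts B \<and> (\<forall>y\<in>elts A. ap f x = ap f y \<longrightarrow> x = y))"

definition lep :: "hc \<Rightarrow> hc \<Rightarrow> bool" where "lep A B \<longleftrightarrow> (\<exists>f\<in>M. injf f A B)"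

definition bijf :: "hc \<Rightarrow> hc \<Rightarrow> hc \<Rightarrow> bool" where
  "bijf f A B \<longleftrightarrow> injf f A B \<and> (\<forall>y\<in>elts B. \<exists>x\<in>elts A. y = ap f x)"

definition eqp :: "hc \<Rightarrow> hc \<Rightarrow> bool" where "eqp A B \<longleftrightarrow> (\<exists>f\<in>M. bijf f A B)"

definition lss :: "hc \<Rightarrow> hc \<Rightarrow> bool" where "lss A \<nu> \<longleftrightarrow> (\<exists>\<alpha>\<in>elts \<nu>. lep A \<alpha>)"

lemma dfn_injf [dfn_intros]: "dft t \<Longrightarrow> dft s \<Longrightarrow> dft r \<Longrightarrow> dfn (\<lambda>e. injf (t e) (s e) (r e))"
  unfolding injf_def
  by (rule dfn3[of "\<lambda>f A B. \<forall>x\<in>elts A. ap f x \<in> elts B \<and> (\<forall>y\<in>elts A. ap f x = ap f y \<longrightarrow> x = y)"]) (intro dfn_intros)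

lemma dfn_bijf [dfn_intros]: "dft t \<Longrightarrow> dft s \<Longrightarrow> dft r \<Longrightarrow> dfn (\<lambda>e. bijf (t e) (s e) (r e))"
  unfolding bijf_def
  by (rule dfn3[of "\<lambda>f A B. injf f A B \<and> (\<forall>y\<in>elts B. \<exists>x\<in>elts A. y = ap f x)"]) (intro dfn_intros)

lemma dfn_lep [dfn_intros]: "dft t \<Longrightarrow> dft s \<Longrightarrow> dfn (\<lambda>e. lep (t e) (s e))"
  unfolding lep_def by (rule dfn2[of "\<lambda>A B. \<exists>f\<in>M. injf f A B"]) (intro dfn_intros)

lemma dfn_eqp [dfn_intros]: "dft t \<Longrightarrow> dft s \<Longrightarrow> dfn (\<lambda>e. eqp (t e) (s e))"
  unfolding eqp_def by (rule dfn2[of "\<lambda>A B. \<exists>f\<in>M. bijf f A B"]) (intro dfn_intros)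

lemma dfn_lss [dfn_intros]: "dft t \<Longrightarrow> dft s \<Longrightarrow> dfn (\<lambda>e. lss (t e) (s e))"
  unfolding lss_def by (rule dfn2[of "\<lambda>A B. \<exists>\<alpha>\<in>elts B. lep A \<alpha>"]) (intro dfn_intros)

lemma injf_iff: "injf f A B \<longleftrightarrow> inj_on (ap f) (elts A) \<and> ap f ` elts A \<subseteq> elts B"
  unfolding injf_def inj_on_def by blast

lemma bijf_iff: "bijf f A B \<longleftrightarrow> bij_betw (ap f) (elts A) (elts B)"
  unfolding bijf_def injf_iff bij_betw_def by blast

lemma lepI:
  assumes "A \<in> M" "dft (\<lambda>e. F (e 0))" "\<And>x. x \<in> elts A \<Longrightarrow> F x \<in> elts B"
    "\<And>x y. x \<in> elts A \<Longrightarrow> y \<in> elts A \<Longrightarrow> F x = F y \<Longrightarrow> x = y"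
  shows "lep A B"
  unfolding lep_def
proof
  show "lam A F \<in> M" by (rule lam_in_M[OF assms(1,2)])
  show "injf (lam A F) A B" unfolding injf_def using assms(3,4) by simp
qed

lemma eqpI:
  assumes "A \<in> M" "dft (\<lambda>e. F (e 0))" "bij_betw F (elts A) (elts B)"
  shows "eqp A B"
  unfolding eqp_def
proof
  show "lam A F \<in> M" by (rule lam_in_M[OF assms(1,2)])
  show "bijf (lam A F) A B" unfolding bijf_iff using assms(3) by (subst bij_betw_cong[of _ _ F]) simp_all
qed

lemma lep_subset: "A \<in> M \<Longrightarrow> elts A \<subseteq> elts B \<Longrightarrow> lep A B"
  by (rule lepI[of A "\<lambda>x. x"]) (auto intro: dft_var)

lemma lep_refl: "A \<in> M \<Longrightarrow> lep A A" by (rule lep_subset) auto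

lemma lep_trans: assumes "A \<in> M" "lep A B" "lep B C" shows "lep A C"
proof -
  obtain f g where fg: "f \<in> M" "injf f A B" "g \<in> M" "injf g B C" using assms unfolding lep_def by blast
  show ?thesis
  proof (rule lepI[OF assms(1), of "\<lambda>x. ap g (ap f x)"])
    show "dft (\<lambda>e. ap g (ap f (e 0)))" by (intro dfn_intros fg)
  qed (use fg in \<open>auto simp: injf_def\<close>)
qed

lemma eqp_lep: "eqp A B \<Longrightarrow> lep A B" unfolding eqp_def lep_def bijf_def by blast

lemma eqp_sym: assumes "eqp A B" "A \<in> M" "B \<in> M" shows "eqp B A"
proof -
  obtain f where f: "f \<in> M" "bijf f A B" using assms unfolding eqp_def by blast
  define g where "g y = theM (\<lambda>x. x \<in> elts A \<and> ap f x = y)" for y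
  have bf: "bij_betw (ap f) (elts A) (elts B)" using f bijf_iff by blast
  have g: "g (ap f x) = x" if x: "x \<in> elts A" for x
    unfolding g_def
  proof (rule theM_eq)
    show "x \<in> M" using M_trans[OF x assms(2)] .
    show "y = x" if "y \<in> elts A \<and> ap f y = ap f x" for y
      using that x bf unfolding bij_betw_def inj_on_def by blast
  qed (use x in simp)
  have eB: "elts B = ap f ` elts A" using bf by (simp add: bij_betw_def)
  have "bij_betw g (elts B) (elts A)"
    unfolding bij_betw_def eB inj_on_def by (auto simp: g image_image)
  then show ?thesis
    by (intro eqpI[OF assms(3), of g]) (auto simp: g_def intro!: dfn_intros assms f)
qed

lemma eqp_trans: assumes "eqp A B" "eqp B C" "A \<in> M" shows "eqp A C"
proof -
  obtain f g where fg: "f \<in> M" "bijf f A B" "g \<in> M" "bijf g B C" using assms unfolding eqp_def by blast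
  show ?thesis
  proof (rule eqpI[OF assms(3), of "\<lambda>x. ap g (ap f x)"])
    show "dft (\<lambda>e. ap g (ap f (e 0)))" by (intro dfn_intros fg)
    show "bij_betw (\<lambda>x. ap g (ap f x)) (elts A) (elts C)"
      using bij_betw_trans[of "ap f" "elts A" "elts B" "ap g"] fg unfolding bijf_iff by (simp add: comp_def)
  qed
qed

lemma lep_surj:
  assumes "A \<in> M" "B \<in> M" "dft (\<lambda>e. F (e 0))" "elts B \<subseteq> F ` elts A"
  shows "lep B A"
proof -
  note F' = dft1[of F, OF assms(3)]
  have "\<exists>f\<in>M. \<forall>y\<in>elts B. ap f y \<in> elts A \<and> F (ap f y) = y"
  proof (rule AC[OF assms(2), of "\<lambda>y x. x \<in> elts A \<and> F x = y"])
    show "dfn (\<lambda>e. e 1 \<in> elts A \<and> F (e 1) = e 0)" by (intro dfn_intros F' assms)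
    fix y assume "y \<in> elts B"
    then obtain x where "x \<in> elts A" "F x = y" using assms(4) by blast
    then show "\<exists>x\<in>M. x \<in> elts A \<and> F x = y" using M_trans[OF _ assms(1)] by blast
  qed
  then obtain f where f: "f \<in> M" "\<And>y. y \<in> elts B \<Longrightarrow> ap f y \<in> elts A \<and> F (ap f y) = y" by blast
  have "injf f B A" unfolding injf_def using f(2) by metis
  then show ?thesis using f(1) unfolding lep_def by blast
qed

text \<open>The Mostowski collapse of \<open>S\<close>. Collapsed values never exceed their
  arguments, so the order type is at most \<alpha>.\<close>

lemma collapse:
  assumes "S \<in> M" "ordinal \<alpha>" "\<alpha> \<in> M" "elts S \<subseteq> elts \<alpha>"
  shows "\<exists>\<gamma>\<in>M. ordinal \<gamma> \<and> elts \<gamma> \<subseteq> elts \<alpha> \<and> eqp S \<gamma>"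
proof -
  define F where "F = hrec (\<lambda>x. x) (\<lambda>x f. mk ((\<lambda>y. ap f y) ` elts (mk {y \<in> elts x. y \<in> elts S})))"
  have F: "elts (F x) = F ` {y \<in> elts x. y \<in> elts S}" for x
    unfolding F_def by (subst hrec_unfold[OF wf_elts']) simp
  have dF: "dft (\<lambda>e. F (e 0))" unfolding F_def
    by (rule dft_hrec[OF _ _ wf_elts']) (intro dfn_intros assms)+
  have sub: "ordinal x \<Longrightarrow> ordinal (F x) \<and> elts (F x) \<subseteq> elts x" for x
  proof (induction x rule: hc_induct)
    case (step x)
    have IH: "ordinal (F y)" "elts (F y) \<subseteq> elts y" "ordinal y" if "y \<in> elts x" for y
      using step.IH[OF that] ordinal_elem[OF step.prems that] by auto
    have "ordinal (F x)"
    proof (rule ordinal_set)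
      show "ordinal z" if "z \<in> elts (F x)" for z using that IH unfolding F[of x] by auto
      fix z w assume "z \<in> elts (F x)" "w \<in> elts z"
      then obtain y where y: "y \<in> elts x" "w \<in> elts (F y)" unfolding F[of x] by auto
      then obtain u where "u \<in> elts y" "u \<in> elts S" "w = F u" unfolding F[of y] by auto
      then show "w \<in> elts (F x)" using ordinal_trans[of u y x] y step.prems unfolding F[of x] by auto
    qed
    moreover have "F y \<in> elts x" if y: "y \<in> elts x" for y
    proof -
      have "F y \<in> elts y \<or> F y = y" using IH[OF y] ordinal_subset_iff by blast
      then show ?thesis using y ordinal_trans[OF _ y step.prems] by metis
    qed
    ultimately show ?case unfolding F[of x] by auto
  qed
  have less: "F x \<in> elts (F y)" if "x \<in> elts y" "x \<in> elts S" for x y using that unfolding F[of y] by auto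
  have inj: "inj_on F (elts S)"
  proof (rule inj_onI)
    fix x y assume xy: "x \<in> elts S" "y \<in> elts S" "F x = F y"
    then have "ordinal x" "ordinal y" using assms ordinal_elem by blast+
    then show "x = y" using ordinal_linear[of x y] less[of x y] less[of y x] xy by auto
  qed
  have "elts (F \<alpha>) = F ` elts S" unfolding F[of \<alpha>] using assms(4) by blast
  then have "bij_betw F (elts S) (elts (F \<alpha>))" using inj by (simp add: bij_betw_def)
  then have "eqp S (F \<alpha>)" by (rule eqpI[OF assms(1) dF])
  moreover have "F \<alpha> \<in> M" by (rule dft1_M[OF dF assms(3)])
  ultimately show ?thesis using sub[OF assms(2)] by blast
qed

lemma lep_ordinal_eqp:
  assumes "A \<in> M" "ordinal \<alpha>" "\<alpha> \<in> M" "lep A \<alpha>"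
  shows "\<exists>\<gamma>\<in>M. ordinal \<gamma> \<and> elts \<gamma> \<subseteq> elts \<alpha> \<and> eqp \<gamma> A"
proof -
  obtain f where f: "f \<in> M" "injf f A \<alpha>" using assms unfolding lep_def by blast
  define S where "S = mk ((\<lambda>x. ap f x) ` elts A)"
  have S: "S \<in> M" unfolding S_def by (rule repl_in_M[OF assms(1)]) (intro dfn_intros f)
  have eS: "elts S = ap f ` elts A" by (simp add: S_def)
  have "elts S \<subseteq> elts \<alpha>" using f unfolding eS injf_iff by blast
  then obtain \<gamma> where \<gamma>: "\<gamma> \<in> M" "ordinal \<gamma>" "elts \<gamma> \<subseteq> elts \<alpha>" "eqp S \<gamma>"
    using collapse[OF S assms(2,3)] by blast
  have "eqp A S" unfolding eqp_def using f by (intro bexI[of _ f]) (auto simp: bijf_iff injf_iff bij_betw_def eS)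
  then have "eqp \<gamma> A" using eqp_sym[OF eqp_trans[OF _ \<gamma>(4) assms(1)] assms(1) \<gamma>(1)] by blast
  then show ?thesis using \<gamma> by blast
qed

lemma is_bij_iff: "A \<in> M \<Longrightarrow> (\<exists>f\<in>M. is_bij f A B) \<longleftrightarrow> eqp A B"
proof
  assume "\<exists>f\<in>M. is_bij f A B"
  then obtain f where f: "f \<in> M" "is_fun f A B" "bij_betw (app f) (elts A) (elts B)" unfolding is_bij_def by blast
  then have "bij_betw (ap f) (elts A) (elts B)" by (subst bij_betw_cong[of _ _ "app f"]) (auto simp: is_fun_ap(1))
  then show "eqp A B" using f(1) unfolding eqp_def bijf_iff by blast
next
  assume A: "A \<in> M" and "eqp A B"
  then obtain f where f: "f \<in> M" "bij_betw (ap f) (elts A) (elts B)" unfolding eqp_def bijf_iff by blast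
  let ?g = "lam A (\<lambda>x. ap f x)"
  have "?g \<in> M" by (rule lam_in_M[OF A]) (intro dfn_intros f)
  moreover have fn: "is_fun ?g A B" by (rule is_fun_lam) (use f(2) in \<open>auto simp: bij_betw_def\<close>)
  moreover have "bij_betw (app ?g) (elts A) (elts B)"
    using f(2) by (subst bij_betw_cong[of _ _ "ap f"]) (auto simp: is_fun_ap(1)[OF fn])
  ultimately show "\<exists>f\<in>M. is_bij f A B" unfolding is_bij_def by blast
qed

lemma card_in_eq: "card_in M A = least_ord (\<lambda>\<alpha>. \<alpha> \<in> M \<and> eqp \<alpha> A)"
proof -
  have "(\<lambda>\<alpha>. \<alpha> \<in> M \<and> (\<exists>f\<in>M. is_bij f \<alpha> A)) = (\<lambda>\<alpha>. \<alpha> \<in> M \<and> eqp \<alpha> A)" by (rule ext) (simp cong: conj_cong add: is_bij_iff)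
  then show ?thesis unfolding card_in_def by simp
qed

lemma card_in:
  assumes A: "A \<in> M"
  shows ordinal_card: "ordinal (card_in M A)" and card_in_M: "card_in M A \<in> M" and card_eqp: "eqp (card_in M A) A"
    and card_least: "\<And>\<beta>. ordinal \<beta> \<Longrightarrow> \<beta> \<in> M \<Longrightarrow> eqp \<beta> A \<Longrightarrow> elts (card_in M A) \<subseteq> elts \<beta>"
proof -
  obtain \<alpha> where \<alpha>: "ordinal \<alpha>" "\<alpha> \<in> M \<and> eqp \<alpha> A" using well_ordering[OF A] unfolding eqp_def bijf_iff by blast
  note l = least_ord[of \<alpha> "\<lambda>\<alpha>. \<alpha> \<in> M \<and> eqp \<alpha> A", OF \<alpha>, folded card_in_eq]
  show "ordinal (card_in M A)" "card_in M A \<in> M" "eqp (card_in M A) A" using l(1,2) by auto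
  show "\<And>\<beta>. ordinal \<beta> \<Longrightarrow> \<beta> \<in> M \<Longrightarrow> eqp \<beta> A \<Longrightarrow> elts (card_in M A) \<subseteq> elts \<beta>" using l(3) by blast
qed

lemma lep_card: "A \<in> M \<Longrightarrow> lep A (card_in M A)" "A \<in> M \<Longrightarrow> lep (card_in M A) A"
  using eqp_lep[OF eqp_sym[OF card_eqp card_in_M]] eqp_lep[OF card_eqp] by blast+

lemma card_le_ordinal: assumes "A \<in> M" "ordinal \<alpha>" "\<alpha> \<in> M" "lep A \<alpha>" shows "elts (card_in M A) \<subseteq> elts \<alpha>"
proof -
  obtain \<gamma> where "\<gamma> \<in> M" "ordinal \<gamma>" "elts \<gamma> \<subseteq> elts \<alpha>" "eqp \<gamma> A" using lep_ordinal_eqp[OF assms] by blast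
  then show ?thesis using card_least[OF assms(1)] by blast
qed

lemma card_mono: assumes "A \<in> M" "B \<in> M" "lep A B" shows "elts (card_in M A) \<subseteq> elts (card_in M B)"
  by (rule card_le_ordinal[OF assms(1) ordinal_card[OF assms(2)] card_in_M[OF assms(2)]
    lep_trans[OF assms(1,3) lep_card(1)[OF assms(2)]]])

lemma lep_iff_card: assumes "A \<in> M" "B \<in> M" shows "lep A B \<longleftrightarrow> elts (card_in M A) \<subseteq> elts (card_in M B)"
proof
  assume "elts (card_in M A) \<subseteq> elts (card_in M B)"
  then have "lep (card_in M A) (card_in M B)" by (rule lep_subset[OF card_in_M[OF assms(1)]])
  then have "lep A (card_in M B)" by (rule lep_trans[OF assms(1) lep_card(1)[OF assms(1)]])
  then show "lep A B" by (rule lep_trans[OF assms(1) _ lep_card(2)[OF assms(2)]])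
qed (rule card_mono[OF assms])

lemma card_eq: assumes "A \<in> M" "B \<in> M" "lep A B" "lep B A" shows "card_in M A = card_in M B"
  using card_mono[OF assms(1-3)] card_mono[OF assms(2,1,4)] by (intro hc_eqI) blast

lemma cardinalD: assumes "cardinal M \<nu>" shows "\<nu> \<in> M" "ordinal \<nu>" "card_in M \<nu> = \<nu>"
  using assms unfolding cardinal_def by auto

lemma cardinal_card: assumes "A \<in> M" shows "cardinal M (card_in M A)"
  unfolding cardinal_def
  using card_in_M[OF assms] ordinal_card[OF assms] card_eq[OF card_in_M[OF assms] assms lep_card(2,1)[OF assms]] by blast

lemma card_eqI: "cardinal M \<nu> \<Longrightarrow> A \<in> M \<Longrightarrow> lep A \<nu> \<Longrightarrow> lep \<nu> A \<Longrightarrow> card_in M A = \<nu>"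
  using card_eq[of A \<nu>] cardinalD[of \<nu>] by simp

lemma lss_iff_card: assumes "cardinal M \<nu>" "A \<in> M" shows "lss A \<nu> \<longleftrightarrow> card_in M A \<in> elts \<nu>"
proof
  note \<nu> = cardinalD[OF assms(1)]
  assume "lss A \<nu>"
  then obtain \<alpha> where \<alpha>: "\<alpha> \<in> elts \<nu>" "lep A \<alpha>" unfolding lss_def by blast
  have o: "ordinal \<alpha>" "\<alpha> \<in> M" using ordinal_elem[OF \<nu>(2) \<alpha>(1)] M_trans[OF \<alpha>(1) \<nu>(1)] by auto
  have "elts (card_in M A) \<subseteq> elts \<alpha>" by (rule card_le_ordinal[OF assms(2) o \<alpha>(2)])
  then have "card_in M A \<in> elts \<alpha> \<or> card_in M A = \<alpha>" using ordinal_subset_iff[OF ordinal_card[OF assms(2)] o(1)] by blast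
  then show "card_in M A \<in> elts \<nu>" using \<alpha>(1) ordinal_trans[OF _ \<alpha>(1) \<nu>(2)] by metis
next
  assume "card_in M A \<in> elts \<nu>" then show "lss A \<nu>" unfolding lss_def using lep_card(1)[OF assms(2)] by blast
qed

lemma not_lss: assumes "cardinal M \<nu>" "A \<in> M" shows "\<not> lss A \<nu> \<longleftrightarrow> lep \<nu> A"
  using lss_iff_card[OF assms] lep_iff_card[OF cardinalD(1)[OF assms(1)] assms(2)] cardinalD[OF assms(1)]
    ordinal_not_subset[OF cardinalD(2)[OF assms(1)] ordinal_card[OF assms(2)]] by metis

lemma lss_ordinal: assumes "cardinal M \<nu>" "ordinal \<beta>" "\<beta> \<in> M" "lss \<beta> \<nu>" shows "\<beta> \<in> elts \<nu>"
proof (rule ccontr)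
  assume "\<beta> \<notin> elts \<nu>"
  then have "elts \<nu> \<subseteq> elts \<beta>" using ordinal_not_subset[OF cardinalD(2)[OF assms(1)] assms(2)] by blast
  then show False using not_lss[OF assms(1,3)] assms(4) lep_subset[OF cardinalD(1)[OF assms(1)]] by blast
qed

lemma lssI: "\<alpha> \<in> elts \<nu> \<Longrightarrow> lep A \<alpha> \<Longrightarrow> lss A \<nu>" unfolding lss_def by blast

lemma lss_lep_trans: "A \<in> M \<Longrightarrow> lep A B \<Longrightarrow> lss B \<nu> \<Longrightarrow> lss A \<nu>"
  unfolding lss_def using lep_trans by blast

lemma lss_imp_lep: assumes "ordinal \<nu>" "\<nu> \<in> M" "A \<in> M" "lss A \<nu>" shows "lep A \<nu>"
proof -
  obtain \<alpha> where "\<alpha> \<in> elts \<nu>" "lep A \<alpha>" using assms unfolding lss_def by blast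
  then show ?thesis using lep_trans[OF assms(3)] lep_subset[OF M_trans[OF _ assms(2)] ordinal_sub[OF _ assms(1)]] by metis
qed

lemma lep_mono_r: "A \<in> M \<Longrightarrow> lep A B \<Longrightarrow> elts B \<subseteq> elts C \<Longrightarrow> lep A C"
  unfolding lep_def injf_def by blast

lemma lep_finite: "lep A B \<Longrightarrow> finite (elts B) \<Longrightarrow> finite (elts A)"
  unfolding lep_def injf_iff using finite_subset finite_imageD by metis

lemma infinite_cardinalD: "infinite_cardinal M \<nu> \<Longrightarrow> cardinal M \<nu>" "infinite_cardinal M \<nu> \<Longrightarrow> infinite (elts \<nu>)"
  unfolding infinite_cardinal_def by blast+

lemma lss_finite: "infinite_cardinal M \<nu> \<Longrightarrow> A \<in> M \<Longrightarrow> finite (elts A) \<Longrightarrow> lss A \<nu>"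
  using not_lss[of \<nu> A] lep_finite[of \<nu> A] infinite_cardinalD by blast

text \<open>The definition by \<open>least_ord\<close> quantifies over all of \<open>hc\<close>. The
  definable form compares only with smaller ordinals, and those are in the model by
  transitivity.\<close>

lemma dft_card [dfn_intros]: "dft t \<Longrightarrow> dft (\<lambda>e. card_in M (t e))"
proof (rule dft1[of "card_in M"])
  have "dft (\<lambda>e. theM (\<lambda>\<alpha>. ordinal \<alpha> \<and> eqp \<alpha> (e 0) \<and> (\<forall>\<beta>\<in>elts \<alpha>. \<not> eqp \<beta> (e 0))))" by (intro dfn_intros)
  then show "dft (\<lambda>e. card_in M (e 0))"
  proof (rule dft_cong)
    fix e :: "nat \<Rightarrow> hc" assume "range e \<subseteq> M"
    then have A: "e 0 \<in> M" by auto
    have nb: "\<not> eqp \<beta> (e 0)" if \<beta>: "\<beta> \<in> elts (card_in M (e 0))" for \<beta>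
    proof
      assume "eqp \<beta> (e 0)"
      then have "elts (card_in M (e 0)) \<subseteq> elts \<beta>"
        by (rule card_least[OF A ordinal_elem[OF ordinal_card[OF A] \<beta>] M_trans[OF \<beta> card_in_M[OF A]]])
      then show False using \<beta> foundation_hc_irrefl[of \<beta>] by blast
    qed
    show "theM (\<lambda>\<alpha>. ordinal \<alpha> \<and> eqp \<alpha> (e 0) \<and> (\<forall>\<beta>\<in>elts \<alpha>. \<not> eqp \<beta> (e 0))) = card_in M (e 0)"
    proof (rule theM_eq)
      fix \<alpha> assume "\<alpha> \<in> M" "ordinal \<alpha> \<and> eqp \<alpha> (e 0) \<and> (\<forall>\<beta>\<in>elts \<alpha>. \<not> eqp \<beta> (e 0))"
      then show "\<alpha> = card_in M (e 0)" using ordinal_linear[of \<alpha> "card_in M (e 0)"] ordinal_card[OF A] card_eqp[OF A] nb by blast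
    qed (use ordinal_card[OF A] card_in_M[OF A] card_eqp[OF A] nb in auto)
  qed
qed

text \<open>First-order stand-in, for ordinals, for the HOL predicate \<open>finite\<close>, which
  cannot occur in a formula of the model.\<close>

definition natord :: "hc \<Rightarrow> bool" where
  "natord x \<longleftrightarrow> (\<forall>y\<in>elts (hsucc x). y = mk {} \<or> (\<exists>z\<in>elts y. y = hsucc z))"

lemma dfn_natord [dfn_intros]: "dft t \<Longrightarrow> dfn (\<lambda>e. natord (t e))"
  unfolding natord_def
  by (rule dfn1[of "\<lambda>x. \<forall>y\<in>elts (hsucc x). y = mk {} \<or> (\<exists>z\<in>elts y. y = hsucc z)"]) (intro dfn_intros empty_in_M)

lemma natord_hsucc: "natord x \<Longrightarrow> natord (hsucc x)"
  unfolding natord_def by auto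

lemma natord_finite: "ordinal x \<Longrightarrow> natord x \<Longrightarrow> finite (elts x)"
proof (induction x rule: hc_induct)
  case (step x)
  from step.prems(2) have "x = mk {} \<or> (\<exists>z\<in>elts x. x = hsucc z)" unfolding natord_def by simp
  then show ?case
  proof
    assume "\<exists>z\<in>elts x. x = hsucc z"
    then obtain z where z: "z \<in> elts x" "x = hsucc z" by blast
    have "natord z" using step.prems(2) unfolding natord_def z(2) by simp
    then have "finite (elts z)" using step.IH[OF z(1) ordinal_elem[OF step.prems(1) z(1)]] by blast
    then show ?thesis using z by simp
  qed simp
qed

lemma hsucc_inject: "hsucc x = hsucc y \<Longrightarrow> x = y"
proof -
  assume a: "hsucc x = hsucc y"
  have "x \<in> elts (hsucc x)" "y \<in> elts (hsucc y)" by simp_all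
  then have "x \<in> elts (hsucc y)" "y \<in> elts (hsucc x)" unfolding a by auto
  then show "x = y" using foundation_hc[of x y] by auto
qed

lemma ordinal_hsucc_le: "ordinal \<alpha> \<Longrightarrow> x \<in> elts \<alpha> \<Longrightarrow> hsucc x \<in> elts \<alpha> \<or> hsucc x = \<alpha>"
  using ordinal_subset_iff[OF ordinal_hsucc[OF ordinal_elem[of \<alpha> x]], of \<alpha>] ordinal_sub[of x \<alpha>] by simp

text \<open>Hilbert's hotel: the new point goes to 0, the natural numbers move up by one, and
  everything else stays.\<close>

lemma lep_hsucc_infinite:
  assumes \<alpha>: "ordinal \<alpha>" "\<alpha> \<in> M" and inf: "infinite (elts \<alpha>)"
  shows "lep (hsucc \<alpha>) \<alpha>"
proof -
  define F where "F x = (if x = \<alpha> then mk {} else if natord x then hsucc x else x)" for x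
  have nz: "\<not> natord \<alpha>" using natord_finite[OF \<alpha>(1)] inf by blast
  have 1: "hsucc x \<in> elts \<alpha>" if x: "x \<in> elts \<alpha>" "natord x" for x
    using ordinal_hsucc_le[OF \<alpha>(1) x(1)] natord_hsucc[OF x(2)] nz by metis
  have "mk {} \<in> elts \<alpha> \<or> mk {} = \<alpha>" using ordinal_subset_iff[OF ordinal_empty \<alpha>(1)] by simp
  then have e: "mk {} \<in> elts \<alpha>" using inf by auto
  have ne: "hsucc x \<noteq> mk {}" for x by (metis elts_hsucc elts_mk countable_empty insert_not_empty)
  have ne0: "natord (mk {})" unfolding natord_def by simp
  show ?thesis
  proof (rule lepI[of _ F])
    show "dft (\<lambda>e. F (e 0))" unfolding F_def by (intro dfn_intros empty_in_M \<alpha>)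
    show "F x \<in> elts \<alpha>" if "x \<in> elts (hsucc \<alpha>)" for x using that 1[of x] e unfolding F_def by auto
    fix x y assume xy: "x \<in> elts (hsucc \<alpha>)" "y \<in> elts (hsucc \<alpha>)" and eq: "F x = F y"
    show "x = y"
      using eq unfolding F_def
      by (auto split: if_splits simp: ne ne[symmetric] ne0 dest: hsucc_inject natord_hsucc)
  qed (use \<alpha> in simp)
qed

lemma infinite_cardinal_limit:
  assumes \<nu>: "infinite_cardinal M \<nu>" and x: "x \<in> elts \<nu>" shows "hsucc x \<in> elts \<nu>"
proof -
  note c = infinite_cardinalD(1)[OF \<nu>] note c' = cardinalD[OF c]
  have o: "ordinal x" "x \<in> M" using ordinal_elem[OF c'(2) x] M_trans[OF x c'(1)] by auto
  have "lss (hsucc x) \<nu>"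
  proof (cases "finite (elts x)")
    case True then show ?thesis using o by (intro lss_finite[OF \<nu>]) auto
  next
    case False then show ?thesis using lssI[OF x lep_hsucc_infinite[OF o]] by blast
  qed
  then show ?thesis using lss_ordinal[OF c ordinal_hsucc[OF o(1)]] o(2) by simp
qed

section \<open>Products and unions of sets of bounded cardinality\<close>

lemma lep_prod_mono:
  assumes "A \<in> M" "B \<in> M" "lep A A'" "lep B B'" shows "lep (hprod A B) (hprod A' B')"
proof -
  obtain f g where f: "f \<in> M" "injf f A A'" and g: "g \<in> M" "injf g B B'" using assms unfolding lep_def by blast
  show ?thesis
  proof (rule lepI[of _ "\<lambda>z. hpair (ap f (hfst z)) (ap g (hsnd z))"])
    show "dft (\<lambda>e. hpair (ap f (hfst (e 0))) (ap g (hsnd (e 0))))" by (intro dfn_intros f g)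
    show "hprod A B \<in> M" using assms by simp
    have fg: "ap f a \<in> elts A'" "ap f a = ap f a' \<Longrightarrow> a' \<in> elts A \<Longrightarrow> a = a'" if "a \<in> elts A" for a a'
      using f(2) that unfolding injf_def by auto
    have gg: "ap g a \<in> elts B'" "ap g a = ap g a' \<Longrightarrow> a' \<in> elts B \<Longrightarrow> a = a'" if "a \<in> elts B" for a a'
      using g(2) that unfolding injf_def by auto
    show "hpair (ap f (hfst z)) (ap g (hsnd z)) \<in> elts (hprod A' B')" if "z \<in> elts (hprod A B)" for z
      using that fg gg by auto
    show "x = y" if "x \<in> elts (hprod A B)" "y \<in> elts (hprod A B)"
      "hpair (ap f (hfst x)) (ap g (hsnd x)) = hpair (ap f (hfst y)) (ap g (hsnd y))" for x y
    proof -
      obtain a b a' b' where "x = hpair a b" "y = hpair a' b'" "a \<in> elts A" "a' \<in> elts A" "b \<in> elts B" "b' \<in> elts B"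
        using \<open>x \<in> elts (hprod A B)\<close> \<open>y \<in> elts (hprod A B)\<close> by auto
      then show ?thesis using that(3) fg(2)[of a a'] gg(2)[of b b'] by simp
    qed
  qed
qed

lemma lep_Pow_mono: assumes "A \<in> M" "B \<in> M" "lep A B" shows "lep (PowM A) (PowM B)"
proof -
  obtain f where f: "f \<in> M" "injf f A B" using assms unfolding lep_def by blast
  let ?F = "\<lambda>x. mk ((\<lambda>y. ap f y) ` elts x)"
  have d: "dft (\<lambda>e. ?F (e 0))" by (intro dfn_intros f)
  show ?thesis
  proof (rule lepI[of _ ?F, OF _ d])
    show "?F x \<in> elts (PowM B)" if "x \<in> elts (PowM A)" for x
      using that f(2) dft1_M[of ?F, OF d, of x] unfolding injf_iff by auto
    fix x y assume xy: "x \<in> elts (PowM A)" "y \<in> elts (PowM A)" "?F x = ?F y"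
    have "ap f ` elts x = ap f ` elts y" using xy(3) by (simp add: mk_eq_iff)
    moreover have "inj_on (ap f) (elts A)" "elts x \<subseteq> elts A" "elts y \<subseteq> elts A" using f xy unfolding injf_iff by auto
    ultimately have "elts x = elts y" using inj_on_image_eq_iff by metis
    then show "x = y" by (rule hc_eqI)
  qed (use assms in simp)
qed

text \<open>Choose an injection into \<open>C\<close> for every member of the family and an index
  for every point of the union; a point is then determined by its index together with its
  image.\<close>

lemma lep_UN_prod:
  assumes "A \<in> M" "B \<in> M" "C \<in> M" "dft (\<lambda>e. F (e 0))" "lep A B" "\<And>x. x \<in> elts A \<Longrightarrow> lep (F x) C"
  shows "lep (mk (\<Union>x\<in>elts A. elts (F x))) (hprod B C)"
proof -
  note F' = dft1[of F, OF assms(4)]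
  let ?U = "mk (\<Union>x\<in>elts A. elts (F x))"
  have eU: "elts ?U = (\<Union>x\<in>elts A. elts (F x))" by simp
  have U: "?U \<in> M" by (rule UN_in_M[OF assms(1,4)])
  have "\<exists>g\<in>M. \<forall>x\<in>elts A. injf (ap g x) (F x) C"
    by (rule AC[OF assms(1), of "\<lambda>x g. injf g (F x) C"]) (intro dfn_intros F' assms, use assms(6) in \<open>simp add: lep_def\<close>)
  then obtain g where g: "g \<in> M" "\<And>x. x \<in> elts A \<Longrightarrow> injf (ap g x) (F x) C" by blast
  have "\<exists>h\<in>M. \<forall>u\<in>elts ?U. ap h u \<in> elts A \<and> u \<in> elts (F (ap h u))"
  proof (rule AC[OF U, of "\<lambda>u x. x \<in> elts A \<and> u \<in> elts (F x)"])
    show "dfn (\<lambda>e. e 1 \<in> elts A \<and> e 0 \<in> elts (F (e 1)))" by (intro dfn_intros F' assms)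
    show "\<exists>x\<in>M. x \<in> elts A \<and> u \<in> elts (F x)" if "u \<in> elts ?U" for u using that M_trans[OF _ assms(1)] unfolding eU by blast
  qed
  then obtain h where h: "h \<in> M" "\<And>u. u \<in> elts ?U \<Longrightarrow> ap h u \<in> elts A \<and> u \<in> elts (F (ap h u))" by blast
  have "lep ?U (hprod A C)"
  proof (rule lepI[of _ "\<lambda>u. hpair (ap h u) (ap (ap g (ap h u)) u)", OF U])
    show "dft (\<lambda>e. hpair (ap h (e 0)) (ap (ap g (ap h (e 0))) (e 0)))" by (intro dfn_intros g h)
    show "hpair (ap h u) (ap (ap g (ap h u)) u) \<in> elts (hprod A C)" if "u \<in> elts ?U" for u
      using h(2)[OF that] g(2)[of "ap h u"] unfolding injf_def by simp
    fix u v assume uv: "u \<in> elts ?U" "v \<in> elts ?U" and eq: "hpair (ap h u) (ap (ap g (ap h u)) u) = hpair (ap h v) (ap (ap g (ap h v)) v)"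
    have "ap h v = ap h u" "ap (ap g (ap h u)) u = ap (ap g (ap h u)) v" using eq by auto
    then show "u = v" using h(2)[OF uv(1)] h(2)[OF uv(2)] g(2)[of "ap h u"] unfolding injf_def by metis
  qed
  moreover have "lep (hprod A C) (hprod B C)" by (rule lep_prod_mono[OF assms(1,3,5) lep_refl[OF assms(3)]])
  ultimately show ?thesis by (rule lep_trans[OF U])
qed

text \<open>Goedel's ordering of pairs: by maximum first, then lexicographically. The predecessors
  of a pair lie in a square with side below \<nu>, so by \<open>sq\<close> every initial segment has
  order type below \<nu>.\<close>

lemma goedel_pairing:
  assumes \<nu>: "infinite_cardinal M \<nu>" and sq: "\<And>\<gamma>. \<gamma> \<in> elts \<nu> \<Longrightarrow> lss (hprod \<gamma> \<gamma>) \<nu>"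
  shows "lep (hprod \<nu> \<nu>) \<nu>"
proof -
  note c = infinite_cardinalD(1)[OF \<nu>] note c' = cardinalD[OF c]
  define A where "A = hprod \<nu> \<nu>"
  have A: "A \<in> M" using c' by (simp add: A_def)
  define mx where "mx z = mk (elts (hfst z) \<union> elts (hsnd z))" for z
  have dmx: "dft t \<Longrightarrow> dft (\<lambda>e. mx (t e))" for t unfolding mx_def by (intro dfn_intros)
  have emx: "elts (mx z) = elts (hfst z) \<union> elts (hsnd z)" for z by (simp add: mx_def)
  define lt where "lt y x \<longleftrightarrow> mx y \<in> elts (mx x) \<or> (mx y = mx x \<and> (hfst y \<in> elts (hfst x) \<or> (hfst y = hfst x \<and> hsnd y \<in> elts (hsnd x))))" for y x
  define pre where "pre x = mk {y \<in> elts A. x \<in> elts A \<and> lt y x}" for x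
  have epre: "elts (pre x) = {y \<in> elts A. x \<in> elts A \<and> lt y x}" for x by (simp add: pre_def)
  have dpre: "dft (\<lambda>e. pre (e 0))" unfolding pre_def lt_def by (intro dfn_intros dmx A)
  have "wf (inv_image ({(x, y). x \<in> elts y} <*lex*> {(x, y). x \<in> elts y} <*lex*> {(x, y). x \<in> elts y}) (\<lambda>z. (mx z, hfst z, hsnd z)))"
    by (intro wf_inv_image wf_lex_prod wf_elts)
  then have wf: "wf {(y, x). y \<in> elts (pre x)}"
    by (rule wf_subset) (auto simp: epre lt_def)
  \<comment> \<open>The collapse of this ordering: a pair goes to the set of values of its
    predecessors, which is an ordinal by transitivity of the ordering.\<close>
  define F where "F = hrec pre (\<lambda>x f. mk ((\<lambda>y. ap f y) ` elts (pre x)))"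
  have F: "elts (F x) = F ` elts (pre x)" for x unfolding F_def by (subst hrec_unfold[OF wf]) simp
  note dpre' = dft1[of pre, OF dpre]
  have dF: "dft (\<lambda>e. F (e 0))" unfolding F_def
    by (rule dft_hrec[OF dpre _ wf]) (intro dfn_intros dpre')+
  have Ao: "ordinal (hfst z)" "ordinal (hsnd z)" "hfst z \<in> elts \<nu>" "hsnd z \<in> elts \<nu>" "z = hpair (hfst z) (hsnd z)" if "z \<in> elts A" for z
    using that ordinal_elem[OF c'(2)] unfolding A_def by auto
  have mxc: "mx z = hfst z \<or> mx z = hsnd z" if z: "z \<in> elts A" for z
  proof -
    have "elts (hfst z) \<subseteq> elts (hsnd z) \<or> elts (hsnd z) \<subseteq> elts (hfst z)"
      using ordinal_linear[OF Ao(1,2)[OF z]] ordinal_sub[OF _ Ao(1)[OF z]] ordinal_sub[OF _ Ao(2)[OF z]] by auto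
    then show ?thesis using emx[of z] by (metis hc_eqI sup.absorb1 sup.absorb2)
  qed
  have mxo: "ordinal (mx z)" "mx z \<in> elts \<nu>" if z: "z \<in> elts A" for z
    using mxc[OF z] Ao[OF z] by auto
  have tr: "lt z x" if "lt z y" "lt y x" "x \<in> elts A" for x y z
    using that(1,2) ordinal_trans[OF _ _ mxo(1)[OF that(3)]] ordinal_trans[OF _ _ Ao(1)[OF that(3)]] ordinal_trans[OF _ _ Ao(2)[OF that(3)]]
    unfolding lt_def by metis
  have lin: "lt x y \<or> lt y x" if "x \<in> elts A" "y \<in> elts A" "x \<noteq> y" for x y
    using ordinal_linear[OF mxo(1)[OF that(1)] mxo(1)[OF that(2)]] ordinal_linear[OF Ao(1)[OF that(1)] Ao(1)[OF that(2)]]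
      ordinal_linear[OF Ao(2)[OF that(1)] Ao(2)[OF that(2)]] Ao(5)[OF that(1)] Ao(5)[OF that(2)] that(3) unfolding lt_def by metis
  have ord: "ordinal (F x)" for x
  proof (induction x rule: wf_induct_rule[OF wf])
    case (1 x)
    show ?case
    proof (rule ordinal_set)
      show "ordinal z" if "z \<in> elts (F x)" for z using that 1 unfolding F[of x] by auto
      fix z w assume "z \<in> elts (F x)" "w \<in> elts z"
      then obtain y where y: "y \<in> elts (pre x)" "w \<in> elts (F y)" unfolding F[of x] by auto
      then obtain u where u: "u \<in> elts (pre y)" "w = F u" unfolding F[of y] by auto
      then have "u \<in> elts (pre x)" using y tr[of u y x] unfolding epre by blast
      then show "w \<in> elts (F x)" using u unfolding F[of x] by auto
    qed
  qed
  have less: "F y \<in> elts (F x)" if "x \<in> elts A" "y \<in> elts A" "lt y x" for x y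
    using that unfolding F[of x] epre by blast
  show ?thesis unfolding A_def[symmetric]
  proof (rule lepI[OF A dF])
    fix x assume x: "x \<in> elts A"
    have xM: "x \<in> M" using M_trans[OF x A] .
    have pM: "pre x \<in> M" by (rule dft1_M[OF dpre xM])
    \<comment> \<open>The successor is taken because a predecessor may have the same maximum as
      \<open>x\<close>, and a coordinate may equal that maximum.\<close>
    let ?\<gamma> = "hsucc (mx x)"
    have \<gamma>: "?\<gamma> \<in> elts \<nu>" by (rule infinite_cardinal_limit[OF \<nu> mxo(2)[OF x]])
    have \<gamma>M: "?\<gamma> \<in> M" using M_trans[OF \<gamma> c'(1)] .
    have "elts (pre x) \<subseteq> elts (hprod ?\<gamma> ?\<gamma>)"
    proof
      fix y assume y: "y \<in> elts (pre x)"
      then have yA: "y \<in> elts A" and "mx y \<in> elts (mx x) \<or> mx y = mx x" unfolding epre lt_def by auto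
      then have "mx y \<in> elts ?\<gamma>" by auto
      moreover have "hfst y \<in> elts (mx y) \<or> hfst y = mx y" "hsnd y \<in> elts (mx y) \<or> hsnd y = mx y"
        using ordinal_subset_iff[OF Ao(1)[OF yA] mxo(1)[OF yA]] ordinal_subset_iff[OF Ao(2)[OF yA] mxo(1)[OF yA]] emx[of y] by auto
      moreover have "ordinal ?\<gamma>" using ordinal_hsucc[OF mxo(1)[OF x]] .
      ultimately have "hfst y \<in> elts ?\<gamma>" "hsnd y \<in> elts ?\<gamma>" using ordinal_trans by metis+
      then show "y \<in> elts (hprod ?\<gamma> ?\<gamma>)" using Ao(5)[OF yA] by (simp del: elts_hsucc) metis
    qed
    then have "lss (pre x) \<nu>" by (intro lss_lep_trans[OF pM lep_subset[OF pM] sq[OF \<gamma>]])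
    moreover have FM: "F x \<in> M" by (rule dft1_M[OF dF xM])
    moreover have "lep (F x) (pre x)" by (rule lep_surj[OF pM FM dF]) (simp add: F[of x])
    ultimately have "lss (F x) \<nu>" using lss_lep_trans by blast
    then show "F x \<in> elts \<nu>" by (rule lss_ordinal[OF c ord FM])
  next
    fix x y assume xy: "x \<in> elts A" "y \<in> elts A" "F x = F y"
    then show "x = y" using lin[of x y] less[of x y] less[of y x] by auto
  qed
qed

text \<open>Induction on \<nu>: an infinite \<gamma> below \<nu> has the cardinality of a smaller
  infinite cardinal, whose square is already under control, and finite squares are finite.\<close>

lemma lep_square: "infinite_cardinal M \<nu> \<Longrightarrow> lep (hprod \<nu> \<nu>) \<nu>"
proof (induction \<nu> rule: hc_induct)
  case (step \<nu>)
  note \<nu> = step.prems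
  note c = infinite_cardinalD(1)[OF \<nu>] note c' = cardinalD[OF c]
  show ?case
  proof (rule goedel_pairing[OF \<nu>])
    fix \<gamma> assume g: "\<gamma> \<in> elts \<nu>"
    have gM: "\<gamma> \<in> M" and go: "ordinal \<gamma>" using M_trans[OF g c'(1)] ordinal_elem[OF c'(2) g] by auto
    show "lss (hprod \<gamma> \<gamma>) \<nu>"
    proof (cases "finite (elts \<gamma>)")
      case True
      have "elts (hprod \<gamma> \<gamma>) = (\<lambda>(a, b). hpair a b) ` (elts \<gamma> \<times> elts \<gamma>)" by auto
      then show ?thesis using True gM by (intro lss_finite[OF \<nu>]) auto
    next
      case False
      let ?c = "card_in M \<gamma>"
      have cM: "?c \<in> M" using card_in_M[OF gM] .
      have ceq: "lep \<gamma> ?c" "lep ?c \<gamma>" using lep_card[OF gM] by auto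
      have "infinite (elts ?c)" using lep_finite[OF ceq(1)] False by blast
      then have ic: "infinite_cardinal M ?c" unfolding infinite_cardinal_def using cardinal_card[OF gM] by blast
      have cn: "?c \<in> elts \<nu>" using lss_iff_card[OF c gM] lssI[OF g lep_refl[OF gM]] by blast
      have "lep (hprod \<gamma> \<gamma>) (hprod ?c ?c)" by (rule lep_prod_mono[OF gM gM ceq(1) ceq(1)])
      moreover have "lep (hprod ?c ?c) ?c" by (rule step.IH[OF cn ic])
      ultimately have "lep (hprod \<gamma> \<gamma>) ?c" using lep_trans gM by (meson hprod_in_M)
      then show ?thesis by (rule lssI[OF cn])
    qed
  qed
qed

lemma lss_prod:
  assumes \<nu>: "infinite_cardinal M \<nu>" and "A \<in> M" "B \<in> M" "lss A \<nu>" "lss B \<nu>" shows "lss (hprod A B) \<nu>"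
proof -
  note c = infinite_cardinalD(1)[OF \<nu>] note c' = cardinalD[OF c]
  obtain \<alpha> \<beta> where ab: "\<alpha> \<in> elts \<nu>" "lep A \<alpha>" "\<beta> \<in> elts \<nu>" "lep B \<beta>" using assms unfolding lss_def by blast
  have o: "ordinal \<alpha>" "ordinal \<beta>" using ab ordinal_elem[OF c'(2)] by auto
  obtain \<gamma> where g: "\<gamma> \<in> elts \<nu>" "elts \<alpha> \<subseteq> elts \<gamma>" "elts \<beta> \<subseteq> elts \<gamma>"
    using ordinal_linear[OF o] ordinal_sub[OF _ o(1)] ordinal_sub[OF _ o(2)] ab by blast
  have gM: "\<gamma> \<in> M" using M_trans[OF g(1) c'(1)] .
  have A: "lep A \<gamma>" "lep B \<gamma>" using lep_mono_r[OF assms(2) ab(2) g(2)] lep_mono_r[OF assms(3) ab(4) g(3)] by auto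
  have "lss (hprod \<gamma> \<gamma>) \<nu>"
  proof (cases "finite (elts \<gamma>)")
    case True
    have "elts (hprod \<gamma> \<gamma>) = (\<lambda>(a, b). hpair a b) ` (elts \<gamma> \<times> elts \<gamma>)" by auto
    then show ?thesis using True gM by (intro lss_finite[OF \<nu>]) auto
  next
    case False
    let ?c = "card_in M \<gamma>"
    have ceq: "lep \<gamma> ?c" using lep_card[OF gM] by auto
    have "infinite (elts ?c)" using lep_finite[OF ceq] False by blast
    then have ic: "infinite_cardinal M ?c" unfolding infinite_cardinal_def using cardinal_card[OF gM] by blast
    have cn: "?c \<in> elts \<nu>" using lss_iff_card[OF c gM] lssI[OF g(1) lep_refl[OF gM]] by blast
    have "lep (hprod \<gamma> \<gamma>) ?c"
      by (rule lep_trans[OF _ lep_prod_mono[OF gM gM ceq ceq] lep_square[OF ic]]) (use gM in simp)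
    then show ?thesis by (rule lssI[OF cn])
  qed
  then show ?thesis using lss_lep_trans[OF _ lep_prod_mono[OF assms(2,3) A]] assms(2,3) by simp
qed

lemma lep_UN:
  assumes \<nu>: "infinite_cardinal M \<nu>" and "A \<in> M" "dft (\<lambda>e. F (e 0))" "lep A \<nu>" "\<And>x. x \<in> elts A \<Longrightarrow> lep (F x) \<nu>"
  shows "lep (mk (\<Union>x\<in>elts A. elts (F x))) \<nu>"
proof -
  have n: "\<nu> \<in> M" using cardinalD[OF infinite_cardinalD(1)[OF \<nu>]] by blast
  show ?thesis by (rule lep_trans[OF UN_in_M[OF assms(2,3)] lep_UN_prod[OF assms(2) n n assms(3-5)] lep_square[OF \<nu>]])
qed

text \<open>The common bound \<gamma> on the members plays the part of regularity: the union injects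
  into the product of \<open>A\<close> and \<gamma>, and both factors are smaller than
  \<nu>.\<close>

lemma lss_UN_bound:
  assumes \<nu>: "infinite_cardinal M \<nu>" and "A \<in> M" "dft (\<lambda>e. F (e 0))" "lss A \<nu>" "\<gamma> \<in> elts \<nu>" "\<And>x. x \<in> elts A \<Longrightarrow> lep (F x) \<gamma>"
  shows "lss (mk (\<Union>x\<in>elts A. elts (F x))) \<nu>"
proof -
  have n: "\<nu> \<in> M" using cardinalD[OF infinite_cardinalD(1)[OF \<nu>]] by blast
  have g: "\<gamma> \<in> M" using M_trans[OF assms(5) n] .
  show ?thesis
    by (rule lss_lep_trans[OF UN_in_M[OF assms(2,3)] lep_UN_prod[OF assms(2) assms(2) g assms(3) lep_refl[OF assms(2)] assms(6)]])
      (auto intro: lss_prod[OF \<nu> assms(2) g assms(4) lssI[OF assms(5) lep_refl[OF g]]])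
qed

lemma lss_cup:
  assumes \<nu>: "infinite_cardinal M \<nu>" and "A \<in> M" "B \<in> M" "lss A \<nu>" "lss B \<nu>" shows "lss (mk (elts A \<union> elts B)) \<nu>"
proof -
  note c = infinite_cardinalD(1)[OF \<nu>] note c' = cardinalD[OF c]
  obtain \<alpha> \<beta> where ab: "\<alpha> \<in> elts \<nu>" "lep A \<alpha>" "\<beta> \<in> elts \<nu>" "lep B \<beta>" using assms unfolding lss_def by blast
  have o: "ordinal \<alpha>" "ordinal \<beta>" using ab ordinal_elem[OF c'(2)] by auto
  obtain \<gamma> where g: "\<gamma> \<in> elts \<nu>" "elts \<alpha> \<subseteq> elts \<gamma>" "elts \<beta> \<subseteq> elts \<gamma>"
    using ordinal_linear[OF o] ordinal_sub[OF _ o(1)] ordinal_sub[OF _ o(2)] ab by blast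
  have "lss (mk (\<Union>x\<in>elts (mk {A, B}). elts x)) \<nu>"
    by (rule lss_UN_bound[OF \<nu> _ _ lss_finite[OF \<nu>] g(1), of _ "\<lambda>x. x"])
      (use assms lep_mono_r[OF assms(2) ab(2) g(2)] lep_mono_r[OF assms(3) ab(4) g(3)] in \<open>auto intro: dft_var\<close>)
  then show ?thesis by simp
qed

section \<open>Function spaces, cofinality, and the theorems of Cantor and Koenig\<close>

definition FunM :: "hc \<Rightarrow> hc \<Rightarrow> hc" where
  "FunM A B = mk {f \<in> elts (PowM (hprod A B)). \<forall>a\<in>elts A. \<exists>b\<in>elts B. hpair a b \<in> elts f \<and> (\<forall>c\<in>elts B. hpair a c \<in> elts f \<longrightarrow> c = b)}"

lemma elts_FunM [simp]: "elts (FunM A B) = {f \<in> M. is_fun f A B}"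
proof -
  have "f \<in> elts (FunM A B) \<longleftrightarrow> f \<in> M \<and> is_fun f A B" for f
  proof -
    have "(\<forall>z\<in>elts f. \<exists>a\<in>elts A. \<exists>b\<in>elts B. z = hpair a b) \<longleftrightarrow> elts f \<subseteq> elts (hprod A B)" by auto
    moreover have "(\<forall>a\<in>elts A. \<exists>!b. hpair a b \<in> elts f) \<longleftrightarrow> (\<forall>a\<in>elts A. \<exists>b\<in>elts B. hpair a b \<in> elts f \<and> (\<forall>c\<in>elts B. hpair a c \<in> elts f \<longrightarrow> c = b))"
      if "elts f \<subseteq> elts (hprod A B)"
    proof -
      have "b \<in> elts B" if "hpair a b \<in> elts f" for a b using that \<open>elts f \<subseteq> elts (hprod A B)\<close> by auto
      then show ?thesis by (intro ball_cong refl) metis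
    qed
    ultimately show ?thesis unfolding FunM_def is_fun_def by (auto simp del: elts_hprod)
  qed
  then show ?thesis by blast
qed

lemma dft_FunM [dfn_intros]: "dft t \<Longrightarrow> dft s \<Longrightarrow> dft (\<lambda>e. FunM (t e) (s e))"
  unfolding FunM_def
  by (rule dft2[of "\<lambda>A B. mk {f \<in> elts (PowM (hprod A B)). \<forall>a\<in>elts A. \<exists>b\<in>elts B. hpair a b \<in> elts f \<and> (\<forall>c\<in>elts B. hpair a c \<in> elts f \<longrightarrow> c = b)}"])
    (intro dfn_intros)

lemma FunM_in_M [simp]: "A \<in> M \<Longrightarrow> B \<in> M \<Longrightarrow> FunM A B \<in> M"
  by (rule dft_constD, rule dft_FunM) (auto intro: dft_const)

lemma cexp_eq: "cexp M \<kappa> \<nu> = card_in M (FunM \<nu> \<kappa>)"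
proof -
  have "mk {f \<in> M. is_fun f \<nu> \<kappa>} = FunM \<nu> \<kappa>" by (rule hc_eqI) simp
  then show ?thesis unfolding cexp_def by simp
qed

lemma is_fun_ext: "is_fun f A B \<Longrightarrow> is_fun g A B' \<Longrightarrow> (\<And>a. a \<in> elts A \<Longrightarrow> ap f a = ap g a) \<Longrightarrow> f = g"
  using is_fun_eq_lam[of f A B] is_fun_eq_lam[of g A B'] lam_cong[of A A "ap f" "ap g"] by simp

text \<open>Only the behaviour of \<open>f\<close> on \<delta> matters here, by way of
  \<open>ap\<close>, so a witness in the ground model is at once a witness in the extension;
  \<open>cofin_iff\<close> gives the link to the official notion.\<close>

definition cofin :: "hc \<Rightarrow> hc \<Rightarrow> bool" where
  "cofin \<delta> \<alpha> \<longleftrightarrow> (\<exists>f\<in>M. (\<forall>\<xi>\<in>elts \<delta>. ap f \<xi> \<in> elts \<alpha>) \<and> (\<forall>\<beta>\<in>elts \<alpha>. \<exists>\<xi>\<in>elts \<delta>. elts \<beta> \<subseteq> elts (ap f \<xi>)))"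

lemma cofin_iff: assumes "\<delta> \<in> M"
  shows "(\<exists>f\<in>M. is_fun f \<delta> \<alpha> \<and> (\<forall>\<beta>\<in>elts \<alpha>. \<exists>\<xi>\<in>elts \<delta>. elts \<beta> \<subseteq> elts (app f \<xi>))) \<longleftrightarrow> cofin \<delta> \<alpha>"
proof
  assume "\<exists>f\<in>M. is_fun f \<delta> \<alpha> \<and> (\<forall>\<beta>\<in>elts \<alpha>. \<exists>\<xi>\<in>elts \<delta>. elts \<beta> \<subseteq> elts (app f \<xi>))"
  then obtain f where f: "f \<in> M" "is_fun f \<delta> \<alpha>" "\<forall>\<beta>\<in>elts \<alpha>. \<exists>\<xi>\<in>elts \<delta>. elts \<beta> \<subseteq> elts (app f \<xi>)" by blast
  have "app f \<xi> = ap f \<xi>" "ap f \<xi> \<in> elts \<alpha>" if "\<xi> \<in> elts \<delta>" for \<xi> using is_fun_ap(1,2)[OF f(2) that] by auto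
  then show "cofin \<delta> \<alpha>" unfolding cofin_def using f(1,3) by (intro bexI[of _ f]) auto
next
  assume "cofin \<delta> \<alpha>"
  then obtain f where f: "f \<in> M" "\<forall>\<xi>\<in>elts \<delta>. ap f \<xi> \<in> elts \<alpha>" "\<forall>\<beta>\<in>elts \<alpha>. \<exists>\<xi>\<in>elts \<delta>. elts \<beta> \<subseteq> elts (ap f \<xi>)"
    unfolding cofin_def by blast
  let ?g = "lam \<delta> (\<lambda>x. ap f x)"
  have "?g \<in> M" by (rule lam_in_M[OF assms]) (intro dfn_intros f)
  moreover have fn: "is_fun ?g \<delta> \<alpha>" by (rule is_fun_lam) (use f(2) in blast)
  moreover have "app ?g \<xi> = ap f \<xi>" if "\<xi> \<in> elts \<delta>" for \<xi> using is_fun_ap(1)[OF fn that] that by simp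
  ultimately show "\<exists>f\<in>M. is_fun f \<delta> \<alpha> \<and> (\<forall>\<beta>\<in>elts \<alpha>. \<exists>\<xi>\<in>elts \<delta>. elts \<beta> \<subseteq> elts (app f \<xi>))"
    using f(3) by (intro bexI[of _ ?g]) auto
qed

lemma cof_eq: "cof M \<alpha> = least_ord (\<lambda>\<delta>. \<delta> \<in> M \<and> cofin \<delta> \<alpha>)"
proof -
  have "(\<lambda>\<delta>. \<delta> \<in> M \<and> (\<exists>f\<in>M. is_fun f \<delta> \<alpha> \<and> (\<forall>\<beta>\<in>elts \<alpha>. \<exists>\<xi>\<in>elts \<delta>. elts \<beta> \<subseteq> elts (app f \<xi>)))) = (\<lambda>\<delta>. \<delta> \<in> M \<and> cofin \<delta> \<alpha>)"
    by (rule ext) (simp cong: conj_cong add: cofin_iff)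
  then show ?thesis unfolding cof_def by simp
qed

lemma cof:
  assumes \<alpha>: "\<alpha> \<in> M" "ordinal \<alpha>"
  shows cof_ordinal: "ordinal (cof M \<alpha>)" and cof_in_M: "cof M \<alpha> \<in> M" and cof_cofin: "cofin (cof M \<alpha>) \<alpha>"
    and cof_least: "\<And>\<delta>. \<delta> \<in> M \<Longrightarrow> ordinal \<delta> \<Longrightarrow> cofin \<delta> \<alpha> \<Longrightarrow> elts (cof M \<alpha>) \<subseteq> elts \<delta>"
    and cof_subset: "elts (cof M \<alpha>) \<subseteq> elts \<alpha>"
proof -
  have "cofin \<alpha> \<alpha>" unfolding cofin_def
  proof (intro bexI conjI)
    show "lam \<alpha> (\<lambda>x. x) \<in> M" by (rule lam_in_M[OF \<alpha>(1)]) (intro dfn_intros)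
  qed auto
  then have id: "\<alpha> \<in> M \<and> cofin \<alpha> \<alpha>" using \<alpha> by blast
  note l = least_ord[of \<alpha> "\<lambda>\<delta>. \<delta> \<in> M \<and> cofin \<delta> \<alpha>", OF \<alpha>(2) id, folded cof_eq]
  show "ordinal (cof M \<alpha>)" "cof M \<alpha> \<in> M" "cofin (cof M \<alpha>) \<alpha>" "elts (cof M \<alpha>) \<subseteq> elts \<alpha>" using l id \<alpha>(2) by auto
  show "\<And>\<delta>. \<delta> \<in> M \<Longrightarrow> ordinal \<delta> \<Longrightarrow> cofin \<delta> \<alpha> \<Longrightarrow> elts (cof M \<alpha>) \<subseteq> elts \<delta>" using l(3) by blast
qed

text \<open>An unbounded \<open>S\<close>, enumerated by an ordinal below the cofinality, would be a
  cofinal sequence that is too short.\<close>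

lemma cof_bounded:
  assumes \<alpha>: "\<alpha> \<in> M" "ordinal \<alpha>" and S: "S \<in> M" "elts S \<subseteq> elts \<alpha>" "lss S (cof M \<alpha>)"
  shows "\<exists>\<beta>\<in>elts \<alpha>. elts S \<subseteq> elts \<beta>"
proof (rule ccontr)
  assume no: "\<not> ?thesis"
  obtain \<delta> where \<delta>: "\<delta> \<in> elts (cof M \<alpha>)" "lep S \<delta>" using S(3) unfolding lss_def by blast
  have o: "ordinal \<delta>" "\<delta> \<in> M" using ordinal_elem[OF cof_ordinal[OF \<alpha>] \<delta>(1)] M_trans[OF \<delta>(1) cof_in_M[OF \<alpha>]] by auto
  obtain \<gamma> where \<gamma>: "\<gamma> \<in> M" "ordinal \<gamma>" "elts \<gamma> \<subseteq> elts \<delta>" "eqp \<gamma> S" using lep_ordinal_eqp[OF S(1) o \<delta>(2)] by blast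
  then obtain f where f: "f \<in> M" "bijf f \<gamma> S" unfolding eqp_def by blast
  have "cofin \<gamma> \<alpha>" unfolding cofin_def
  proof (intro bexI[OF _ f(1)] conjI ballI)
    show "ap f \<xi> \<in> elts \<alpha>" if "\<xi> \<in> elts \<gamma>" for \<xi> using f(2) that S(2) unfolding bijf_def injf_def by blast
    fix \<beta> assume \<beta>: "\<beta> \<in> elts \<alpha>"
    then obtain s where s: "s \<in> elts S" "s \<notin> elts \<beta>" using no by blast
    then have "elts \<beta> \<subseteq> elts s" using S(2) ordinal_not_subset[of \<beta> s] ordinal_elem[OF \<alpha>(2)] \<beta> by blast
    moreover obtain \<xi> where "\<xi> \<in> elts \<gamma>" "s = ap f \<xi>" using f(2) s(1) unfolding bijf_def by blast
    ultimately show "\<exists>\<xi>\<in>elts \<gamma>. elts \<beta> \<subseteq> elts (ap f \<xi>)" by blast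
  qed
  then have "elts (cof M \<alpha>) \<subseteq> elts \<gamma>" by (rule cof_least[OF \<alpha> \<gamma>(1,2)])
  then show False using \<delta>(1) \<gamma>(3) foundation_hc_irrefl[of \<delta>] by blast
qed

lemma regularD:
  assumes "regular_cardinal M \<nu>" shows "infinite_cardinal M \<nu>" "cardinal M \<nu>" "\<nu> \<in> M" "ordinal \<nu>" "cof M \<nu> = \<nu>"
  using assms infinite_cardinalD(1)[of \<nu>] cardinalD[of \<nu>] unfolding regular_cardinal_def by auto

text \<open>The cardinalities of the members form a small subset of \<nu>, so regularity gives them
  a common bound and \<open>lss_UN_bound\<close> applies.\<close>

lemma lss_UN:
  assumes \<nu>: "regular_cardinal M \<nu>" and A: "A \<in> M" "lss A \<nu>" and F: "dft (\<lambda>e. F (e 0))" "\<And>x. x \<in> elts A \<Longrightarrow> lss (F x) \<nu>"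
  shows "lss (mk (\<Union>x\<in>elts A. elts (F x))) \<nu>"
proof -
  note r = regularD[OF \<nu>]
  note F' = dft1[of F, OF F(1)]
  have FM: "F x \<in> M" if "x \<in> elts A" for x using dft1_M[OF F(1) M_trans[OF that A(1)]] .
  let ?G = "\<lambda>x. card_in M (F x)"
  have dG: "dft (\<lambda>e. ?G (e 0))" by (intro dfn_intros F')
  let ?S = "mk (?G ` elts A)"
  have S: "?S \<in> M" by (rule repl_in_M[OF A(1) dG])
  have Sn: "elts ?S \<subseteq> elts \<nu>" using F(2) FM lss_iff_card[OF r(2)] by auto
  have "lep ?S A" by (rule lep_surj[OF A(1) S dG]) simp
  then have "lss ?S (cof M \<nu>)" unfolding r(5) by (rule lss_lep_trans[OF S _ A(2)])
  from cof_bounded[OF r(3,4) S Sn this] obtain \<beta> where \<beta>: "\<beta> \<in> elts \<nu>" "elts ?S \<subseteq> elts \<beta>" by blast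
  have \<beta>o: "ordinal \<beta>" "\<beta> \<in> M" using ordinal_elem[OF r(4) \<beta>(1)] M_trans[OF \<beta>(1) r(3)] by auto
  show ?thesis
  proof (rule lss_UN_bound[OF r(1) A(1) F(1) A(2) \<beta>(1)])
    fix x assume x: "x \<in> elts A"
    then have "?G x \<in> elts \<beta>" using \<beta>(2) by auto
    then have "elts (?G x) \<subseteq> elts \<beta>" using ordinal_sub[OF _ \<beta>o(1)] by blast
    then show "lep (F x) \<beta>" using lep_mono_r[OF FM[OF x] lep_card(1)[OF FM[OF x]]] by blast
  qed
qed

lemma cantor: assumes c: "c \<in> M" shows "\<not> lep (PowM c) c"
proof
  assume "lep (PowM c) c"
  then obtain f where f: "f \<in> M" "injf f (PowM c) c" unfolding lep_def by blast
  define D where "D = mk {x \<in> elts c. \<exists>y\<in>elts (PowM c). ap f y = x \<and> x \<notin> elts y}"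
  have D: "D \<in> M" unfolding D_def by (rule sep_in_M[OF c]) (intro dfn_intros f c)
  have eD: "x \<in> elts D \<longleftrightarrow> x \<in> elts c \<and> (\<exists>y\<in>elts (PowM c). ap f y = x \<and> x \<notin> elts y)" for x
    unfolding D_def by (simp del: elts_PowM)
  have DP: "D \<in> elts (PowM c)" using D eD by auto
  then have fc: "ap f D \<in> elts c" using f(2) unfolding injf_def by blast
  have inj: "y = D" if "y \<in> elts (PowM c)" "ap f y = ap f D" for y using f(2) that DP unfolding injf_def by blast
  show False
  proof (cases "ap f D \<in> elts D")
    case True
    then show False using eD[of "ap f D"] inj by blast
  next
    case False
    then show False using eD[of "ap f D"] fc DP by blast
  qed
qed

text \<open>The witness is the successor cardinal of \<open>c\<close>, obtained as the least ordinal
  without an injection into \<open>c\<close>; it lies below \<mu> because the power set of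
  \<open>c\<close> is smaller than \<mu>. A shorter cofinal sequence would cover it by at most
  \<open>c\<close> sets of size at most \<open>c\<close>. Such regular cardinals unbounded below
  \<mu> are what later keeps \<mu> a cardinal.\<close>

lemma successor_regular:
  assumes c: "infinite_cardinal M c" and \<mu>: "cardinal M \<mu>" "lss (PowM c) \<mu>"
  shows "\<exists>\<nu>\<in>elts \<mu>. cof M \<nu> = \<nu> \<and> c \<in> elts \<nu>"
proof -
  note cc = cardinalD[OF infinite_cardinalD(1)[OF c]] and mm = cardinalD[OF \<mu>(1)]
  let ?p = "card_in M (PowM c)"
  have P: "PowM c \<in> M" using cc by simp
  have p: "?p \<in> M" "ordinal ?p" "?p \<in> elts \<mu>" using card_in_M[OF P] ordinal_card[OF P] lss_iff_card[OF \<mu>(1) P] \<mu>(2) by auto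
  have np: "\<not> lep ?p c" using cantor[OF cc(1)] lep_trans[OF P lep_card(1)[OF P]] by blast
  obtain \<nu> where \<nu>: "ordinal \<nu>" "\<nu> \<in> M \<and> \<not> lep \<nu> c" "\<And>\<gamma>. ordinal \<gamma> \<Longrightarrow> \<gamma> \<in> M \<and> \<not> lep \<gamma> c \<Longrightarrow> elts \<nu> \<subseteq> elts \<gamma>"
    using ordinal_least[of ?p "\<lambda>\<nu>. \<nu> \<in> M \<and> \<not> lep \<nu> c"] p np by metis
  have nM: "\<nu> \<in> M" using \<nu> by blast
  have n\<mu>: "\<nu> \<in> elts \<mu>"
    using \<nu>(3)[OF p(2)] p np ordinal_subset_iff[OF \<nu>(1) p(2)] ordinal_trans[OF _ p(3) mm(2)] by metis
  have below: "lep \<gamma> c" if "\<gamma> \<in> elts \<nu>" for \<gamma>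
    using \<nu>(3)[OF ordinal_elem[OF \<nu>(1) that]] M_trans[OF that nM] that foundation_hc_irrefl[of \<gamma>] by blast
  have cn: "c \<in> elts \<nu>"
    using ordinal_not_subset[OF \<nu>(1) cc(2)] lep_subset[OF nM] \<nu>(2) by blast
  have "cof M \<nu> = \<nu>"
  proof (rule ccontr)
    assume ne: "cof M \<nu> \<noteq> \<nu>"
    let ?d = "cof M \<nu>"
    note co = cof[OF nM \<nu>(1)]
    have "?d \<in> elts \<nu>" using ordinal_subset_iff[OF co(1) \<nu>(1)] co(5) ne by blast
    then have dc: "lep ?d c" by (rule below)
    obtain f where f: "f \<in> M" "\<And>\<xi>. \<xi> \<in> elts ?d \<Longrightarrow> ap f \<xi> \<in> elts \<nu>" "\<And>\<beta>. \<beta> \<in> elts \<nu> \<Longrightarrow> \<exists>\<xi>\<in>elts ?d. elts \<beta> \<subseteq> elts (ap f \<xi>)"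
      using co(3) unfolding cofin_def by blast
    let ?F = "\<lambda>\<xi>. hsucc (ap f \<xi>)"
    have dF: "dft (\<lambda>e. ?F (e 0))" by (intro dfn_intros f)
    have Fc: "lep (?F \<xi>) c" if x: "\<xi> \<in> elts ?d" for \<xi>
    proof (rule below)
      have nl: "ap f \<xi> \<in> elts \<nu>" using f(2)[OF x] .
      have "hsucc (ap f \<xi>) \<noteq> \<nu>"
      proof
        assume e: "hsucc (ap f \<xi>) = \<nu>"
        have fo: "ordinal (ap f \<xi>)" "ap f \<xi> \<in> M" using ordinal_elem[OF \<nu>(1) nl] M_trans[OF nl nM] by auto
        have "infinite (elts (ap f \<xi>))"
        proof
          assume "finite (elts (ap f \<xi>))"
          then have "finite (elts \<nu>)" unfolding e[symmetric] by simp
          then show False using infinite_cardinalD(2)[OF c] ordinal_sub[OF cn \<nu>(1)] finite_subset by blast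
        qed
        then have "lep \<nu> (ap f \<xi>)" using lep_hsucc_infinite[OF fo] e by simp
        then show False using lep_trans[OF nM _ below[OF nl]] \<nu>(2) by blast
      qed
      then show "?F \<xi> \<in> elts \<nu>" using ordinal_hsucc_le[OF \<nu>(1) nl] by blast
    qed
    have U: "lep (mk (\<Union>\<xi>\<in>elts ?d. elts (?F \<xi>))) c" by (rule lep_UN[OF c co(2) dF dc Fc])
    have "elts \<nu> \<subseteq> elts (mk (\<Union>\<xi>\<in>elts ?d. elts (?F \<xi>)))"
    proof
      fix \<beta> assume b: "\<beta> \<in> elts \<nu>"
      then obtain \<xi> where x: "\<xi> \<in> elts ?d" "elts \<beta> \<subseteq> elts (ap f \<xi>)" using f(3) by blast
      then have "\<beta> \<in> elts (ap f \<xi>) \<or> \<beta> = ap f \<xi>" using ordinal_subset_iff[OF ordinal_elem[OF \<nu>(1) b] ordinal_elem[OF \<nu>(1) f(2)[OF x(1)]]] by blast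
      then show "\<beta> \<in> elts (mk (\<Union>\<xi>\<in>elts ?d. elts (?F \<xi>)))" using x(1) by auto
    qed
    then have "lep \<nu> c" using lep_trans[OF nM lep_subset[OF nM] U] by blast
    then show False using \<nu>(2) by blast
  qed
  then show ?thesis using n\<mu> cn by blast
qed

lemma koenig:
  assumes \<mu>: "infinite_cardinal M \<mu>" and \<delta>: "\<delta> \<in> M" "cofin \<delta> \<mu>"
  shows "\<not> lep (FunM \<delta> \<mu>) \<mu>"
proof
  note m = infinite_cardinalD(1)[OF \<mu>] note mm = cardinalD[OF m]
  assume "lep (FunM \<delta> \<mu>) \<mu>"
  then obtain f where f: "f \<in> M" "injf f (FunM \<delta> \<mu>) \<mu>" unfolding lep_def by blast
  obtain c where c: "c \<in> M" "\<And>\<xi>. \<xi> \<in> elts \<delta> \<Longrightarrow> ap c \<xi> \<in> elts \<mu>" "\<And>\<beta>. \<beta> \<in> elts \<mu> \<Longrightarrow> \<exists>\<xi>\<in>elts \<delta>. elts \<beta> \<subseteq> elts (ap c \<xi>)"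
    using \<delta>(2) unfolding cofin_def by blast
  \<comment> \<open>If \<open>f\<close> indexes all functions by elements of \<mu>, then
    \<open>T\<close> \<xi> collects the values at \<xi> of those with index below
    \<open>ap c\<close> \<xi>. These are fewer than \<mu>, so a function can avoid \<open>T\<close>
    \<xi> at every \<xi>, yet it must itself have an index below some \<open>ap c\<close>
    \<xi>.\<close>
  define T where "T \<xi> = mk {\<beta> \<in> elts \<mu>. \<exists>h\<in>elts (FunM \<delta> \<mu>). ap f h \<in> elts (ap c \<xi>) \<and> ap h \<xi> = \<beta>}" for \<xi>
  have eT: "\<beta> \<in> elts (T \<xi>) \<longleftrightarrow> \<beta> \<in> elts \<mu> \<and> (\<exists>h\<in>elts (FunM \<delta> \<mu>). ap f h \<in> elts (ap c \<xi>) \<and> ap h \<xi> = \<beta>)" for \<beta> \<xi>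
    unfolding T_def by (simp del: elts_FunM)
  have dT: "dft (\<lambda>e. T (e 0))" unfolding T_def by (intro dfn_intros f c mm \<delta>)
  note dT' = dft1[of T, OF dT]
  have "\<exists>H\<in>M. \<forall>\<xi>\<in>elts \<delta>. ap H \<xi> \<in> elts \<mu> \<and> ap H \<xi> \<notin> elts (T \<xi>)"
  proof (rule AC[OF \<delta>(1), of "\<lambda>\<xi> \<beta>. \<beta> \<in> elts \<mu> \<and> \<beta> \<notin> elts (T \<xi>)"])
    show "dfn (\<lambda>e. e 1 \<in> elts \<mu> \<and> e 1 \<notin> elts (T (e 0)))" by (intro dfn_intros dT' mm)
    fix \<xi> assume x: "\<xi> \<in> elts \<delta>"
    have xM: "\<xi> \<in> M" using M_trans[OF x \<delta>(1)] .
    have cM: "ap c \<xi> \<in> M" using M_trans[OF c(2)[OF x] mm(1)] .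
    have TM: "T \<xi> \<in> M" by (rule dft1_M[OF dT xM])
    let ?F = "\<lambda>\<eta>. ap (theM (\<lambda>h. h \<in> elts (FunM \<delta> \<mu>) \<and> ap f h = \<eta>)) \<xi>"
    have "lep (T \<xi>) (ap c \<xi>)"
    proof (rule lep_surj[OF cM TM, of ?F])
      show "dft (\<lambda>e. ?F (e 0))" by (intro dfn_intros f mm \<delta> xM)
      show "elts (T \<xi>) \<subseteq> ?F ` elts (ap c \<xi>)"
      proof
        fix \<beta> assume "\<beta> \<in> elts (T \<xi>)"
        then obtain h where h: "h \<in> elts (FunM \<delta> \<mu>)" "ap f h \<in> elts (ap c \<xi>)" "ap h \<xi> = \<beta>" unfolding eT by blast
        have "theM (\<lambda>h'. h' \<in> elts (FunM \<delta> \<mu>) \<and> ap f h' = ap f h) = h"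
        proof (rule theM_eq)
          show "h \<in> M" using h(1) by simp
          show "y = h" if "y \<in> elts (FunM \<delta> \<mu>) \<and> ap f y = ap f h" for y using f(2) h(1) that unfolding injf_def by blast
        qed (use h(1) in blast)
        then show "\<beta> \<in> ?F ` elts (ap c \<xi>)" using h(2,3) by (intro image_eqI[of _ _ "ap f h"]) simp_all
      qed
    qed
    then have "lss (T \<xi>) \<mu>" by (rule lssI[OF c(2)[OF x]])
    then have "\<not> elts \<mu> \<subseteq> elts (T \<xi>)" using not_lss[OF m TM] lep_subset[OF mm(1)] by blast
    then show "\<exists>y\<in>M. y \<in> elts \<mu> \<and> y \<notin> elts (T \<xi>)" using M_sub[OF mm(1)] by blast
  qed
  then obtain H where H: "H \<in> M" "\<And>\<xi>. \<xi> \<in> elts \<delta> \<Longrightarrow> ap H \<xi> \<in> elts \<mu> \<and> ap H \<xi> \<notin> elts (T \<xi>)" by blast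
  let ?h = "lam \<delta> (\<lambda>x. ap H x)"
  have hM: "?h \<in> M" by (rule lam_in_M[OF \<delta>(1)]) (intro dfn_intros H)
  have hF: "?h \<in> elts (FunM \<delta> \<mu>)" using hM H(2) by (simp add: is_fun_lam)
  then have "ap f ?h \<in> elts \<mu>" using f(2) unfolding injf_def by blast
  \<comment> \<open>Cofinality only gives inclusion; applied to the successor it puts the index
    itself strictly below \<open>ap c\<close> \<xi>.\<close>
  then have "hsucc (ap f ?h) \<in> elts \<mu>" by (rule infinite_cardinal_limit[OF \<mu>])
  then obtain \<xi> where x: "\<xi> \<in> elts \<delta>" "elts (hsucc (ap f ?h)) \<subseteq> elts (ap c \<xi>)" using c(3) by blast
  then have "ap f ?h \<in> elts (ap c \<xi>)" by simp
  then have "ap ?h \<xi> \<in> elts (T \<xi>)" unfolding eT using hF H(2)[OF x(1)] x(1) by auto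
  then show False using H(2)[OF x(1)] x(1) by simp
qed

lemma lep_Pow_Fun: assumes A: "A \<in> M" and B: "elts two \<subseteq> elts B" "B \<in> M" shows "lep (PowM A) (FunM A B)"
proof (rule lepI[of _ "\<lambda>x. lam A (\<lambda>a. if a \<in> elts x then mk {mk {}} else mk {})"])
  let ?F = "\<lambda>x. lam A (\<lambda>a. if a \<in> elts x then mk {mk {}} else mk {})"
  show d: "dft (\<lambda>e. ?F (e 0))" by (intro dfn_intros A empty_in_M)
  show "PowM A \<in> M" using A by simp
  have ne: "mk {mk {}} \<noteq> mk {}" by (simp add: mk_eq_iff)
  show "?F x \<in> elts (FunM A B)" if "x \<in> elts (PowM A)" for x
  proof -
    have "?F x \<in> M" by (rule dft1_M[of ?F, OF d]) (use that in simp)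
    moreover have "is_fun (?F x) A B" by (rule is_fun_lam) (use B in \<open>auto simp: two_def\<close>)
    ultimately show ?thesis by simp
  qed
  fix x y assume xy: "x \<in> elts (PowM A)" "y \<in> elts (PowM A)" "?F x = ?F y"
  have "a \<in> elts x \<longleftrightarrow> a \<in> elts y" if a: "a \<in> elts A" for a
  proof -
    have "ap (?F x) a = ap (?F y) a" using xy(3) by simp
    then show ?thesis using a ne by (auto split: if_splits)
  qed
  then show "x = y" using xy(1,2) by (intro hc_eqI) auto
qed

lemma lep_Fun_Pow: assumes A: "A \<in> M" shows "lep (FunM A two) (PowM A)"
proof (rule lepI[of _ "\<lambda>f. mk {a \<in> elts A. ap f a = mk {}}"])
  let ?F = "\<lambda>f. mk {a \<in> elts A. ap f a = mk {}}"
  show d: "dft (\<lambda>e. ?F (e 0))" by (intro dfn_intros A empty_in_M)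
  show "FunM A two \<in> M" using A by simp
  show "?F x \<in> elts (PowM A)" if "x \<in> elts (FunM A two)" for x
    using dft1_M[of ?F, OF d, of x] that by auto
  fix x y assume xy: "x \<in> elts (FunM A two)" "y \<in> elts (FunM A two)" "?F x = ?F y"
  have xy': "is_fun x A two" "is_fun y A two" using xy(1,2) by auto
  show "x = y"
  proof (rule is_fun_ext[OF xy'])
    fix a assume a: "a \<in> elts A"
    have "a \<in> elts (?F x) \<longleftrightarrow> a \<in> elts (?F y)" using xy(3) by simp
    then have "ap x a = mk {} \<longleftrightarrow> ap y a = mk {}" using a by simp
    moreover have "ap x a \<in> elts two" "ap y a \<in> elts two" using is_fun_ap(2)[OF _ a] xy' by auto
    ultimately show "ap x a = ap y a" unfolding two_def by auto
  qed
qed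

lemma two_subset: assumes "infinite_cardinal M \<nu>" shows "elts two \<subseteq> elts \<nu>"
proof -
  note c = cardinalD[OF infinite_cardinalD(1)[OF assms]]
  have "mk {} \<in> elts \<nu> \<or> mk {} = \<nu>" using ordinal_subset_iff[OF ordinal_empty c(2)] by simp
  then have e: "mk {} \<in> elts \<nu>" using infinite_cardinalD(2)[OF assms] by auto
  from infinite_cardinal_limit[OF assms this] have "mk {mk {}} \<in> elts \<nu>" by (simp add: hsucc_def)
  then show ?thesis using e by (simp add: two_def)
qed

text \<open>Stated with a general base \<open>B\<close> so as to serve both 2^{<\<theta>} = \<theta>
  and \<lambda>^{<\<lambda>} = \<lambda>. As \<open>cexp_less\<close> ranges over cardinals only,
  \<alpha> is first replaced by its cardinality.\<close>

lemma Pow_lep_of_cexp_less: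
  assumes \<nu>: "infinite_cardinal M \<nu>" and B: "elts two \<subseteq> elts B" "B \<in> M" and c: "elts (cexp_less M B \<nu>) \<subseteq> elts \<nu>" and a: "\<alpha> \<in> elts \<nu>"
  shows "lep (PowM \<alpha>) \<nu>"
proof -
  note n = infinite_cardinalD(1)[OF \<nu>] note nn = cardinalD[OF n]
  have aM: "\<alpha> \<in> M" using M_trans[OF a nn(1)] .
  let ?c = "card_in M \<alpha>"
  have cn: "?c \<in> elts \<nu>" using lss_iff_card[OF n aM] lssI[OF a lep_refl[OF aM]] by blast
  have cM: "?c \<in> M" using card_in_M[OF aM] .
  have F: "FunM ?c B \<in> M" using cM B(2) by simp
  have "elts (cexp M B ?c) \<subseteq> elts (cexp_less M B \<nu>)"
    unfolding cexp_less_def using cn cardinal_card[OF aM] by auto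
  then have "elts (card_in M (FunM ?c B)) \<subseteq> elts \<nu>" using c unfolding cexp_eq by blast
  then have "lep (FunM ?c B) \<nu>" using lep_mono_r[OF F lep_card(1)[OF F]] by blast
  then have "lep (PowM ?c) \<nu>" using lep_trans[OF _ lep_Pow_Fun[OF cM B]] cM by simp
  then show ?thesis using lep_trans[OF _ lep_Pow_mono[OF aM cM lep_card(1)[OF aM]]] aM by simp
qed

text \<open>Were \<open>l\<close> singular, its cofinality would be an exponent below
  \<open>l\<close> for which Koenig's theorem yields more than \<open>l\<close> functions.\<close>

lemma regular_of_cexp_less:
  assumes l: "infinite_cardinal M l" and c: "elts (cexp_less M l l) \<subseteq> elts l"
  shows "regular_cardinal M l"
proof -
  note n = infinite_cardinalD(1)[OF l] note nn = cardinalD[OF n]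
  note co = cof[OF nn(1,2)]
  have "cof M l = l"
  proof (rule ccontr)
    assume "cof M l \<noteq> l"
    then have d: "cof M l \<in> elts l" using ordinal_subset_iff[OF co(1) nn(2)] co(5) by blast
    let ?d = "cof M l" let ?c = "card_in M ?d"
    have cn: "?c \<in> elts l" using lss_iff_card[OF n co(2)] lssI[OF d lep_refl[OF co(2)]] by blast
    have cM: "?c \<in> M" using card_in_M[OF co(2)] .
    have F: "FunM ?c l \<in> M" using cM nn by simp
    have "elts (cexp M l ?c) \<subseteq> elts (cexp_less M l l)"
      unfolding cexp_less_def using cn cardinal_card[OF co(2)] by auto
    then have "elts (card_in M (FunM ?c l)) \<subseteq> elts l" using c unfolding cexp_eq by blast
    then have lp: "lep (FunM ?c l) l" using lep_mono_r[OF F lep_card(1)[OF F]] by blast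
    obtain g where g: "g \<in> M" "bijf g ?c ?d" using card_eqp[OF co(2)] unfolding eqp_def by blast
    obtain f where f: "f \<in> M" "\<And>\<xi>. \<xi> \<in> elts ?d \<Longrightarrow> ap f \<xi> \<in> elts l" "\<And>\<beta>. \<beta> \<in> elts l \<Longrightarrow> \<exists>\<xi>\<in>elts ?d. elts \<beta> \<subseteq> elts (ap f \<xi>)"
      using co(3) unfolding cofin_def by blast
    let ?h = "lam ?c (\<lambda>x. ap f (ap g x))"
    have "?h \<in> M" by (rule lam_in_M[OF cM]) (intro dfn_intros f g)
    moreover have "ap ?h \<xi> \<in> elts l" if "\<xi> \<in> elts ?c" for \<xi>
      using that g(2) f(2)[of "ap g \<xi>"] unfolding bijf_def injf_def by simp
    moreover have "\<exists>\<xi>\<in>elts ?c. elts \<beta> \<subseteq> elts (ap ?h \<xi>)" if b: "\<beta> \<in> elts l" for \<beta>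
    proof -
      obtain \<eta> where e: "\<eta> \<in> elts ?d" "elts \<beta> \<subseteq> elts (ap f \<eta>)" using f(3)[OF b] by blast
      then obtain \<xi> where "\<xi> \<in> elts ?c" "\<eta> = ap g \<xi>" using g(2) unfolding bijf_def by blast
      then show ?thesis using e by (intro bexI[of _ \<xi>]) simp_all
    qed
    ultimately have "cofin ?c l" unfolding cofin_def by blast
    then show False using koenig[OF l cM] lp by blast
  qed
  then show ?thesis unfolding regular_cardinal_def using l by blast
qed

lemma strong_limit_Pow:
  assumes \<mu>: "strong_limit M \<mu>" and A: "A \<in> M" "lss A \<mu>" shows "lss (PowM A) \<mu>"
proof -
  have m: "infinite_cardinal M \<mu>" using \<mu> unfolding strong_limit_def by blast
  note n = infinite_cardinalD(1)[OF m] note nn = cardinalD[OF n]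
  let ?c = "card_in M A"
  have cn: "?c \<in> elts \<mu>" using lss_iff_card[OF n A(1)] A(2) by blast
  have cM: "?c \<in> M" using card_in_M[OF A(1)] .
  have F: "FunM ?c two \<in> M" using cM by simp
  have "cexp M two ?c \<in> elts \<mu>" using \<mu> cn cardinal_card[OF A(1)] unfolding strong_limit_def by blast
  then have "lss (FunM ?c two) \<mu>" unfolding cexp_eq by (rule lssI[OF _ lep_card(1)[OF F]])
  then have "lss (PowM ?c) \<mu>" using lss_lep_trans[OF _ lep_Pow_Fun[OF cM subset_refl two_in_M]] cM by simp
  then show ?thesis using lss_lep_trans[OF _ lep_Pow_mono[OF A(1) cM lep_card(1)[OF A(1)]]] A(1) by simp
qed

section \<open>Measures\<close>

lemma ultrafilterD:
  assumes "ultrafilter_on M \<kappa> U"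
  shows "U \<in> M" "\<And>A. A \<in> elts U \<Longrightarrow> elts A \<subseteq> elts \<kappa>" "\<kappa> \<in> elts U" "mk {} \<notin> elts U"
    "\<And>A B. A \<in> elts U \<Longrightarrow> B \<in> elts U \<Longrightarrow> mk (elts A \<inter> elts B) \<in> elts U"
    "\<And>A B. A \<in> elts U \<Longrightarrow> B \<in> M \<Longrightarrow> elts A \<subseteq> elts B \<Longrightarrow> elts B \<subseteq> elts \<kappa> \<Longrightarrow> B \<in> elts U"
    "\<And>A. A \<in> M \<Longrightarrow> elts A \<subseteq> elts \<kappa> \<Longrightarrow> A \<in> elts U \<or> mk (elts \<kappa> - elts A) \<in> elts U"
  using assms unfolding ultrafilter_on_def by (fast | blast)+

lemma measure_complete:
  assumes U: "measure_on M \<kappa> U" and b: "\<beta> \<in> elts \<kappa>" "\<beta> \<in> M" and F: "dft (\<lambda>e. F (e 0))" "\<And>\<eta>. \<eta> \<in> elts \<beta> \<Longrightarrow> F \<eta> \<in> elts U"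
  shows "mk {\<xi> \<in> elts \<kappa>. \<forall>\<eta>\<in>elts \<beta>. \<xi> \<in> elts (F \<eta>)} \<in> elts U"
proof -
  let ?f = "lam \<beta> F"
  have f: "?f \<in> M" "is_fun ?f \<beta> U" using lam_in_M[OF b(2) F(1)] is_fun_lam[of \<beta> F U] F(2) by auto
  have "complete_filter M \<kappa> U" using U unfolding measure_on_def by blast
  then have "mk {\<xi> \<in> elts \<kappa>. \<forall>\<eta>\<in>elts \<beta>. \<xi> \<in> elts (app ?f \<eta>)} \<in> elts U"
    using b f unfolding complete_filter_def by blast
  moreover have "app ?f \<eta> = F \<eta>" if "\<eta> \<in> elts \<beta>" for \<eta> using is_fun_ap(1)[OF f(2) that] that by simp
  ultimately show ?thesis by (simp cong: conj_cong)
qed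

lemma measure_disjoint:
  assumes U: "ultrafilter_on M \<kappa> U" and "A \<in> elts U" "B \<in> elts U" shows "elts A \<inter> elts B \<noteq> {}"
  using ultrafilterD(5)[OF U assms(2,3)] ultrafilterD(4)[OF U] by auto

text \<open>If no piece were large, the complements of fewer than \<kappa> pieces would all be
  large, and by completeness so would their empty intersection.\<close>

lemma measure_partition:
  assumes U: "measure_on M \<kappa> U" and k: "\<kappa> \<in> M" and b: "\<beta> \<in> elts \<kappa>" and c: "dft (\<lambda>e. c (e 0))" "\<And>\<xi>. \<xi> \<in> elts \<kappa> \<Longrightarrow> c \<xi> \<in> elts \<beta>"
  shows "\<exists>\<eta>\<in>elts \<beta>. mk {\<xi> \<in> elts \<kappa>. c \<xi> = \<eta>} \<in> elts U"
proof (rule ccontr)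
  assume no: "\<not> ?thesis"
  have bM: "\<beta> \<in> M" using M_trans[OF b k] .
  note c' = dft1[of c, OF c(1)]
  have uf: "ultrafilter_on M \<kappa> U" using U unfolding measure_on_def by blast
  let ?F = "\<lambda>\<eta>. mk (elts \<kappa> - elts (mk {\<xi> \<in> elts \<kappa>. c \<xi> = \<eta>}))"
  have "mk {\<xi> \<in> elts \<kappa>. \<forall>\<eta>\<in>elts \<beta>. \<xi> \<in> elts (?F \<eta>)} \<in> elts U"
  proof (rule measure_complete[OF U b bM])
    show "dft (\<lambda>e. ?F (e 0))" by (intro dfn_intros c' k)
    fix \<eta> assume e: "\<eta> \<in> elts \<beta>"
    have "mk {\<xi> \<in> elts \<kappa>. c \<xi> = \<eta>} \<in> M" by (rule sep_in_M[OF k]) (intro dfn_intros c' M_trans[OF e bM])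
    then show "?F \<eta> \<in> elts U" using ultrafilterD(7)[OF uf, of "mk {\<xi> \<in> elts \<kappa>. c \<xi> = \<eta>}"] no e by auto
  qed
  moreover have "{\<xi> \<in> elts \<kappa>. \<forall>\<eta>\<in>elts \<beta>. \<xi> \<in> elts (?F \<eta>)} = {}" using c(2) by auto
  ultimately show False using ultrafilterD(4)[OF uf] by (simp only:)
qed

text \<open>The complements of the singletons below \<beta> are in the ultrafilter, and completeness
  intersects them. In the extension these final segments make every ultrafilter containing the
  measure uniform.\<close>

lemma measure_cobounded:
  assumes U: "measure_on M \<kappa> U" and k: "\<kappa> \<in> M" "ordinal \<kappa>" and b: "\<beta> \<in> elts \<kappa>"
  shows "mk (elts \<kappa> - elts \<beta>) \<in> elts U"
proof -
  have uf: "ultrafilter_on M \<kappa> U" and np: "nonprincipal \<kappa> U" using U unfolding measure_on_def by blast+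
  have bM: "\<beta> \<in> M" using M_trans[OF b k(1)] .
  let ?F = "\<lambda>\<eta>. mk (elts \<kappa> - elts (mk {\<eta>}))"
  have "mk {\<xi> \<in> elts \<kappa>. \<forall>\<eta>\<in>elts \<beta>. \<xi> \<in> elts (?F \<eta>)} \<in> elts U"
  proof (rule measure_complete[OF U b bM])
    show "dft (\<lambda>e. ?F (e 0))" by (intro dfn_intros k)
    fix \<eta> assume e: "\<eta> \<in> elts \<beta>"
    have ek: "\<eta> \<in> elts \<kappa>" using ordinal_trans[OF e b k(2)] .
    then show "?F \<eta> \<in> elts U"
      using ultrafilterD(7)[OF uf, of "mk {\<eta>}"] np M_trans[OF e bM] unfolding nonprincipal_def by auto
  qed
  moreover have "{\<xi> \<in> elts \<kappa>. \<forall>\<eta>\<in>elts \<beta>. \<xi> \<in> elts (?F \<eta>)} = elts \<kappa> - elts \<beta>" by auto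
  ultimately show ?thesis by simp
qed

text \<open>A short cofinal sequence would split \<kappa> into few bounded pieces. One of them would
  be large, although it misses a large final segment.\<close>

lemma measure_regular:
  assumes U: "measure_on M \<kappa> U" and k: "infinite_cardinal M \<kappa>"
  shows "regular_cardinal M \<kappa>"
proof -
  note kk = cardinalD[OF infinite_cardinalD(1)[OF k]]
  note co = cof[OF kk(1,2)]
  have uf: "ultrafilter_on M \<kappa> U" using U unfolding measure_on_def by blast
  have "cof M \<kappa> = \<kappa>"
  proof (rule ccontr)
    assume "cof M \<kappa> \<noteq> \<kappa>"
    then have d: "cof M \<kappa> \<in> elts \<kappa>" using ordinal_subset_iff[OF co(1) kk(2)] co(5) by blast
    let ?d = "cof M \<kappa>"
    obtain f where f: "f \<in> M" "\<And>\<xi>. \<xi> \<in> elts ?d \<Longrightarrow> ap f \<xi> \<in> elts \<kappa>" "\<And>\<beta>. \<beta> \<in> elts \<kappa> \<Longrightarrow> \<exists>\<xi>\<in>elts ?d. elts \<beta> \<subseteq> elts (ap f \<xi>)"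
      using co(3) unfolding cofin_def by blast
    have "\<exists>g\<in>M. \<forall>\<xi>\<in>elts \<kappa>. ap g \<xi> \<in> elts ?d \<and> \<xi> \<in> elts (ap f (ap g \<xi>))"
    proof (rule AC[OF kk(1), of "\<lambda>\<xi> \<eta>. \<eta> \<in> elts ?d \<and> \<xi> \<in> elts (ap f \<eta>)"])
      show "dfn (\<lambda>e. e 1 \<in> elts ?d \<and> e 0 \<in> elts (ap f (e 1)))" by (intro dfn_intros f co)
      fix \<xi> assume "\<xi> \<in> elts \<kappa>"
      from f(3)[OF infinite_cardinal_limit[OF k this]]
      obtain \<eta> where "\<eta> \<in> elts ?d" "\<xi> \<in> elts (ap f \<eta>)" by auto
      then show "\<exists>y\<in>M. y \<in> elts ?d \<and> \<xi> \<in> elts (ap f y)" using M_trans[OF _ co(2)] by blast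
    qed
    then obtain g where g: "g \<in> M" "\<And>\<xi>. \<xi> \<in> elts \<kappa> \<Longrightarrow> ap g \<xi> \<in> elts ?d \<and> \<xi> \<in> elts (ap f (ap g \<xi>))" by blast
    have "\<exists>\<eta>\<in>elts ?d. mk {\<xi> \<in> elts \<kappa>. ap g \<xi> = \<eta>} \<in> elts U"
      by (rule measure_partition[OF U kk(1) d]) (intro dfn_intros g, use g in blast)
    then obtain \<eta> where e: "\<eta> \<in> elts ?d" "mk {\<xi> \<in> elts \<kappa>. ap g \<xi> = \<eta>} \<in> elts U" by blast
    have "elts (mk {\<xi> \<in> elts \<kappa>. ap g \<xi> = \<eta>}) \<inter> elts (mk (elts \<kappa> - elts (ap f \<eta>))) \<noteq> {}"
      by (rule measure_disjoint[OF uf e(2) measure_cobounded[OF U kk(1,2) f(2)[OF e(1)]]])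
    then show False using g(2) by auto
  qed
  then show ?thesis unfolding regular_cardinal_def using k by blast
qed

text \<open>Otherwise there are \<kappa> distinct subsets of \<alpha>. For each \<eta> < \<alpha>
  the measure decides whether \<eta> belongs to almost all of them; by completeness almost all agree
  at every \<eta>, so some large set has at most one point.\<close>

lemma measure_strong_limit:
  assumes U: "measure_on M \<kappa> U" and k: "infinite_cardinal M \<kappa>" and a: "\<alpha> \<in> elts \<kappa>"
  shows "lss (PowM \<alpha>) \<kappa>"
proof (rule ccontr)
  assume no: "\<not> ?thesis"
  note kk = cardinalD[OF infinite_cardinalD(1)[OF k]]
  have uf: "ultrafilter_on M \<kappa> U" and np: "nonprincipal \<kappa> U" using U unfolding measure_on_def by blast+
  have aM: "\<alpha> \<in> M" using M_trans[OF a kk(1)] .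
  have UM: "U \<in> M" using ultrafilterD(1)[OF uf] .
  have "lep \<kappa> (PowM \<alpha>)" using no not_lss[OF infinite_cardinalD(1)[OF k], of "PowM \<alpha>"] aM by simp
  then obtain f where f: "f \<in> M" "injf f \<kappa> (PowM \<alpha>)" unfolding lep_def by blast
  define A where "A \<eta> = mk {\<xi> \<in> elts \<kappa>. \<eta> \<in> elts (ap f \<xi>)}" for \<eta>
  have dA: "dft (\<lambda>e. A (e 0))" unfolding A_def by (intro dfn_intros f kk)
  note dA' = dft1[of A, OF dA]
  define F where "F \<eta> = (if A \<eta> \<in> elts U then A \<eta> else mk (elts \<kappa> - elts (A \<eta>)))" for \<eta>
  have dF: "dft (\<lambda>e. F (e 0))" unfolding F_def by (intro dfn_intros dA' UM kk)
  define B where "B = mk {\<xi> \<in> elts \<kappa>. \<forall>\<eta>\<in>elts \<alpha>. \<xi> \<in> elts (F \<eta>)}"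
  have BU: "B \<in> elts U" unfolding B_def
  proof (rule measure_complete[OF U a aM dF])
    fix \<eta> assume e: "\<eta> \<in> elts \<alpha>"
    have "A \<eta> \<in> M" by (rule dft1_M[OF dA M_trans[OF e aM]])
    moreover have "elts (A \<eta>) \<subseteq> elts \<kappa>" unfolding A_def by auto
    ultimately show "F \<eta> \<in> elts U" using ultrafilterD(7)[OF uf] unfolding F_def by auto
  qed
  have eq: "\<xi> = \<xi>'" if "\<xi> \<in> elts B" "\<xi>' \<in> elts B" for \<xi> \<xi>'
  proof -
    have x: "\<xi> \<in> elts \<kappa>" "\<xi>' \<in> elts \<kappa>" using that unfolding B_def by auto
    have "\<eta> \<in> elts (ap f \<xi>) \<longleftrightarrow> \<eta> \<in> elts (ap f \<xi>')" if e: "\<eta> \<in> elts \<alpha>" for \<eta>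
    proof -
      have "\<xi> \<in> elts (F \<eta>)" "\<xi>' \<in> elts (F \<eta>)" using \<open>\<xi> \<in> elts B\<close> \<open>\<xi>' \<in> elts B\<close> e unfolding B_def by auto
      then show ?thesis unfolding F_def A_def using x by (auto split: if_splits)
    qed
    moreover have "elts (ap f \<xi>) \<subseteq> elts \<alpha>" "elts (ap f \<xi>') \<subseteq> elts \<alpha>" using f(2) x unfolding injf_def by auto
    ultimately have "ap f \<xi> = ap f \<xi>'" by (intro hc_eqI) blast
    then show ?thesis using f(2) x unfolding injf_def by blast
  qed
  show False
  proof (cases "elts B = {}")
    case True
    then have "B = mk {}" by (metis mk_elts)
    then show False using BU ultrafilterD(4)[OF uf] by simp
  next
    case False
    then obtain \<xi> where x: "\<xi> \<in> elts B" by blast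
    then have "elts B = {\<xi>}" using eq by blast
    then have "B = mk {\<xi>}" by (metis mk_elts)
    moreover have "\<xi> \<in> elts \<kappa>" using x unfolding B_def by auto
    ultimately show False using BU np unfolding nonprincipal_def by blast
  qed
qed

end

section \<open>The forcing theorem\<close>

locale forcing_poset = ctm_model +
  fixes P leq one :: hc
  assumes notion: "forcing_notion M P leq one"
begin

abbreviation le :: "hc \<Rightarrow> hc \<Rightarrow> bool" where "le p q \<equiv> hpair p q \<in> elts leq"

lemma P_in_M: "P \<in> M" and leq_in_M: "leq \<in> M" and one_in_P: "one \<in> elts P"
  and le_refl: "\<And>p. p \<in> elts P \<Longrightarrow> le p p" and le_trans: "\<And>p q r. le p q \<Longrightarrow> le q r \<Longrightarrow> le p r"
  using notion unfolding forcing_notion_def by blast+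

lemma P_M: "p \<in> elts P \<Longrightarrow> p \<in> M" using M_trans[OF _ P_in_M] .

lemma one_in_M: "one \<in> M" using P_M[OF one_in_P] .

lemmas poset_M = P_in_M leq_in_M one_in_M

text \<open>
  \<open>EQ (\<sigma>, \<tau>)\<close> is the set of conditions forcing \<open>\<sigma> = \<tau>\<close>, by recursion on pairs of names; it comes first
  because membership (\<open>fmem\<close>) and inclusion (\<open>fsub\<close>) are explicit in terms of it.
\<close>

definition EQpre :: "hc \<Rightarrow> hc" where "EQpre z = hprod (hdom (hfst z)) (hdom (hsnd z))"

definition EQ :: "hc \<Rightarrow> hc" where
  "EQ = hrec EQpre (\<lambda>z f. mk {p \<in> elts P.
    (\<forall>\<rho>\<in>elts (hdom (hfst z)). \<forall>s\<in>elts P. hpair \<rho> s \<in> elts (hfst z) \<longrightarrow> (\<forall>q\<in>elts P. le q p \<and> le q s \<longrightarrow>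
      (\<exists>r\<in>elts P. le r q \<and> (\<exists>\<pi>\<in>elts (hdom (hsnd z)). \<exists>t\<in>elts P. hpair \<pi> t \<in> elts (hsnd z) \<and> le r t \<and> r \<in> elts (ap f (hpair \<rho> \<pi>)))))) \<and>
    (\<forall>\<pi>\<in>elts (hdom (hsnd z)). \<forall>t\<in>elts P. hpair \<pi> t \<in> elts (hsnd z) \<longrightarrow> (\<forall>q\<in>elts P. le q p \<and> le q t \<longrightarrow>
      (\<exists>r\<in>elts P. le r q \<and> (\<exists>\<rho>\<in>elts (hdom (hfst z)). \<exists>s\<in>elts P. hpair \<rho> s \<in> elts (hfst z) \<and> le r s \<and> r \<in> elts (ap f (hpair \<rho> \<pi>))))))})"

definition feq :: "hc \<Rightarrow> hc \<Rightarrow> hc \<Rightarrow> bool" where "feq p \<sigma> \<tau> \<longleftrightarrow> p \<in> elts (EQ (hpair \<sigma> \<tau>))"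

text \<open>The form of membership before closing under density: \<open>r\<close> already names a
  member of \<tau> that it forces to equal \<sigma>.\<close>

definition fwit :: "hc \<Rightarrow> hc \<Rightarrow> hc \<Rightarrow> bool" where
  "fwit r \<sigma> \<tau> \<longleftrightarrow> (\<exists>\<pi>\<in>elts (hdom \<tau>). \<exists>t\<in>elts P. hpair \<pi> t \<in> elts \<tau> \<and> le r t \<and> feq r \<sigma> \<pi>)"

definition fmem :: "hc \<Rightarrow> hc \<Rightarrow> hc \<Rightarrow> bool" where
  "fmem p \<sigma> \<tau> \<longleftrightarrow> (\<forall>q\<in>elts P. le q p \<longrightarrow> (\<exists>r\<in>elts P. le r q \<and> fwit r \<sigma> \<tau>))"

definition fsub :: "hc \<Rightarrow> hc \<Rightarrow> hc \<Rightarrow> bool" where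
  "fsub p \<sigma> \<tau> \<longleftrightarrow> (\<forall>\<rho>\<in>elts (hdom \<sigma>). \<forall>s\<in>elts P. hpair \<rho> s \<in> elts \<sigma> \<longrightarrow> (\<forall>q\<in>elts P. le q p \<and> le q s \<longrightarrow>
    (\<exists>r\<in>elts P. le r q \<and> fwit r \<rho> \<tau>)))"

lemma wf_hdom: "wf {(\<rho>, \<sigma>). \<rho> \<in> elts (hdom \<sigma>)}"
proof (rule wf_subset[OF wf_trancl[OF wf_elts]])
  have "(\<rho>, \<sigma>) \<in> {(x, y). x \<in> elts y}\<^sup>+" if r: "\<rho> \<in> elts (hdom \<sigma>)" for \<rho> \<sigma>
  proof -
    obtain p where 1: "hpair \<rho> p \<in> elts \<sigma>" using r by auto
    obtain y where "y \<in> elts (hpair \<rho> p)" "\<rho> \<in> elts y" using hpair_fst by blast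
    then have "(\<rho>, y) \<in> {(x, y). x \<in> elts y}" "(y, hpair \<rho> p) \<in> {(x, y). x \<in> elts y}"
      "(hpair \<rho> p, \<sigma>) \<in> {(x, y). x \<in> elts y}" using 1 by auto
    then show ?thesis by (rule trancl_into_trancl[OF trancl_into_trancl[OF r_into_trancl]])
  qed
  then show "{(\<rho>, \<sigma>). \<rho> \<in> elts (hdom \<sigma>)} \<subseteq> {(x, y). x \<in> elts y}\<^sup>+" by auto
qed

lemma wf_EQpre: "wf {(y, x). y \<in> elts (EQpre x)}"
  by (rule wf_subset[OF wf_inv_image[OF wf_hdom, of hfst]]) (auto simp: EQpre_def)

lemma dft_EQ [dfn_intros]: "dft t \<Longrightarrow> dft (\<lambda>e. EQ (t e))"
  unfolding EQ_def by (rule dft_hrec[OF _ _ wf_EQpre]) (unfold EQpre_def, (intro dfn_intros poset_M | assumption)+)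

lemma dfn_feq [dfn_intros]: "dft t \<Longrightarrow> dft s \<Longrightarrow> dft r \<Longrightarrow> dfn (\<lambda>e. feq (t e) (s e) (r e))"
  unfolding feq_def by (intro dfn_intros)

lemma dfn_fwit [dfn_intros]: "dft t \<Longrightarrow> dft s \<Longrightarrow> dft r \<Longrightarrow> dfn (\<lambda>e. fwit (t e) (s e) (r e))"
  unfolding fwit_def by (rule dfn3[of "\<lambda>r \<sigma> \<tau>. \<exists>\<pi>\<in>elts (hdom \<tau>). \<exists>t\<in>elts P. hpair \<pi> t \<in> elts \<tau> \<and> le r t \<and> feq r \<sigma> \<pi>"]) (intro dfn_intros poset_M)

lemma dfn_fmem [dfn_intros]: "dft t \<Longrightarrow> dft s \<Longrightarrow> dft r \<Longrightarrow> dfn (\<lambda>e. fmem (t e) (s e) (r e))"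
  unfolding fmem_def by (rule dfn3[of "\<lambda>p \<sigma> \<tau>. \<forall>q\<in>elts P. le q p \<longrightarrow> (\<exists>r\<in>elts P. le r q \<and> fwit r \<sigma> \<tau>)"]) (intro dfn_intros poset_M)

lemma dfn_fsub [dfn_intros]: "dft t \<Longrightarrow> dft s \<Longrightarrow> dft r \<Longrightarrow> dfn (\<lambda>e. fsub (t e) (s e) (r e))"
  unfolding fsub_def by (rule dfn3[of "\<lambda>p \<sigma> \<tau>. \<forall>\<rho>\<in>elts (hdom \<sigma>). \<forall>s\<in>elts P. hpair \<rho> s \<in> elts \<sigma> \<longrightarrow> (\<forall>q\<in>elts P. le q p \<and> le q s \<longrightarrow>
    (\<exists>r\<in>elts P. le r q \<and> fwit r \<rho> \<tau>))"]) (intro dfn_intros poset_M)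

text \<open>Both halves of the clause for equality have this shape. With the recursive call as a
  parameter \<open>X\<close>, the halves differ only in the order of the arguments of
  \<open>X\<close>.\<close>

definition fgen :: "(hc \<Rightarrow> hc \<Rightarrow> hc \<Rightarrow> bool) \<Rightarrow> hc \<Rightarrow> hc \<Rightarrow> hc \<Rightarrow> bool" where
  "fgen X p \<sigma> \<tau> \<longleftrightarrow> (\<forall>\<rho>\<in>elts (hdom \<sigma>). \<forall>s\<in>elts P. hpair \<rho> s \<in> elts \<sigma> \<longrightarrow> (\<forall>q\<in>elts P. le q p \<and> le q s \<longrightarrow>
      (\<exists>r\<in>elts P. le r q \<and> (\<exists>\<pi>\<in>elts (hdom \<tau>). \<exists>t\<in>elts P. hpair \<pi> t \<in> elts \<tau> \<and> le r t \<and> X r \<rho> \<pi>))))"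

lemma fgen_cong:
  assumes "\<And>r \<rho> \<pi>. \<rho> \<in> elts (hdom \<sigma>) \<Longrightarrow> \<pi> \<in> elts (hdom \<tau>) \<Longrightarrow> X r \<rho> \<pi> = Y r \<rho> \<pi>"
  shows "fgen X p \<sigma> \<tau> = fgen Y p \<sigma> \<tau>"
  unfolding fgen_def by (intro ball_cong bex_cong imp_cong conj_cong refl assms)

lemma feq_unfold: "feq p \<sigma> \<tau> \<longleftrightarrow> p \<in> elts P \<and> fgen feq p \<sigma> \<tau> \<and> fgen (\<lambda>r \<pi> \<rho>. feq r \<rho> \<pi>) p \<tau> \<sigma>"
proof -
  have 1: "elts (mk {p \<in> elts P. Q p}) = {p \<in> elts P. Q p}" for Q by simp
  have ap: "ap (lam (EQpre (hpair \<sigma> \<tau>)) (hrec EQpre H)) (hpair \<rho> \<pi>) = hrec EQpre H (hpair \<rho> \<pi>)"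
    if "\<rho> \<in> elts (hdom \<sigma>)" "\<pi> \<in> elts (hdom \<tau>)" for \<rho> \<pi> H
    using that by (intro ap_lam) (simp add: EQpre_def)
  show ?thesis
    unfolding feq_def EQ_def fgen_def
    by (subst hrec_unfold[OF wf_EQpre], subst 1) (simp only: mem_Collect_eq hfst_hpair hsnd_hpair ap cong: ball_cong bex_cong conj_cong)
qed

text \<open>Both halves of the recursion look up pairs with the name from \<sigma> first, so
  symmetry is not visible in the clause and takes an induction. Only then do both halves become
  instances of \<open>fsub\<close>.\<close>

lemma feq_sym: "feq p \<sigma> \<tau> \<longleftrightarrow> feq p \<tau> \<sigma>"
proof (induction \<sigma> arbitrary: p \<tau> rule: wf_induct_rule[OF wf_hdom])
  case (1 \<sigma>)
  have IH: "feq p \<rho> \<pi> \<longleftrightarrow> feq p \<pi> \<rho>" if "\<rho> \<in> elts (hdom \<sigma>)" for p \<rho> \<pi> using 1[of \<rho>] that by simp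
  have "fgen feq p \<sigma> \<tau> = fgen (\<lambda>r \<pi> \<rho>. feq r \<rho> \<pi>) p \<sigma> \<tau>" by (rule fgen_cong) (rule IH)
  moreover have "fgen (\<lambda>r \<pi> \<rho>. feq r \<rho> \<pi>) p \<tau> \<sigma> = fgen feq p \<tau> \<sigma>" by (rule fgen_cong) (rule IH)
  ultimately show ?case unfolding feq_unfold[of p \<sigma> \<tau>] feq_unfold[of p \<tau> \<sigma>] by blast
qed

lemma fsub_fgen: "fsub p \<sigma> \<tau> = fgen feq p \<sigma> \<tau>"
  unfolding fsub_def fgen_def fwit_def ..

lemma feq_iff: "feq p \<sigma> \<tau> \<longleftrightarrow> p \<in> elts P \<and> fsub p \<sigma> \<tau> \<and> fsub p \<tau> \<sigma>"
proof -
  have "fgen (\<lambda>r \<pi> \<rho>. feq r \<rho> \<pi>) p \<tau> \<sigma> = fgen feq p \<tau> \<sigma>" by (rule fgen_cong) (rule feq_sym)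
  then show ?thesis unfolding feq_unfold[of p \<sigma> \<tau>] fsub_fgen by simp
qed

lemma fsub_mono: "fsub p \<sigma> \<tau> \<Longrightarrow> le q p \<Longrightarrow> fsub q \<sigma> \<tau>"
  unfolding fsub_def using le_trans by blast

lemma feq_mono: "feq p \<sigma> \<tau> \<Longrightarrow> le q p \<Longrightarrow> q \<in> elts P \<Longrightarrow> feq q \<sigma> \<tau>"
  unfolding feq_iff using fsub_mono by blast

lemma fwit_mono: "fwit p \<sigma> \<tau> \<Longrightarrow> le q p \<Longrightarrow> q \<in> elts P \<Longrightarrow> fwit q \<sigma> \<tau>"
  unfolding fwit_def using feq_mono le_trans by blast

lemma fmem_mono: "fmem p \<sigma> \<tau> \<Longrightarrow> le q p \<Longrightarrow> fmem q \<sigma> \<tau>"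
  unfolding fmem_def using le_trans by blast

lemma fwit_fmem: "fwit p \<sigma> \<tau> \<Longrightarrow> fmem p \<sigma> \<tau>"
  unfolding fmem_def using fwit_mono le_refl by blast

lemma fsub_dense: assumes "\<And>q. q \<in> elts P \<Longrightarrow> le q p \<Longrightarrow> \<exists>r\<in>elts P. le r q \<and> fsub r \<sigma> \<tau>" shows "fsub p \<sigma> \<tau>"
  unfolding fsub_def
proof (intro ballI impI)
  fix \<rho> s q assume a: "\<rho> \<in> elts (hdom \<sigma>)" "s \<in> elts P" "hpair \<rho> s \<in> elts \<sigma>" "q \<in> elts P" "le q p \<and> le q s"
  obtain r where r: "r \<in> elts P" "le r q" "fsub r \<sigma> \<tau>" using assms[OF a(4)] a(5) by blast
  have "le r r" "le r s" using le_refl r a(5) le_trans by blast+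
  then obtain u where "u \<in> elts P" "le u r" "fwit u \<rho> \<tau>" using r a unfolding fsub_def by blast
  then show "\<exists>r\<in>elts P. le r q \<and> fwit r \<rho> \<tau>" using le_trans r(2) by blast
qed

lemma feq_dense: assumes "p \<in> elts P" "\<And>q. q \<in> elts P \<Longrightarrow> le q p \<Longrightarrow> \<exists>r\<in>elts P. le r q \<and> feq r \<sigma> \<tau>" shows "feq p \<sigma> \<tau>"
  unfolding feq_iff using assms fsub_dense[of p \<sigma> \<tau>] fsub_dense[of p \<tau> \<sigma>] unfolding feq_iff by blast

lemma fmem_dense: assumes "\<And>q. q \<in> elts P \<Longrightarrow> le q p \<Longrightarrow> \<exists>r\<in>elts P. le r q \<and> fmem r \<sigma> \<tau>" shows "fmem p \<sigma> \<tau>"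
  unfolding fmem_def
proof (intro ballI impI)
  fix q assume q: "q \<in> elts P" "le q p"
  then obtain r where r: "r \<in> elts P" "le r q" "fmem r \<sigma> \<tau>" using assms by blast
  then obtain u where "u \<in> elts P" "le u r" "fwit u \<sigma> \<tau>" using le_refl unfolding fmem_def by blast
  then show "\<exists>r\<in>elts P. le r q \<and> fwit r \<sigma> \<tau>" using le_trans r(2) by blast
qed

text \<open>The universal clause ranges over all of \<open>M\<close>, as every element of the model
  acts as a name.\<close>

primrec Frc :: "fm \<Rightarrow> hc \<Rightarrow> (nat \<Rightarrow> hc) \<Rightarrow> bool" where
  "Frc (FMem i j) p e \<longleftrightarrow> fmem p (e i) (e j)"
| "Frc (FEq i j) p e \<longleftrightarrow> feq p (e i) (e j)"
| "Frc (FNeg \<phi>) p e \<longleftrightarrow> (\<forall>q\<in>elts P. le q p \<longrightarrow> \<not> Frc \<phi> q e)"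
| "Frc (FConj \<phi> \<psi>) p e \<longleftrightarrow> Frc \<phi> p e \<and> Frc \<psi> p e"
| "Frc (FAll n \<phi>) p e \<longleftrightarrow> (\<forall>x\<in>M. Frc \<phi> p (e(n := x)))"

lemma Frc_mono: "Frc \<phi> p e \<Longrightarrow> le q p \<Longrightarrow> q \<in> elts P \<Longrightarrow> Frc \<phi> q e"
proof (induction \<phi> arbitrary: p q e)
  case (FMem i j) then show ?case using fmem_mono by simp
next
  case (FEq i j) then show ?case using feq_mono by simp
next
  case (FNeg \<phi>) then show ?case unfolding Frc.simps using le_trans[OF _ FNeg.prems(2)] by blast
next
  case (FConj \<phi> \<psi>) then show ?case by (simp, blast)
next
  case (FAll n \<phi>) then show ?case by (simp, blast)
qed

text \<open>Applied in contrapositive form: a condition that does not force \<phi> has an extension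
  below which nothing forces \<phi>.\<close>

lemma Frc_dense: "p \<in> elts P \<Longrightarrow> (\<And>q. q \<in> elts P \<Longrightarrow> le q p \<Longrightarrow> \<exists>r\<in>elts P. le r q \<and> Frc \<phi> r e) \<Longrightarrow> Frc \<phi> p e"
proof (induction \<phi> arbitrary: p e)
  case (FMem i j) then show ?case using fmem_dense by simp
next
  case (FEq i j) then show ?case using feq_dense by simp
next
  case (FNeg \<phi>)
  show ?case unfolding Frc.simps
  proof (intro ballI impI notI)
    fix q assume q: "q \<in> elts P" "le q p" "Frc \<phi> q e"
    then obtain r where "r \<in> elts P" "le r q" "Frc (FNeg \<phi>) r e" using FNeg.prems by blast
    then show False using Frc_mono[OF q(3)] le_refl by auto
  qed
next
  case (FConj \<phi> \<psi>)
  have "Frc \<phi> p e" by (rule FConj.IH(1)[OF FConj.prems(1)]) (use FConj.prems(2) in fastforce)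
  moreover have "Frc \<psi> p e" by (rule FConj.IH(2)[OF FConj.prems(1)]) (use FConj.prems(2) in fastforce)
  ultimately show ?case by simp
next
  case (FAll n \<phi>)
  have "Frc \<phi> p (e(n := x))" if x: "x \<in> M" for x
  proof (rule FAll.IH[OF FAll.prems(1)])
    fix q assume "q \<in> elts P" "le q p"
    from FAll.prems(2)[OF this] x show "\<exists>r\<in>elts P. le r q \<and> Frc \<phi> r (e(n := x))" unfolding Frc.simps by blast
  qed
  then show ?case by simp
qed

text \<open>Definability of forcing, by induction on the formula outside the model. Arbitrary
  definable terms are allowed for the assignment because the quantifier case replaces one of them by
  a new argument.\<close>

lemma dfn_Frc: "dft \<pi> \<Longrightarrow> (\<And>i. dft (\<lambda>e. T i e)) \<Longrightarrow> dfn (\<lambda>e. Frc \<phi> (\<pi> e) (\<lambda>i. T i e))"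
proof (induction \<phi> arbitrary: \<pi> T)
  case (FMem i j) then show ?case by (simp add: dfn_fmem)
next
  case (FEq i j) then show ?case by (simp add: dfn_feq)
next
  case (FNeg \<phi>)
  note \<pi> = FNeg.prems(1) and T = FNeg.prems(2)
  have "dfn (\<lambda>e. Frc \<phi> (e 0) (\<lambda>i. T i (\<lambda>i. e (Suc i))))" by (rule FNeg.IH[OF dft_var dft_tl[OF T]])
  then show ?case unfolding Frc.simps
    by (intro dfn_all_elts dfn_imp dfn_neg dfn_mem dft_hpair dft_var dft_tl[OF \<pi>] dft_const poset_M)
next
  case (FConj \<phi> \<psi>) then show ?case by (simp add: dfn_conj)
next
  case (FAll n \<phi>)
  note \<pi> = FAll.prems(1) and T = FAll.prems(2)
  have "dfn (\<lambda>e. Frc \<phi> (\<pi> (\<lambda>i. e (Suc i))) (\<lambda>i. if i = n then e 0 else T i (\<lambda>i. e (Suc i))))"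
  proof (rule FAll.IH[OF dft_tl[OF \<pi>]])
    show "dft (\<lambda>e. if i = n then e 0 else T i (\<lambda>i. e (Suc i)))" for i
      using dft_var dft_tl[OF T] by (cases "i = n") simp_all
  qed
  then have "dfn (\<lambda>e. Frc \<phi> (\<pi> (\<lambda>i. e (Suc i))) ((\<lambda>i. T i (\<lambda>i. e (Suc i)))(n := e 0)))"
    unfolding fun_upd_def .
  then show ?case unfolding Frc.simps by (rule dfn_all_M)
qed

end

section \<open>Generic filters and the truth lemma\<close>

locale forcing = forcing_poset +
  fixes G :: "hc set"
  assumes gen: "generic M P leq one G"
begin

lemma G_P: "p \<in> G \<Longrightarrow> p \<in> elts P" and one_G: "one \<in> G"
  and G_up: "\<And>p q. p \<in> G \<Longrightarrow> q \<in> elts P \<Longrightarrow> le p q \<Longrightarrow> q \<in> G"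
  and G_dir: "\<And>p q. p \<in> G \<Longrightarrow> q \<in> G \<Longrightarrow> \<exists>r\<in>G. le r p \<and> le r q"
  using gen unfolding generic_def by blast+

lemma G_dir3: "p \<in> G \<Longrightarrow> q \<in> G \<Longrightarrow> r \<in> G \<Longrightarrow> \<exists>u\<in>G. le u p \<and> le u q \<and> le u r"
  using G_dir[of p q] G_dir[of _ r] le_trans by meson

text \<open>Genericity is stated for sets dense in the whole poset. The conditions that satisfy
  \<open>Q\<close> below \<open>p\<close>, together with those incompatible with \<open>p\<close>,
  form such a set, and the filter excludes the second kind.\<close>

lemma G_meets:
  assumes p: "p \<in> G" and Q: "dfn (\<lambda>e. Q (e 0))" and d: "\<And>q. q \<in> elts P \<Longrightarrow> le q p \<Longrightarrow> \<exists>r\<in>elts P. le r q \<and> Q r"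
  shows "\<exists>r\<in>G. Q r \<and> le r p"
proof -
  note Q' = dfn1[of Q, OF Q]
  have pM: "p \<in> M" using P_M[OF G_P[OF p]] .
  define E where "E = mk {r \<in> elts P. (Q r \<and> le r p) \<or> \<not> (\<exists>u\<in>elts P. le u r \<and> le u p)}"
  have EM: "E \<in> M" unfolding E_def by (rule sep_in_M[OF P_in_M]) (intro dfn_intros Q' poset_M pM)
  have eE: "elts E = {r \<in> elts P. (Q r \<and> le r p) \<or> \<not> (\<exists>u\<in>elts P. le u r \<and> le u p)}" unfolding E_def by simp
  have "dense_in P leq E" unfolding dense_in_def
  proof (intro conjI ballI)
    show "elts E \<subseteq> elts P" unfolding eE by blast
    fix x assume x: "x \<in> elts P"
    show "\<exists>d\<in>elts E. le d x"
    proof (cases "\<exists>u\<in>elts P. le u x \<and> le u p")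
      case True
      then obtain u where u: "u \<in> elts P" "le u x" "le u p" by blast
      from d[OF u(1,3)] obtain r where r: "r \<in> elts P" "le r u" "Q r" by blast
      have "le r p" "le r x" using le_trans r(2) u by blast+
      then show ?thesis using r unfolding eE by blast
    next
      case False then show ?thesis using x le_refl unfolding eE by blast
    qed
  qed
  then obtain r where r: "r \<in> G" "r \<in> elts E" using gen EM unfolding generic_def by blast
  obtain u where u: "u \<in> G" "le u r" "le u p" using G_dir[OF r(1) p] by blast
  then have "Q r \<and> le r p" using r(2) G_P unfolding eE by blast
  then show ?thesis using r(1) by blast
qed

lemma mem_val: "v \<in> elts (val G \<tau>) \<longleftrightarrow> (\<exists>\<sigma>\<in>elts (hdom \<tau>). \<exists>p\<in>G. hpair \<sigma> p \<in> elts \<tau> \<and> v = val G \<sigma>)"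
  unfolding elts_val by auto

text \<open>Inclusion with the truth lemma for equality of members as hypothesis. Separating it lets
  the induction for equality apply it in both directions.\<close>

lemma fsub_truth0:
  assumes \<sigma>: "\<sigma> \<in> M" and \<tau>: "\<tau> \<in> M"
    and IH: "\<And>\<rho> \<pi>. \<rho> \<in> elts (hdom \<sigma>) \<Longrightarrow> \<pi> \<in> elts (hdom \<tau>) \<Longrightarrow> (\<exists>p\<in>G. feq p \<rho> \<pi>) \<longleftrightarrow> val G \<rho> = val G \<pi>"
  shows "(\<exists>p\<in>G. fsub p \<sigma> \<tau>) \<longleftrightarrow> elts (val G \<sigma>) \<subseteq> elts (val G \<tau>)"
proof
  assume "\<exists>p\<in>G. fsub p \<sigma> \<tau>"
  then obtain p where p: "p \<in> G" "fsub p \<sigma> \<tau>" by blast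
  show "elts (val G \<sigma>) \<subseteq> elts (val G \<tau>)"
  proof
    fix v assume "v \<in> elts (val G \<sigma>)"
    then obtain \<rho> s where s: "\<rho> \<in> elts (hdom \<sigma>)" "s \<in> G" "hpair \<rho> s \<in> elts \<sigma>" "v = val G \<rho>" unfolding mem_val by blast
    have \<rho>M: "\<rho> \<in> M" using M_trans_pair[OF s(3) \<sigma>] by blast
    obtain q where q: "q \<in> G" "le q p" "le q s" using G_dir[OF p(1) s(2)] by blast
    have "\<exists>r\<in>G. fwit r \<rho> \<tau> \<and> le r q"
    proof (rule G_meets[OF q(1)])
      show "dfn (\<lambda>e. fwit (e 0) \<rho> \<tau>)" by (intro dfn_intros \<rho>M \<tau>)
      fix q' assume q': "q' \<in> elts P" "le q' q"
      have "le q' p" "le q' s" using q' q le_trans by blast+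
      then show "\<exists>r\<in>elts P. le r q' \<and> fwit r \<rho> \<tau>" using p(2) s(1,3) G_P[OF s(2)] q'(1) unfolding fsub_def by blast
    qed
    then obtain r \<pi> t where r: "r \<in> G" "\<pi> \<in> elts (hdom \<tau>)" "t \<in> elts P" "hpair \<pi> t \<in> elts \<tau>" "le r t" "feq r \<rho> \<pi>"
      unfolding fwit_def by blast
    have "t \<in> G" using G_up[OF r(1,3,5)] .
    moreover have "val G \<rho> = val G \<pi>" using IH[OF s(1) r(2)] r(1,6) by blast
    ultimately show "v \<in> elts (val G \<tau>)" unfolding mem_val using s(4) r(2,4) by blast
  qed
next
  assume sub: "elts (val G \<sigma>) \<subseteq> elts (val G \<tau>)"
  \<comment> \<open>Below such a condition some member of \<sigma> is kept out of \<tau> for good.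
    These conditions and the ones forcing inclusion are together dense, while the assumed inclusion
    keeps the former out of \<open>G\<close>.\<close>
  define A where "A p \<longleftrightarrow> (\<exists>\<rho>\<in>elts (hdom \<sigma>). \<exists>s\<in>elts P. hpair \<rho> s \<in> elts \<sigma> \<and> le p s \<and> (\<forall>r\<in>elts P. le r p \<longrightarrow> \<not> fwit r \<rho> \<tau>))" for p
  have dA: "dfn (\<lambda>e. A (e 0))" unfolding A_def by (intro dfn_intros \<sigma> \<tau> poset_M)
  have "\<exists>r\<in>G. (fsub r \<sigma> \<tau> \<or> A r) \<and> le r one"
  proof (rule G_meets[OF one_G])
    show "dfn (\<lambda>e. fsub (e 0) \<sigma> \<tau> \<or> A (e 0))" by (intro dfn_disj dA dfn_intros \<sigma> \<tau>)
    fix q assume q: "q \<in> elts P"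
    show "\<exists>r\<in>elts P. le r q \<and> (fsub r \<sigma> \<tau> \<or> A r)"
    proof (cases "fsub q \<sigma> \<tau>")
      case True then show ?thesis using q le_refl by blast
    next
      case False
      then obtain \<rho> s r where r: "\<rho> \<in> elts (hdom \<sigma>)" "s \<in> elts P" "hpair \<rho> s \<in> elts \<sigma>" "r \<in> elts P" "le r q" "le r s"
        "\<not> (\<exists>u\<in>elts P. le u r \<and> fwit u \<rho> \<tau>)" unfolding fsub_def by blast
      then have "A r" unfolding A_def by blast
      then show ?thesis using r by blast
    qed
  qed
  then obtain r where r: "r \<in> G" "fsub r \<sigma> \<tau> \<or> A r" by blast
  have "\<not> A r"
  proof
    assume "A r"
    then obtain \<rho> s where s: "\<rho> \<in> elts (hdom \<sigma>)" "s \<in> elts P" "hpair \<rho> s \<in> elts \<sigma>" "le r s" "\<forall>u\<in>elts P. le u r \<longrightarrow> \<not> fwit u \<rho> \<tau>"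
      unfolding A_def by blast
    have "s \<in> G" using G_up[OF r(1) s(2,4)] .
    then have "val G \<rho> \<in> elts (val G \<sigma>)" using s(1,3) unfolding mem_val[of "val G \<rho>" \<sigma>] by blast
    then have "val G \<rho> \<in> elts (val G \<tau>)" using sub by blast
    then obtain \<pi> t where t: "\<pi> \<in> elts (hdom \<tau>)" "t \<in> G" "hpair \<pi> t \<in> elts \<tau>" "val G \<rho> = val G \<pi>" unfolding mem_val by blast
    obtain p where p: "p \<in> G" "feq p \<rho> \<pi>" using IH[OF s(1) t(1)] t(4) by blast
    obtain u where u: "u \<in> G" "le u r" "le u p" "le u t" using G_dir3[OF r(1) p(1) t(2)] by blast
    have "feq u \<rho> \<pi>" using feq_mono[OF p(2) u(3) G_P[OF u(1)]] .
    then have "fwit u \<rho> \<tau>" unfolding fwit_def using t u(4) G_P by blast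
    then show False using s(5) u(1,2) G_P by blast
  qed
  then show "\<exists>p\<in>G. fsub p \<sigma> \<tau>" using r by blast
qed

lemma feq_truth: "\<sigma> \<in> M \<Longrightarrow> \<tau> \<in> M \<Longrightarrow> (\<exists>p\<in>G. feq p \<sigma> \<tau>) \<longleftrightarrow> val G \<sigma> = val G \<tau>"
proof (induction \<sigma> arbitrary: \<tau> rule: wf_induct_rule[OF wf_hdom])
  case (1 \<sigma>)
  have IH: "(\<exists>p\<in>G. feq p \<rho> \<pi>) \<longleftrightarrow> val G \<rho> = val G \<pi>" if "\<rho> \<in> elts (hdom \<sigma>)" "\<pi> \<in> elts (hdom \<tau>)" for \<rho> \<pi>
  proof -
    have "\<rho> \<in> M" "\<pi> \<in> M" using M_trans[OF that(1) hdom_in_M[OF 1(2)]] M_trans[OF that(2) hdom_in_M[OF 1(3)]] by auto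
    moreover have "(\<rho>, \<sigma>) \<in> {(\<rho>, \<sigma>). \<rho> \<in> elts (hdom \<sigma>)}" using that(1) by blast
    ultimately show ?thesis using 1(1) by blast
  qed
  have a: "(\<exists>p\<in>G. fsub p \<sigma> \<tau>) \<longleftrightarrow> elts (val G \<sigma>) \<subseteq> elts (val G \<tau>)"
    by (rule fsub_truth0[OF 1(2,3) IH])
  have b: "(\<exists>p\<in>G. fsub p \<tau> \<sigma>) \<longleftrightarrow> elts (val G \<tau>) \<subseteq> elts (val G \<sigma>)"
  proof (rule fsub_truth0[OF 1(3,2)])
    show "(\<exists>p\<in>G. feq p \<rho> \<pi>) \<longleftrightarrow> val G \<rho> = val G \<pi>" if "\<rho> \<in> elts (hdom \<tau>)" "\<pi> \<in> elts (hdom \<sigma>)" for \<rho> \<pi>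
      using IH[OF that(2,1)] feq_sym by metis
  qed
  have "(\<exists>p\<in>G. feq p \<sigma> \<tau>) \<longleftrightarrow> (\<exists>p\<in>G. fsub p \<sigma> \<tau>) \<and> (\<exists>p\<in>G. fsub p \<tau> \<sigma>)"
  proof
    assume "(\<exists>p\<in>G. fsub p \<sigma> \<tau>) \<and> (\<exists>p\<in>G. fsub p \<tau> \<sigma>)"
    then obtain p q where pq: "p \<in> G" "q \<in> G" "fsub p \<sigma> \<tau>" "fsub q \<tau> \<sigma>" by blast
    obtain u where "u \<in> G" "le u p" "le u q" using G_dir[OF pq(1,2)] by blast
    then show "\<exists>p\<in>G. feq p \<sigma> \<tau>" unfolding feq_iff using fsub_mono[OF pq(3)] fsub_mono[OF pq(4)] G_P by blast
  qed (auto simp: feq_iff)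
  also have "\<dots> \<longleftrightarrow> elts (val G \<sigma>) = elts (val G \<tau>)" unfolding a b by blast
  also have "\<dots> \<longleftrightarrow> val G \<sigma> = val G \<tau>" using hc_eqI[of "val G \<sigma>" "val G \<tau>"] by auto
  finally show ?case .
qed

lemma fsub_truth: assumes "\<sigma> \<in> M" "\<tau> \<in> M" shows "(\<exists>p\<in>G. fsub p \<sigma> \<tau>) \<longleftrightarrow> elts (val G \<sigma>) \<subseteq> elts (val G \<tau>)"
proof (rule fsub_truth0[OF assms])
  show "(\<exists>p\<in>G. feq p \<rho> \<pi>) \<longleftrightarrow> val G \<rho> = val G \<pi>" if "\<rho> \<in> elts (hdom \<sigma>)" "\<pi> \<in> elts (hdom \<tau>)" for \<rho> \<pi>
    by (rule feq_truth[OF M_trans[OF that(1) hdom_in_M[OF assms(1)]] M_trans[OF that(2) hdom_in_M[OF assms(2)]]])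
qed

lemma fmem_truth: assumes \<sigma>: "\<sigma> \<in> M" and \<tau>: "\<tau> \<in> M"
  shows "(\<exists>p\<in>G. fmem p \<sigma> \<tau>) \<longleftrightarrow> val G \<sigma> \<in> elts (val G \<tau>)"
proof
  assume "\<exists>p\<in>G. fmem p \<sigma> \<tau>"
  then obtain p where p: "p \<in> G" "fmem p \<sigma> \<tau>" by blast
  have "\<exists>r\<in>G. fwit r \<sigma> \<tau> \<and> le r p"
  proof (rule G_meets[OF p(1)])
    show "dfn (\<lambda>e. fwit (e 0) \<sigma> \<tau>)" by (intro dfn_intros \<sigma> \<tau>)
  qed (use p(2) in \<open>auto simp: fmem_def\<close>)
  then obtain r \<pi> t where r: "r \<in> G" "\<pi> \<in> elts (hdom \<tau>)" "t \<in> elts P" "hpair \<pi> t \<in> elts \<tau>" "le r t" "feq r \<sigma> \<pi>"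
    unfolding fwit_def by blast
  have "\<pi> \<in> M" using M_trans[OF r(2) hdom_in_M[OF \<tau>]] .
  then have "val G \<sigma> = val G \<pi>" using feq_truth[OF \<sigma>] r by blast
  then show "val G \<sigma> \<in> elts (val G \<tau>)" unfolding mem_val using r(2,4) G_up[OF r(1,3,5)] by blast
next
  assume "val G \<sigma> \<in> elts (val G \<tau>)"
  then obtain \<pi> t where t: "\<pi> \<in> elts (hdom \<tau>)" "t \<in> G" "hpair \<pi> t \<in> elts \<tau>" "val G \<sigma> = val G \<pi>" unfolding mem_val by blast
  have "\<pi> \<in> M" using M_trans[OF t(1) hdom_in_M[OF \<tau>]] .
  then obtain p where p: "p \<in> G" "feq p \<sigma> \<pi>" using feq_truth[OF \<sigma>] t(4) by blast
  obtain u where u: "u \<in> G" "le u p" "le u t" using G_dir[OF p(1) t(2)] by blast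
  have "feq u \<sigma> \<pi>" using feq_mono[OF p(2) u(2) G_P[OF u(1)]] .
  then have "fwit u \<sigma> \<tau>" unfolding fwit_def using t u(3) G_P by blast
  then show "\<exists>p\<in>G. fmem p \<sigma> \<tau>" using u(1) fwit_fmem by blast
qed

abbreviation N :: "hc set" where "N \<equiv> generic_ext M P G"

text \<open>
  \<open>val\<close> ignores the elements of a set that are not pairs with second component in the forcing;
  \<open>cl\<close> deletes them hereditarily, so that every element of the model may serve as a name.
\<close>

definition cl :: "hc \<Rightarrow> hc" where
  "cl = hrec hdom (\<lambda>\<tau> f. mk ((\<lambda>z. hpair (ap f (hfst z)) (hsnd z)) ` elts (mk {z \<in> elts \<tau>. hsnd z \<in> elts P \<and> hpair (hfst z) (hsnd z) = z})))"

lemma wf_hdom': "wf {(y, x). y \<in> elts (hdom x)}" using wf_hdom .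

lemma elts_cl: "elts (cl \<tau>) = {hpair (cl \<sigma>) p |\<sigma> p. hpair \<sigma> p \<in> elts \<tau> \<and> p \<in> elts P}"
proof -
  have "elts (cl \<tau>) = (\<lambda>z. hpair (ap (lam (hdom \<tau>) cl) (hfst z)) (hsnd z)) ` {z \<in> elts \<tau>. hsnd z \<in> elts P \<and> hpair (hfst z) (hsnd z) = z}"
    unfolding cl_def by (subst hrec_unfold[OF wf_hdom']) simp
  also have "\<dots> = (\<lambda>z. hpair (cl (hfst z)) (hsnd z)) ` {z \<in> elts \<tau>. hsnd z \<in> elts P \<and> hpair (hfst z) (hsnd z) = z}"
  proof (rule image_cong[OF refl])
    fix z assume "z \<in> {z \<in> elts \<tau>. hsnd z \<in> elts P \<and> hpair (hfst z) (hsnd z) = z}"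
    then have "hpair (hfst z) (hsnd z) \<in> elts \<tau>" by simp
    then have "hfst z \<in> elts (hdom \<tau>)" by auto
    then show "hpair (ap (lam (hdom \<tau>) cl) (hfst z)) (hsnd z) = hpair (cl (hfst z)) (hsnd z)" by (simp del: elts_hdom)
  qed
  also have "\<dots> = {hpair (cl \<sigma>) p |\<sigma> p. hpair \<sigma> p \<in> elts \<tau> \<and> p \<in> elts P}"
  proof (intro equalityI subsetI)
    fix x assume "x \<in> {hpair (cl \<sigma>) p |\<sigma> p. hpair \<sigma> p \<in> elts \<tau> \<and> p \<in> elts P}"
    then obtain \<sigma> p where "x = hpair (cl \<sigma>) p" "hpair \<sigma> p \<in> elts \<tau>" "p \<in> elts P" by blast
    then show "x \<in> (\<lambda>z. hpair (cl (hfst z)) (hsnd z)) ` {z \<in> elts \<tau>. hsnd z \<in> elts P \<and> hpair (hfst z) (hsnd z) = z}"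
      by (intro image_eqI[of _ _ "hpair \<sigma> p"]) simp_all
  next
    fix x assume "x \<in> (\<lambda>z. hpair (cl (hfst z)) (hsnd z)) ` {z \<in> elts \<tau>. hsnd z \<in> elts P \<and> hpair (hfst z) (hsnd z) = z}"
    then obtain z where z: "x = hpair (cl (hfst z)) (hsnd z)" "z \<in> elts \<tau>" "hsnd z \<in> elts P" "hpair (hfst z) (hsnd z) = z" by blast
    then have "hpair (hfst z) (hsnd z) \<in> elts \<tau>" by simp
    then show "x \<in> {hpair (cl \<sigma>) p |\<sigma> p. hpair \<sigma> p \<in> elts \<tau> \<and> p \<in> elts P}" using z(1,3) by blast
  qed
  finally show ?thesis .
qed

lemma cl_in_M: assumes "\<tau> \<in> M" shows "cl \<tau> \<in> M"
proof (rule dft1_M[of cl, OF _ assms])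
  show "dft (\<lambda>e. cl (e 0))" unfolding cl_def by (rule dft_hrec[OF _ _ wf_hdom']) (intro dfn_intros poset_M)+
qed

lemma pname_cl: "pname P (cl \<tau>)"
proof (induction \<tau> rule: wf_induct_rule[OF wf_hdom])
  case (1 \<tau>)
  show ?case
  proof (rule pname.intros)
    fix z assume "z \<in> elts (cl \<tau>)"
    then obtain \<sigma> p where s: "z = hpair (cl \<sigma>) p" "hpair \<sigma> p \<in> elts \<tau>" "p \<in> elts P" unfolding elts_cl by blast
    then have "pname P (cl \<sigma>)" using 1 by auto
    then show "\<exists>\<sigma> p. z = hpair \<sigma> p \<and> p \<in> elts P \<and> pname P \<sigma>" using s by blast
  qed
qed

lemma val_cl: "val G (cl \<tau>) = val G \<tau>"
proof (induction \<tau> rule: wf_induct_rule[OF wf_hdom])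
  case (1 \<tau>)
  have IH: "val G (cl \<sigma>) = val G \<sigma>" if "hpair \<sigma> p \<in> elts \<tau>" for \<sigma> p using 1 that by auto
  show ?case
  proof (rule hc_eqI, intro equalityI subsetI)
    fix v assume "v \<in> elts (val G (cl \<tau>))"
    then obtain \<sigma> p where "v = val G (cl \<sigma>)" "p \<in> G" "hpair \<sigma> p \<in> elts \<tau>" unfolding elts_val elts_cl by auto
    then show "v \<in> elts (val G \<tau>)" unfolding elts_val using IH by blast
  next
    fix v assume "v \<in> elts (val G \<tau>)"
    then obtain \<sigma> p where s: "v = val G \<sigma>" "p \<in> G" "hpair \<sigma> p \<in> elts \<tau>" unfolding elts_val by auto
    then have "hpair (cl \<sigma>) p \<in> elts (cl \<tau>)" unfolding elts_cl using G_P by blast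
    then show "v \<in> elts (val G (cl \<tau>))" unfolding elts_val
      using IH[OF s(3)] s(1,2) by (intro CollectI exI[of _ "cl \<sigma>"]) auto
  qed
qed

lemma N_eq: "N = val G ` M"
proof (intro equalityI subsetI)
  fix x assume "x \<in> val G ` M"
  then obtain \<tau> where t: "\<tau> \<in> M" "x = val G \<tau>" by blast
  then have "x = val G (cl \<tau>)" "cl \<tau> \<in> M" "pname P (cl \<tau>)" using val_cl cl_in_M pname_cl by auto
  then show "x \<in> N" unfolding generic_ext_def by blast
qed (auto simp: generic_ext_def)

lemma val_in_N: "\<tau> \<in> M \<Longrightarrow> val G \<tau> \<in> N" unfolding N_eq by blast

lemma N_name: assumes "x \<in> N" obtains \<tau> where "\<tau> \<in> M" "x = val G \<tau>" using assms unfolding N_eq by blast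

lemma countable_N: "countable N" unfolding N_eq using countable_M by simp

lemma transitive_N: "x \<in> N \<Longrightarrow> elts x \<subseteq> N"
proof
  fix v assume "x \<in> N" "v \<in> elts x"
  then obtain \<tau> where t: "\<tau> \<in> M" "v \<in> elts (val G \<tau>)" unfolding N_eq by blast
  then obtain \<sigma> p where "hpair \<sigma> p \<in> elts \<tau>" "v = val G \<sigma>" unfolding elts_val by blast
  then show "v \<in> N" using M_trans_pair[OF _ t(1)] val_in_N by blast
qed

lemma Frc_truth: "range e \<subseteq> M \<Longrightarrow> sat N (\<lambda>i. val G (e i)) \<phi> \<longleftrightarrow> (\<exists>p\<in>G. Frc \<phi> p e)"
proof (induction \<phi> arbitrary: e)
  case (FMem i j)
  have "e i \<in> M" "e j \<in> M" using FMem by auto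
  then show ?case using fmem_truth by simp
next
  case (FEq i j)
  have "e i \<in> M" "e j \<in> M" using FEq by auto
  then show ?case using feq_truth by simp
next
  case (FNeg \<phi>)
  have d: "dfn (\<lambda>e'. Frc \<phi> (e' 0) e)"
    by (rule dfn_Frc[of "\<lambda>e. e 0" "\<lambda>i _. e i"]) (use FNeg.prems in \<open>auto intro: dft_var dft_const\<close>)
  have "(\<exists>p\<in>G. Frc (FNeg \<phi>) p e) \<longleftrightarrow> \<not> (\<exists>p\<in>G. Frc \<phi> p e)"
  proof
    assume "\<exists>p\<in>G. Frc (FNeg \<phi>) p e"
    then obtain p where p: "p \<in> G" "\<And>q. q \<in> elts P \<Longrightarrow> le q p \<Longrightarrow> \<not> Frc \<phi> q e" by auto
    show "\<not> (\<exists>p\<in>G. Frc \<phi> p e)"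
    proof
      assume "\<exists>p\<in>G. Frc \<phi> p e"
      then obtain q where q: "q \<in> G" "Frc \<phi> q e" by blast
      obtain u where u: "u \<in> G" "le u p" "le u q" using G_dir[OF p(1) q(1)] by blast
      then show False using p(2) Frc_mono[OF q(2) u(3)] G_P by blast
    qed
  next
    assume no: "\<not> (\<exists>p\<in>G. Frc \<phi> p e)"
    define Q where "Q p \<longleftrightarrow> Frc \<phi> p e \<or> (\<forall>q\<in>elts P. le q p \<longrightarrow> \<not> Frc \<phi> q e)" for p
    have "\<exists>r\<in>G. Q r \<and> le r one"
    proof (rule G_meets[OF one_G])
      show "dfn (\<lambda>e. Q (e 0))" unfolding Q_def
        by (intro dfn_intros d dfn1[of "\<lambda>p. Frc \<phi> p e", OF d] poset_M)
      show "\<exists>r\<in>elts P. le r q \<and> Q r" if "q \<in> elts P" for q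
        using that le_refl unfolding Q_def by blast
    qed
    then show "\<exists>p\<in>G. Frc (FNeg \<phi>) p e" using no unfolding Q_def by auto
  qed
  then show ?case using FNeg by simp
next
  case (FConj \<phi> \<psi>)
  have "(\<exists>p\<in>G. Frc (FConj \<phi> \<psi>) p e) \<longleftrightarrow> (\<exists>p\<in>G. Frc \<phi> p e) \<and> (\<exists>p\<in>G. Frc \<psi> p e)"
  proof
    assume "(\<exists>p\<in>G. Frc \<phi> p e) \<and> (\<exists>p\<in>G. Frc \<psi> p e)"
    then obtain p q where pq: "p \<in> G" "q \<in> G" "Frc \<phi> p e" "Frc \<psi> q e" by blast
    obtain u where u: "u \<in> G" "le u p" "le u q" using G_dir[OF pq(1,2)] by blast
    then show "\<exists>p\<in>G. Frc (FConj \<phi> \<psi>) p e" using Frc_mono[OF pq(3) u(2)] Frc_mono[OF pq(4) u(3)] G_P by auto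
  qed auto
  then show ?case using FConj by simp
next
  case (FAll n \<phi>)
  have upd: "(\<lambda>i. val G (e i))(n := val G x) = (\<lambda>i. val G ((e(n := x)) i))" for x by auto
  have rg: "range (e(n := x)) \<subseteq> M" if "x \<in> M" for x using FAll.prems that by auto
  have eM: "e i \<in> M" for i using FAll.prems by auto
  have d: "dfn (\<lambda>e'. Frc \<phi> (e' 0) (e(n := e' 1)))"
  proof -
    have "dfn (\<lambda>e'. Frc \<phi> (e' 0) (\<lambda>i. if i = n then e' 1 else e i))"
      by (rule dfn_Frc[of "\<lambda>e. e 0" "\<lambda>i e'. if i = n then e' 1 else e i"])
        (intro dft_if dfn_const dft_var dft_const eM)+
    then show ?thesis unfolding fun_upd_def .
  qed
  have "(\<forall>x\<in>M. \<exists>p\<in>G. Frc \<phi> p (e(n := x))) \<Longrightarrow> \<exists>p\<in>G. Frc (FAll n \<phi>) p e"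
  proof -
    assume all: "\<forall>x\<in>M. \<exists>p\<in>G. Frc \<phi> p (e(n := x))"
    note d' = dfn2[of "\<lambda>p x. Frc \<phi> p (e(n := x))", OF d]
    \<comment> \<open>With \<open>B\<close> some instance is refuted for good, with \<open>A\<close>
      all instances are forced. By \<open>Frc_dense\<close> one of the two can always be reached,
      and \<open>B\<close> within \<open>G\<close> would contradict the truth of that
      instance.\<close>
    define B where "B p \<longleftrightarrow> (\<exists>x\<in>M. \<forall>q\<in>elts P. le q p \<longrightarrow> \<not> Frc \<phi> q (e(n := x)))" for p
    define A where "A p \<longleftrightarrow> (\<forall>x\<in>M. Frc \<phi> p (e(n := x)))" for p
    have "\<exists>r\<in>G. (A r \<or> B r) \<and> le r one"
    proof (rule G_meets[OF one_G])
      show "dfn (\<lambda>e. A (e 0) \<or> B (e 0))" unfolding A_def B_def by (intro dfn_intros d' poset_M)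
      fix q assume q: "q \<in> elts P"
      show "\<exists>r\<in>elts P. le r q \<and> (A r \<or> B r)"
      proof (cases "A q")
        case False
        then obtain x where x: "x \<in> M" "\<not> Frc \<phi> q (e(n := x))" unfolding A_def by blast
        then obtain r where r: "r \<in> elts P" "le r q" "\<not> (\<exists>u\<in>elts P. le u r \<and> Frc \<phi> u (e(n := x)))"
          using Frc_dense[OF q] by blast
        then have "B r" unfolding B_def using x(1) by blast
        then show ?thesis using r by blast
      qed (use q le_refl in blast)
    qed
    then obtain r where r: "r \<in> G" "A r \<or> B r" by blast
    have "\<not> B r"
    proof
      assume "B r"
      then obtain x where x: "x \<in> M" "\<And>q. q \<in> elts P \<Longrightarrow> le q r \<Longrightarrow> \<not> Frc \<phi> q (e(n := x))" unfolding B_def by blast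
      obtain p where p: "p \<in> G" "Frc \<phi> p (e(n := x))" using all x(1) by blast
      obtain u where u: "u \<in> G" "le u r" "le u p" using G_dir[OF r(1) p(1)] by blast
      then show False using x(2) Frc_mono[OF p(2) u(3)] G_P by blast
    qed
    then show "\<exists>p\<in>G. Frc (FAll n \<phi>) p e" using r unfolding A_def by auto
  qed
  then have "(\<exists>p\<in>G. Frc (FAll n \<phi>) p e) \<longleftrightarrow> (\<forall>x\<in>M. \<exists>p\<in>G. Frc \<phi> p (e(n := x)))" by auto
  also have "\<dots> \<longleftrightarrow> (\<forall>x\<in>M. sat N (\<lambda>i. val G ((e(n := x)) i)) \<phi>)" using FAll.IH[OF rg] by blast
  also have "\<dots> \<longleftrightarrow> sat N (\<lambda>i. val G (e i)) (FAll n \<phi>)" unfolding N_eq by (simp add: upd[symmetric] del: fun_upd_apply)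
  finally show ?case by blast
qed

text \<open>The standard name for a subset: each name in \<open>A\<close> is paired with all
  conditions that force the property of it.\<close>

definition ncompr :: "hc \<Rightarrow> (hc \<Rightarrow> hc \<Rightarrow> bool) \<Rightarrow> hc" where
  "ncompr A Q = mk {z \<in> elts (hprod A P). Q (hsnd z) (hfst z)}"

lemma ncompr_in_M: assumes "A \<in> M" "dfn (\<lambda>e. Q (e 0) (e 1))" shows "ncompr A Q \<in> M"
  unfolding ncompr_def
  by (rule sep_in_M) (use assms(1) poset_M in simp, intro dfn2[of Q, OF assms(2)] dfn_intros)

lemma hpair_in_ncompr: "hpair \<sigma> p \<in> elts (ncompr A Q) \<longleftrightarrow> \<sigma> \<in> elts A \<and> p \<in> elts P \<and> Q p \<sigma>"
proof -
  have "elts (ncompr A Q) = {z \<in> elts (hprod A P). Q (hsnd z) (hfst z)}" unfolding ncompr_def by (rule elts_mk) (intro countable_Collect countable_elts)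
  then show ?thesis by auto
qed

lemma elts_val_ncompr: "elts (val G (ncompr A Q)) = {val G \<sigma> |\<sigma>. \<sigma> \<in> elts A \<and> (\<exists>p\<in>G. Q p \<sigma>)}"
  unfolding elts_val hpair_in_ncompr using G_P by blast

lemma G_conj:
  assumes "\<exists>p\<in>G. X p" "\<exists>p\<in>G. Y p" "\<And>p q. X p \<Longrightarrow> le q p \<Longrightarrow> q \<in> elts P \<Longrightarrow> X q" "\<And>p q. Y p \<Longrightarrow> le q p \<Longrightarrow> q \<in> elts P \<Longrightarrow> Y q"
  shows "\<exists>p\<in>G. X p \<and> Y p"
proof -
  obtain p q where pq: "p \<in> G" "q \<in> G" "X p" "Y q" using assms by blast
  obtain u where "u \<in> G" "le u p" "le u q" using G_dir[OF pq(1,2)] by blast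
  then show ?thesis using assms(3)[OF pq(3)] assms(4)[OF pq(4)] G_P by blast
qed

lemma val_mem_hdom: "x \<in> elts (val G \<tau>) \<Longrightarrow> \<exists>\<sigma>\<in>elts (hdom \<tau>). x = val G \<sigma>"
  unfolding mem_val by blast

section \<open>The axioms of ZFC in the generic extension\<close>

lemma separation_N: "separation_ax N"
  unfolding separation_ax_def
proof (intro allI impI ballI)
  fix \<phi> :: fm and e :: "nat \<Rightarrow> hc" and a assume e: "range e \<subseteq> N" and a: "a \<in> N"
  have "\<forall>i. \<exists>\<tau>. \<tau> \<in> M \<and> e i = val G \<tau>" using e unfolding N_eq by blast
  then obtain n where n: "\<And>i. n i \<in> M" "\<And>i. e i = val G (n i)" by metis
  obtain \<tau> where \<tau>: "\<tau> \<in> M" "a = val G \<tau>" using a by (rule N_name)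
  define Q where "Q p \<sigma> \<longleftrightarrow> fmem p \<sigma> \<tau> \<and> Frc \<phi> p (n(0 := \<sigma>))" for p \<sigma>
  have d: "dfn (\<lambda>e'. Frc \<phi> (e' 0) (n(0 := e' 1)))"
  proof -
    have "dfn (\<lambda>e'. Frc \<phi> (e' 0) (\<lambda>i. if i = 0 then e' 1 else n i))"
      by (rule dfn_Frc[of "\<lambda>e. e 0" "\<lambda>i e'. if i = 0 then e' 1 else n i"]) (intro dft_if dfn_const dft_var dft_const n)+
    then show ?thesis unfolding fun_upd_def .
  qed
  have dQ: "dfn (\<lambda>e. Q (e 0) (e 1))" unfolding Q_def by (intro dfn_intros d \<tau>)
  let ?b = "val G (ncompr (hdom \<tau>) Q)"
  have b: "?b \<in> N" using val_in_N ncompr_in_M[OF _ dQ] \<tau>(1) by simp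
  have "x \<in> elts ?b \<longleftrightarrow> x \<in> elts a \<and> sat N (e(0 := x)) \<phi>" for x
  proof -
    have tr: "(\<exists>p\<in>G. Q p \<sigma>) \<longleftrightarrow> val G \<sigma> \<in> elts a \<and> sat N (e(0 := val G \<sigma>)) \<phi>" if s: "\<sigma> \<in> M" for \<sigma>
    proof -
      have "(\<lambda>i. val G ((n(0 := \<sigma>)) i)) = e(0 := val G \<sigma>)" using n(2) by auto
      moreover have "range (n(0 := \<sigma>)) \<subseteq> M" using n s by auto
      ultimately have 1: "(\<exists>p\<in>G. Frc \<phi> p (n(0 := \<sigma>))) \<longleftrightarrow> sat N (e(0 := val G \<sigma>)) \<phi>" using Frc_truth[of "n(0 := \<sigma>)" \<phi>] by simp
      have 2: "(\<exists>p\<in>G. fmem p \<sigma> \<tau>) \<longleftrightarrow> val G \<sigma> \<in> elts a" using fmem_truth[OF s \<tau>(1)] \<tau>(2) by simp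
      have "(\<exists>p\<in>G. Q p \<sigma>) \<longleftrightarrow> (\<exists>p\<in>G. fmem p \<sigma> \<tau>) \<and> (\<exists>p\<in>G. Frc \<phi> p (n(0 := \<sigma>)))"
      proof
        assume "(\<exists>p\<in>G. fmem p \<sigma> \<tau>) \<and> (\<exists>p\<in>G. Frc \<phi> p (n(0 := \<sigma>)))"
        then have "\<exists>p\<in>G. fmem p \<sigma> \<tau>" "\<exists>p\<in>G. Frc \<phi> p (n(0 := \<sigma>))" by blast+
        then show "\<exists>p\<in>G. Q p \<sigma>" unfolding Q_def by (rule G_conj) (erule fmem_mono Frc_mono, assumption+)+
      qed (auto simp: Q_def)
      then show ?thesis using 1 2 by blast
    qed
    have hM: "\<sigma> \<in> M" if "\<sigma> \<in> elts (hdom \<tau>)" for \<sigma> using M_trans[OF that hdom_in_M[OF \<tau>(1)]] .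
    show ?thesis
    proof
      assume "x \<in> elts ?b"
      then show "x \<in> elts a \<and> sat N (e(0 := x)) \<phi>" unfolding elts_val_ncompr using tr hM by blast
    next
      assume x: "x \<in> elts a \<and> sat N (e(0 := x)) \<phi>"
      then obtain \<sigma> where "\<sigma> \<in> elts (hdom \<tau>)" "x = val G \<sigma>" using val_mem_hdom \<tau>(2) by blast
      then show "x \<in> elts ?b" unfolding elts_val_ncompr using x tr hM by blast
    qed
  qed
  then show "\<exists>b\<in>N. \<forall>x\<in>N. (x \<in> elts b) = (x \<in> elts a \<and> sat N (e(0 := x)) \<phi>)" using b by blast
qed

lemma replacement_N: "replacement_ax N"
  unfolding replacement_ax_def
proof (intro allI impI ballI)
  fix \<phi> :: fm and e :: "nat \<Rightarrow> hc" and a assume e: "range e \<subseteq> N" and a: "a \<in> N"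
    and fn: "\<forall>x\<in>N. \<forall>y\<in>N. \<forall>y'\<in>N. x \<in> elts a \<and> sat N (e(0 := x, 1 := y)) \<phi> \<and> sat N (e(0 := x, 1 := y')) \<phi> \<longrightarrow> y = y'"
  have "\<forall>i. \<exists>\<tau>. \<tau> \<in> M \<and> e i = val G \<tau>" using e unfolding N_eq by blast
  then obtain n where n: "\<And>i. n i \<in> M" "\<And>i. e i = val G (n i)" by metis
  obtain \<tau> where \<tau>: "\<tau> \<in> M" "a = val G \<tau>" using a by (rule N_name)
  define X where "X p \<sigma> \<rho> \<longleftrightarrow> Frc \<phi> p (n(0 := \<sigma>, 1 := \<rho>))" for p \<sigma> \<rho>
  have d: "dfn (\<lambda>e'. X (e' 0) (e' 1) (e' 2))"
  proof -
    have "dfn (\<lambda>e'. Frc \<phi> (e' 0) (\<lambda>i. if i = 1 then e' 2 else if i = 0 then e' 1 else n i))"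
      by (rule dfn_Frc[of "\<lambda>e. e 0" "\<lambda>i e'. if i = 1 then e' 2 else if i = 0 then e' 1 else n i"]) (intro dft_if dfn_const dft_var dft_const n)+
    then show ?thesis unfolding fun_upd_def X_def .
  qed
  note d' = dfn3[of X, OF d]
  have trX: "(\<exists>p\<in>G. X p \<sigma> \<rho>) \<longleftrightarrow> sat N (e(0 := val G \<sigma>, 1 := val G \<rho>)) \<phi>" if s: "\<sigma> \<in> M" "\<rho> \<in> M" for \<sigma> \<rho>
  proof -
    have "(\<lambda>i. val G ((n(0 := \<sigma>, 1 := \<rho>)) i)) = e(0 := val G \<sigma>, 1 := val G \<rho>)" using n(2) by auto
    moreover have "range (n(0 := \<sigma>, 1 := \<rho>)) \<subseteq> M" using n s by auto
    ultimately show ?thesis using Frc_truth[of "n(0 := \<sigma>, 1 := \<rho>)" \<phi>] unfolding X_def by simp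
  qed
  have Xmono: "X q \<sigma> \<rho>" if "X p \<sigma> \<rho>" "le q p" "q \<in> elts P" for p q \<sigma> \<rho> using Frc_mono that unfolding X_def by blast
  \<comment> \<open>Collection in the ground model bounds the names needed for the values. The
    implication makes a witness available also where no value is forced.\<close>
  have "\<exists>B\<in>M. \<forall>z\<in>elts (hprod (hdom \<tau>) P). \<exists>\<rho>\<in>elts B. (\<exists>\<pi>\<in>M. X (hsnd z) (hfst z) \<pi>) \<longrightarrow> X (hsnd z) (hfst z) \<rho>"
  proof (rule collection)
    show "hprod (hdom \<tau>) P \<in> M" using \<tau>(1) poset_M by simp
    show "dfn (\<lambda>e. (\<exists>\<pi>\<in>M. X (hsnd (e 0)) (hfst (e 0)) \<pi>) \<longrightarrow> X (hsnd (e 0)) (hfst (e 0)) (e 1))" by (intro dfn_intros d')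
  qed (use M_ne in blast)
  then obtain B where B: "B \<in> M" "\<And>\<sigma> p. \<sigma> \<in> elts (hdom \<tau>) \<Longrightarrow> p \<in> elts P \<Longrightarrow> \<exists>\<rho>\<in>elts B. (\<exists>\<pi>\<in>M. X p \<sigma> \<pi>) \<longrightarrow> X p \<sigma> \<rho>"
    by (fastforce simp del: elts_hdom)
  define Q where "Q p \<rho> \<longleftrightarrow> (\<exists>\<sigma>\<in>elts (hdom \<tau>). fmem p \<sigma> \<tau> \<and> X p \<sigma> \<rho>)" for p \<rho>
  have dQ: "dfn (\<lambda>e. Q (e 0) (e 1))" unfolding Q_def by (intro dfn_intros d' \<tau>)
  let ?b = "val G (ncompr B Q)"
  have b: "?b \<in> N" using val_in_N ncompr_in_M[OF B(1) dQ] by simp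
  have hM: "\<sigma> \<in> M" if "\<sigma> \<in> elts (hdom \<tau>)" for \<sigma> using M_trans[OF that hdom_in_M[OF \<tau>(1)]] .
  have tr: "(\<exists>p\<in>G. Q p \<rho>) \<longleftrightarrow> (\<exists>x\<in>elts a. sat N (e(0 := x, 1 := val G \<rho>)) \<phi>)" if r: "\<rho> \<in> M" for \<rho>
  proof
    assume "\<exists>p\<in>G. Q p \<rho>"
    then obtain p \<sigma> where p: "p \<in> G" "\<sigma> \<in> elts (hdom \<tau>)" "fmem p \<sigma> \<tau>" "X p \<sigma> \<rho>" unfolding Q_def by blast
    have "val G \<sigma> \<in> elts a" using fmem_truth[OF hM[OF p(2)] \<tau>(1)] p \<tau>(2) by blast
    moreover have "sat N (e(0 := val G \<sigma>, 1 := val G \<rho>)) \<phi>" using trX[OF hM[OF p(2)] r] p by blast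
    ultimately show "\<exists>x\<in>elts a. sat N (e(0 := x, 1 := val G \<rho>)) \<phi>" by blast
  next
    assume "\<exists>x\<in>elts a. sat N (e(0 := x, 1 := val G \<rho>)) \<phi>"
    then obtain x where x: "x \<in> elts a" "sat N (e(0 := x, 1 := val G \<rho>)) \<phi>" by blast
    then obtain \<sigma> where s: "\<sigma> \<in> elts (hdom \<tau>)" "x = val G \<sigma>" using val_mem_hdom \<tau>(2) by blast
    have "\<exists>p\<in>G. fmem p \<sigma> \<tau>" using fmem_truth[OF hM[OF s(1)] \<tau>(1)] s(2) x(1) \<tau>(2) by blast
    moreover have "\<exists>p\<in>G. X p \<sigma> \<rho>" using trX[OF hM[OF s(1)] r] x(2) s(2) by blast
    ultimately have "\<exists>p\<in>G. fmem p \<sigma> \<tau> \<and> X p \<sigma> \<rho>" by (rule G_conj) (erule fmem_mono Xmono, assumption+)+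
    then show "\<exists>p\<in>G. Q p \<rho>" unfolding Q_def using s(1) by blast
  qed
  have "y \<in> elts ?b \<longleftrightarrow> (\<exists>x\<in>N. x \<in> elts a \<and> sat N (e(0 := x, 1 := y)) \<phi>)" if y: "y \<in> N" for y
  proof
    assume "y \<in> elts ?b"
    then obtain \<rho> where r: "\<rho> \<in> elts B" "y = val G \<rho>" "\<exists>p\<in>G. Q p \<rho>" unfolding elts_val_ncompr by blast
    then show "\<exists>x\<in>N. x \<in> elts a \<and> sat N (e(0 := x, 1 := y)) \<phi>"
      using tr[OF M_trans[OF r(1) B(1)]] transitive_N[OF a] by blast
  next
    assume "\<exists>x\<in>N. x \<in> elts a \<and> sat N (e(0 := x, 1 := y)) \<phi>"
    then obtain x where x: "x \<in> elts a" "sat N (e(0 := x, 1 := y)) \<phi>" by blast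
    have xN: "x \<in> N" using transitive_N[OF a] x(1) by blast
    obtain \<sigma> where s: "\<sigma> \<in> elts (hdom \<tau>)" "x = val G \<sigma>" using x(1) val_mem_hdom \<tau>(2) by blast
    obtain \<rho>' where r': "\<rho>' \<in> M" "y = val G \<rho>'" using y by (rule N_name)
    obtain p where p: "p \<in> G" "X p \<sigma> \<rho>'" using trX[OF hM[OF s(1)] r'(1)] x(2) s(2) r'(2) by blast
    then obtain \<rho> where r: "\<rho> \<in> elts B" "X p \<sigma> \<rho>" using B(2)[OF s(1) G_P[OF p(1)]] r'(1) by blast
    have rM: "\<rho> \<in> M" using M_trans[OF r(1) B(1)] .
    have "sat N (e(0 := x, 1 := val G \<rho>)) \<phi>" using trX[OF hM[OF s(1)] rM] p(1) r(2) s(2) by blast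
    then have "y = val G \<rho>" "\<exists>p\<in>G. Q p \<rho>" using fn xN y val_in_N[OF rM] x tr[OF rM] by blast+
    then show "y \<in> elts ?b" unfolding elts_val_ncompr using r(1) by blast
  qed
  then show "\<exists>b\<in>N. \<forall>y\<in>N. (y \<in> elts b) = (\<exists>x\<in>N. x \<in> elts a \<and> sat N (e(0 := x, 1 := y)) \<phi>)" using b by blast
qed

lemma ncompr_subset: "elts (ncompr A Q) \<subseteq> elts (hprod A P)"
proof -
  have "elts (ncompr A Q) = {z \<in> elts (hprod A P). Q (hsnd z) (hfst z)}" unfolding ncompr_def by (rule elts_mk) (intro countable_Collect countable_elts)
  then show ?thesis by blast
qed

text \<open>The canonical name of a ground model set.\<close>

definition chk :: "hc \<Rightarrow> hc" where
  "chk = hrec (\<lambda>x. x) (\<lambda>x f. mk ((\<lambda>y. hpair (ap f y) one) ` elts x))"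

lemma elts_chk: "elts (chk x) = (\<lambda>y. hpair (chk y) one) ` elts x"
  unfolding chk_def by (subst hrec_unfold[OF wf_elts']) simp

lemma dft_chk [dfn_intros]: "dft t \<Longrightarrow> dft (\<lambda>e. chk (t e))"
  unfolding chk_def by (rule dft_hrec[OF _ _ wf_elts']) (intro dfn_intros poset_M | assumption)+

lemma chk_in_M [simp]: "x \<in> M \<Longrightarrow> chk x \<in> M" by (rule dft1_M, rule dft_chk) (intro dfn_intros)

lemma val_chk [simp]: "val G (chk x) = x"
proof (induction x rule: hc_induct)
  case (step x)
  show ?case
  proof (rule hc_eqI, intro equalityI subsetI)
    fix v assume "v \<in> elts (val G (chk x))"
    then show "v \<in> elts x" unfolding elts_val elts_chk using step by auto
  next
    fix v assume v: "v \<in> elts x"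
    show "v \<in> elts (val G (chk x))" unfolding elts_val elts_chk
      using v one_G step[OF v] by (intro CollectI exI[of _ "chk v"]) auto
  qed
qed

lemma M_sub_N: "M \<subseteq> N"
proof
  fix x assume "x \<in> M"
  then have "val G (chk x) \<in> N" by (intro val_in_N) simp
  then show "x \<in> N" by simp
qed

lemma G_in_N: "mk G \<in> N"
proof -
  let ?\<gamma> = "mk ((\<lambda>p. hpair (chk p) p) ` elts P)"
  have "?\<gamma> \<in> M" by (rule repl_in_M[OF P_in_M]) (intro dfn_intros)
  moreover have "elts (val G ?\<gamma>) = G" unfolding elts_val using G_P by force
  then have "val G ?\<gamma> = mk G" by (metis mk_elts)
  ultimately show ?thesis using val_in_N by metis
qed

lemma countable_G [simp]: "countable G"
proof -
  have "G \<subseteq> elts P" using G_P by blast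
  then show ?thesis using countable_elts countable_subset by blast
qed

definition upn :: "hc \<Rightarrow> hc \<Rightarrow> hc" where "upn \<sigma> \<tau> = mk {hpair \<sigma> one, hpair \<tau> one}"

definition opn :: "hc \<Rightarrow> hc \<Rightarrow> hc" where "opn \<sigma> \<tau> = upn (upn \<sigma> \<sigma>) (upn \<sigma> \<tau>)"

lemma val_upn [simp]: "val G (upn \<sigma> \<tau>) = mk {val G \<sigma>, val G \<tau>}"
proof (rule hc_eqI)
  show "elts (val G (upn \<sigma> \<tau>)) = elts (mk {val G \<sigma>, val G \<tau>})"
    unfolding elts_val upn_def using one_G by auto
qed

lemma val_opn [simp]: "val G (opn \<sigma> \<tau>) = hpair (val G \<sigma>) (val G \<tau>)"
  unfolding opn_def hpair_def by simp

lemma dft_upn [dfn_intros]: "dft t \<Longrightarrow> dft s \<Longrightarrow> dft (\<lambda>e. upn (t e) (s e))"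
  unfolding upn_def by (intro dfn_intros poset_M)

lemma dft_opn [dfn_intros]: "dft t \<Longrightarrow> dft s \<Longrightarrow> dft (\<lambda>e. opn (t e) (s e))"
  unfolding opn_def by (intro dfn_intros poset_M)

lemma upn_in_M [simp]: "\<sigma> \<in> M \<Longrightarrow> \<tau> \<in> M \<Longrightarrow> upn \<sigma> \<tau> \<in> M"
  unfolding upn_def using one_in_M by simp

lemma val_image_in_N: assumes A: "A \<in> M" and s: "dft (\<lambda>e. s (e 0))" shows "mk ((\<lambda>x. val G (s x)) ` elts A) \<in> N"
proof -
  let ?\<tau> = "mk ((\<lambda>x. hpair (s x) one) ` elts A)"
  have "?\<tau> \<in> M" by (rule repl_in_M[OF A]) (intro dfn_intros dft1[of s, OF s] poset_M)
  moreover have "elts (val G ?\<tau>) = (\<lambda>x. val G (s x)) ` elts A" unfolding elts_val using one_G by force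
  then have "val G ?\<tau> = mk ((\<lambda>x. val G (s x)) ` elts A)" by (metis mk_elts)
  ultimately show ?thesis using val_in_N by metis
qed

lemma val_lam_in_N: assumes A: "A \<in> M" and s: "dft (\<lambda>e. s (e 0))" shows "lam A (\<lambda>x. val G (s x)) \<in> N"
proof -
  have "mk ((\<lambda>x. val G (opn (chk x) (s x))) ` elts A) \<in> N"
    by (rule val_image_in_N[OF A]) (intro dfn_intros dft1[of s, OF s])
  then show ?thesis unfolding lam_def by simp
qed

lemma zf_model_N: "zf_model N"
proof
  show "countable N" by (rule countable_N)
  show "x \<in> N \<Longrightarrow> elts x \<subseteq> N" for x by (rule transitive_N)
  show "separation_ax N" by (rule separation_N)
  show "replacement_ax N" by (rule replacement_N)
  show "extensionality_ax N" unfolding extensionality_ax_def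
  proof (intro ballI impI)
    fix x y assume xy: "x \<in> N" "y \<in> N" "\<forall>z\<in>N. (z \<in> elts x) = (z \<in> elts y)"
    then show "x = y" using transitive_N[OF xy(1)] transitive_N[OF xy(2)] by (intro hc_eqI) blast
  qed
  show "foundation_ax N" unfolding foundation_ax_def
  proof (intro ballI impI)
    fix x assume x: "x \<in> N" "\<exists>y\<in>N. y \<in> elts x"
    then obtain y where "y \<in> elts x" by blast
    then obtain y where y: "y \<in> elts x" "\<And>z. (z, y) \<in> {(x, y). x \<in> elts y} \<Longrightarrow> z \<notin> elts x" using wfE_min[OF wf_elts] by metis
    then show "\<exists>y\<in>N. y \<in> elts x \<and> \<not> (\<exists>z\<in>N. z \<in> elts x \<and> z \<in> elts y)" using transitive_N[OF x(1)] by blast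
  qed
  show "pairing_ax N" unfolding pairing_ax_def
  proof (intro ballI)
    fix x y assume "x \<in> N" "y \<in> N"
    then obtain \<sigma> \<tau> where s: "\<sigma> \<in> M" "\<tau> \<in> M" "x = val G \<sigma>" "y = val G \<tau>" unfolding N_eq by blast
    have "val G (upn \<sigma> \<tau>) \<in> N" using s by (intro val_in_N) simp
    then show "\<exists>z\<in>N. \<forall>w\<in>N. (w \<in> elts z) = (w = x \<or> w = y)" using s by (intro bexI[of _ "val G (upn \<sigma> \<tau>)"]) auto
  qed
  show "union_ax N" unfolding union_ax_def
  proof (intro ballI)
    fix x assume x: "x \<in> N"
    obtain \<tau> where t: "\<tau> \<in> M" "x = val G \<tau>" using x by (rule N_name)
    define Q where "Q p \<pi> \<longleftrightarrow> (\<exists>\<sigma>\<in>elts (hdom \<tau>). fmem p \<sigma> \<tau> \<and> fmem p \<pi> \<sigma>)" for p \<pi>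
    have dQ: "dfn (\<lambda>e. Q (e 0) (e 1))" unfolding Q_def by (intro dfn_intros t)
    let ?A = "mk (\<Union>\<sigma>\<in>elts (hdom \<tau>). elts (hdom \<sigma>))"
    have A: "?A \<in> M" by (rule UN_in_M) (use t in simp, intro dfn_intros)
    have eA: "elts ?A = (\<Union>\<sigma>\<in>elts (hdom \<tau>). elts (hdom \<sigma>))" by (rule elts_mk) (intro countable_UN countable_elts)
    have b: "val G (ncompr ?A Q) \<in> N" by (rule val_in_N[OF ncompr_in_M[OF A dQ]])
    have hM: "\<sigma> \<in> M" if "\<sigma> \<in> elts (hdom \<tau>)" for \<sigma> using M_trans[OF that hdom_in_M[OF t(1)]] .
    have tr: "(\<exists>p\<in>G. Q p \<pi>) \<longleftrightarrow> (\<exists>y\<in>elts x. val G \<pi> \<in> elts y)" if pM: "\<pi> \<in> M" for \<pi>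
    proof
      assume "\<exists>p\<in>G. Q p \<pi>"
      then obtain p \<sigma> where p: "p \<in> G" "\<sigma> \<in> elts (hdom \<tau>)" "fmem p \<sigma> \<tau>" "fmem p \<pi> \<sigma>" unfolding Q_def by blast
      then show "\<exists>y\<in>elts x. val G \<pi> \<in> elts y" using fmem_truth[OF hM[OF p(2)] t(1)] fmem_truth[OF pM hM[OF p(2)]] t(2) by blast
    next
      assume "\<exists>y\<in>elts x. val G \<pi> \<in> elts y"
      then obtain y where y: "y \<in> elts x" "val G \<pi> \<in> elts y" by blast
      then obtain \<sigma> where s: "\<sigma> \<in> elts (hdom \<tau>)" "y = val G \<sigma>" using val_mem_hdom t(2) by blast
      have "\<exists>p\<in>G. fmem p \<sigma> \<tau>" "\<exists>p\<in>G. fmem p \<pi> \<sigma>" using fmem_truth[OF hM[OF s(1)] t(1)] fmem_truth[OF pM hM[OF s(1)]] y s t(2) by blast+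
      then have "\<exists>p\<in>G. fmem p \<sigma> \<tau> \<and> fmem p \<pi> \<sigma>" by (rule G_conj) (erule fmem_mono, assumption)+
      then show "\<exists>p\<in>G. Q p \<pi>" unfolding Q_def using s(1) by blast
    qed
    have "z \<in> elts (val G (ncompr ?A Q)) \<longleftrightarrow> (\<exists>y\<in>elts x. z \<in> elts y)" for z
    proof
      assume "z \<in> elts (val G (ncompr ?A Q))"
      then obtain \<pi> where p: "\<pi> \<in> elts ?A" "z = val G \<pi>" "\<exists>p\<in>G. Q p \<pi>" unfolding elts_val_ncompr by blast
      then show "\<exists>y\<in>elts x. z \<in> elts y" using tr[OF M_trans[OF p(1) A]] by blast
    next
      assume z: "\<exists>y\<in>elts x. z \<in> elts y"
      then obtain y where y: "y \<in> elts x" "z \<in> elts y" by blast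
      then obtain \<sigma> where s: "\<sigma> \<in> elts (hdom \<tau>)" "y = val G \<sigma>" using val_mem_hdom t(2) by blast
      then obtain \<pi> where p: "\<pi> \<in> elts (hdom \<sigma>)" "z = val G \<pi>" using val_mem_hdom y(2) by blast
      have pA: "\<pi> \<in> elts ?A" unfolding eA using s(1) p(1) by blast
      have "\<exists>p\<in>G. Q p \<pi>" using tr[OF M_trans[OF pA A]] z p(2) by blast
      then show "z \<in> elts (val G (ncompr ?A Q))" unfolding elts_val_ncompr using pA p(2) by blast
    qed
    then show "\<exists>u\<in>N. \<forall>z\<in>N. (z \<in> elts u) = (\<exists>y\<in>N. y \<in> elts x \<and> z \<in> elts y)" using b transitive_N[OF x] by blast
  qed
  show "powerset_ax N" unfolding powerset_ax_def
  proof (intro ballI)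
    fix x assume x: "x \<in> N"
    obtain \<tau> where t: "\<tau> \<in> M" "x = val G \<tau>" using x by (rule N_name)
    \<comment> \<open>Every subset of the value of \<tau> has a name consisting of pairs from
      \<open>hdom\<close> \<tau> and \<open>P\<close>, so these names already yield the whole power
      set.\<close>
    let ?B = "PowM (hprod (hdom \<tau>) P)"
    have B: "?B \<in> M" using t poset_M by simp
    have dQ: "dfn (\<lambda>e. fsub (e 0) (e 1) \<tau>)" by (intro dfn_intros t)
    let ?b = "val G (ncompr ?B (\<lambda>p \<sigma>. fsub p \<sigma> \<tau>))"
    have b: "?b \<in> N" by (rule val_in_N[OF ncompr_in_M[OF B dQ]])
    have "y \<in> elts ?b \<longleftrightarrow> elts y \<subseteq> elts x" if y: "y \<in> N" for y
    proof
      assume "y \<in> elts ?b"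
      then obtain \<sigma> where s: "\<sigma> \<in> elts ?B" "y = val G \<sigma>" "\<exists>p\<in>G. fsub p \<sigma> \<tau>" unfolding elts_val_ncompr by blast
      then show "elts y \<subseteq> elts x" using fsub_truth[OF M_trans[OF s(1) B] t(1)] t(2) by blast
    next
      assume sub: "elts y \<subseteq> elts x"
      obtain \<sigma>0 where s0: "\<sigma>0 \<in> M" "y = val G \<sigma>0" using y by (rule N_name)
      let ?\<sigma> = "ncompr (hdom \<tau>) (\<lambda>p \<rho>. fmem p \<rho> \<sigma>0)"
      have sM: "?\<sigma> \<in> M" by (rule ncompr_in_M) (use t in simp, intro dfn_intros s0)
      have "elts ?\<sigma> \<subseteq> elts (hprod (hdom \<tau>) P)" by (rule ncompr_subset)
      then have sB: "?\<sigma> \<in> elts ?B" using sM by simp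
      have hM: "\<sigma> \<in> M" if "\<sigma> \<in> elts (hdom \<tau>)" for \<sigma> using M_trans[OF that hdom_in_M[OF t(1)]] .
      have "elts (val G ?\<sigma>) = elts y"
      proof (intro equalityI subsetI)
        fix v assume "v \<in> elts (val G ?\<sigma>)"
        then obtain \<rho> where r: "\<rho> \<in> elts (hdom \<tau>)" "v = val G \<rho>" "\<exists>p\<in>G. fmem p \<rho> \<sigma>0" unfolding elts_val_ncompr by blast
        then show "v \<in> elts y" using fmem_truth[OF hM[OF r(1)] s0(1)] s0(2) by blast
      next
        fix v assume v: "v \<in> elts y"
        then obtain \<rho> where r: "\<rho> \<in> elts (hdom \<tau>)" "v = val G \<rho>" using sub val_mem_hdom t(2) by blast
        then have "\<exists>p\<in>G. fmem p \<rho> \<sigma>0" using fmem_truth[OF hM[OF r(1)] s0(1)] s0(2) v by blast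
        then show "v \<in> elts (val G ?\<sigma>)" unfolding elts_val_ncompr using r by blast
      qed
      then have e: "y = val G ?\<sigma>" by (metis hc_eqI)
      have "\<exists>p\<in>G. fsub p ?\<sigma> \<tau>" using fsub_truth[OF sM t(1)] sub e t(2) by simp
      then show "y \<in> elts ?b" unfolding elts_val_ncompr using sB e by blast
    qed
    then show "\<exists>p\<in>N. \<forall>y\<in>N. (y \<in> elts p) = (\<forall>z\<in>N. z \<in> elts y \<longrightarrow> z \<in> elts x)" using b transitive_N by (intro bexI[OF _ b]) blast
  qed
  show "infinity_ax N"
  proof -
    obtain x where x: "x \<in> M" "\<exists>e\<in>M. e \<in> elts x \<and> (\<forall>z\<in>M. z \<notin> elts e)"
      "\<And>y. y \<in> M \<Longrightarrow> y \<in> elts x \<Longrightarrow> \<exists>s\<in>M. s \<in> elts x \<and> (\<forall>z\<in>M. (z \<in> elts s) = (z \<in> elts y \<or> z = y))"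
      using zf_axioms(6) unfolding infinity_ax_def by blast
    obtain e where e: "e \<in> M" "e \<in> elts x" "\<forall>z\<in>M. z \<notin> elts e" using x(2) by blast
    have "elts e = {}" using e M_sub[OF e(1)] by blast
    moreover have "\<exists>s\<in>N. s \<in> elts x \<and> (\<forall>z\<in>N. (z \<in> elts s) = (z \<in> elts y \<or> z = y))" if y: "y \<in> elts x" for y
    proof -
      have yM: "y \<in> M" using M_trans[OF y x(1)] .
      obtain s where s: "s \<in> M" "s \<in> elts x" "\<forall>z\<in>M. (z \<in> elts s) = (z \<in> elts y \<or> z = y)" using x(3)[OF yM y] by blast
      have "elts s = insert y (elts y)" using s(3) M_sub[OF s(1)] M_sub[OF yM] yM by blast
      then show ?thesis using s(1,2) M_sub_N by blast
    qed
    ultimately show ?thesis unfolding infinity_ax_def using x(1) e(1,2) M_sub_N by blast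
  qed
qed

sublocale ext: zf_model N by (rule zf_model_N)

text \<open>A ground model well-ordering of the names for the union of the family becomes, after
  evaluation, an enumeration \<open>E\<close> of that union with repetitions. From each set of the
  family the member of least index is taken.\<close>

lemma choice_N: "choice_ax N"
  unfolding choice_ax_def
proof (intro ballI impI)
  fix a assume a: "a \<in> N"
    and h: "(\<forall>x\<in>N. x \<in> elts a \<longrightarrow> (\<exists>z\<in>N. z \<in> elts x)) \<and>
      (\<forall>x\<in>N. \<forall>y\<in>N. x \<in> elts a \<and> y \<in> elts a \<and> x \<noteq> y \<longrightarrow> \<not> (\<exists>z\<in>N. z \<in> elts x \<and> z \<in> elts y))"
  define U where "U = Un1 a"
  have U: "U \<in> N" using a by (simp add: U_def)
  have eU: "elts U = (\<Union>y\<in>elts a. elts y)" by (simp add: U_def)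
  obtain \<upsilon> where u: "\<upsilon> \<in> M" "U = val G \<upsilon>" using U by (rule N_name)
  obtain \<gamma> f where g: "\<gamma> \<in> M" "ordinal \<gamma>" "f \<in> M" "bij_betw (ap f) (elts \<gamma>) (elts (hdom \<upsilon>))"
    using well_ordering[OF hdom_in_M[OF u(1)]] by blast
  define E where "E = lam \<gamma> (\<lambda>\<xi>. val G (ap f \<xi>))"
  have E: "E \<in> N" unfolding E_def by (rule val_lam_in_N[OF g(1)]) (intro dfn_intros g)
  have gN: "\<gamma> \<in> N" using g(1) M_sub_N by blast
  have cov: "\<exists>\<xi>\<in>elts \<gamma>. z = ap E \<xi>" if z: "z \<in> elts U" for z
  proof -
    obtain \<sigma> where s: "\<sigma> \<in> elts (hdom \<upsilon>)" "z = val G \<sigma>" using z val_mem_hdom u(2) by blast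
    then have "\<sigma> \<in> ap f ` elts \<gamma>" using g(4) unfolding bij_betw_def by blast
    then show ?thesis using s(2) unfolding E_def by auto
  qed
  define c where "c = mk {z \<in> elts U. \<exists>x\<in>elts a. z \<in> elts x \<and> (\<exists>\<xi>\<in>elts \<gamma>. z = ap E \<xi> \<and> (\<forall>\<eta>\<in>elts \<xi>. ap E \<eta> \<notin> elts x))}"
  have c: "c \<in> N" unfolding c_def by (rule ext.sep_in_M[OF U]) (intro dfn_intros a E gN)
  have ec: "z \<in> elts c \<longleftrightarrow> z \<in> elts U \<and> (\<exists>x\<in>elts a. z \<in> elts x \<and> (\<exists>\<xi>\<in>elts \<gamma>. z = ap E \<xi> \<and> (\<forall>\<eta>\<in>elts \<xi>. ap E \<eta> \<notin> elts x)))" for z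
    unfolding c_def by (subst elts_mk) (auto simp del: elts_Un1)
  have uniq: "\<exists>!z. z \<in> N \<and> z \<in> elts x \<and> z \<in> elts c" if x: "x \<in> N" "x \<in> elts a" for x
  proof -
    obtain z0 where z0: "z0 \<in> elts x" using h x by blast
    have xU: "z \<in> elts U" if "z \<in> elts x" for z using that x(2) unfolding eU by blast
    obtain \<xi>0 where x0: "\<xi>0 \<in> elts \<gamma>" "z0 = ap E \<xi>0" using cov[OF xU[OF z0]] by blast
    obtain \<xi> where xi: "ordinal \<xi>" "\<xi> \<in> elts \<gamma> \<and> ap E \<xi> \<in> elts x" "\<And>\<eta>. ordinal \<eta> \<Longrightarrow> \<eta> \<in> elts \<gamma> \<and> ap E \<eta> \<in> elts x \<Longrightarrow> elts \<xi> \<subseteq> elts \<eta>"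
      using ordinal_least[of \<xi>0 "\<lambda>\<xi>. \<xi> \<in> elts \<gamma> \<and> ap E \<xi> \<in> elts x"] x0 z0 ordinal_elem[OF g(2) x0(1)] by metis
    have nb: "ap E \<eta> \<notin> elts x" if e: "\<eta> \<in> elts \<xi>" for \<eta>
    proof
      assume "ap E \<eta> \<in> elts x"
      moreover have "\<eta> \<in> elts \<gamma>" using ordinal_trans[OF e _ g(2)] xi(2) by blast
      ultimately have "elts \<xi> \<subseteq> elts \<eta>" using xi(3)[OF ordinal_elem[OF xi(1) e]] by blast
      then show False using e foundation_hc_irrefl[of \<eta>] by blast
    qed
    show ?thesis
    proof (rule ex1I[of _ "ap E \<xi>"])
      show "ap E \<xi> \<in> N \<and> ap E \<xi> \<in> elts x \<and> ap E \<xi> \<in> elts c"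
      proof (intro conjI)
        show 1: "ap E \<xi> \<in> elts x" using xi by blast
        then show "ap E \<xi> \<in> N" using transitive_N[OF x(1)] by blast
        show "ap E \<xi> \<in> elts c" unfolding ec using xU[OF 1] 1 x(2) xi nb by blast
      qed
      fix z assume z: "z \<in> N \<and> z \<in> elts x \<and> z \<in> elts c"
      then obtain y \<eta> where y: "y \<in> elts a" "z \<in> elts y" "\<eta> \<in> elts \<gamma>" "z = ap E \<eta>" "\<forall>\<zeta>\<in>elts \<eta>. ap E \<zeta> \<notin> elts y"
        unfolding ec by blast
      have "y \<in> N" using transitive_N[OF a] y(1) by blast
      then have "y = x" using h x y(1,2) z by blast
      then have "\<eta> = \<xi>" using ordinal_linear[OF ordinal_elem[OF g(2) y(3)] xi(1)] nb[of \<eta>] y z xi(2) by blast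
      then show "z = ap E \<xi>" using y by blast
    qed
  qed
  then show "\<exists>c\<in>N. \<forall>x\<in>N. x \<in> elts a \<longrightarrow> (\<exists>!z. z \<in> N \<and> z \<in> elts x \<and> z \<in> elts c)" using c by blast
qed

text \<open>From here on the cardinal arithmetic of the extension is available under the prefix
  \<open>ext\<close>.\<close>

sublocale ext: ctm_model N by unfold_locales (rule choice_N)

lemma M_N: "x \<in> M \<Longrightarrow> x \<in> N" using M_sub_N by blast

lemma lep_M_N: "lep A B \<Longrightarrow> ext.lep A B"
  unfolding lep_def ext.lep_def using M_sub_N by blast

lemma cofin_M_N: "cofin \<delta> \<alpha> \<Longrightarrow> ext.cofin \<delta> \<alpha>"
  unfolding cofin_def ext.cofin_def using M_sub_N by blast

end

section \<open>The product of two Cohen forcings\<close>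

text \<open>Compatibility of partial functions coded as sets of pairs; \<open>agree p p\<close> says
  that \<open>p\<close> is single-valued.\<close>

definition agree :: "hc \<Rightarrow> hc \<Rightarrow> bool" where
  "agree p q \<longleftrightarrow> (\<forall>z\<in>elts p. \<forall>w\<in>elts q. hfst z = hfst w \<longrightarrow> hsnd z = hsnd w)"

lemma agree_sym: "agree p q \<longleftrightarrow> agree q p" unfolding agree_def by metis

lemma agree_mono: "agree p q \<Longrightarrow> elts p' \<subseteq> elts p \<Longrightarrow> elts q' \<subseteq> elts q \<Longrightarrow> agree p' q'"
  unfolding agree_def by blast

definition restr :: "hc \<Rightarrow> hc \<Rightarrow> hc" where "restr X p = mk {z \<in> elts p. hfst z \<in> elts X}"

lemma elts_restr: "elts (restr X p) = {z \<in> elts p. hfst z \<in> elts X}" by (simp add: restr_def)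

section \<open>The chain condition, by closing off sets of coordinates\<close>

context ctm_model begin

lemma dfn_agree [dfn_intros]: "dft t \<Longrightarrow> dft s \<Longrightarrow> dfn (\<lambda>e. agree (t e) (s e))"
  unfolding agree_def by (rule dfn2[of "\<lambda>p q. \<forall>z\<in>elts p. \<forall>w\<in>elts q. hfst z = hfst w \<longrightarrow> hsnd z = hsnd w"]) (intro dfn_intros)

lemma dft_restr [dfn_intros]: "dft t \<Longrightarrow> dft s \<Longrightarrow> dft (\<lambda>e. restr (t e) (s e))"
  unfolding restr_def by (rule dft2[of "\<lambda>X p. mk {z \<in> elts p. hfst z \<in> elts X}"]) (intro dfn_intros)

lemma restr_in_M [simp]: "X \<in> M \<Longrightarrow> p \<in> M \<Longrightarrow> restr X p \<in> M"
  by (rule dft_constD, rule dft_restr) (auto intro: dft_const)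

text \<open>This is \<nu>^{<\<nu>} \<le> \<nu> for regular \<nu> with 2^{<\<nu>} \<le> \<nu>:
  transported to \<nu>, a small subset is bounded and hence lies in one of \<nu> power sets.\<close>

lemma small_subsets:
  assumes \<nu>: "regular_cardinal M \<nu>" and pw: "\<And>\<alpha>. \<alpha> \<in> elts \<nu> \<Longrightarrow> lep (PowM \<alpha>) \<nu>" and Y: "Y \<in> M" "lep Y \<nu>"
  shows "lep (mk {s \<in> elts (PowM Y). lss s \<nu>}) \<nu>"
proof -
  note r = regularD[OF \<nu>]
  obtain f where f: "f \<in> M" "injf f Y \<nu>" using Y(2) unfolding lep_def by blast
  let ?T = "mk (\<Union>\<beta>\<in>elts \<nu>. elts (PowM \<beta>))"
  have T: "?T \<in> M" "lep ?T \<nu>"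
    by (rule UN_in_M[OF r(3)], intro dfn_intros, rule lep_UN[OF r(1,3) _ lep_refl[OF r(3)] pw], intro dfn_intros)
  have eT: "elts ?T = (\<Union>\<beta>\<in>elts \<nu>. elts (PowM \<beta>))" by (rule elts_mk) (intro countable_UN countable_elts)
  let ?F = "\<lambda>s. mk ((\<lambda>y. ap f y) ` elts s)"
  let ?S = "mk {s \<in> elts (PowM Y). lss s \<nu>}"
  have d: "dft (\<lambda>e. ?F (e 0))" by (intro dfn_intros f)
  have S: "?S \<in> M" by (rule sep_in_M) (use Y in simp, intro dfn_intros r)
  have eS: "elts ?S = {s \<in> elts (PowM Y). lss s \<nu>}" by (rule elts_mk) (intro countable_Collect countable_elts)
  have "lep ?S ?T"
  proof (rule lepI[OF S d])
    fix s assume "s \<in> elts ?S"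
    then have s: "s \<in> M" "elts s \<subseteq> elts Y" "lss s \<nu>" unfolding eS by auto
    have FM: "?F s \<in> M" by (rule dft1_M[of ?F, OF d s(1)])
    have sub: "elts (?F s) \<subseteq> elts \<nu>" using f(2) s(2) unfolding injf_def by auto
    have "lep (?F s) s" by (rule lep_surj[OF s(1) FM, of "\<lambda>y. ap f y"]) (intro dfn_intros f, simp)
    then have "lss (?F s) (cof M \<nu>)" unfolding r(5) by (rule lss_lep_trans[OF FM _ s(3)])
    then obtain \<beta> where "\<beta> \<in> elts \<nu>" "elts (?F s) \<subseteq> elts \<beta>" using cof_bounded[OF r(3,4) FM sub] by blast
    then show "?F s \<in> elts ?T" unfolding eT using FM by auto
  next
    fix x y assume xy: "x \<in> elts ?S" "y \<in> elts ?S" "?F x = ?F y"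
    have "ap f ` elts x = ap f ` elts y" using xy(3) by (simp add: mk_eq_iff)
    moreover have "inj_on (ap f) (elts Y)" "elts x \<subseteq> elts Y" "elts y \<subseteq> elts Y" using f xy unfolding injf_iff eS by auto
    ultimately have "elts x = elts y" using inj_on_image_eq_iff by metis
    then show "x = y" by (rule hc_eqI)
  qed
  then show ?thesis using lep_trans[OF S _ T(2)] by blast
qed

lemma lep_two: assumes "infinite_cardinal M \<nu>" shows "lep two \<nu>"
  by (rule lep_subset[OF two_in_M two_subset[OF assms]])

lemma lep_hdom: "p \<in> M \<Longrightarrow> lep (hdom p) p"
  by (rule lep_surj[of _ _ hfst]) (auto intro!: dfn_intros image_eqI[of _ hfst "hpair a b" for a b])

text \<open>Close a set of coordinates under picking, for every trace of a condition on it, one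
  condition of \<open>S\<close> with that trace and adding its domain. After \<nu> rounds at most
  \<nu> conditions have been picked. The trace of a condition \<open>p\<close> on the closed set is
  small, hence present at an earlier stage, and the condition picked there for the trace of
  \<open>p\<close> agrees with \<open>p\<close>.\<close>

lemma predense_subset:
  assumes \<nu>: "regular_cardinal M \<nu>" and pw: "\<And>\<alpha>. \<alpha> \<in> elts \<nu> \<Longrightarrow> lep (PowM \<alpha>) \<nu>" and I: "I \<in> M"
    and S: "S \<in> M" "\<And>p. p \<in> elts S \<Longrightarrow> elts p \<subseteq> elts (hprod I two) \<and> agree p p \<and> lss p \<nu>"
  shows "\<exists>A\<in>M. elts A \<subseteq> elts S \<and> lep A \<nu> \<and> (\<forall>p\<in>elts S. \<exists>q\<in>elts A. agree p q)"
proof -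
  note r = regularD[OF \<nu>]
  have SM: "p \<in> M" if "p \<in> elts S" for p using M_trans[OF that S(1)] .
  obtain ch where ch: "ch \<in> M" "\<And>x. x \<in> M \<Longrightarrow> elts x \<subseteq> elts S \<Longrightarrow> elts x \<noteq> {} \<Longrightarrow> ap ch x \<in> elts x"
    using choice_fun[OF S(1)] by metis
  \<comment> \<open>One representative in \<open>S\<close> for every trace on
    \<open>X\<close>.\<close>
  define A where "A X = mk ((\<lambda>s. ap ch (mk {p \<in> elts S. restr X p = s})) ` elts (mk ((\<lambda>p. restr X p) ` elts S)))" for X
  have dA: "dft (\<lambda>e. A (e 0))" unfolding A_def by (intro dfn_intros S ch)
  note dA' = dft1[of A, OF dA]
  have AM: "A X \<in> M" if "X \<in> M" for X by (rule dft1_M[OF dA that])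
  have eA: "elts (A X) = (\<lambda>p. ap ch (mk {p' \<in> elts S. restr X p' = restr X p})) ` elts S" for X
    unfolding A_def by (simp add: image_image)
  have chp: "ap ch (mk {p' \<in> elts S. restr X p' = restr X p}) \<in> elts S \<and> restr X (ap ch (mk {p' \<in> elts S. restr X p' = restr X p})) = restr X p"
    if p: "p \<in> elts S" and X: "X \<in> M" for p X
  proof -
    let ?x = "mk {p' \<in> elts S. restr X p' = restr X p}"
    have "?x \<in> M" by (rule sep_in_M[OF S(1)]) (intro dfn_intros X SM[OF p])
    moreover have "elts ?x = {p' \<in> elts S. restr X p' = restr X p}" by simp
    ultimately have "ap ch ?x \<in> elts ?x" using p by (intro ch(2)) auto
    then show ?thesis by simp
  qed
  have AS: "elts (A X) \<subseteq> elts S" if "X \<in> M" for X using chp[OF _ that] unfolding eA by blast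
  define st where "st X = mk (elts X \<union> elts (mk (\<Union>q\<in>elts (A X). elts (hdom q))))" for X
  have dst: "dft (\<lambda>e. st (e 0))" unfolding st_def by (intro dfn_intros dA')
  note dst' = dft1[of st, OF dst]
  have est: "elts (st X) = elts X \<union> (\<Union>q\<in>elts (A X). elts (hdom q))" for X
  proof -
    have "elts (mk (\<Union>q\<in>elts (A X). elts (hdom q))) = (\<Union>q\<in>elts (A X). elts (hdom q))" by (rule elts_mk) (intro countable_UN countable_elts)
    then show ?thesis unfolding st_def by (subst elts_mk) (simp_all del: elts_hdom)
  qed
  have Alep: "lep (A X) \<nu>" if X: "X \<in> M" "lep X \<nu>" for X
  proof -
    let ?R = "mk ((\<lambda>p. restr X p) ` elts S)"
    have R: "?R \<in> M" by (rule repl_in_M[OF S(1)]) (intro dfn_intros X)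
    have Y: "hprod X two \<in> M" using X by simp
    have "lep (hprod X two) (hprod \<nu> \<nu>)" by (rule lep_prod_mono[OF X(1) two_in_M X(2) lep_two[OF r(1)]])
    then have "lep (hprod X two) \<nu>" by (rule lep_trans[OF Y _ lep_square[OF r(1)]])
    note sm = small_subsets[OF \<nu> pw Y this]
    have es: "elts (mk {s \<in> elts (PowM (hprod X two)). lss s \<nu>}) = {s \<in> elts (PowM (hprod X two)). lss s \<nu>}"
      by (rule elts_mk) (intro countable_Collect countable_elts)
    have "elts ?R \<subseteq> elts (mk {s \<in> elts (PowM (hprod X two)). lss s \<nu>})"
    proof
      fix s assume "s \<in> elts ?R"
      then obtain p where p: "p \<in> elts S" "s = restr X p" by auto
      have sM: "s \<in> M" using p X SM by simp
      have sub: "elts s \<subseteq> elts p" unfolding p(2) elts_restr by blast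
      have "lss s \<nu>" using lss_lep_trans[OF sM lep_subset[OF sM sub]] S(2)[OF p(1)] by blast
      moreover have "elts s \<subseteq> elts (hprod X two)" using S(2)[OF p(1)] unfolding p(2) elts_restr by auto
      ultimately show "s \<in> elts (mk {s \<in> elts (PowM (hprod X two)). lss s \<nu>})" unfolding es using sM by simp
    qed
    then have "lep ?R \<nu>" by (rule lep_trans[OF R lep_subset[OF R] sm])
    moreover have "lep (A X) ?R"
      by (rule lep_surj[OF R AM[OF X(1)], of "\<lambda>s. ap ch (mk {p \<in> elts S. restr X p = s})"]) (intro dfn_intros S ch X, simp add: A_def)
    ultimately show ?thesis using lep_trans[OF AM[OF X(1)]] by blast
  qed
  have stlep: "lep (st X) \<nu>" if X: "X \<in> M" "lep X \<nu>" for X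
  proof -
    let ?U = "mk (\<Union>q\<in>elts (A X). elts (hdom q))"
    have U: "?U \<in> M" by (rule UN_in_M[OF AM[OF X(1)]]) (intro dfn_intros)
    have "lep ?U \<nu>"
    proof (rule lep_UN[OF r(1) AM[OF X(1)] _ Alep[OF X]])
      show "dft (\<lambda>e. hdom (e 0))" by (intro dfn_intros)
      fix q assume "q \<in> elts (A X)"
      then have q: "q \<in> elts S" using AS[OF X(1)] by blast
      have "lep q \<nu>" using lss_imp_lep[OF r(4,3) SM[OF q]] S(2)[OF q] by blast
      then show "lep (hdom q) \<nu>" using lep_trans[OF _ lep_hdom[OF SM[OF q]]] SM[OF q] by simp
    qed
    have "lep (mk (\<Union>x\<in>elts (mk {X, ?U}). elts x)) \<nu>"
    proof (rule lep_UN[OF r(1)])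
      show "mk {X, ?U} \<in> M" using X U by simp
      show "dft (\<lambda>e. e 0)" by (intro dfn_intros)
      show "lep (mk {X, ?U}) \<nu>"
        by (rule lss_imp_lep[OF r(4,3) _ lss_finite[OF r(1)]]) (use X U in auto)
      show "lep x \<nu>" if "x \<in> elts (mk {X, ?U})" for x using that X(2) \<open>lep ?U \<nu>\<close> by auto
    qed
    then show ?thesis unfolding st_def by simp
  qed
  \<comment> \<open>Stage \<open>i\<close> is the union of the one-step closures of all earlier
    stages; stage \<nu> is the closed set of coordinates.\<close>
  define X where "X = hrec (\<lambda>x. x) (\<lambda>i f. mk (\<Union>j\<in>elts i. elts (st (ap f j))))"
  have eX: "elts (X i) = (\<Union>j\<in>elts i. elts (st (X j)))" for i
  proof -
    have "elts (X i) = (\<Union>j\<in>elts i. elts (st (ap (lam i X) j)))"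
      unfolding X_def by (subst hrec_unfold[OF wf_elts'], rule elts_mk) (intro countable_UN countable_elts)
    also have "\<dots> = (\<Union>j\<in>elts i. elts (st (X j)))" by simp
    finally show ?thesis .
  qed
  have dX: "dft (\<lambda>e. X (e 0))" unfolding X_def by (rule dft_hrec[OF _ _ wf_elts']) (intro dfn_intros dst')+
  note dX' = dft1[of X, OF dX]
  have XM: "X i \<in> M" if "i \<in> M" for i by (rule dft1_M[OF dX that])
  have nuM: "i \<in> M" if "i \<in> elts \<nu>" for i using M_trans[OF that r(3)] .
  have Xlep: "elts i \<subseteq> elts \<nu> \<Longrightarrow> i \<in> M \<Longrightarrow> lep (X i) \<nu>" for i
  proof (induction i rule: hc_induct)
    case (step i)
    have "lep (mk (\<Union>j\<in>elts i. elts (st (X j)))) \<nu>"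
    proof (rule lep_UN[OF r(1) step.prems(2) _ lep_subset[OF step.prems(2,1)]])
      show "dft (\<lambda>e. st (X (e 0)))" by (intro dst' dX)
      fix j assume j: "j \<in> elts i"
      then have jn: "j \<in> elts \<nu>" using step.prems by blast
      have "elts j \<subseteq> elts \<nu>" using ordinal_sub[OF jn r(4)] .
      then show "lep (st (X j)) \<nu>" using step.IH[OF j] nuM[OF jn] XM stlep by blast
    qed
    moreover have "mk (\<Union>j\<in>elts i. elts (st (X j))) = X i" using eX[of i] by (metis mk_elts)
    ultimately show ?case by simp
  qed
  define B where "B = mk (\<Union>i\<in>elts \<nu>. elts (A (X i)))"
  have dAX: "dft (\<lambda>e. A (X (e 0)))" by (intro dA' dX)
  have B: "B \<in> M" unfolding B_def by (rule UN_in_M[OF r(3) dAX])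
  have eB: "elts B = (\<Union>i\<in>elts \<nu>. elts (A (X i)))" unfolding B_def by (rule elts_mk) (intro countable_UN countable_elts)
  have "lep B \<nu>" unfolding B_def
    by (rule lep_UN[OF r(1,3) dAX lep_refl[OF r(3)]]) (use Alep Xlep XM nuM ordinal_sub[OF _ r(4)] in blast)
  moreover have "elts B \<subseteq> elts S" unfolding eB using AS XM nuM by blast
  moreover have "\<exists>q\<in>elts B. agree p q" if p: "p \<in> elts S" for p
  proof -
    have pM: "p \<in> M" using SM[OF p] .
    let ?s = "restr (X \<nu>) p"
    have sM: "?s \<in> M" using pM XM[OF r(3)] by simp
    have "\<exists>g\<in>M. \<forall>z\<in>elts ?s. ap g z \<in> elts \<nu> \<and> hfst z \<in> elts (st (X (ap g z)))"
    proof (rule AC[OF sM, of "\<lambda>z i. i \<in> elts \<nu> \<and> hfst z \<in> elts (st (X i))"])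
      show "dfn (\<lambda>e. e 1 \<in> elts \<nu> \<and> hfst (e 0) \<in> elts (st (X (e 1))))" by (intro dfn_intros dst' dX' r)
      fix z assume "z \<in> elts ?s"
      then have "hfst z \<in> elts (X \<nu>)" unfolding elts_restr by blast
      then show "\<exists>i\<in>M. i \<in> elts \<nu> \<and> hfst z \<in> elts (st (X i))" unfolding eX[of \<nu>] using nuM by blast
    qed
    then obtain g where g: "g \<in> M" "\<And>z. z \<in> elts ?s \<Longrightarrow> ap g z \<in> elts \<nu> \<and> hfst z \<in> elts (st (X (ap g z)))" by blast
    let ?D = "mk ((\<lambda>z. ap g z) ` elts ?s)"
    have dg: "dft (\<lambda>e. ap g (e 0))" by (intro dfn_intros g)
    have D: "?D \<in> M" by (rule repl_in_M[OF sM dg])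
    have Dn: "elts ?D \<subseteq> elts \<nu>" using g(2) by auto
    have "elts ?s \<subseteq> elts p" unfolding elts_restr by blast
    then have "lss ?s \<nu>" using lss_lep_trans[OF sM lep_subset[OF sM]] S(2)[OF p] by blast
    moreover have "lep ?D ?s" by (rule lep_surj[OF sM D dg]) simp
    ultimately have "lss ?D (cof M \<nu>)" unfolding r(5) using lss_lep_trans[OF D] by blast
    \<comment> \<open>Fewer than \<nu> coordinates, each caught at a stage below \<nu>: by
      regularity all of them are caught by stage \<beta>.\<close>
    from cof_bounded[OF r(3,4) D Dn this] obtain \<beta> where b: "\<beta> \<in> elts \<nu>" "elts ?D \<subseteq> elts \<beta>" by blast
    have bM: "\<beta> \<in> M" using nuM[OF b(1)] .
    have sb: "hfst z \<in> elts (X \<beta>)" if "z \<in> elts ?s" for z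
      unfolding eX[of \<beta>] using g(2)[OF that] b(2) that by auto
    let ?q = "ap ch (mk {p' \<in> elts S. restr (X \<beta>) p' = restr (X \<beta>) p})"
    have q: "?q \<in> elts S" "restr (X \<beta>) ?q = restr (X \<beta>) p" using chp[OF p XM[OF bM]] by blast+
    have qA: "?q \<in> elts (A (X \<beta>))" unfolding eA using p by blast
    \<comment> \<open>A common coordinate belongs to the domain of the representative, hence to the
      closed set, hence as a coordinate of \<open>p\<close> already to stage \<beta>, where the two
      traces coincide.\<close>
    have "agree p ?q" unfolding agree_def
    proof (intro ballI impI)
      fix z w assume z: "z \<in> elts p" and w: "w \<in> elts ?q" and eq: "hfst z = hfst w"
      have "w \<in> elts (hprod I two)" using S(2)[OF q(1)] w by blast
      then obtain i b where ib: "w = hpair i b" by auto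
      then have "hfst w \<in> elts (hdom ?q)" using w by auto
      then have "hfst w \<in> elts (st (X \<beta>))" unfolding est using qA by blast
      then have "hfst z \<in> elts (X \<nu>)" unfolding eX[of \<nu>] using b(1) eq by auto
      then have "z \<in> elts ?s" unfolding elts_restr using z by blast
      then have "z \<in> elts (restr (X \<beta>) ?q)" unfolding q(2) unfolding elts_restr[of "X \<beta>"] using sb z by blast
      then have "z \<in> elts ?q" unfolding elts_restr by blast
      then show "hsnd z = hsnd w" using S(2)[OF q(1)] w eq unfolding agree_def by blast
    qed
    then show ?thesis unfolding eB using qA b(1) by blast
  qed
  ultimately show ?thesis using B by blast
qed

end

section \<open>The poset, its factors, and Easton's argument\<close>

locale cohen = ctm_model +
  fixes \<theta> l \<kappa> \<mu> :: hc
  assumes th: "regular_cardinal M \<theta>" and lr: "regular_cardinal M l" and thl: "\<theta> \<in> elts l"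
    and powth: "\<And>\<alpha>. \<alpha> \<in> elts \<theta> \<Longrightarrow> lep (PowM \<alpha>) \<theta>" and powl: "\<And>\<alpha>. \<alpha> \<in> elts l \<Longrightarrow> lep (PowM \<alpha>) l"
    and kM: "\<kappa> \<in> M" and muM: "\<mu> \<in> M"
begin

text \<open>The ordinals 0 and 1. As tags they keep the two index sets disjoint; being the elements
  of \<open>two\<close>, they also serve as the values of the generic functions.\<close>

definition tag0 :: hc where "tag0 = mk {}"
definition tag1 :: hc where "tag1 = mk {mk {}}"
definition I0 :: hc where "I0 = hprod (mk {tag0}) (hprod \<kappa> \<theta>)"
definition I1 :: hc where "I1 = hprod (mk {tag1}) (hprod \<mu> l)"
definition II :: hc where "II = mk (elts I0 \<union> elts I1)"
text \<open>A pair of conditions is represented by a single partial function on the disjoint union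
  of the index sets, with a size restriction on each part. Compatibility and common extension are
  then agreement and union for both factors at once.\<close>

definition CP :: hc where
  "CP = mk {p \<in> elts (PowM (hprod II two)). agree p p \<and> lss (restr I0 p) \<theta> \<and> lss (restr I1 p) l}"
definition Cleq :: hc where "Cleq = mk {z \<in> elts (hprod CP CP). elts (hsnd z) \<subseteq> elts (hfst z)}"

lemma thM: "\<theta> \<in> M" and lM: "l \<in> M" using regularD[OF th] regularD[OF lr] by blast+

lemma tag_M [simp]: "tag0 \<in> M" "tag1 \<in> M" unfolding tag0_def tag1_def by simp_all
lemma tag_neq [simp]: "tag0 \<noteq> tag1" "tag1 \<noteq> tag0" unfolding tag0_def tag1_def by (simp_all add: mk_eq_iff)
lemma I0_M [simp]: "I0 \<in> M" and I1_M [simp]: "I1 \<in> M" unfolding I0_def I1_def using kM muM thM lM by simp_all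
lemma II_M [simp]: "II \<in> M" unfolding II_def by simp
lemma elts_II: "elts II = elts I0 \<union> elts I1" unfolding II_def by simp
lemma elts_CP: "elts CP = {p \<in> M. elts p \<subseteq> elts (hprod II two) \<and> agree p p \<and> lss (restr I0 p) \<theta> \<and> lss (restr I1 p) l}"
proof -
  have "elts CP = {p \<in> elts (PowM (hprod II two)). agree p p \<and> lss (restr I0 p) \<theta> \<and> lss (restr I1 p) l}"
    unfolding CP_def by (rule elts_mk) (intro countable_Collect countable_elts)
  then show ?thesis by auto
qed

lemma CP_in_M [simp]: "CP \<in> M"
  unfolding CP_def by (rule sep_in_M) (simp, intro dfn_intros I0_M I1_M thM lM)

lemma Cleq_in_M [simp]: "Cleq \<in> M"
  unfolding Cleq_def by (rule sep_in_M) (simp, intro dfn_intros)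

lemma Cleq_iff: "hpair p q \<in> elts Cleq \<longleftrightarrow> p \<in> elts CP \<and> q \<in> elts CP \<and> elts q \<subseteq> elts p"
proof -
  have "elts Cleq = {z \<in> elts (hprod CP CP). elts (hsnd z) \<subseteq> elts (hfst z)}"
    unfolding Cleq_def by (rule elts_mk) (intro countable_Collect countable_elts)
  then show ?thesis by auto
qed

lemma CP_M: "p \<in> elts CP \<Longrightarrow> p \<in> M" unfolding elts_CP by blast

lemma lss_sub: "p \<in> M \<Longrightarrow> q \<in> M \<Longrightarrow> elts q \<subseteq> elts p \<Longrightarrow> lss p \<nu> \<Longrightarrow> lss q \<nu>"
  using lss_lep_trans lep_subset by blast

lemma CP_sub: assumes "p \<in> elts CP" "q \<in> M" "elts q \<subseteq> elts p" shows "q \<in> elts CP"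
proof -
  have p: "p \<in> M" "elts p \<subseteq> elts (hprod II two)" "agree p p" "lss (restr I0 p) \<theta>" "lss (restr I1 p) l"
    using assms(1) unfolding elts_CP by blast+
  have "elts (restr J q) \<subseteq> elts (restr J p)" for J using assms(3) unfolding elts_restr by blast
  then have "lss (restr I0 q) \<theta>" "lss (restr I1 q) l"
    using lss_sub[of "restr I0 p" "restr I0 q"] lss_sub[of "restr I1 p" "restr I1 q"] p assms(2) by simp_all
  moreover have "agree q q" using agree_mono[OF p(3) assms(3,3)] .
  ultimately show ?thesis unfolding elts_CP using assms(2,3) p(2) by blast
qed

lemma empty_CP: "mk {} \<in> elts CP"
proof -
  have "restr J (mk {}) = mk {}" for J unfolding restr_def by simp
  moreover have "lss (mk {}) \<theta>" "lss (mk {}) l" using lss_finite[of _ "mk {}"] regularD(1)[OF th] regularD(1)[OF lr] by simp_all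
  ultimately show ?thesis unfolding elts_CP by (simp add: agree_def)
qed

lemma notion: "forcing_notion M CP Cleq (mk {})"
  unfolding forcing_notion_def
proof (intro conjI)
  show "\<forall>z\<in>elts Cleq. \<exists>p\<in>elts CP. \<exists>q\<in>elts CP. z = hpair p q"
  proof
    fix z assume "z \<in> elts Cleq"
    then have "z \<in> elts (hprod CP CP)" unfolding Cleq_def by (simp del: elts_hprod)
    then show "\<exists>p\<in>elts CP. \<exists>q\<in>elts CP. z = hpair p q" by auto
  qed
qed (auto simp: Cleq_iff empty_CP)

lemma CP_agree: "p \<in> elts CP \<Longrightarrow> agree p p" unfolding elts_CP by blast

lemma CP_pair: "p \<in> elts CP \<Longrightarrow> z \<in> elts p \<Longrightarrow> hfst z \<in> elts II \<and> hsnd z \<in> elts two \<and> z = hpair (hfst z) (hsnd z)"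
proof -
  assume "p \<in> elts CP" "z \<in> elts p"
  then have "z \<in> elts (hprod II two)" unfolding elts_CP by blast
  then show ?thesis by auto
qed

lemma lss_theta_l: "lss A \<theta> \<Longrightarrow> lss A l"
  unfolding lss_def using ordinal_trans[OF _ thl regularD(4)[OF lr]] by blast

lemma CP_union: assumes "p \<in> elts CP" "q \<in> elts CP" "agree p q" shows "mk (elts p \<union> elts q) \<in> elts CP"
proof -
  have p: "p \<in> M" "elts p \<subseteq> elts (hprod II two)" "agree p p" "lss (restr I0 p) \<theta>" "lss (restr I1 p) l"
    using assms(1) unfolding elts_CP by blast+
  have q: "q \<in> M" "elts q \<subseteq> elts (hprod II two)" "agree q q" "lss (restr I0 q) \<theta>" "lss (restr I1 q) l"
    using assms(2) unfolding elts_CP by blast+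
  let ?u = "mk (elts p \<union> elts q)"
  have r: "restr J ?u = mk (elts (restr J p) \<union> elts (restr J q))" for J
    by (rule hc_eqI) (auto simp: elts_restr)
  have "lss (restr I0 ?u) \<theta>" "lss (restr I1 ?u) l" unfolding r
    using lss_cup[OF regularD(1)[OF th] _ _ p(4) q(4)] lss_cup[OF regularD(1)[OF lr] _ _ p(5) q(5)] p(1) q(1) by simp_all
  moreover have "agree ?u ?u" unfolding agree_def
  proof (intro ballI impI)
    fix z w assume "z \<in> elts ?u" "w \<in> elts ?u" and e: "hfst z = hfst w"
    then have "z \<in> elts p \<or> z \<in> elts q" "w \<in> elts p \<or> w \<in> elts q" by simp_all
    then show "hsnd z = hsnd w" using p(3) q(3) assms(3) e e[symmetric] unfolding agree_def by metis
  qed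
  ultimately show ?thesis unfolding elts_CP using p q by simp
qed

lemma lss_CP: assumes "p \<in> elts CP" shows "lss p l"
proof -
  have p: "p \<in> M" "elts p \<subseteq> elts (hprod II two)" "lss (restr I0 p) \<theta>" "lss (restr I1 p) l"
    using assms unfolding elts_CP by blast+
  have "lss (mk (elts (restr I0 p) \<union> elts (restr I1 p))) l"
    using lss_cup[OF regularD(1)[OF lr] _ _ lss_theta_l[OF p(3)] p(4)] p(1) by simp
  moreover have "mk (elts (restr I0 p) \<union> elts (restr I1 p)) = p"
    by (rule hc_eqI) (use CP_pair[OF assms] in \<open>auto simp: elts_restr elts_II\<close>)
  ultimately show ?thesis by simp
qed

text \<open>Closure of the whole poset below \<theta>, and of the part avoiding the first factor
  below \<open>l\<close>. These are the two cases in which \<open>easton\<close> is used.\<close>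

lemma chain_union:
  assumes C: "C \<in> M" "elts C \<subseteq> elts CP" "\<And>p q. p \<in> elts C \<Longrightarrow> q \<in> elts C \<Longrightarrow> agree p q" "lss C l"
    and d: "lss C \<theta> \<or> (\<forall>p\<in>elts C. \<forall>z\<in>elts p. hfst z \<notin> elts I0)"
  shows "Un1 C \<in> elts CP"
proof -
  have CM: "p \<in> M" if "p \<in> elts C" for p using C(2) CP_M that by blast
  have r: "restr J (Un1 C) = mk (\<Union>p\<in>elts C. elts (restr J p))" for J
  proof (rule hc_eqI)
    have "elts (mk (\<Union>p\<in>elts C. elts (restr J p))) = (\<Union>p\<in>elts C. elts (restr J p))" by (rule elts_mk) (intro countable_UN countable_elts)
    then show "elts (restr J (Un1 C)) = elts (mk (\<Union>p\<in>elts C. elts (restr J p)))" by (auto simp: elts_restr)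
  qed
  have dr: "dft (\<lambda>e. restr J (e 0))" if "J \<in> M" for J by (intro dfn_intros that)
  have pc: "lss (restr I0 p) \<theta>" "lss (restr I1 p) l" if "p \<in> elts C" for p using C(2) that unfolding elts_CP by blast+
  have "lss (restr I1 (Un1 C)) l" unfolding r by (rule lss_UN[OF lr C(1,4) dr pc(2)]) simp_all
  moreover have "lss (restr I0 (Un1 C)) \<theta>"
    using d
  proof
    assume "lss C \<theta>"
    then show ?thesis unfolding r by (intro lss_UN[OF th C(1) _ dr pc(1)]) simp_all
  next
    assume "\<forall>p\<in>elts C. \<forall>z\<in>elts p. hfst z \<notin> elts I0"
    then have "elts (restr I0 (Un1 C)) = {}" unfolding elts_restr by auto
    then show ?thesis using lss_finite[OF regularD(1)[OF th], of "restr I0 (Un1 C)"] C(1) by simp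
  qed
  moreover have "agree (Un1 C) (Un1 C)" unfolding agree_def
  proof (intro ballI impI)
    fix z w assume "z \<in> elts (Un1 C)" "w \<in> elts (Un1 C)" and e: "hfst z = hfst w"
    then obtain p q where pq: "p \<in> elts C" "q \<in> elts C" "z \<in> elts p" "w \<in> elts q" by auto
    then show "hsnd z = hsnd w" using C(3)[OF pq(1,2)] e unfolding agree_def by blast
  qed
  moreover have "elts (Un1 C) \<subseteq> elts (hprod II two)" using C(2) unfolding elts_CP elts_Un1 by blast
  ultimately show ?thesis unfolding elts_CP using C(1) by simp
qed

text \<open>\<open>Rs J\<close> and \<open>Qs J\<close> are the factors of the poset along a set
  \<open>J\<close> of coordinates, with projections \<open>restr J\<close> and
  \<open>co J\<close>.\<close>

definition Rs :: "hc \<Rightarrow> hc" where "Rs J = mk {r \<in> elts CP. \<forall>z\<in>elts r. hfst z \<in> elts J}"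
definition Qs :: "hc \<Rightarrow> hc" where "Qs J = mk {q \<in> elts CP. \<forall>z\<in>elts q. hfst z \<notin> elts J}"
definition co :: "hc \<Rightarrow> hc \<Rightarrow> hc" where "co J p = mk (elts p - elts (restr J p))"

lemma elts_Rs: "elts (Rs J) = {r \<in> elts CP. \<forall>z\<in>elts r. hfst z \<in> elts J}" unfolding Rs_def by simp
lemma elts_Qs: "elts (Qs J) = {q \<in> elts CP. \<forall>z\<in>elts q. hfst z \<notin> elts J}" unfolding Qs_def by simp
lemma elts_co: "elts (co J p) = {z \<in> elts p. hfst z \<notin> elts J}" unfolding co_def by (auto simp: elts_restr)
lemma dft_Rs [dfn_intros]: "dft t \<Longrightarrow> dft (\<lambda>e. Rs (t e))"
  unfolding Rs_def by (rule dft1[of "\<lambda>J. mk {r \<in> elts CP. \<forall>z\<in>elts r. hfst z \<in> elts J}"]) (intro dfn_intros CP_in_M)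
lemma dft_Qs [dfn_intros]: "dft t \<Longrightarrow> dft (\<lambda>e. Qs (t e))"
  unfolding Qs_def by (rule dft1[of "\<lambda>J. mk {r \<in> elts CP. \<forall>z\<in>elts r. hfst z \<notin> elts J}"]) (intro dfn_intros CP_in_M)
lemma dft_co [dfn_intros]: "dft t \<Longrightarrow> dft s \<Longrightarrow> dft (\<lambda>e. co (t e) (s e))"
  unfolding co_def by (rule dft2[of "\<lambda>J p. mk (elts p - elts (restr J p))"]) (intro dfn_intros)
lemma Rs_in_M [simp]: "J \<in> M \<Longrightarrow> Rs J \<in> M" by (rule dft1_M, rule dft_Rs) (intro dfn_intros)
lemma Qs_in_M [simp]: "J \<in> M \<Longrightarrow> Qs J \<in> M" by (rule dft1_M, rule dft_Qs) (intro dfn_intros)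
lemma co_in_M [simp]: "J \<in> M \<Longrightarrow> p \<in> M \<Longrightarrow> co J p \<in> M" unfolding co_def by simp

lemma restr_Rs: "p \<in> elts CP \<Longrightarrow> J \<in> M \<Longrightarrow> restr J p \<in> elts (Rs J)"
  using CP_sub[of p "restr J p"] CP_M[of p] unfolding elts_Rs by (auto simp: elts_restr)
lemma co_Qs: "p \<in> elts CP \<Longrightarrow> J \<in> M \<Longrightarrow> co J p \<in> elts (Qs J)"
  using CP_sub[of p "co J p"] CP_M[of p] unfolding elts_Qs by (auto simp: elts_co)
lemma RQ_agree: "r \<in> elts (Rs J) \<Longrightarrow> q \<in> elts (Qs J) \<Longrightarrow> agree r q"
  unfolding elts_Rs elts_Qs agree_def by force
lemma RQ_union: "r \<in> elts (Rs J) \<Longrightarrow> q \<in> elts (Qs J) \<Longrightarrow> mk (elts r \<union> elts q) \<in> elts CP"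
  using CP_union RQ_agree unfolding elts_Rs elts_Qs by blast
lemma restr_co_union: "mk (elts (restr J p) \<union> elts (co J p)) = p"
  by (rule hc_eqI) (auto simp: elts_restr elts_co)

text \<open>
  \<open>T\<close> collects triples \<open>(\<xi>, r, \<beta>)\<close> such that \<open>r\<close>, together with the fixed condition \<open>q\<close> on the other
  coordinates, decides the value at \<open>\<xi>\<close> to be \<open>\<beta>\<close>; the \<open>r\<close>'s for a fixed \<open>\<xi>\<close> form a maximal antichain.
\<close>

definition egood :: "(hc \<Rightarrow> hc \<Rightarrow> hc \<Rightarrow> bool) \<Rightarrow> hc \<Rightarrow> hc \<Rightarrow> hc \<Rightarrow> hc \<Rightarrow> hc \<Rightarrow> hc \<Rightarrow> bool" where
  "egood Dec \<delta> B J \<chi> q T \<longleftrightarrow> lss T \<chi> \<and>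
    (\<forall>t\<in>elts T. \<exists>\<xi>\<in>elts \<delta>. \<exists>r\<in>elts (Rs J). \<exists>\<beta>\<in>elts B. t = hpair \<xi> (hpair r \<beta>) \<and> Dec \<xi> (mk (elts r \<union> elts q)) \<beta>) \<and>
    (\<forall>t\<in>elts T. \<forall>t'\<in>elts T. hfst t = hfst t' \<and> t \<noteq> t' \<longrightarrow> \<not> agree (hfst (hsnd t)) (hfst (hsnd t'))) \<and>
    (\<forall>\<xi>\<in>elts \<delta>. \<forall>r\<in>elts (Rs J). \<exists>t\<in>elts T. hfst t = \<xi> \<and> agree (hfst (hsnd t)) r)"

text \<open>A recursion picks at each stage, as long as possible, one more triple for
  \<open>T\<close> together with a stronger condition outside \<open>J\<close>. Antichains of
  \<open>Rs J\<close> and the set \<delta> are smaller than \<chi>, so it gets stuck before \<chi>;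
  by closure the conditions outside \<open>J\<close> then have a union \<open>q\<close>. Being stuck
  means that the antichains are maximal.\<close>

lemma easton:
  assumes \<chi>: "regular_cardinal M \<chi>" and J: "J \<in> M"
    and clos: "\<And>C. C \<in> M \<Longrightarrow> lss C \<chi> \<Longrightarrow> elts C \<subseteq> elts (Qs J) \<Longrightarrow> (\<And>p q. p \<in> elts C \<Longrightarrow> q \<in> elts C \<Longrightarrow> agree p q) \<Longrightarrow> Un1 C \<in> elts CP"
    and anti: "\<And>A. A \<in> M \<Longrightarrow> elts A \<subseteq> elts (Rs J) \<Longrightarrow> (\<And>p q. p \<in> elts A \<Longrightarrow> q \<in> elts A \<Longrightarrow> p \<noteq> q \<Longrightarrow> \<not> agree p q) \<Longrightarrow> lss A \<chi>"
    and \<delta>: "\<delta> \<in> M" "lss \<delta> \<chi>" and B: "B \<in> M"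
    and dDec: "dfn (\<lambda>e. Dec (e 0) (e 1) (e 2))"
    and mono: "\<And>\<xi> p p' \<beta>. Dec \<xi> p \<beta> \<Longrightarrow> p \<in> elts CP \<Longrightarrow> p' \<in> elts CP \<Longrightarrow> elts p \<subseteq> elts p' \<Longrightarrow> Dec \<xi> p' \<beta>"
    and dense: "\<And>\<xi> p. \<xi> \<in> elts \<delta> \<Longrightarrow> p \<in> elts CP \<Longrightarrow> \<exists>p'\<in>elts CP. elts p \<subseteq> elts p' \<and> (\<exists>\<beta>\<in>elts B. Dec \<xi> p' \<beta>)"
    and p0: "p0 \<in> elts CP"
  shows "\<exists>p\<in>elts CP. elts p0 \<subseteq> elts p \<and> (\<exists>T\<in>M. egood Dec \<delta> B J \<chi> (co J p) T)"
proof -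
  note x = regularD[OF \<chi>]
  note dDec' = dfn3[of Dec, OF dDec]
  define q0 where "q0 = co J p0"
  have q0: "q0 \<in> elts (Qs J)" unfolding q0_def by (rule co_Qs[OF p0 J])
  have q0M: "q0 \<in> M" unfolding q0_def using J CP_M[OF p0] by simp
  define W where "W = hprod \<delta> (hprod (Rs J) (hprod B (Qs J)))"
  have W: "W \<in> M" unfolding W_def using J B \<delta> by simp
  define zr where "zr z = hfst (hsnd z)" for z
  define zb where "zb z = hfst (hsnd (hsnd z))" for z
  define zq where "zq z = hsnd (hsnd (hsnd z))" for z
  have dz: "dft (\<lambda>e. zr (t e))" "dft (\<lambda>e. zb (t e))" "dft (\<lambda>e. zq (t e))" if "dft t" for t
    unfolding zr_def zb_def zq_def by (intro dfn_intros that)+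
  have Wz: "hfst z \<in> elts \<delta>" "zr z \<in> elts (Rs J)" "zb z \<in> elts B" "zq z \<in> elts (Qs J)" if "z \<in> elts W" for z
    using that unfolding W_def zr_def zb_def zq_def by auto
  \<comment> \<open>A candidate extends all previous conditions outside \<open>J\<close>, is
    incompatible on \<open>J\<close> with every earlier choice for the same \<xi>, and decides a
    value at \<xi>.\<close>
  define Cand where "Cand i f = mk {z \<in> elts W. elts q0 \<subseteq> elts (zq z) \<and>
    (\<forall>j\<in>elts i. elts (zq (ap f j)) \<subseteq> elts (zq z) \<and> (hfst (ap f j) = hfst z \<longrightarrow> \<not> agree (zr (ap f j)) (zr z))) \<and>
    Dec (hfst z) (mk (elts (zr z) \<union> elts (zq z))) (zb z)}" for i f
  have dCand: "dft (\<lambda>e. Cand (e 0) (e 1))" unfolding Cand_def by (intro dfn_intros dz dDec' W q0M)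
  note dCand' = dft2[of Cand, OF dCand]
  obtain ch where ch: "ch \<in> M" "\<And>x. x \<in> M \<Longrightarrow> elts x \<subseteq> elts W \<Longrightarrow> elts x \<noteq> {} \<Longrightarrow> ap ch x \<in> elts x"
    using choice_fun[OF W] by metis
  define F where "F = hrec (\<lambda>x. x) (\<lambda>i f. ap ch (Cand i f))"
  have dF: "dft (\<lambda>e. F (e 0))" unfolding F_def by (rule dft_hrec[OF _ _ wf_elts']) (intro dfn_intros dCand' ch)+
  note dF' = dft1[of F, OF dF]
  define C where "C i = Cand i (lam i F)" for i
  have F: "F i = ap ch (C i)" for i unfolding C_def F_def by (subst hrec_unfold[OF wf_elts']) simp
  have eC: "z \<in> elts (C i) \<longleftrightarrow> z \<in> elts W \<and> elts q0 \<subseteq> elts (zq z) \<and>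
    (\<forall>j\<in>elts i. elts (zq (F j)) \<subseteq> elts (zq z) \<and> (hfst (F j) = hfst z \<longrightarrow> \<not> agree (zr (F j)) (zr z))) \<and>
    Dec (hfst z) (mk (elts (zr z) \<union> elts (zq z))) (zb z)" for z i
  proof -
    have "elts (C i) = {z \<in> elts W. elts q0 \<subseteq> elts (zq z) \<and>
    (\<forall>j\<in>elts i. elts (zq (ap (lam i F) j)) \<subseteq> elts (zq z) \<and> (hfst (ap (lam i F) j) = hfst z \<longrightarrow> \<not> agree (zr (ap (lam i F) j)) (zr z))) \<and>
    Dec (hfst z) (mk (elts (zr z) \<union> elts (zq z))) (zb z)}"
      unfolding C_def Cand_def by (rule elts_mk) (intro countable_Collect countable_elts)
    then show ?thesis by simp
  qed
  have CM: "C i \<in> M" if "i \<in> M" for i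
    unfolding C_def by (rule dft1_M[of "\<lambda>i. Cand i (lam i F)", OF _ that]) (intro dfn_intros dCand' dF')
  have FC: "F i \<in> elts (C i)" if "i \<in> M" "elts (C i) \<noteq> {}" for i
    unfolding F by (rule ch(2)[OF CM[OF that(1)] _ that(2)]) (use eC in blast)
  have chiM: "i \<in> M" if "i \<in> elts \<chi>" for i using M_trans[OF that x(3)] .
  have Rag: "agree r r" if "r \<in> elts (Rs J)" for r using that CP_agree unfolding elts_Rs by blast
  have "\<exists>i\<in>elts \<chi>. elts (C i) = {}"
  proof (rule ccontr)
    assume "\<not> ?thesis"
    then have FCi: "F i \<in> elts (C i)" if "i \<in> elts \<chi>" for i using FC[OF chiM[OF that]] that by blast
    have FW: "F i \<in> elts W" if "i \<in> elts \<chi>" for i using FCi[OF that] eC by blast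
    have sep: "\<not> agree (zr (F j)) (zr (F i))" if "i \<in> elts \<chi>" "j \<in> elts i" "hfst (F j) = hfst (F i)" for i j
      using FCi[OF that(1)] that(2,3) eC by blast
    have sep': "\<not> agree (zr (F j)) (zr (F i))" if "i \<in> elts \<chi>" "j \<in> elts \<chi>" "i \<noteq> j" "hfst (F j) = hfst (F i)" for i j
      using ordinal_linear[OF ordinal_elem[OF x(4) that(1)] ordinal_elem[OF x(4) that(2)]] sep[of i j] sep[of j i] that agree_sym by metis
    \<comment> \<open>The stages devoted to \<xi>; they inject into an antichain of
      \<open>Rs J\<close>. If no stage below \<chi> got stuck, \<chi> would be a union of fewer than
      \<chi> sets smaller than \<chi>.\<close>
    define K where "K \<xi> = mk {i \<in> elts \<chi>. hfst (F i) = \<xi>}" for \<xi>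
    have eK: "i \<in> elts (K \<xi>) \<longleftrightarrow> i \<in> elts \<chi> \<and> hfst (F i) = \<xi>" for i \<xi> unfolding K_def by simp
    have dK: "dft (\<lambda>e. K (e 0))" unfolding K_def by (intro dfn_intros dF' x)
    have dzF: "dft (\<lambda>e. zr (F (e 0)))" by (intro dz dF)
    have "lss (K \<xi>) \<chi>" if xd: "\<xi> \<in> elts \<delta>" for \<xi>
    proof -
      have KM: "K \<xi> \<in> M" by (rule dft1_M[OF dK M_trans[OF xd \<delta>(1)]])
      let ?A = "mk ((\<lambda>i. zr (F i)) ` elts (K \<xi>))"
      have A: "?A \<in> M" by (rule repl_in_M[OF KM dzF])
      have "lss ?A \<chi>"
      proof (rule anti[OF A])
        show "elts ?A \<subseteq> elts (Rs J)" using Wz(2) FW eK by auto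
        fix p q assume "p \<in> elts ?A" "q \<in> elts ?A" and pq: "p \<noteq> q"
        then obtain i j where ij: "i \<in> elts (K \<xi>)" "p = zr (F i)" "j \<in> elts (K \<xi>)" "q = zr (F j)" by auto
        then have "i \<noteq> j" using pq by blast
        then show "\<not> agree p q" using sep'[of j i] ij eK by auto
      qed
      moreover have "lep (K \<xi>) ?A"
      proof (rule lepI[OF KM dzF])
        fix i j assume ij: "i \<in> elts (K \<xi>)" "j \<in> elts (K \<xi>)" "zr (F i) = zr (F j)"
        show "i = j"
        proof (rule ccontr)
          assume "i \<noteq> j"
          then have "\<not> agree (zr (F j)) (zr (F i))" using sep'[of i j] ij eK by auto
          then show False using ij(3) Rag[OF Wz(2)[OF FW[of j]]] ij(2) eK by auto
        qed
      qed simp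
      ultimately show ?thesis using lss_lep_trans[OF KM] by blast
    qed
    then have U: "lss (mk (\<Union>\<xi>\<in>elts \<delta>. elts (K \<xi>))) \<chi>" by (rule lss_UN[OF \<chi> \<delta> dK])
    have UM: "mk (\<Union>\<xi>\<in>elts \<delta>. elts (K \<xi>)) \<in> M" by (rule UN_in_M[OF \<delta>(1) dK])
    have "elts (mk (\<Union>\<xi>\<in>elts \<delta>. elts (K \<xi>))) = (\<Union>\<xi>\<in>elts \<delta>. elts (K \<xi>))" by (rule elts_mk) (intro countable_UN countable_elts)
    then have "elts \<chi> \<subseteq> elts (mk (\<Union>\<xi>\<in>elts \<delta>. elts (K \<xi>)))" using Wz(1)[OF FW] eK by blast
    then have "lss \<chi> \<chi>" using lss_sub[OF UM x(3) _ U] by blast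
    then show False using not_lss[OF x(2,3)] lep_refl[OF x(3)] by blast
  qed
  then obtain i1 where "i1 \<in> elts \<chi>" "elts (C i1) = {}" by blast
  \<comment> \<open>The first stuck stage is taken, so that every earlier choice is a genuine
    candidate.\<close>
  then obtain i where i: "ordinal i" "i \<in> elts \<chi> \<and> elts (C i) = {}" "\<And>j. ordinal j \<Longrightarrow> j \<in> elts \<chi> \<and> elts (C j) = {} \<Longrightarrow> elts i \<subseteq> elts j"
    using ordinal_least[of i1 "\<lambda>i. i \<in> elts \<chi> \<and> elts (C i) = {}"] ordinal_elem[OF x(4)] by metis
  have ix: "i \<in> elts \<chi>" and Ci: "elts (C i) = {}" using i(2) by auto
  have iM: "i \<in> M" using chiM[OF ix] .
  have jx: "j \<in> elts \<chi>" if "j \<in> elts i" for j using ordinal_trans[OF that ix x(4)] .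
  have FCj: "F j \<in> elts (C j)" if j: "j \<in> elts i" for j
  proof (rule FC[OF chiM[OF jx[OF j]]])
    show "elts (C j) \<noteq> {}"
    proof
      assume "elts (C j) = {}"
      then have "elts i \<subseteq> elts j" using i(3)[OF ordinal_elem[OF i(1) j]] jx[OF j] by blast
      then show False using j foundation_hc_irrefl[of j] by blast
    qed
  qed
  have FW: "F j \<in> elts W" if "j \<in> elts i" for j using FCj[OF that] eC by blast
  define Cq where "Cq = mk (insert q0 (elts (mk ((\<lambda>j. zq (F j)) ` elts i))))"
  have dzqF: "dft (\<lambda>e. zq (F (e 0)))" by (intro dz dF)
  have im: "mk ((\<lambda>j. zq (F j)) ` elts i) \<in> M" by (rule repl_in_M[OF iM dzqF])
  have Cq: "Cq \<in> M" unfolding Cq_def by (rule insert_in_M[OF q0M im])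
  have eCq: "elts Cq = insert q0 ((\<lambda>j. zq (F j)) ` elts i)" unfolding Cq_def by simp
  have CqQ: "elts Cq \<subseteq> elts (Qs J)" unfolding eCq using q0 Wz(4) FW by blast
  have comp: "elts p \<subseteq> elts q \<or> elts q \<subseteq> elts p" if "p \<in> elts Cq" "q \<in> elts Cq" for p q
  proof -
    have 0: "elts q0 \<subseteq> elts (zq (F j))" if "j \<in> elts i" for j using FCj[OF that] eC by blast
    have 1: "elts (zq (F j)) \<subseteq> elts (zq (F k)) \<or> elts (zq (F k)) \<subseteq> elts (zq (F j))" if "j \<in> elts i" "k \<in> elts i" for j k
      using ordinal_linear[OF ordinal_elem[OF i(1) that(1)] ordinal_elem[OF i(1) that(2)]] FCj[OF that(1)] FCj[OF that(2)] eC by blast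
    show ?thesis using that 0 1 unfolding eCq by blast
  qed
  have Qag: "agree q q" if "q \<in> elts (Qs J)" for q using that CP_agree unfolding elts_Qs by blast
  have lssCq: "lss Cq \<chi>"
  proof -
    have "lep (mk ((\<lambda>j. zq (F j)) ` elts i)) i" by (rule lep_surj[OF iM im dzqF]) simp
    then have 1: "lss (mk ((\<lambda>j. zq (F j)) ` elts i)) \<chi>" by (rule lssI[OF ix])
    have "lss (mk (elts (mk {q0}) \<union> elts (mk ((\<lambda>j. zq (F j)) ` elts i)))) \<chi>"
      by (rule lss_cup[OF x(1) _ im lss_finite[OF x(1)] 1]) (use q0M in simp_all)
    then show ?thesis unfolding Cq_def by simp
  qed
  define q where "q = Un1 Cq"
  have qCP: "q \<in> elts CP" unfolding q_def
  proof (rule clos[OF Cq lssCq CqQ])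
    fix a b assume ab: "a \<in> elts Cq" "b \<in> elts Cq"
    have "agree a a" "agree b b" using ab CqQ Qag by blast+
    then show "agree a b" using comp[OF ab] agree_mono[of a a a b] agree_mono[of b b a b] by blast
  qed
  have eq: "elts q = (\<Union>a\<in>elts Cq. elts a)" unfolding q_def by simp
  have qQ: "q \<in> elts (Qs J)" unfolding elts_Qs using qCP CqQ eq unfolding elts_Qs by auto
  have qM: "q \<in> M" using CP_M[OF qCP] .
  have q0q: "elts q0 \<subseteq> elts q" unfolding eq eCq by blast
  have zqq: "elts (zq (F j)) \<subseteq> elts q" if "j \<in> elts i" for j unfolding eq eCq using that by blast
  \<comment> \<open>On \<open>J\<close> nothing is added to \<open>p0\<close>; only the part outside
    \<open>J\<close> has grown.\<close>
  define p where "p = mk (elts (restr J p0) \<union> elts q)"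
  have pCP: "p \<in> elts CP" unfolding p_def by (rule RQ_union[OF restr_Rs[OF p0 J] qQ])
  have ep: "elts p = elts (restr J p0) \<union> elts q" unfolding p_def by simp
  have "co J p = q"
    by (rule hc_eqI) (use qQ in \<open>auto simp: elts_co ep elts_restr elts_Qs\<close>)
  have p0p: "elts p0 \<subseteq> elts p" using q0q unfolding ep q0_def by (auto simp: elts_co elts_restr)
  define T where "T = mk ((\<lambda>j. hpair (hfst (F j)) (hpair (zr (F j)) (zb (F j)))) ` elts i)"
  have dT: "dft (\<lambda>e. hpair (hfst (F (e 0))) (hpair (zr (F (e 0))) (zb (F (e 0)))))" by (intro dfn_intros dz dF')
  have TM: "T \<in> M" unfolding T_def by (rule repl_in_M[OF iM dT])
  have eT: "elts T = (\<lambda>j. hpair (hfst (F j)) (hpair (zr (F j)) (zb (F j)))) ` elts i" unfolding T_def by simp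
  have "egood Dec \<delta> B J \<chi> q T"
    unfolding egood_def
  proof (intro conjI ballI impI)
    have "lep T i" by (rule lep_surj[OF iM TM dT]) (simp add: eT)
    then show "lss T \<chi>" by (rule lssI[OF ix])
  next
    fix t assume "t \<in> elts T"
    then obtain j where j: "j \<in> elts i" "t = hpair (hfst (F j)) (hpair (zr (F j)) (zb (F j)))" unfolding eT by blast
    note w = Wz[OF FW[OF j(1)]]
    have "Dec (hfst (F j)) (mk (elts (zr (F j)) \<union> elts (zq (F j)))) (zb (F j))" using FCj[OF j(1)] eC by blast
    then have "Dec (hfst (F j)) (mk (elts (zr (F j)) \<union> elts q)) (zb (F j))"
      by (rule mono[OF _ RQ_union[OF w(2,4)] RQ_union[OF w(2) qQ]]) (use zqq[OF j(1)] in auto)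
    then show "\<exists>\<xi>\<in>elts \<delta>. \<exists>r\<in>elts (Rs J). \<exists>\<beta>\<in>elts B. t = hpair \<xi> (hpair r \<beta>) \<and> Dec \<xi> (mk (elts r \<union> elts q)) \<beta>"
      using j(2) w by blast
  next
    fix t t' assume "t \<in> elts T" "t' \<in> elts T" and tt: "hfst t = hfst t' \<and> t \<noteq> t'"
    then obtain j k where jk: "j \<in> elts i" "t = hpair (hfst (F j)) (hpair (zr (F j)) (zb (F j)))"
      "k \<in> elts i" "t' = hpair (hfst (F k)) (hpair (zr (F k)) (zb (F k)))" unfolding eT by blast
    have ne: "j \<noteq> k" "hfst (F j) = hfst (F k)" using tt jk by auto
    have s: "\<not> agree (zr (F a)) (zr (F b))" if "b \<in> elts i" "a \<in> elts b" "hfst (F a) = hfst (F b)" for a b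
      using FCj[OF that(1)] that(2,3) eC by blast
    have "\<not> agree (zr (F j)) (zr (F k))"
      using ordinal_linear[OF ordinal_elem[OF i(1) jk(1)] ordinal_elem[OF i(1) jk(3)]] ne s[of k j] s[of j k] jk agree_sym by metis
    then show "\<not> agree (hfst (hsnd t)) (hfst (hsnd t'))" using jk by simp
  next
    fix \<xi> r assume xd: "\<xi> \<in> elts \<delta>" and r: "r \<in> elts (Rs J)"
    show "\<exists>t\<in>elts T. hfst t = \<xi> \<and> agree (hfst (hsnd t)) r"
    proof (rule ccontr)
      assume "\<not> ?thesis"
      then have no: "\<not> agree (zr (F j)) r" if "j \<in> elts i" "hfst (F j) = \<xi>" for j using that unfolding eT by auto
      have "mk (elts r \<union> elts q) \<in> elts CP" by (rule RQ_union[OF r qQ])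
      from dense[OF xd this] obtain p' \<beta> where p': "p' \<in> elts CP" "elts r \<union> elts q \<subseteq> elts p'" "\<beta> \<in> elts B" "Dec \<xi> p' \<beta>" by auto
      \<comment> \<open>If \<open>r\<close> were incompatible with everything recorded for \<xi>, an
        extension of \<open>r\<close> and \<open>q\<close> deciding a value would be a further
        candidate at the stuck stage.\<close>
      let ?z = "hpair \<xi> (hpair (restr J p') (hpair \<beta> (co J p')))"
      have zW: "?z \<in> elts W" unfolding W_def using xd p'(3) restr_Rs[OF p'(1) J] co_Qs[OF p'(1) J] by simp
      have qc: "elts q \<subseteq> elts (co J p')" using p'(2) qQ unfolding elts_co elts_Qs by blast
      have rr: "elts r \<subseteq> elts (restr J p')" using p'(2) r unfolding elts_restr elts_Rs by blast
      have "?z \<in> elts (C i)" unfolding eC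
      proof (intro conjI ballI impI)
        show "?z \<in> elts W" by (rule zW)
        show "elts q0 \<subseteq> elts (zq ?z)" using q0q qc by (simp add: zq_def)
        show "Dec (hfst ?z) (mk (elts (zr ?z) \<union> elts (zq ?z))) (zb ?z)" using p'(4) by (simp add: zr_def zq_def zb_def restr_co_union)
        fix j assume j: "j \<in> elts i"
        show "elts (zq (F j)) \<subseteq> elts (zq ?z)" using zqq[OF j] qc by (simp add: zq_def)
        assume "hfst (F j) = hfst ?z"
        then have "\<not> agree (zr (F j)) r" using no[OF j] by simp
        then show "\<not> agree (zr (F j)) (zr ?z)" using agree_mono[of "zr (F j)" "zr ?z" "zr (F j)" r] rr by (auto simp: zr_def)
      qed
      then show False using Ci by blast
    qed
  qed
  then show ?thesis using pCP p0p TM \<open>co J p = q\<close> by blast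
qed

end

lemma (in forcing) decide:
  assumes f: "f \<in> N" and \<delta>: "\<delta> \<in> M" and B: "B \<in> M" and fB: "\<And>\<xi>. \<xi> \<in> elts \<delta> \<Longrightarrow> ap f \<xi> \<in> elts B"
  obtains Dec where "dfn (\<lambda>e. Dec (e 0) (e 1) (e 2))" "\<And>\<xi> p p' \<beta>. Dec \<xi> p \<beta> \<Longrightarrow> le p' p \<Longrightarrow> Dec \<xi> p' \<beta>"
    "\<And>\<xi> p. \<xi> \<in> elts \<delta> \<Longrightarrow> p \<in> elts P \<Longrightarrow> \<exists>p'\<in>elts P. le p' p \<and> (\<exists>\<beta>\<in>elts B. Dec \<xi> p' \<beta>)"
    "\<And>\<xi> p \<beta>. \<xi> \<in> elts \<delta> \<Longrightarrow> p \<in> G \<Longrightarrow> \<beta> \<in> M \<Longrightarrow> Dec \<xi> p \<beta> \<Longrightarrow> \<beta> = ap f \<xi>"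
proof (cases "elts \<delta> = {}")
  case True
  show ?thesis by (rule that[of "\<lambda>_ _ _. False"]) (use True in \<open>auto intro: dfn_const\<close>)
next
  case False
  then obtain b0 where b0: "b0 \<in> elts B" using fB by blast
  have b0M: "b0 \<in> M" using M_trans[OF b0 B] .
  let ?F = "lam \<delta> (\<lambda>x. ap f x)"
  have "?F \<in> N" by (rule ext.lam_in_M[OF M_N[OF \<delta>]]) (intro dfn_intros f)
  then obtain \<tau> where t: "\<tau> \<in> M" "?F = val G \<tau>" by (rule N_name)
  define st where "st p \<xi> \<beta> \<longleftrightarrow> fmem p (opn (chk \<xi>) (chk \<beta>)) \<tau>" for p \<xi> \<beta>
  have dst: "dfn (\<lambda>e. st (e 0) (e 1) (e 2))" unfolding st_def by (intro dfn_intros t)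
  note dst' = dfn3[of st, OF dst]
  have st_tr: "(\<exists>p\<in>G. st p \<xi> \<beta>) \<longleftrightarrow> \<xi> \<in> elts \<delta> \<and> \<beta> = ap f \<xi>" if "\<xi> \<in> M" "\<beta> \<in> M" for \<xi> \<beta>
  proof -
    have "opn (chk \<xi>) (chk \<beta>) \<in> M" by (rule dft_constD, intro dfn_intros that)
    from fmem_truth[OF this t(1)] show ?thesis unfolding st_def t(2)[symmetric] by simp
  qed
  \<comment> \<open>The second alternative assigns the default \<open>b0\<close> below conditions
    that leave no value possible. This makes deciding conditions dense everywhere, although not
    every condition forces the name to be a function; members of \<open>G\<close> never use this
    alternative.\<close>
  define Dec where "Dec \<xi> p \<beta> \<longleftrightarrow> st p \<xi> \<beta> \<or> (\<beta> = b0 \<and> (\<forall>\<beta>'\<in>elts B. \<forall>q\<in>elts P. le q p \<longrightarrow> \<not> st q \<xi> \<beta>'))" for \<xi> p \<beta>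
  show ?thesis
  proof (rule that[of Dec])
    show "dfn (\<lambda>e. Dec (e 0) (e 1) (e 2))" unfolding Dec_def by (intro dfn_intros dst' B b0M poset_M)
    show "Dec \<xi> p' \<beta>" if "Dec \<xi> p \<beta>" "le p' p" for \<xi> p p' \<beta>
      using that(1) fmem_mono[OF _ that(2)] le_trans[OF _ that(2)] unfolding Dec_def st_def by blast
    show "\<exists>p'\<in>elts P. le p' p \<and> (\<exists>\<beta>\<in>elts B. Dec \<xi> p' \<beta>)" if "p \<in> elts P" for \<xi> p
    proof (cases "\<exists>\<beta>'\<in>elts B. \<exists>q\<in>elts P. le q p \<and> st q \<xi> \<beta>'")
      case True then show ?thesis unfolding Dec_def by blast
    next
      case False
      then have "Dec \<xi> p b0" unfolding Dec_def by blast
      then show ?thesis using that le_refl b0 by blast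
    qed
    show "\<beta> = ap f \<xi>" if x: "\<xi> \<in> elts \<delta>" and p: "p \<in> G" and b: "\<beta> \<in> M" and D: "Dec \<xi> p \<beta>" for \<xi> p \<beta>
    proof -
      have xM: "\<xi> \<in> M" using M_trans[OF x \<delta>] .
      have fM: "ap f \<xi> \<in> M" using M_trans[OF fB[OF x] B] .
      obtain q where q: "q \<in> G" "st q \<xi> (ap f \<xi>)" using st_tr[OF xM fM] x by blast
      obtain u where u: "u \<in> G" "le u p" "le u q" using G_dir[OF p q(1)] by blast
      have "st u \<xi> (ap f \<xi>)" using q(2) fmem_mono[OF _ u(3)] unfolding st_def by blast
      then have "\<not> (\<forall>\<beta>'\<in>elts B. \<forall>q\<in>elts P. le q p \<longrightarrow> \<not> st q \<xi> \<beta>')" using fB[OF x] u G_P by blast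
      then have "st p \<xi> \<beta>" using D unfolding Dec_def by blast
      then show ?thesis using st_tr[OF xM b] p by blast
    qed
  qed
qed

context cohen begin

lemma CP_predense:
  assumes S: "S \<in> M" "elts S \<subseteq> elts CP"
  shows "\<exists>A\<in>M. elts A \<subseteq> elts S \<and> lep A l \<and> (\<forall>p\<in>elts S. \<exists>q\<in>elts A. agree p q)"
proof (rule predense_subset[OF lr powl II_M S(1)])
  fix p assume "p \<in> elts S"
  then have "p \<in> elts CP" using S by blast
  then show "elts p \<subseteq> elts (hprod II two) \<and> agree p p \<and> lss p l" using lss_CP unfolding elts_CP by blast
qed

lemma Rs_antichain:
  assumes A: "A \<in> M" "elts A \<subseteq> elts (Rs I0)" and anti: "\<And>p q. p \<in> elts A \<Longrightarrow> q \<in> elts A \<Longrightarrow> p \<noteq> q \<Longrightarrow> \<not> agree p q"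
  shows "lep A \<theta>"
proof -
  have "\<exists>A'\<in>M. elts A' \<subseteq> elts A \<and> lep A' \<theta> \<and> (\<forall>p\<in>elts A. \<exists>q\<in>elts A'. agree p q)"
  proof (rule predense_subset[OF th powth II_M A(1)])
    fix p assume "p \<in> elts A"
    then have p: "p \<in> elts CP" "\<forall>z\<in>elts p. hfst z \<in> elts I0" using A(2) unfolding elts_Rs by blast+
    have "restr I0 p = p" by (rule hc_eqI) (use p(2) in \<open>auto simp: elts_restr\<close>)
    then show "elts p \<subseteq> elts (hprod II two) \<and> agree p p \<and> lss p \<theta>" using p(1) unfolding elts_CP by auto
  qed
  then obtain A' where A': "A' \<in> M" "elts A' \<subseteq> elts A" "lep A' \<theta>" "\<forall>p\<in>elts A. \<exists>q\<in>elts A'. agree p q" by blast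
  have "elts A \<subseteq> elts A'" using anti A'(2,4) by blast
  then show ?thesis using lep_trans[OF A(1) lep_subset[OF A(1)] A'(3)] by blast
qed

text \<open>The case \<chi> = \<open>l\<close>: antichains of the first factor have size at most
  \<theta> < \<open>l\<close>, and the second factor is closed below \<open>l\<close>.\<close>

lemma easton_I0_hyps:
  shows "C \<in> M \<Longrightarrow> lss C l \<Longrightarrow> elts C \<subseteq> elts (Qs I0) \<Longrightarrow> (\<And>p q. p \<in> elts C \<Longrightarrow> q \<in> elts C \<Longrightarrow> agree p q) \<Longrightarrow> Un1 C \<in> elts CP"
    and "A \<in> M \<Longrightarrow> elts A \<subseteq> elts (Rs I0) \<Longrightarrow> (\<And>p q. p \<in> elts A \<Longrightarrow> q \<in> elts A \<Longrightarrow> p \<noteq> q \<Longrightarrow> \<not> agree p q) \<Longrightarrow> lss A l"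
proof -
  assume C: "C \<in> M" "lss C l" "elts C \<subseteq> elts (Qs I0)" "\<And>p q. p \<in> elts C \<Longrightarrow> q \<in> elts C \<Longrightarrow> agree p q"
  show "Un1 C \<in> elts CP"
    by (rule chain_union[OF C(1) _ C(4,2)]) (use C(3) in \<open>auto simp: elts_Qs\<close>)
next
  assume "A \<in> M" "elts A \<subseteq> elts (Rs I0)" "\<And>p q. p \<in> elts A \<Longrightarrow> q \<in> elts A \<Longrightarrow> p \<noteq> q \<Longrightarrow> \<not> agree p q"
  then show "lss A l" using lssI[OF thl Rs_antichain] by blast
qed

lemma Rs_empty: "elts (Rs (mk {})) \<subseteq> {mk {}}"
proof
  fix r assume "r \<in> elts (Rs (mk {}))"
  then have "elts r = {}" unfolding elts_Rs by auto
  then have "r = mk {}" by (metis mk_elts)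
  then show "r \<in> {mk {}}" by simp
qed

text \<open>The case \<chi> = \<theta>, where the first factor is trivial and the whole poset is the
  closed one. Easton's argument becomes the usual one that a closed forcing adds no short sequences
  of ground model elements.\<close>

lemma easton_empty_hyps:
  shows "C \<in> M \<Longrightarrow> lss C \<theta> \<Longrightarrow> elts C \<subseteq> elts (Qs (mk {})) \<Longrightarrow> (\<And>p q. p \<in> elts C \<Longrightarrow> q \<in> elts C \<Longrightarrow> agree p q) \<Longrightarrow> Un1 C \<in> elts CP"
    and "A \<in> M \<Longrightarrow> elts A \<subseteq> elts (Rs (mk {})) \<Longrightarrow> lss A \<theta>"
proof -
  assume C: "C \<in> M" "lss C \<theta>" "elts C \<subseteq> elts (Qs (mk {}))" "\<And>p q. p \<in> elts C \<Longrightarrow> q \<in> elts C \<Longrightarrow> agree p q"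
  show "Un1 C \<in> elts CP"
    by (rule chain_union[OF C(1) _ C(4) lss_theta_l[OF C(2)]]) (use C(2,3) in \<open>auto simp: elts_Qs\<close>)
next
  assume A: "A \<in> M" "elts A \<subseteq> elts (Rs (mk {}))"
  have "finite (elts A)" using finite_subset[of "elts A" "{mk {}}"] A(2) Rs_empty by auto
  then show "lss A \<theta>" by (rule lss_finite[OF regularD(1)[OF th] A(1)])
qed

end

section \<open>Covering functions of the extension by ground model sets\<close>

locale cohen_ext = cohen +
  fixes G :: "hc set"
  assumes generic: "generic M CP Cleq (mk {}) G"

sublocale cohen_ext \<subseteq> forcing M CP Cleq "mk {}" G
  by unfold_locales (rule notion, rule generic)

context cohen_ext begin

lemma G_CP: "p \<in> G \<Longrightarrow> p \<in> elts CP" using G_P .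

lemma G_sub: "p \<in> G \<Longrightarrow> q \<in> elts CP \<Longrightarrow> elts q \<subseteq> elts p \<Longrightarrow> q \<in> G"
  using G_up[of p q] G_CP[of p] Cleq_iff by blast

lemma G_ext: "p \<in> G \<Longrightarrow> q \<in> G \<Longrightarrow> \<exists>r\<in>G. elts p \<subseteq> elts r \<and> elts q \<subseteq> elts r"
  using G_dir[of p q] unfolding Cleq_iff by blast

lemma G_meets':
  assumes p: "p \<in> G" and Q: "dfn (\<lambda>e. Q (e 0))" and d: "\<And>q. q \<in> elts CP \<Longrightarrow> elts p \<subseteq> elts q \<Longrightarrow> \<exists>r\<in>elts CP. elts q \<subseteq> elts r \<and> Q r"
  shows "\<exists>r\<in>G. Q r \<and> elts p \<subseteq> elts r"
proof -
  have "\<exists>r\<in>G. Q r \<and> hpair r p \<in> elts Cleq"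
    by (rule G_meets[OF p Q]) (use d in \<open>auto simp: Cleq_iff\<close>)
  then show ?thesis unfolding Cleq_iff by blast
qed

lemma empty_G: "mk {} \<in> G" using one_G .

lemma agree_G: "p \<in> G \<Longrightarrow> q \<in> G \<Longrightarrow> agree p q"
  using G_ext[of p q] CP_agree agree_mono G_CP by blast

text \<open>Whether \<open>G\<close> meets \<open>S\<close> \<xi> can be tested on at most
  \<open>l\<close> conditions, found in the ground model for all \<xi> at once. Every condition
  below a member of \<open>S\<close> \<xi> is again in \<open>S\<close> \<xi> and so compatible with
  a selected one; hence extensions of the selected ones are dense there.\<close>

lemma cc_G:
  assumes K: "K \<in> M" and dS: "dft (\<lambda>e. S (e 0))" and S: "\<And>\<xi>. \<xi> \<in> elts K \<Longrightarrow> elts (S \<xi>) \<subseteq> elts CP"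
    and down: "\<And>\<xi> p q. \<xi> \<in> elts K \<Longrightarrow> p \<in> elts (S \<xi>) \<Longrightarrow> q \<in> elts CP \<Longrightarrow> elts p \<subseteq> elts q \<Longrightarrow> q \<in> elts (S \<xi>)"
  shows "\<exists>A\<in>M. \<forall>\<xi>\<in>elts K. elts (ap A \<xi>) \<subseteq> elts (S \<xi>) \<and> lep (ap A \<xi>) l \<and> (G \<inter> elts (S \<xi>) \<noteq> {} \<longrightarrow> G \<inter> elts (ap A \<xi>) \<noteq> {})"
proof -
  note dS' = dft1[of S, OF dS]
  have "\<exists>A\<in>M. \<forall>\<xi>\<in>elts K. elts (ap A \<xi>) \<subseteq> elts (S \<xi>) \<and> lep (ap A \<xi>) l \<and> (\<forall>p\<in>elts (S \<xi>). \<exists>q\<in>elts (ap A \<xi>). agree p q)"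
  proof (rule AC[OF K, of "\<lambda>\<xi> A. elts A \<subseteq> elts (S \<xi>) \<and> lep A l \<and> (\<forall>p\<in>elts (S \<xi>). \<exists>q\<in>elts A. agree p q)"])
    show "dfn (\<lambda>e. elts (e 1) \<subseteq> elts (S (e 0)) \<and> lep (e 1) l \<and> (\<forall>p\<in>elts (S (e 0)). \<exists>q\<in>elts (e 1). agree p q))"
      by (intro dfn_intros dS' lM)
    fix \<xi> assume x: "\<xi> \<in> elts K"
    have "S \<xi> \<in> M" by (rule dft1_M[OF dS M_trans[OF x K]])
    from CP_predense[OF this S[OF x]]
    show "\<exists>A\<in>M. elts A \<subseteq> elts (S \<xi>) \<and> lep A l \<and> (\<forall>p\<in>elts (S \<xi>). \<exists>q\<in>elts A. agree p q)" .
  qed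
  then obtain A where A: "A \<in> M" "\<And>\<xi>. \<xi> \<in> elts K \<Longrightarrow> elts (ap A \<xi>) \<subseteq> elts (S \<xi>) \<and> lep (ap A \<xi>) l \<and> (\<forall>p\<in>elts (S \<xi>). \<exists>q\<in>elts (ap A \<xi>). agree p q)" by blast
  have "G \<inter> elts (ap A \<xi>) \<noteq> {}" if x: "\<xi> \<in> elts K" and ne: "G \<inter> elts (S \<xi>) \<noteq> {}" for \<xi>
  proof -
    obtain p where p: "p \<in> G" "p \<in> elts (S \<xi>)" using ne by blast
    have aM: "ap A \<xi> \<in> M" using A(1) M_trans[OF x K] by simp
    have "\<exists>r\<in>G. (\<exists>a\<in>elts (ap A \<xi>). elts a \<subseteq> elts r) \<and> elts p \<subseteq> elts r"
    proof (rule G_meets'[OF p(1)])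
      show "dfn (\<lambda>e. \<exists>a\<in>elts (ap A \<xi>). elts a \<subseteq> elts (e 0))" by (intro dfn_intros aM)
      fix q assume q: "q \<in> elts CP" "elts p \<subseteq> elts q"
      have "q \<in> elts (S \<xi>)" by (rule down[OF x p(2) q])
      then obtain a where a: "a \<in> elts (ap A \<xi>)" "agree q a" using A(2)[OF x] by blast
      have "a \<in> elts CP" using a(1) A(2)[OF x] S[OF x] by blast
      from CP_union[OF q(1) this a(2)] show "\<exists>r\<in>elts CP. elts q \<subseteq> elts r \<and> (\<exists>a\<in>elts (ap A \<xi>). elts a \<subseteq> elts r)"
        using a(1) by (intro bexI[of _ "mk (elts q \<union> elts a)"]) auto
    qed
    then obtain r a where r: "r \<in> G" "a \<in> elts (ap A \<xi>)" "elts a \<subseteq> elts r" by blast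
    have "a \<in> elts CP" using r(2) A(2)[OF x] S[OF x] by blast
    then have "a \<in> G" using G_sub r by blast
    then show ?thesis using r(2) by blast
  qed
  then show ?thesis using A by blast
qed

text \<open>The possible values at \<xi> are those assigned to the at most \<open>l\<close> selected
  conditions that decide the value there.\<close>

lemma cover_l:
  assumes f: "f \<in> N" and \<delta>: "\<delta> \<in> M" and B: "B \<in> M" and fB: "\<And>\<xi>. \<xi> \<in> elts \<delta> \<Longrightarrow> ap f \<xi> \<in> elts B"
  shows "\<exists>F\<in>M. \<forall>\<xi>\<in>elts \<delta>. ap f \<xi> \<in> elts (ap F \<xi>) \<and> elts (ap F \<xi>) \<subseteq> elts B \<and> lep (ap F \<xi>) l"
proof -
  obtain Dec where D: "dfn (\<lambda>e. Dec (e 0) (e 1) (e 2))" "\<And>\<xi> p p' \<beta>. Dec \<xi> p \<beta> \<Longrightarrow> le p' p \<Longrightarrow> Dec \<xi> p' \<beta>"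
    "\<And>\<xi> p. \<xi> \<in> elts \<delta> \<Longrightarrow> p \<in> elts CP \<Longrightarrow> \<exists>p'\<in>elts CP. le p' p \<and> (\<exists>\<beta>\<in>elts B. Dec \<xi> p' \<beta>)"
    "\<And>\<xi> p \<beta>. \<xi> \<in> elts \<delta> \<Longrightarrow> p \<in> G \<Longrightarrow> \<beta> \<in> M \<Longrightarrow> Dec \<xi> p \<beta> \<Longrightarrow> \<beta> = ap f \<xi>"
    using decide[OF f \<delta> B fB] by blast
  note D' = dfn3[of Dec, OF D(1)]
  define S where "S \<xi> = mk {p \<in> elts CP. \<exists>\<beta>\<in>elts B. Dec \<xi> p \<beta>}" for \<xi>
  have dS: "dft (\<lambda>e. S (e 0))" unfolding S_def by (intro dfn_intros D' B CP_in_M)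
  have eS: "elts (S \<xi>) = {p \<in> elts CP. \<exists>\<beta>\<in>elts B. Dec \<xi> p \<beta>}" for \<xi> unfolding S_def by simp
  have "\<exists>A\<in>M. \<forall>\<xi>\<in>elts \<delta>. elts (ap A \<xi>) \<subseteq> elts (S \<xi>) \<and> lep (ap A \<xi>) l \<and> (G \<inter> elts (S \<xi>) \<noteq> {} \<longrightarrow> G \<inter> elts (ap A \<xi>) \<noteq> {})"
  proof (rule cc_G[OF \<delta> dS])
    fix \<xi> p q assume "p \<in> elts (S \<xi>)" "q \<in> elts CP" "elts p \<subseteq> elts q"
    then have "le q p" "p \<in> elts (S \<xi>)" "q \<in> elts CP" unfolding Cleq_iff eS by blast+
    then show "q \<in> elts (S \<xi>)" unfolding eS using D(2) by blast
  qed (use eS in blast)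
  then obtain A where A: "A \<in> M" "\<And>\<xi>. \<xi> \<in> elts \<delta> \<Longrightarrow> elts (ap A \<xi>) \<subseteq> elts (S \<xi>) \<and> lep (ap A \<xi>) l \<and> (G \<inter> elts (S \<xi>) \<noteq> {} \<longrightarrow> G \<inter> elts (ap A \<xi>) \<noteq> {})" by blast
  \<comment> \<open>Outside \<open>G\<close> a condition may be related by \<open>Dec\<close> to
    several values. Fixing one for each condition bounds the number of values by the number of
    conditions.\<close>
  have "\<exists>c\<in>M. \<forall>z\<in>elts (hprod \<delta> CP). (\<exists>\<beta>\<in>elts B. Dec (hfst z) (hsnd z) \<beta>) \<longrightarrow> ap c z \<in> elts B \<and> Dec (hfst z) (hsnd z) (ap c z)"
  proof (rule AC[of _ "\<lambda>z b. (\<exists>\<beta>\<in>elts B. Dec (hfst z) (hsnd z) \<beta>) \<longrightarrow> b \<in> elts B \<and> Dec (hfst z) (hsnd z) b"])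
    show "hprod \<delta> CP \<in> M" using \<delta> by simp
    show "dfn (\<lambda>e. (\<exists>\<beta>\<in>elts B. Dec (hfst (e 0)) (hsnd (e 0)) \<beta>) \<longrightarrow> e 1 \<in> elts B \<and> Dec (hfst (e 0)) (hsnd (e 0)) (e 1))"
      by (intro dfn_intros D' B)
    fix z
    show "\<exists>y\<in>M. (\<exists>\<beta>\<in>elts B. Dec (hfst z) (hsnd z) \<beta>) \<longrightarrow> y \<in> elts B \<and> Dec (hfst z) (hsnd z) y"
      using M_sub[OF B] M_ne by blast
  qed
  then obtain c where c: "c \<in> M" and c0: "\<And>z. z \<in> elts (hprod \<delta> CP) \<Longrightarrow> (\<exists>\<beta>\<in>elts B. Dec (hfst z) (hsnd z) \<beta>) \<Longrightarrow> ap c z \<in> elts B \<and> Dec (hfst z) (hsnd z) (ap c z)"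
    by blast
  have c2: "ap c (hpair \<xi> p) \<in> elts B \<and> Dec \<xi> p (ap c (hpair \<xi> p))" if "\<xi> \<in> elts \<delta>" "p \<in> elts CP" "\<exists>\<beta>\<in>elts B. Dec \<xi> p \<beta>" for \<xi> p
    using c0[of "hpair \<xi> p"] that by simp
  define F where "F = lam \<delta> (\<lambda>\<xi>. mk ((\<lambda>p. ap c (hpair \<xi> p)) ` elts (ap A \<xi>)))"
  have FM: "F \<in> M" unfolding F_def by (rule lam_in_M[OF \<delta>]) (intro dfn_intros c A)
  have "ap f \<xi> \<in> elts (ap F \<xi>) \<and> elts (ap F \<xi>) \<subseteq> elts B \<and> lep (ap F \<xi>) l" if x: "\<xi> \<in> elts \<delta>" for \<xi>
  proof -
    have xM: "\<xi> \<in> M" using M_trans[OF x \<delta>] .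
    have eF: "elts (ap F \<xi>) = (\<lambda>p. ap c (hpair \<xi> p)) ` elts (ap A \<xi>)" unfolding F_def using x by simp
    have AS: "p \<in> elts CP" "\<exists>\<beta>\<in>elts B. Dec \<xi> p \<beta>" if "p \<in> elts (ap A \<xi>)" for p using A(2)[OF x] that unfolding eS by blast+
    have cc: "ap c (hpair \<xi> p) \<in> elts B" "Dec \<xi> p (ap c (hpair \<xi> p))" if "p \<in> elts (ap A \<xi>)" for p using c2[OF x AS[OF that]] by blast+
    have "\<exists>r\<in>G. r \<in> elts (S \<xi>) \<and> elts (mk {}) \<subseteq> elts r"
    proof (rule G_meets'[OF empty_G])
      show "dfn (\<lambda>e. e 0 \<in> elts (S \<xi>))" by (intro dfn_intros dft1[of S, OF dS] xM)
      fix q assume "q \<in> elts CP"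
      then show "\<exists>r\<in>elts CP. elts q \<subseteq> elts r \<and> r \<in> elts (S \<xi>)" using D(3)[OF x] unfolding eS Cleq_iff by blast
    qed
    then have "G \<inter> elts (S \<xi>) \<noteq> {}" by blast
    then obtain a where a: "a \<in> G" "a \<in> elts (ap A \<xi>)" using A(2)[OF x] by blast
    have "ap c (hpair \<xi> a) = ap f \<xi>" by (rule D(4)[OF x a(1) M_trans[OF cc(1)[OF a(2)] B] cc(2)[OF a(2)]])
    then have "ap f \<xi> \<in> elts (ap F \<xi>)" unfolding eF using a(2) by (metis imageI)
    moreover have "elts (ap F \<xi>) \<subseteq> elts B" unfolding eF using cc(1) by blast
    moreover have "lep (ap F \<xi>) l"
    proof (rule lep_trans)
      show FxM: "ap F \<xi> \<in> M" using FM xM by simp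
      show "lep (ap F \<xi>) (ap A \<xi>)"
      proof (rule lep_surj[OF _ FxM, of _ "\<lambda>p. ap c (hpair \<xi> p)"])
        show "ap A \<xi> \<in> M" using A(1) xM by simp
        show "dft (\<lambda>e. ap c (hpair \<xi> (e 0)))" by (intro dfn_intros c xM)
      qed (simp only: eF subset_refl)
      show "lep (ap A \<xi>) l" using A(2)[OF x] by blast
    qed
    ultimately show ?thesis by blast
  qed
  then show ?thesis using FM by blast
qed

text \<open>By genericity \<open>G\<close> contains a condition as produced by
  \<open>easton\<close>. Its part outside \<open>J\<close> then belongs to \<open>G\<close> as well
  and need not be mentioned again: the values of \<open>f\<close> are determined by \<open>T\<close>
  and the members of \<open>G\<close> in \<open>Rs J\<close>.\<close>

lemma easton_N:
  assumes \<chi>: "regular_cardinal M \<chi>" and J: "J \<in> M"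
    and clos: "\<And>C. C \<in> M \<Longrightarrow> lss C \<chi> \<Longrightarrow> elts C \<subseteq> elts (Qs J) \<Longrightarrow> (\<And>p q. p \<in> elts C \<Longrightarrow> q \<in> elts C \<Longrightarrow> agree p q) \<Longrightarrow> Un1 C \<in> elts CP"
    and anti: "\<And>A. A \<in> M \<Longrightarrow> elts A \<subseteq> elts (Rs J) \<Longrightarrow> (\<And>p q. p \<in> elts A \<Longrightarrow> q \<in> elts A \<Longrightarrow> p \<noteq> q \<Longrightarrow> \<not> agree p q) \<Longrightarrow> lss A \<chi>"
    and \<delta>: "\<delta> \<in> M" "lss \<delta> \<chi>" and B: "B \<in> M"
    and f: "f \<in> N" and fB: "\<And>\<xi>. \<xi> \<in> elts \<delta> \<Longrightarrow> ap f \<xi> \<in> elts B"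
  obtains T where "T \<in> M" "lss T \<chi>" "elts T \<subseteq> elts (hprod \<delta> (hprod (Rs J) B))"
    "\<forall>t\<in>elts T. \<forall>t'\<in>elts T. hfst t = hfst t' \<and> t \<noteq> t' \<longrightarrow> \<not> agree (hfst (hsnd t)) (hfst (hsnd t'))"
    "\<forall>\<xi>\<in>elts \<delta>. \<exists>r\<in>G. hpair \<xi> (hpair r (ap f \<xi>)) \<in> elts T"
    "\<forall>r\<in>G. \<forall>\<xi> \<beta>. hpair \<xi> (hpair r \<beta>) \<in> elts T \<longrightarrow> \<beta> = ap f \<xi>"
proof -
  obtain Dec where D: "dfn (\<lambda>e. Dec (e 0) (e 1) (e 2))" "\<And>\<xi> p p' \<beta>. Dec \<xi> p \<beta> \<Longrightarrow> le p' p \<Longrightarrow> Dec \<xi> p' \<beta>"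
    "\<And>\<xi> p. \<xi> \<in> elts \<delta> \<Longrightarrow> p \<in> elts CP \<Longrightarrow> \<exists>p'\<in>elts CP. le p' p \<and> (\<exists>\<beta>\<in>elts B. Dec \<xi> p' \<beta>)"
    "\<And>\<xi> p \<beta>. \<xi> \<in> elts \<delta> \<Longrightarrow> p \<in> G \<Longrightarrow> \<beta> \<in> M \<Longrightarrow> Dec \<xi> p \<beta> \<Longrightarrow> \<beta> = ap f \<xi>"
    using decide[OF f \<delta>(1) B fB] by blast
  note D' = dfn3[of Dec, OF D(1)]
  have chiM: "\<chi> \<in> M" using regularD[OF \<chi>] by blast
  have "\<exists>p\<in>G. (\<exists>T\<in>M. egood Dec \<delta> B J \<chi> (co J p) T) \<and> elts (mk {}) \<subseteq> elts p"
  proof (rule G_meets'[OF empty_G])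
    show "dfn (\<lambda>e. \<exists>T\<in>M. egood Dec \<delta> B J \<chi> (co J (e 0)) T)" unfolding egood_def
      by (intro dfn_intros D' \<delta> B J chiM)
    fix q assume q: "q \<in> elts CP"
    have mono: "Dec \<xi> p' \<beta>" if "Dec \<xi> p \<beta>" "p \<in> elts CP" "p' \<in> elts CP" "elts p \<subseteq> elts p'" for \<xi> p p' \<beta>
      using D(2)[OF that(1)] that(2-4) Cleq_iff by blast
    have dense: "\<exists>p'\<in>elts CP. elts p \<subseteq> elts p' \<and> (\<exists>\<beta>\<in>elts B. Dec \<xi> p' \<beta>)" if "\<xi> \<in> elts \<delta>" "p \<in> elts CP" for \<xi> p
      using D(3)[OF that] Cleq_iff by blast
    show "\<exists>r\<in>elts CP. elts q \<subseteq> elts r \<and> (\<exists>T\<in>M. egood Dec \<delta> B J \<chi> (co J r) T)"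
      by (rule easton[OF \<chi> J clos anti \<delta> B D(1) mono dense q])
  qed
  then obtain p T where p: "p \<in> G" and T: "T \<in> M" and eg: "egood Dec \<delta> B J \<chi> (co J p) T" by blast
  let ?q = "co J p"
  have qQ: "?q \<in> elts (Qs J)" by (rule co_Qs[OF G_CP[OF p] J])
  have qCP: "?q \<in> elts CP" using qQ unfolding elts_Qs by blast
  have qG: "?q \<in> G" by (rule G_sub[OF p qCP]) (auto simp: elts_co)
  have T1: "\<exists>\<xi>\<in>elts \<delta>. \<exists>r\<in>elts (Rs J). \<exists>\<beta>\<in>elts B. t = hpair \<xi> (hpair r \<beta>) \<and> Dec \<xi> (mk (elts r \<union> elts ?q)) \<beta>" if "t \<in> elts T" for t
    using eg that unfolding egood_def by blast
  have val: "\<beta> = ap f \<xi>" if r: "r \<in> G" and t: "hpair \<xi> (hpair r \<beta>) \<in> elts T" for \<xi> r \<beta>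
  proof -
    from T1[OF t] have a: "\<xi> \<in> elts \<delta>" "r \<in> elts (Rs J)" "\<beta> \<in> elts B" "Dec \<xi> (mk (elts r \<union> elts ?q)) \<beta>" by auto
    have rq: "mk (elts r \<union> elts ?q) \<in> elts CP" by (rule RQ_union[OF a(2) qQ])
    obtain u where u: "u \<in> G" "elts r \<subseteq> elts u" "elts ?q \<subseteq> elts u" using G_ext[OF r qG] by blast
    have "mk (elts r \<union> elts ?q) \<in> G" by (rule G_sub[OF u(1) rq]) (use u in simp)
    then show ?thesis using D(4)[OF a(1) _ M_trans[OF a(3) B] a(4)] by blast
  qed
  show thesis
  proof (rule that[OF T])
    show "lss T \<chi>" using eg unfolding egood_def by blast
    show "elts T \<subseteq> elts (hprod \<delta> (hprod (Rs J) B))" using T1 by fastforce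
    show "\<forall>t\<in>elts T. \<forall>t'\<in>elts T. hfst t = hfst t' \<and> t \<noteq> t' \<longrightarrow> \<not> agree (hfst (hsnd t)) (hfst (hsnd t'))"
      using eg unfolding egood_def by (elim conjE)
    show "\<forall>r\<in>G. \<forall>\<xi> \<beta>. hpair \<xi> (hpair r \<beta>) \<in> elts T \<longrightarrow> \<beta> = ap f \<xi>" using val by blast
    show "\<forall>\<xi>\<in>elts \<delta>. \<exists>r\<in>G. hpair \<xi> (hpair r (ap f \<xi>)) \<in> elts T"
    proof
    fix \<xi> assume x: "\<xi> \<in> elts \<delta>"
    have xM: "\<xi> \<in> M" using M_trans[OF x \<delta>(1)] .
    have "\<exists>u\<in>G. (\<exists>t\<in>elts T. hfst t = \<xi> \<and> elts (hfst (hsnd t)) \<subseteq> elts u) \<and> elts (mk {}) \<subseteq> elts u"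
    proof (rule G_meets'[OF empty_G])
      show "dfn (\<lambda>e. \<exists>t\<in>elts T. hfst t = \<xi> \<and> elts (hfst (hsnd t)) \<subseteq> elts (e 0))" by (intro dfn_intros T xM)
      fix p' assume p': "p' \<in> elts CP"
      have "restr J p' \<in> elts (Rs J)" by (rule restr_Rs[OF p' J])
      then obtain t where t: "t \<in> elts T" "hfst t = \<xi>" "agree (hfst (hsnd t)) (restr J p')" using eg x unfolding egood_def by blast
      obtain r \<beta> where r: "r \<in> elts (Rs J)" "t = hpair \<xi> (hpair r \<beta>)" using T1[OF t(1)] t(2) by auto
      have ag: "agree (restr J p') r" using t(3) r(2) agree_sym by simp
      \<comment> \<open>All coordinates of \<open>r\<close> lie in \<open>J\<close>, so agreement
        with the restriction of \<open>p'\<close> to \<open>J\<close> is enough.\<close>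
      have "agree p' r" unfolding agree_def
      proof (intro ballI impI)
        fix z w assume zw: "z \<in> elts p'" "w \<in> elts r" "hfst z = hfst w"
        then have "hfst z \<in> elts J" using r(1) unfolding elts_Rs by auto
        then have "z \<in> elts (restr J p')" using zw(1) unfolding elts_restr by blast
        then show "hsnd z = hsnd w" using ag zw unfolding agree_def by blast
      qed
      moreover have "r \<in> elts CP" using r(1) unfolding elts_Rs by blast
      ultimately have "mk (elts p' \<union> elts r) \<in> elts CP" using CP_union[OF p'] by blast
      then show "\<exists>r\<in>elts CP. elts p' \<subseteq> elts r \<and> (\<exists>t\<in>elts T. hfst t = \<xi> \<and> elts (hfst (hsnd t)) \<subseteq> elts r)"
        using t(1,2) r(2) by (intro bexI[of _ "mk (elts p' \<union> elts r)"]) (auto intro!: bexI[of _ t])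
    qed
    then obtain u t where u: "u \<in> G" "t \<in> elts T" "hfst t = \<xi>" "elts (hfst (hsnd t)) \<subseteq> elts u" by blast
    obtain r \<beta> where r: "r \<in> elts (Rs J)" "t = hpair \<xi> (hpair r \<beta>)" using T1[OF u(2)] u(3) by auto
    have "r \<in> G" by (rule G_sub[OF u(1)]) (use r u(4) in \<open>auto simp: elts_Rs\<close>)
    moreover have "\<beta> = ap f \<xi>" using val[OF \<open>r \<in> G\<close>] u(2) r(2) by blast
    ultimately show "\<exists>r\<in>G. hpair \<xi> (hpair r (ap f \<xi>)) \<in> elts T" using u(2) r(2) by blast
    qed
  qed
qed

end

context ctm_model begin

text \<open>A bijection from the cardinality onto \<nu> is cofinal. This recovers cardinals of the
  extension from the preserved cofinalities.\<close>

lemma cardinal_of_cof: assumes "\<nu> \<in> M" "ordinal \<nu>" "cof M \<nu> = \<nu>" shows "cardinal M \<nu>"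
proof -
  let ?c = "card_in M \<nu>"
  obtain g where g: "g \<in> M" "bijf g ?c \<nu>" using card_eqp[OF assms(1)] unfolding eqp_def by blast
  have "cofin ?c \<nu>" unfolding cofin_def
  proof (intro bexI[OF _ g(1)] conjI ballI)
    show "ap g \<xi> \<in> elts \<nu>" if "\<xi> \<in> elts ?c" for \<xi> using g(2) that unfolding bijf_def injf_def by blast
    fix \<beta> assume "\<beta> \<in> elts \<nu>"
    then obtain \<xi> where "\<xi> \<in> elts ?c" "\<beta> = ap g \<xi>" using g(2) unfolding bijf_def by blast
    then show "\<exists>\<xi>\<in>elts ?c. elts \<beta> \<subseteq> elts (ap g \<xi>)" by blast
  qed
  then have "elts \<nu> \<subseteq> elts ?c" using cof_least[OF assms(1,2) card_in_M[OF assms(1)] ordinal_card[OF assms(1)]] assms(3) by simp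
  moreover have "elts ?c \<subseteq> elts \<nu>" by (rule card_le_ordinal[OF assms(1,2,1) lep_refl[OF assms(1)]])
  ultimately have "?c = \<nu>" by (intro hc_eqI) blast
  then show ?thesis unfolding cardinal_def using assms by blast
qed

section \<open>Extending a filter base to an ultrafilter inside a model\<close>

definition pfilter :: "hc \<Rightarrow> hc \<Rightarrow> bool" where
  "pfilter \<kappa> T \<longleftrightarrow> (\<forall>A\<in>elts T. A \<in> elts (PowM \<kappa>)) \<and> \<kappa> \<in> elts T \<and> mk {} \<notin> elts T \<and>
    (\<forall>A\<in>elts T. \<forall>B\<in>elts T. mk (elts A \<inter> elts B) \<in> elts T) \<and>
    (\<forall>A\<in>elts T. \<forall>B\<in>elts (PowM \<kappa>). elts A \<subseteq> elts B \<longrightarrow> B \<in> elts T)"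

lemma pfilterD:
  assumes "pfilter \<kappa> T"
  shows "\<And>A. A \<in> elts T \<Longrightarrow> A \<in> elts (PowM \<kappa>)" "\<kappa> \<in> elts T" "mk {} \<notin> elts T"
    "\<And>A B. A \<in> elts T \<Longrightarrow> B \<in> elts T \<Longrightarrow> mk (elts A \<inter> elts B) \<in> elts T"
    "\<And>A B. A \<in> elts T \<Longrightarrow> B \<in> elts (PowM \<kappa>) \<Longrightarrow> elts A \<subseteq> elts B \<Longrightarrow> B \<in> elts T"
proof -
  note c1 = assms[unfolded pfilter_def]
  note 1 = conjunct1[OF c1] and c2 = conjunct2[OF c1]
  note 2 = conjunct1[OF c2] and c3 = conjunct2[OF c2]
  note 3 = conjunct1[OF c3] and c4 = conjunct2[OF c3]
  note 4 = conjunct1[OF c4] and 5 = conjunct2[OF c4]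
  show "A \<in> elts (PowM \<kappa>)" if "A \<in> elts T" for A by (rule bspec[OF 1 that])
  show "\<kappa> \<in> elts T" "mk {} \<notin> elts T" by (fact 2, fact 3)
  show "mk (elts A \<inter> elts B) \<in> elts T" if "A \<in> elts T" "B \<in> elts T" for A B
    by (rule bspec[OF bspec[OF 4 that(1)] that(2)])
  show "B \<in> elts T" if "A \<in> elts T" "B \<in> elts (PowM \<kappa>)" "elts A \<subseteq> elts B" for A B
    by (rule mp[OF bspec[OF bspec[OF 5 that(1)] that(2)] that(3)])
qed

lemma pfilter_Un:
  assumes ne: "\<S> \<noteq> {}" and pf: "\<And>T. T \<in> \<S> \<Longrightarrow> pfilter \<kappa> T"
    and dir: "\<And>T T'. T \<in> \<S> \<Longrightarrow> T' \<in> \<S> \<Longrightarrow> elts T \<subseteq> elts T' \<or> elts T' \<subseteq> elts T" and U: "elts U = (\<Union>T\<in>\<S>. elts T)"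
  shows "pfilter \<kappa> U"
  unfolding pfilter_def U
proof (intro conjI ballI impI)
  show "\<kappa> \<in> (\<Union>T\<in>\<S>. elts T)" using ne pfilterD(2)[OF pf] by blast
  show "mk {} \<notin> (\<Union>T\<in>\<S>. elts T)" using pfilterD(3)[OF pf] by blast
  fix A assume A: "A \<in> (\<Union>T\<in>\<S>. elts T)"
  then obtain T where T: "T \<in> \<S>" "A \<in> elts T" by blast
  show "A \<in> elts (PowM \<kappa>)" by (rule pfilterD(1)[OF pf[OF T(1)] T(2)])
  show "B \<in> (\<Union>T\<in>\<S>. elts T)" if "B \<in> elts (PowM \<kappa>)" "elts A \<subseteq> elts B" for B
    using pfilterD(5)[OF pf[OF T(1)] T(2) that] T(1) by blast
  fix B assume "B \<in> (\<Union>T\<in>\<S>. elts T)"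
  then obtain T' where T': "T' \<in> \<S>" "B \<in> elts T'" by blast
  from dir[OF T(1) T'(1)] show "mk (elts A \<inter> elts B) \<in> (\<Union>T\<in>\<S>. elts T)"
  proof
    assume "elts T \<subseteq> elts T'"
    then have "A \<in> elts T'" using T(2) by blast
    from pfilterD(4)[OF pf[OF T'(1)] this T'(2)] show ?thesis using T'(1) by blast
  next
    assume "elts T' \<subseteq> elts T"
    then have "B \<in> elts T" using T'(2) by blast
    from pfilterD(4)[OF pf[OF T(1)] T(2) this] show ?thesis using T(1) by blast
  qed
qed

text \<open>Run through an enumeration of the subsets of \<kappa> and add each one that meets all
  sets collected so far; if one is rejected, its complement contains a collected set.\<close>

lemma ultrafilter_extension:
  assumes k: "\<kappa> \<in> M" and F: "F \<in> M" "\<And>A. A \<in> elts F \<Longrightarrow> elts A \<subseteq> elts \<kappa>" "\<kappa> \<in> elts F" "mk {} \<notin> elts F"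
    "\<And>A B. A \<in> elts F \<Longrightarrow> B \<in> elts F \<Longrightarrow> mk (elts A \<inter> elts B) \<in> elts F"
  shows "\<exists>U. ultrafilter_on M \<kappa> U \<and> elts F \<subseteq> elts U"
proof -
  \<comment> \<open>Upward closure comes first: in the extension, where this is applied, a ground
    model filter need only be a filter base.\<close>
  define F0 where "F0 = mk {B \<in> elts (PowM \<kappa>). \<exists>C\<in>elts F. elts C \<subseteq> elts B}"
  have F0M: "F0 \<in> M" unfolding F0_def by (rule sep_in_M) (use k in simp, intro dfn_intros F)
  have eF0: "B \<in> elts F0 \<longleftrightarrow> B \<in> elts (PowM \<kappa>) \<and> (\<exists>C\<in>elts F. elts C \<subseteq> elts B)" for B
    unfolding F0_def by (simp del: elts_PowM)
  have FP: "A \<in> elts (PowM \<kappa>)" if "A \<in> elts F" for A using F(2)[OF that] M_trans[OF that F(1)] by simp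
  have capP: "mk (elts A \<inter> elts B) \<in> elts (PowM \<kappa>)" if "A \<in> elts (PowM \<kappa>)" "B \<in> elts (PowM \<kappa>)" for A B using that by auto
  have pf0: "pfilter \<kappa> F0" unfolding pfilter_def
  proof (intro conjI ballI impI)
    show "\<kappa> \<in> elts F0" unfolding eF0 using F(3) FP[OF F(3)] by blast
    show "mk {} \<notin> elts F0"
    proof
      assume "mk {} \<in> elts F0"
      then obtain C where "C \<in> elts F" "elts C = {}" unfolding eF0 by auto
      then have "C = mk {}" by (metis mk_elts)
      then show False using F(4) \<open>C \<in> elts F\<close> by simp
    qed
    fix A assume A: "A \<in> elts F0"
    show "A \<in> elts (PowM \<kappa>)" using A unfolding eF0 by blast
    show "B \<in> elts F0" if "B \<in> elts (PowM \<kappa>)" "elts A \<subseteq> elts B" for B using A that unfolding eF0 by blast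
    fix B assume B: "B \<in> elts F0"
    obtain C C' where C: "C \<in> elts F" "elts C \<subseteq> elts A" "C' \<in> elts F" "elts C' \<subseteq> elts B" using A B unfolding eF0 by blast
    have "mk (elts C \<inter> elts C') \<in> elts F" by (rule F(5)[OF C(1,3)])
    moreover have "elts (mk (elts C \<inter> elts C')) \<subseteq> elts (mk (elts A \<inter> elts B))" using C by auto
    moreover have "mk (elts A \<inter> elts B) \<in> elts (PowM \<kappa>)" using A B capP unfolding eF0 by blast
    ultimately show "mk (elts A \<inter> elts B) \<in> elts F0" unfolding eF0 by blast
  qed
  have FF0: "elts F \<subseteq> elts F0"
  proof
    fix A assume A: "A \<in> elts F"
    show "A \<in> elts F0" unfolding eF0 using FP[OF A] A by blast
  qed
  obtain \<gamma> f where g: "\<gamma> \<in> M" "ordinal \<gamma>" "f \<in> M" "bij_betw (ap f) (elts \<gamma>) (elts (PowM \<kappa>))"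
    using well_ordering[OF PowM_in_M[OF k]] by blast
  define step where "step T A = (if \<forall>C\<in>elts T. mk (elts C \<inter> elts A) \<noteq> mk {} then mk {B \<in> elts (PowM \<kappa>). \<exists>C\<in>elts T. elts (mk (elts C \<inter> elts A)) \<subseteq> elts B} else T)" for T A
  have dstep: "dft (\<lambda>e. step (e 0) (e 1))" unfolding step_def by (intro dfn_intros k empty_in_M)
  note dstep' = dft2[of step, OF dstep]
  have estep: "B \<in> elts (step T A) \<longleftrightarrow> B \<in> elts (PowM \<kappa>) \<and> (\<exists>C\<in>elts T. elts C \<inter> elts A \<subseteq> elts B)"
    if "\<forall>C\<in>elts T. mk (elts C \<inter> elts A) \<noteq> mk {}" for T A B
  proof -
    have e: "step T A = mk {B \<in> elts (PowM \<kappa>). \<exists>C\<in>elts T. elts (mk (elts C \<inter> elts A)) \<subseteq> elts B}" unfolding step_def using that by (rule if_P)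
    have "elts (mk {B \<in> elts (PowM \<kappa>). \<exists>C\<in>elts T. elts (mk (elts C \<inter> elts A)) \<subseteq> elts B}) = {B \<in> elts (PowM \<kappa>). \<exists>C\<in>elts T. elts (mk (elts C \<inter> elts A)) \<subseteq> elts B}"
      by (rule elts_mk) (intro countable_Collect countable_elts)
    then show ?thesis unfolding e by simp
  qed
  have step_sub: "elts T \<subseteq> elts (step T A)" if "pfilter \<kappa> T" for T A
  proof (cases "\<forall>C\<in>elts T. mk (elts C \<inter> elts A) \<noteq> mk {}")
    case True
    show ?thesis
    proof
      fix B assume B: "B \<in> elts T"
      from pfilterD(1)[OF that B] show "B \<in> elts (step T A)" unfolding estep[OF True] using B by blast
    qed
  next
    case False
    then have "step T A = T" unfolding step_def by (rule if_not_P)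
    then show ?thesis by simp
  qed
  have step_pf: "pfilter \<kappa> (step T A)" if T: "pfilter \<kappa> T" for T A
  proof (cases "\<forall>C\<in>elts T. mk (elts C \<inter> elts A) \<noteq> mk {}")
    case True
    note es = estep[OF True]
    show ?thesis unfolding pfilter_def
    proof (intro conjI ballI impI)
      show "\<kappa> \<in> elts (step T A)" using step_sub[OF T] pfilterD(2)[OF T] by blast
      show "mk {} \<notin> elts (step T A)"
      proof
        assume "mk {} \<in> elts (step T A)"
        then obtain C where C: "C \<in> elts T" "elts C \<inter> elts A \<subseteq> elts (mk {})" unfolding es by blast
        then have "elts C \<inter> elts A = {}" by simp
        then have "mk (elts C \<inter> elts A) = mk {}" by simp
        then show False using True C(1) by blast
      qed
      fix B assume B: "B \<in> elts (step T A)"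
      show "B \<in> elts (PowM \<kappa>)" using B unfolding es by blast
      show "B' \<in> elts (step T A)" if "B' \<in> elts (PowM \<kappa>)" "elts B \<subseteq> elts B'" for B' using B that unfolding es by blast
      fix B' assume B': "B' \<in> elts (step T A)"
      obtain C C' where C: "C \<in> elts T" "elts C \<inter> elts A \<subseteq> elts B" "C' \<in> elts T" "elts C' \<inter> elts A \<subseteq> elts B'" using B B' unfolding es by blast
      have "mk (elts C \<inter> elts C') \<in> elts T" by (rule pfilterD(4)[OF T C(1,3)])
      moreover have "elts (mk (elts C \<inter> elts C')) \<inter> elts A \<subseteq> elts (mk (elts B \<inter> elts B'))" using C by auto
      moreover have "mk (elts B \<inter> elts B') \<in> elts (PowM \<kappa>)" using B B' capP unfolding es by blast
      ultimately show "mk (elts B \<inter> elts B') \<in> elts (step T A)" unfolding es by blast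
    qed
  next
    case False
    then have "step T A = T" unfolding step_def by (rule if_not_P)
    then show ?thesis using T by simp
  qed
  \<comment> \<open>The filter before stage \<open>x\<close> is the union of \<open>F0\<close> and
    the results of all earlier steps, which treats successor and limit stages alike.\<close>
  define V where "V = hrec (\<lambda>x. x) (\<lambda>x h. mk (elts F0 \<union> elts (mk (\<Union>\<eta>\<in>elts x. elts (step (ap h \<eta>) (ap f \<eta>))))))"
  have eV: "elts (V x) = elts F0 \<union> (\<Union>\<eta>\<in>elts x. elts (step (V \<eta>) (ap f \<eta>)))" for x
  proof -
    have c: "elts (mk (\<Union>\<eta>\<in>elts x. elts (step (ap (lam x V) \<eta>) (ap f \<eta>)))) = (\<Union>\<eta>\<in>elts x. elts (step (ap (lam x V) \<eta>) (ap f \<eta>)))"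
      by (rule elts_mk) (intro countable_UN countable_elts)
    have "V x = mk (elts F0 \<union> elts (mk (\<Union>\<eta>\<in>elts x. elts (step (ap (lam x V) \<eta>) (ap f \<eta>)))))"
      unfolding V_def by (rule hrec_unfold[OF wf_elts'])
    then have "elts (V x) = elts F0 \<union> elts (mk (\<Union>\<eta>\<in>elts x. elts (step (ap (lam x V) \<eta>) (ap f \<eta>))))"
      by (simp only: elts_mk countable_elts countable_Un_iff)
    then show ?thesis unfolding c by simp
  qed
  have dV: "dft (\<lambda>e. V (e 0))" unfolding V_def by (rule dft_hrec[OF _ _ wf_elts']) (intro dfn_intros dstep' F0M g)+
  have main: "ordinal x \<Longrightarrow> pfilter \<kappa> (V x) \<and> (\<forall>\<eta>\<in>elts x. elts (step (V \<eta>) (ap f \<eta>)) \<subseteq> elts (V x))" for x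
  proof (induction x rule: hc_induct)
    case (step x)
    have IH: "pfilter \<kappa> (V y)" "\<And>z. z \<in> elts y \<Longrightarrow> elts (step (V z) (ap f z)) \<subseteq> elts (V y)" if "y \<in> elts x" for y
      using step.IH[OF that ordinal_elem[OF step.prems that]] by blast+
    let ?S = "insert F0 ((\<lambda>\<eta>. step (V \<eta>) (ap f \<eta>)) ` elts x)"
    have F0s: "elts F0 \<subseteq> elts (step (V y) (ap f y))" if "y \<in> elts x" for y
      using step_sub[OF IH(1)[OF that], of "ap f y"] eV[of y] by blast
    have ch: "elts (step (V z) (ap f z)) \<subseteq> elts (step (V y) (ap f y))" if "y \<in> elts x" "z \<in> elts y" for y z
      using IH(2)[OF that] step_sub[OF IH(1)[OF that(1)], of "ap f y"] by blast
    have "pfilter \<kappa> (V x)"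
    proof (rule pfilter_Un[of ?S])
      show "pfilter \<kappa> T" if "T \<in> ?S" for T using that pf0 step_pf IH(1) by blast
      show "elts (V x) = (\<Union>T\<in>?S. elts T)" unfolding eV[of x] by simp
      fix T T' assume "T \<in> ?S" "T' \<in> ?S"
      then consider "T = F0" | "T' = F0" | y z where "y \<in> elts x" "z \<in> elts x" "T = step (V y) (ap f y)" "T' = step (V z) (ap f z)" by blast
      then show "elts T \<subseteq> elts T' \<or> elts T' \<subseteq> elts T"
      proof cases
        case 1 then show ?thesis using \<open>T' \<in> ?S\<close> F0s by blast
      next
        case 2 then show ?thesis using \<open>T \<in> ?S\<close> F0s by blast
      next
        case 3
        then show ?thesis using ordinal_linear[OF ordinal_elem[OF step.prems 3(1)] ordinal_elem[OF step.prems 3(2)]] ch by blast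
      qed
    qed simp
    moreover have "\<forall>\<eta>\<in>elts x. elts (step (V \<eta>) (ap f \<eta>)) \<subseteq> elts (V x)" unfolding eV[of x] by blast
    ultimately show ?case by blast
  qed
  let ?U = "V \<gamma>"
  have UM: "?U \<in> M" by (rule dft1_M[OF dV g(1)])
  have pf: "pfilter \<kappa> ?U" using main[OF g(2)] by blast
  have ul: "X \<in> elts ?U \<or> mk (elts \<kappa> - elts X) \<in> elts ?U" if X: "X \<in> M" "elts X \<subseteq> elts \<kappa>" for X
  proof -
    have XP: "X \<in> elts (PowM \<kappa>)" using X by simp
    then obtain \<eta> where e: "\<eta> \<in> elts \<gamma>" "X = ap f \<eta>" using g(4) unfolding bij_betw_def by blast
    have pe: "pfilter \<kappa> (V \<eta>)" using main[OF ordinal_elem[OF g(2) e(1)]] by blast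
    have sU: "elts (step (V \<eta>) X) \<subseteq> elts ?U" using main[OF g(2)] e by blast
    show ?thesis
    proof (cases "\<forall>C\<in>elts (V \<eta>). mk (elts C \<inter> elts X) \<noteq> mk {}")
      case True
      have "\<kappa> \<in> elts (V \<eta>)" by (rule pfilterD(2)[OF pe])
      then have "X \<in> elts (step (V \<eta>) X)" unfolding estep[OF True] using XP by blast
      then show ?thesis using sU by blast
    next
      case False
      then obtain C where C: "C \<in> elts (V \<eta>)" "mk (elts C \<inter> elts X) = mk {}" by blast
      have "elts C \<inter> elts X = {}" using C(2) by (simp add: mk_eq_iff)
      moreover have "elts C \<subseteq> elts \<kappa>" using pfilterD(1)[OF pe C(1)] by simp
      ultimately have "elts C \<subseteq> elts (mk (elts \<kappa> - elts X))" by auto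
      moreover have "mk (elts \<kappa> - elts X) \<in> elts (PowM \<kappa>)" using k X by auto
      ultimately have "mk (elts \<kappa> - elts X) \<in> elts (V \<eta>)" using pfilterD(5)[OF pe C(1)] by blast
      then show ?thesis using sU step_sub[OF pe, of X] by blast
    qed
  qed
  have FU: "elts F \<subseteq> elts ?U" using FF0 eV[of \<gamma>] by blast
  have u1: "\<forall>A\<in>elts ?U. elts A \<subseteq> elts \<kappa>" using pfilterD(1)[OF pf] by simp
  have u2: "\<forall>A\<in>elts ?U. \<forall>B\<in>M. elts A \<subseteq> elts B \<and> elts B \<subseteq> elts \<kappa> \<longrightarrow> B \<in> elts ?U"
  proof (intro ballI impI)
    fix A B assume "A \<in> elts ?U" "B \<in> M" "elts A \<subseteq> elts B \<and> elts B \<subseteq> elts \<kappa>"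
    then show "B \<in> elts ?U" using pfilterD(5)[OF pf, of A B] by simp
  qed
  have u3: "\<forall>A\<in>elts ?U. \<forall>B\<in>elts ?U. mk (elts A \<inter> elts B) \<in> elts ?U"
    by (intro ballI pfilterD(4)[OF pf])
  have u4: "\<forall>A\<in>M. elts A \<subseteq> elts \<kappa> \<longrightarrow> A \<in> elts ?U \<or> mk (elts \<kappa> - elts A) \<in> elts ?U"
    by (intro ballI impI ul)
  have "ultrafilter_on M \<kappa> ?U" unfolding ultrafilter_on_def
    by (intro conjI UM u1 u2 u3 u4 pfilterD(2,3)[OF pf])
  then show ?thesis using FU by blast
qed

end

section \<open>Preservation of cofinalities, and the new subsets\<close>

context cohen_ext begin

text \<open>Different values recorded for the same \<xi> come with incompatible conditions, so there
  are at most as many values as elements of an antichain in \<open>Rs J\<close>.\<close>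

lemma fiber:
  assumes T: "T \<in> M" "elts T \<subseteq> elts (hprod \<delta> (hprod (Rs J) B))" and J: "J \<in> M" and B: "B \<in> M" and x: "\<xi> \<in> M"
    and anti: "\<forall>t\<in>elts T. \<forall>t'\<in>elts T. hfst t = hfst t' \<and> t \<noteq> t' \<longrightarrow> \<not> agree (hfst (hsnd t)) (hfst (hsnd t'))"
  shows "\<exists>A\<in>M. elts A \<subseteq> elts (Rs J) \<and> (\<forall>p\<in>elts A. \<forall>q\<in>elts A. p \<noteq> q \<longrightarrow> \<not> agree p q) \<and>
    lep (mk {\<beta> \<in> elts B. \<exists>r\<in>elts (Rs J). hpair \<xi> (hpair r \<beta>) \<in> elts T}) A"
proof -
  let ?F = "mk {\<beta> \<in> elts B. \<exists>r\<in>elts (Rs J). hpair \<xi> (hpair r \<beta>) \<in> elts T}"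
  let ?A = "mk {r \<in> elts (Rs J). \<exists>\<beta>\<in>elts B. hpair \<xi> (hpair r \<beta>) \<in> elts T}"
  have RM: "Rs J \<in> M" using J by simp
  have FM: "?F \<in> M" by (rule sep_in_M[OF B]) (intro dfn_intros x T J)
  have AM: "?A \<in> M" by (rule sep_in_M[OF RM]) (intro dfn_intros x T B)
  have eA: "elts ?A = {r \<in> elts (Rs J). \<exists>\<beta>\<in>elts B. hpair \<xi> (hpair r \<beta>) \<in> elts T}" by simp
  have eF: "elts ?F = {\<beta> \<in> elts B. \<exists>r\<in>elts (Rs J). hpair \<xi> (hpair r \<beta>) \<in> elts T}" by simp
  have an: "\<not> agree r r'" if "hpair \<xi> (hpair r \<beta>) \<in> elts T" "hpair \<xi> (hpair r' \<beta>') \<in> elts T" "r \<noteq> r' \<or> \<beta> \<noteq> \<beta>'" for r r' \<beta> \<beta>'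
    using bspec[OF bspec[OF anti that(1)] that(2)] that(3) by simp
  have "lep ?F ?A"
  proof (rule lep_surj[OF AM FM, of "\<lambda>r. theM (\<lambda>\<beta>. \<beta> \<in> elts B \<and> hpair \<xi> (hpair r \<beta>) \<in> elts T)"])
    show "dft (\<lambda>e. theM (\<lambda>\<beta>. \<beta> \<in> elts B \<and> hpair \<xi> (hpair (e 0) \<beta>) \<in> elts T))" by (intro dfn_intros x T B)
    show "elts ?F \<subseteq> (\<lambda>r. theM (\<lambda>\<beta>. \<beta> \<in> elts B \<and> hpair \<xi> (hpair r \<beta>) \<in> elts T)) ` elts ?A"
    proof
      fix \<beta> assume "\<beta> \<in> elts ?F"
      then obtain r where r: "\<beta> \<in> elts B" "r \<in> elts (Rs J)" "hpair \<xi> (hpair r \<beta>) \<in> elts T" unfolding eF by blast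
      have rr: "agree r r" using r(2) CP_agree unfolding elts_Rs by blast
      have "theM (\<lambda>\<beta>. \<beta> \<in> elts B \<and> hpair \<xi> (hpair r \<beta>) \<in> elts T) = \<beta>"
        by (rule theM_eq) (use M_trans[OF r(1) B] r an[OF _ r(3)] rr in blast)+
      then show "\<beta> \<in> (\<lambda>r. theM (\<lambda>\<beta>. \<beta> \<in> elts B \<and> hpair \<xi> (hpair r \<beta>) \<in> elts T)) ` elts ?A"
        using r by (intro image_eqI[of _ _ r]) (simp, unfold eA, blast)
    qed
  qed
  moreover have "\<forall>p\<in>elts ?A. \<forall>q\<in>elts ?A. p \<noteq> q \<longrightarrow> \<not> agree p q" unfolding eA using an by blast
  moreover have "elts ?A \<subseteq> elts (Rs J)" unfolding eA by blast
  ultimately show ?thesis using AM by blast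
qed

text \<open>The set of possible values at \<xi> is smaller than the old cofinality and so bounded in
  \<alpha>. Choosing a bound for every \<xi> gives a sequence in the ground model that is still
  cofinal.\<close>

lemma cofin_transfer:
  assumes \<alpha>: "\<alpha> \<in> M" "ordinal \<alpha>" and \<delta>: "\<delta> \<in> M" and F: "dft (\<lambda>e. F (e 0))"
    and f: "\<And>\<beta>. \<beta> \<in> elts \<alpha> \<Longrightarrow> \<exists>\<xi>\<in>elts \<delta>. elts \<beta> \<subseteq> elts (ap f \<xi>)"
    and c: "\<And>\<xi>. \<xi> \<in> elts \<delta> \<Longrightarrow> ap f \<xi> \<in> elts (F \<xi>) \<and> elts (F \<xi>) \<subseteq> elts \<alpha> \<and> lss (F \<xi>) (cof M \<alpha>)"
  shows "cofin \<delta> \<alpha>"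
proof -
  have "\<exists>g\<in>M. \<forall>\<xi>\<in>elts \<delta>. ap g \<xi> \<in> elts \<alpha> \<and> elts (F \<xi>) \<subseteq> elts (ap g \<xi>)"
  proof (rule AC[OF \<delta>, of "\<lambda>\<xi> \<gamma>. \<gamma> \<in> elts \<alpha> \<and> elts (F \<xi>) \<subseteq> elts \<gamma>"])
    show "dfn (\<lambda>e. e 1 \<in> elts \<alpha> \<and> elts (F (e 0)) \<subseteq> elts (e 1))" by (intro dfn_intros dft1[of F, OF F] \<alpha>)
    fix \<xi> assume x: "\<xi> \<in> elts \<delta>"
    have "F \<xi> \<in> M" by (rule dft1_M[OF F M_trans[OF x \<delta>]])
    then obtain \<gamma> where "\<gamma> \<in> elts \<alpha>" "elts (F \<xi>) \<subseteq> elts \<gamma>" using cof_bounded[OF \<alpha>, of "F \<xi>"] c[OF x] by blast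
    then show "\<exists>y\<in>M. y \<in> elts \<alpha> \<and> elts (F \<xi>) \<subseteq> elts y" using M_trans[OF _ \<alpha>(1)] by blast
  qed
  then obtain g where g: "g \<in> M" "\<And>\<xi>. \<xi> \<in> elts \<delta> \<Longrightarrow> ap g \<xi> \<in> elts \<alpha> \<and> elts (F \<xi>) \<subseteq> elts (ap g \<xi>)" by blast
  show ?thesis unfolding cofin_def
  proof (intro bexI[OF _ g(1)] conjI ballI)
    show "ap g \<xi> \<in> elts \<alpha>" if "\<xi> \<in> elts \<delta>" for \<xi> using g(2)[OF that] by blast
    fix \<beta> assume "\<beta> \<in> elts \<alpha>"
    then obtain \<xi> where x: "\<xi> \<in> elts \<delta>" "elts \<beta> \<subseteq> elts (ap f \<xi>)" using f by blast
    have "ap f \<xi> \<in> elts (ap g \<xi>)" using c[OF x(1)] g(2)[OF x(1)] by blast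
    then have "elts (ap f \<xi>) \<subseteq> elts (ap g \<xi>)" by (rule ordinal_sub) (use g(2)[OF x(1)] ordinal_elem[OF \<alpha>(2)] in blast)
    then show "\<exists>\<xi>\<in>elts \<delta>. elts \<beta> \<subseteq> elts (ap g \<xi>)" using x by blast
  qed
qed

text \<open>Suppose the new cofinality is below the old one, \<nu>. Values of a new cofinal sequence
  are covered by ground model sets of size \<open>l\<close> if \<open>l\<close> < \<nu>, of size
  \<theta> if \<theta> < \<nu> \<le> \<open>l\<close>, and with a single element if \<nu> \<le>
  \<theta>. In each case the covers are smaller than \<nu>, so the ground model has an equally short
  cofinal sequence.\<close>

lemma same_cof: assumes \<alpha>: "\<alpha> \<in> M" "ordinal \<alpha>" shows "cof N \<alpha> = cof M \<alpha>"
proof (rule ccontr)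
  let ?\<nu> = "cof M \<alpha>" let ?\<delta> = "cof N \<alpha>"
  note m = cof[OF \<alpha>]
  note n = ext.cof[OF M_N[OF \<alpha>(1)] \<alpha>(2)]
  assume ne: "?\<delta> \<noteq> ?\<nu>"
  have "elts ?\<delta> \<subseteq> elts ?\<nu>" by (rule n(4)[OF M_N[OF m(2)] m(1) cofin_M_N[OF m(3)]])
  then have dn: "?\<delta> \<in> elts ?\<nu>" using ordinal_subset_iff[OF n(1) m(1)] ne by blast
  have dM: "?\<delta> \<in> M" using M_trans[OF dn m(2)] .
  obtain f where f: "f \<in> N" "\<And>\<xi>. \<xi> \<in> elts ?\<delta> \<Longrightarrow> ap f \<xi> \<in> elts \<alpha>" "\<And>\<beta>. \<beta> \<in> elts \<alpha> \<Longrightarrow> \<exists>\<xi>\<in>elts ?\<delta>. elts \<beta> \<subseteq> elts (ap f \<xi>)"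
    using n(3) unfolding ext.cofin_def by blast
  note l = regularD[OF lr] and t = regularD[OF th]
  have easton_case: "cofin ?\<delta> \<alpha>" if tT: "T \<in> M" and tsub: "elts T \<subseteq> elts (hprod ?\<delta> (hprod (Rs J) \<alpha>))" and tJ: "J \<in> M"
    and tG: "\<forall>\<xi>\<in>elts ?\<delta>. \<exists>r\<in>G. hpair \<xi> (hpair r (ap f \<xi>)) \<in> elts T"
    and tl: "\<And>\<xi>. \<xi> \<in> elts ?\<delta> \<Longrightarrow> lss (mk {\<beta> \<in> elts \<alpha>. \<exists>r\<in>elts (Rs J). hpair \<xi> (hpair r \<beta>) \<in> elts T}) ?\<nu>" for T J
  proof (rule cofin_transfer[OF \<alpha> dM, of "\<lambda>\<xi>. mk {\<beta> \<in> elts \<alpha>. \<exists>r\<in>elts (Rs J). hpair \<xi> (hpair r \<beta>) \<in> elts T}", OF _ f(3)])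
    show "dft (\<lambda>e. mk {\<beta> \<in> elts \<alpha>. \<exists>r\<in>elts (Rs J). hpair (e 0) (hpair r \<beta>) \<in> elts T})" by (intro dfn_intros tT tJ \<alpha>)
    fix \<xi> assume x: "\<xi> \<in> elts ?\<delta>"
    let ?F = "mk {\<beta> \<in> elts \<alpha>. \<exists>r\<in>elts (Rs J). hpair \<xi> (hpair r \<beta>) \<in> elts T}"
    have eF: "elts ?F = {\<beta> \<in> elts \<alpha>. \<exists>r\<in>elts (Rs J). hpair \<xi> (hpair r \<beta>) \<in> elts T}" by simp
    obtain r where r: "hpair \<xi> (hpair r (ap f \<xi>)) \<in> elts T" using tG x by blast
    then have "hpair \<xi> (hpair r (ap f \<xi>)) \<in> elts (hprod ?\<delta> (hprod (Rs J) \<alpha>))" using tsub by blast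
    then have "r \<in> elts (Rs J)" by auto
    then show "ap f \<xi> \<in> elts ?F \<and> elts ?F \<subseteq> elts \<alpha> \<and> lss ?F ?\<nu>" unfolding eF using r f(2)[OF x] tl[OF x] by blast
  qed
  have "cofin ?\<delta> \<alpha>"
  proof (cases "l \<in> elts ?\<nu>")
    case True
    obtain F where F: "F \<in> M" "\<forall>\<xi>\<in>elts ?\<delta>. ap f \<xi> \<in> elts (ap F \<xi>) \<and> elts (ap F \<xi>) \<subseteq> elts \<alpha> \<and> lep (ap F \<xi>) l"
      using cover_l[OF f(1) dM \<alpha>(1) f(2)] by blast
    show ?thesis
    proof (rule cofin_transfer[OF \<alpha> dM, of "\<lambda>\<xi>. ap F \<xi>", OF _ f(3)])
      show "dft (\<lambda>e. ap F (e 0))" by (intro dfn_intros F)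
    qed (use F(2) lssI[OF True] in blast)+
  next
    case False
    then have nl: "elts ?\<nu> \<subseteq> elts l" using ordinal_linear[OF m(1) l(4)] ordinal_sub[OF _ l(4)] by blast
    show ?thesis
    proof (cases "\<theta> \<in> elts ?\<nu>")
      case True
      have dl: "lss ?\<delta> l" using nl dn lssI[OF _ lep_refl[OF dM]] by blast
      obtain T where T: "T \<in> M" "lss T l" "elts T \<subseteq> elts (hprod ?\<delta> (hprod (Rs I0) \<alpha>))"
        "\<forall>t\<in>elts T. \<forall>t'\<in>elts T. hfst t = hfst t' \<and> t \<noteq> t' \<longrightarrow> \<not> agree (hfst (hsnd t)) (hfst (hsnd t'))"
        "\<forall>\<xi>\<in>elts ?\<delta>. \<exists>r\<in>G. hpair \<xi> (hpair r (ap f \<xi>)) \<in> elts T"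
        "\<forall>r\<in>G. \<forall>\<xi> \<beta>. hpair \<xi> (hpair r \<beta>) \<in> elts T \<longrightarrow> \<beta> = ap f \<xi>"
        by (rule easton_N[OF lr I0_M easton_I0_hyps dM dl \<alpha>(1) f(1,2)])
      show ?thesis
      proof (rule easton_case[OF T(1,3) I0_M T(5)])
        fix \<xi> assume x: "\<xi> \<in> elts ?\<delta>"
        let ?F = "mk {\<beta> \<in> elts \<alpha>. \<exists>r\<in>elts (Rs I0). hpair \<xi> (hpair r \<beta>) \<in> elts T}"
        have xM: "\<xi> \<in> M" using M_trans[OF x dM] .
        have FM: "?F \<in> M" by (rule sep_in_M[OF \<alpha>(1)]) (intro dfn_intros xM T I0_M)
        obtain A where A: "A \<in> M" "elts A \<subseteq> elts (Rs I0)" "\<forall>p\<in>elts A. \<forall>q\<in>elts A. p \<noteq> q \<longrightarrow> \<not> agree p q" "lep ?F A"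
          using fiber[OF T(1,3) I0_M \<alpha>(1) xM T(4)] by blast
        have "lep A \<theta>" by (rule Rs_antichain[OF A(1,2)]) (use A(3) in blast)
        then show "lss ?F ?\<nu>" using lssI[OF True lep_trans[OF FM A(4)]] by blast
      qed
    next
      case False
      then have nt: "elts ?\<nu> \<subseteq> elts \<theta>" using ordinal_linear[OF m(1) t(4)] ordinal_sub[OF _ t(4)] by blast
      have dt: "lss ?\<delta> \<theta>" using nt dn lssI[OF _ lep_refl[OF dM]] by blast
      obtain T where T: "T \<in> M" "lss T \<theta>" "elts T \<subseteq> elts (hprod ?\<delta> (hprod (Rs (mk {})) \<alpha>))"
        "\<forall>t\<in>elts T. \<forall>t'\<in>elts T. hfst t = hfst t' \<and> t \<noteq> t' \<longrightarrow> \<not> agree (hfst (hsnd t)) (hfst (hsnd t'))"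
        "\<forall>\<xi>\<in>elts ?\<delta>. \<exists>r\<in>G. hpair \<xi> (hpair r (ap f \<xi>)) \<in> elts T"
        "\<forall>r\<in>G. \<forall>\<xi> \<beta>. hpair \<xi> (hpair r \<beta>) \<in> elts T \<longrightarrow> \<beta> = ap f \<xi>"
        by (rule easton_N[OF th empty_in_M easton_empty_hyps dM dt \<alpha>(1) f(1,2)])
      show ?thesis
      proof (rule easton_case[OF T(1,3) empty_in_M T(5)])
        fix \<xi> assume x: "\<xi> \<in> elts ?\<delta>"
        let ?F = "mk {\<beta> \<in> elts \<alpha>. \<exists>r\<in>elts (Rs (mk {})). hpair \<xi> (hpair r \<beta>) \<in> elts T}"
        have xM: "\<xi> \<in> M" using M_trans[OF x dM] .
        have FM: "?F \<in> M" by (rule sep_in_M[OF \<alpha>(1)]) (intro dfn_intros xM T empty_in_M)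
        obtain A where A: "A \<in> M" "elts A \<subseteq> elts (Rs (mk {}))" "lep ?F A"
          using fiber[OF T(1,3) empty_in_M \<alpha>(1) xM T(4)] by blast
        have "lep A ?\<delta>"
        proof (rule lepI[OF A(1), of "\<lambda>_. \<xi>"])
          show "dft (\<lambda>e. \<xi>)" by (intro dfn_intros xM)
          show "a = b" if "a \<in> elts A" "b \<in> elts A" for a b using that A(2) Rs_empty by blast
        qed (use x in simp)
        then show "lss ?F ?\<nu>" using lssI[OF dn lep_trans[OF FM A(3)]] by blast
      qed
    qed
  qed
  then have "elts ?\<nu> \<subseteq> elts ?\<delta>" by (rule m(4)[OF dM n(1)])
  then show False using dn foundation_hc_irrefl[of ?\<delta>] by blast
qed

text \<open>Row \<open>a\<close> of the generic function is the characteristic function of a subset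
  of \<nu>. A condition touches fewer than \<nu> places of two given rows, so it can be extended to
  make the rows differ at an untouched place.\<close>

lemma new_subsets:
  assumes \<nu>: "infinite_cardinal M \<nu>" and K: "K \<in> M" and t: "t \<in> M"
    and J: "elts (hprod (mk {t}) (hprod K \<nu>)) \<subseteq> elts II" and small: "\<And>p. p \<in> elts CP \<Longrightarrow> lss (restr (hprod (mk {t}) (hprod K \<nu>)) p) \<nu>"
  shows "ext.lep K (ext.PowM \<nu>)"
proof -
  note n = infinite_cardinalD(1)[OF \<nu>]
  have nM: "\<nu> \<in> M" using cardinalD[OF n] by blast
  let ?J = "hprod (mk {t}) (hprod K \<nu>)"
  have JM: "?J \<in> M" using t K nM by simp
  let ?i = "\<lambda>a s. hpair t (hpair a s)"
  let ?x = "\<lambda>a. mk {s \<in> elts \<nu>. \<exists>p\<in>elts (mk G). hpair (?i a s) tag1 \<in> elts p}"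
  have tagN: "tag0 \<in> N" "tag1 \<in> N" "t \<in> N" "\<nu> \<in> N" using M_N t nM by simp_all
  have dx: "ext.dft (\<lambda>e. ?x (e 0))" by (intro dfn_intros tagN G_in_N)
  have two: "tag0 \<in> elts two" "tag1 \<in> elts two" unfolding tag0_def tag1_def two_def by simp_all
  show ?thesis
  proof (rule ext.lepI[OF M_N[OF K] dx])
    fix a assume a: "a \<in> elts K"
    have aN: "a \<in> N" using M_N[OF M_trans[OF a K]] .
    have "?x a \<in> N" by (rule ext.dft1_M[of ?x, OF dx aN])
    then show "?x a \<in> elts (ext.PowM \<nu>)" by auto
  next
    fix a b assume ab: "a \<in> elts K" "b \<in> elts K" and eq: "?x a = ?x b"
    show "a = b"
    proof (rule ccontr)
      assume ne: "a \<noteq> b"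
      have abM: "a \<in> M" "b \<in> M" using ab M_trans[OF _ K] by auto
      have "\<exists>u\<in>G. (\<exists>s\<in>elts \<nu>. hpair (?i a s) tag1 \<in> elts u \<and> hpair (?i b s) tag0 \<in> elts u) \<and> elts (mk {}) \<subseteq> elts u"
      proof (rule G_meets'[OF empty_G])
        show "dfn (\<lambda>e. \<exists>s\<in>elts \<nu>. hpair (?i a s) tag1 \<in> elts (e 0) \<and> hpair (?i b s) tag0 \<in> elts (e 0))"
          by (intro dfn_intros abM t nM tag_M)
        fix q assume q: "q \<in> elts CP"
        have qM: "q \<in> M" using CP_M[OF q] .
        let ?D = "mk {s \<in> elts \<nu>. \<exists>z\<in>elts q. hfst z = ?i a s \<or> hfst z = ?i b s}"
        have DM: "?D \<in> M" by (rule sep_in_M[OF nM]) (intro dfn_intros qM abM t)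
        have eD: "elts ?D = {s \<in> elts \<nu>. \<exists>z\<in>elts q. hfst z = ?i a s \<or> hfst z = ?i b s}" by simp
        have "lep ?D (restr ?J q)"
        proof (rule lep_surj[OF _ DM, of _ "\<lambda>z. hsnd (hsnd (hfst z))"])
          show "restr ?J q \<in> M" using JM qM by simp
          show "dft (\<lambda>e. hsnd (hsnd (hfst (e 0))))" by (intro dfn_intros)
          show "elts ?D \<subseteq> (\<lambda>z. hsnd (hsnd (hfst z))) ` elts (restr ?J q)"
          proof
            fix s assume "s \<in> elts ?D"
            then obtain z where z: "s \<in> elts \<nu>" "z \<in> elts q" "hfst z = ?i a s \<or> hfst z = ?i b s" unfolding eD by blast
            then have "hfst z \<in> elts ?J" using ab by auto
            then show "s \<in> (\<lambda>z. hsnd (hsnd (hfst z))) ` elts (restr ?J q)" using z by (intro image_eqI[of _ _ z]) (auto simp: elts_restr)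
          qed
        qed
        then have "lss ?D \<nu>" using lss_lep_trans[OF DM] small[OF q] by blast
        then have "\<not> elts \<nu> \<subseteq> elts ?D" using not_lss[OF n DM] lep_subset[OF nM] by blast
        then obtain s where s: "s \<in> elts \<nu>" "s \<notin> elts ?D" by blast
        have sM: "s \<in> M" using M_trans[OF s(1) nM] .
        let ?e = "mk {hpair (?i a s) tag1, hpair (?i b s) tag0}"
        have eM: "?e \<in> M" using abM sM t by simp
        have ee: "elts ?e = {hpair (?i a s) tag1, hpair (?i b s) tag0}" by simp
        have "?i a s \<in> elts II" "?i b s \<in> elts II" using J ab s(1) by auto
        then have "elts ?e \<subseteq> elts (hprod II two)" using two by simp
        moreover have "agree ?e ?e" unfolding agree_def ee using ne by auto
        moreover have "finite (elts (restr X ?e))" for X unfolding elts_restr ee by simp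
        then have "lss (restr I0 ?e) \<theta>" "lss (restr I1 ?e) l"
          using lss_finite[OF regularD(1)[OF th]] lss_finite[OF regularD(1)[OF lr]] eM by simp_all
        ultimately have eCP: "?e \<in> elts CP" unfolding elts_CP using eM by blast
        have "agree q ?e" unfolding agree_def ee using s unfolding eD by auto
        from CP_union[OF q eCP this]
        show "\<exists>r\<in>elts CP. elts q \<subseteq> elts r \<and> (\<exists>s\<in>elts \<nu>. hpair (?i a s) tag1 \<in> elts r \<and> hpair (?i b s) tag0 \<in> elts r)"
          using s(1) by (intro bexI[of _ "mk (elts q \<union> elts ?e)"]) auto
      qed
      then obtain u s where u: "u \<in> G" "s \<in> elts \<nu>" "hpair (?i a s) tag1 \<in> elts u" "hpair (?i b s) tag0 \<in> elts u" by blast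
      have ex: "s' \<in> elts (?x c) \<longleftrightarrow> s' \<in> elts \<nu> \<and> (\<exists>p\<in>G. hpair (?i c s') tag1 \<in> elts p)" for s' c by simp
      have "s \<in> elts (?x a)" unfolding ex using u by blast
      then have "s \<in> elts (?x b)" unfolding eq .
      then obtain p where p: "p \<in> G" "hpair (?i b s) tag1 \<in> elts p" unfolding ex by blast
      have "hsnd (hpair (?i b s) tag1) = hsnd (hpair (?i b s) tag0)"
        using agree_G[OF p(1) u(1)] p(2) u(4) unfolding agree_def by fastforce
      then show False by simp
    qed
  qed
qed

end

section \<open>Cardinal arithmetic and the ultrafilter number in the extension\<close>

locale small_ultrafilter = cohen_ext +
  fixes D :: hc
  assumes kreg: "regular_cardinal M \<kappa>" and kstrong: "\<And>\<alpha>. \<alpha> \<in> elts \<kappa> \<Longrightarrow> lss (PowM \<alpha>) \<kappa>"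
    and lcof: "l \<in> elts (cof M \<mu>)" and cofk: "cof M \<mu> \<in> elts \<kappa>" and km: "\<kappa> \<in> elts \<mu>"
    and mus: "strong_limit M \<mu>" and D: "measure_on M \<kappa> D"
begin

lemma kinf: "infinite_cardinal M \<kappa>" and kcard: "cardinal M \<kappa>" and kord: "ordinal \<kappa>" and kcof: "cof M \<kappa> = \<kappa>"
  using regularD[OF kreg] by blast+

lemma minf: "infinite_cardinal M \<mu>" using mus unfolding strong_limit_def by blast
lemma mcard: "cardinal M \<mu>" using infinite_cardinalD(1)[OF minf] .
lemma mord: "ordinal \<mu>" using cardinalD[OF mcard] by blast

lemma cofM: "cof M \<mu> \<in> M" by (rule cof_in_M[OF muM mord])

lemma lk: "l \<in> elts \<kappa>" by (rule ordinal_trans[OF lcof cofk kord])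
lemma thk: "\<theta> \<in> elts \<kappa>" by (rule ordinal_trans[OF thl lk kord])
lemma lm: "l \<in> elts \<mu>" by (rule ordinal_trans[OF lk km mord])
lemma theta_mu: "\<theta> \<in> elts \<mu>" by (rule ordinal_trans[OF thk km mord])

lemma lss_Pow_k: assumes "A \<in> M" "lss A \<kappa>" shows "lss (PowM A) \<kappa>"
proof -
  obtain \<alpha> where a: "\<alpha> \<in> elts \<kappa>" "lep A \<alpha>" using assms unfolding lss_def by blast
  show ?thesis using lss_lep_trans[OF _ lep_Pow_mono[OF assms(1) M_trans[OF a(1) kM] a(2)] kstrong[OF a(1)]] assms(1) by simp
qed

lemma lss_elem: "infinite_cardinal M \<nu> \<Longrightarrow> \<alpha> \<in> elts \<nu> \<Longrightarrow> lss \<alpha> \<nu>"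
  using lssI[OF _ lep_refl] M_trans[OF _ cardinalD(1)[OF infinite_cardinalD(1)]] by blast

lemma kreg_N: "cardinal N \<kappa>" "infinite_cardinal N \<kappa>" "regular_cardinal N \<kappa>"
proof -
  have c: "cof N \<kappa> = \<kappa>" using same_cof[OF kM kord] kcof by simp
  show 1: "cardinal N \<kappa>" by (rule ext.cardinal_of_cof[OF M_N[OF kM] kord c])
  show 2: "infinite_cardinal N \<kappa>" unfolding infinite_cardinal_def using 1 infinite_cardinalD(2)[OF kinf] by blast
  show "regular_cardinal N \<kappa>" unfolding regular_cardinal_def using 2 c by blast
qed

text \<open>An index has the form (tag, (a, s)); the component a is kept. It numbers the Cohen set
  that is described, below \<kappa> or below \<mu> according to the tag.\<close>

definition coord :: "hc \<Rightarrow> hc" where "coord r = mk ((\<lambda>z. hfst (hsnd (hfst z))) ` elts r)"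

lemma elts_coord: "elts (coord r) = (\<lambda>z. hfst (hsnd (hfst z))) ` elts r" unfolding coord_def by simp

lemma dft_coord [dfn_intros]: "dft t \<Longrightarrow> dft (\<lambda>e. coord (t e))"
  unfolding coord_def by (rule dft1[of "\<lambda>r. mk ((\<lambda>z. hfst (hsnd (hfst z))) ` elts r)"]) (intro dfn_intros)

lemma coord_in_M [simp]: "r \<in> M \<Longrightarrow> coord r \<in> M" by (rule dft1_M, rule dft_coord) (intro dfn_intros)

lemma lep_coord: "r \<in> M \<Longrightarrow> lep (coord r) r"
  by (rule lep_surj[of _ _ "\<lambda>z. hfst (hsnd (hfst z))"]) (simp_all add: elts_coord dfn_intros)

text \<open>\<open>Y\<close> codes the name consisting of all \<open>(chk \<xi>, p)\<close> with \<open>(\<xi>, p) \<in> Y\<close>, and \<open>decode K Y\<close> is its value cut down to \<open>K\<close>.\<close>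

definition decode :: "hc \<Rightarrow> hc \<Rightarrow> hc" where
  "decode K Y = mk {\<xi> \<in> elts K. \<exists>p\<in>elts (mk G). hpair \<xi> p \<in> elts Y}"

lemma elts_decode: "elts (decode K Y) = {\<xi> \<in> elts K. \<exists>p\<in>G. hpair \<xi> p \<in> elts Y}"
  unfolding decode_def by simp

lemma dft_decode: "K \<in> M \<Longrightarrow> ext.dft t \<Longrightarrow> ext.dft (\<lambda>e. decode K (t e))"
  unfolding decode_def by (rule ext.dft1[of "\<lambda>Y. mk {\<xi> \<in> elts K. \<exists>p\<in>elts (mk G). hpair \<xi> p \<in> elts Y}"]) (intro dfn_intros M_N G_in_N)

section \<open>The value of the continuum function at theta\<close>

definition Rb :: "hc \<Rightarrow> hc" where "Rb \<beta> = mk {r \<in> elts (Rs I0). elts (coord r) \<subseteq> elts \<beta>}"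

lemma elts_Rb: "elts (Rb \<beta>) = {r \<in> elts (Rs I0). elts (coord r) \<subseteq> elts \<beta>}" unfolding Rb_def by simp

lemma dft_Rb [dfn_intros]: "dft t \<Longrightarrow> dft (\<lambda>e. Rb (t e))"
  unfolding Rb_def by (rule dft1[of "\<lambda>\<beta>. mk {r \<in> elts (Rs I0). elts (coord r) \<subseteq> elts \<beta>}"]) (intro dfn_intros I0_M)

text \<open>A condition about the first \<beta> Cohen sets is a subset of a set of size below
  \<kappa>. As \<kappa> is a strong limit, forming power sets twice stays below \<kappa>.\<close>

lemma lss_Rb: assumes b: "\<beta> \<in> elts \<kappa>" shows "lss (PowM (hprod \<theta> (Rb \<beta>))) \<kappa>"
proof -
  have bM: "\<beta> \<in> M" using M_trans[OF b kM] .
  have RM: "Rb \<beta> \<in> M" by (rule dft1_M[of Rb, OF _ bM]) (intro dfn_intros)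
  let ?Z = "hprod (hprod (mk {tag0}) (hprod \<beta> \<theta>)) two"
  have ZM: "?Z \<in> M" using bM thM by simp
  have "lss (mk {tag0}) \<kappa>" "lss two \<kappa>" by (rule lss_finite[OF kinf]; simp add: two_def)+
  moreover have "lss \<beta> \<kappa>" "lss \<theta> \<kappa>" using lss_elem[OF kinf] b thk by blast+
  ultimately have "lss ?Z \<kappa>" by (intro lss_prod[OF kinf]) (use bM thM in simp_all)
  then have P: "lss (PowM ?Z) \<kappa>" by (rule lss_Pow_k[OF ZM])
  have "elts (Rb \<beta>) \<subseteq> elts (PowM ?Z)"
  proof
    fix r assume r: "r \<in> elts (Rb \<beta>)"
    then have r': "r \<in> elts CP" "\<forall>z\<in>elts r. hfst z \<in> elts I0" "elts (coord r) \<subseteq> elts \<beta>" unfolding elts_Rb elts_Rs by blast+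
    have "z \<in> elts ?Z" if z: "z \<in> elts r" for z
    proof -
      have "hfst z \<in> elts I0" using r'(2) z by blast
      then obtain a s where as: "hfst z = hpair tag0 (hpair a s)" "s \<in> elts \<theta>" unfolding I0_def by auto
      have "hfst (hsnd (hfst z)) \<in> elts \<beta>" using r'(3) z unfolding elts_coord by blast
      then have "a \<in> elts \<beta>" using as by simp
      then have "hfst z \<in> elts (hprod (mk {tag0}) (hprod \<beta> \<theta>))" using as by simp
      then have "hpair (hfst z) (hsnd z) \<in> elts ?Z" using hprod_intro CP_pair[OF r'(1) z] by blast
      then show ?thesis using CP_pair[OF r'(1) z] by metis
    qed
    then show "r \<in> elts (PowM ?Z)" using CP_M[OF r'(1)] by (auto simp del: elts_hprod)
  qed
  then have "lss (Rb \<beta>) \<kappa>" using lss_lep_trans[OF RM lep_subset[OF RM] P] by blast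
  then have "lss (hprod \<theta> (Rb \<beta>)) \<kappa>" by (intro lss_prod[OF kinf thM RM]) (use lss_elem[OF kinf thk] in simp_all)
  then show ?thesis by (rule lss_Pow_k[rotated]) (use thM RM in simp)
qed

text \<open>A subset of \<theta> is read off from fewer than \<open>l\<close> conditions of the
  first factor. Together they use fewer than \<kappa> coordinates, bounded by some \<beta> <
  \<kappa> by regularity. So a subset of \<open>hprod\<close> \<theta> \<open>(Rb\<close>
  \<beta>\<open>)\<close> in the ground model codes it, and there are at most \<kappa> such
  codes.\<close>

lemma Pow_theta_upper: "ext.lep (ext.PowM \<theta>) \<kappa>"
proof -
  note r = regularD[OF kreg]
  let ?W = "mk (\<Union>\<beta>\<in>elts \<kappa>. elts (PowM (hprod \<theta> (Rb \<beta>))))"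
  have dW: "dft (\<lambda>e. PowM (hprod \<theta> (Rb (e 0))))" by (intro dfn_intros thM)
  have WM: "?W \<in> M" by (rule UN_in_M[OF kM dW])
  have eW: "elts ?W = (\<Union>\<beta>\<in>elts \<kappa>. elts (PowM (hprod \<theta> (Rb \<beta>))))" by (rule elts_mk) (intro countable_UN countable_elts)
  have RbM: "Rb \<beta> \<in> M" if "\<beta> \<in> M" for \<beta> by (rule dft1_M[of Rb, OF _ that]) (intro dfn_intros)
  have Wk: "lep ?W \<kappa>"
  proof (rule lep_UN[OF kinf kM dW lep_refl[OF kM]])
    fix \<beta> assume b: "\<beta> \<in> elts \<kappa>"
    have "PowM (hprod \<theta> (Rb \<beta>)) \<in> M" using RbM[OF M_trans[OF b kM]] thM by simp
    then show "lep (PowM (hprod \<theta> (Rb \<beta>))) \<kappa>" using lss_imp_lep[OF kord kM _ lss_Rb[OF b]] by blast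
  qed
  have PN: "ext.PowM \<theta> \<in> N" using M_N[OF thM] by simp
  have "ext.lep (ext.PowM \<theta>) ?W"
  proof (rule ext.lep_surj[OF M_N[OF WM] PN, of "decode \<theta>"])
    show "ext.dft (\<lambda>e. decode \<theta> (e 0))" by (rule dft_decode[OF thM]) (rule ext.dft_var)
    show "elts (ext.PowM \<theta>) \<subseteq> decode \<theta> ` elts ?W"
    proof
      fix x assume "x \<in> elts (ext.PowM \<theta>)"
      then have x: "x \<in> N" "elts x \<subseteq> elts \<theta>" by simp_all
      let ?f = "lam \<theta> (\<lambda>\<xi>. if \<xi> \<in> elts x then tag1 else tag0)"
      have f: "?f \<in> N" by (rule ext.lam_in_M[OF M_N[OF thM]]) (intro dfn_intros x M_N tag_M)
      have dl: "lss \<theta> l" by (rule lssI[OF thl lep_refl[OF thM]])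
      have fB: "ap ?f \<xi> \<in> elts two" if "\<xi> \<in> elts \<theta>" for \<xi> using that by (simp add: tag0_def tag1_def two_def)
      obtain T where T: "T \<in> M" "lss T l" "elts T \<subseteq> elts (hprod \<theta> (hprod (Rs I0) two))"
        "\<forall>t\<in>elts T. \<forall>t'\<in>elts T. hfst t = hfst t' \<and> t \<noteq> t' \<longrightarrow> \<not> agree (hfst (hsnd t)) (hfst (hsnd t'))"
        "\<forall>\<xi>\<in>elts \<theta>. \<exists>r\<in>G. hpair \<xi> (hpair r (ap ?f \<xi>)) \<in> elts T"
        "\<forall>r\<in>G. \<forall>\<xi> \<beta>. hpair \<xi> (hpair r \<beta>) \<in> elts T \<longrightarrow> \<beta> = ap ?f \<xi>"
        by (rule easton_N[OF lr I0_M easton_I0_hyps thM dl two_in_M f fB])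
      \<comment> \<open>The recorded pairs of a point and a condition that assigns it the value
        1.\<close>
      let ?Y = "mk {z \<in> elts (hprod \<theta> (Rs I0)). hpair (hfst z) (hpair (hsnd z) tag1) \<in> elts T}"
      have YM: "?Y \<in> M" by (rule sep_in_M) (use thM in simp, intro dfn_intros T tag_M)
      have eY: "elts ?Y = {z \<in> elts (hprod \<theta> (Rs I0)). hpair (hfst z) (hpair (hsnd z) tag1) \<in> elts T}"
        by (rule elts_mk) (intro countable_Collect countable_elts)
      let ?C = "mk (\<Union>t\<in>elts T. elts (coord (hfst (hsnd t))))"
      have dC: "dft (\<lambda>e. coord (hfst (hsnd (e 0))))" by (intro dfn_intros)
      have CM: "?C \<in> M" by (rule UN_in_M[OF T(1) dC])
      have eC: "elts ?C = (\<Union>t\<in>elts T. elts (coord (hfst (hsnd t))))" by (rule elts_mk) (intro countable_UN countable_elts)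
      have tR: "hfst (hsnd t) \<in> elts (Rs I0)" if "t \<in> elts T" for t
      proof -
        have "t \<in> elts (hprod \<theta> (hprod (Rs I0) two))" using that T(3) by blast
        then show ?thesis by auto
      qed
      have lssk: "lss A \<kappa>" if "lss A l" for A using that ordinal_trans[OF _ lk kord] unfolding lss_def by blast
      have "lss ?C \<kappa>"
      proof (rule lss_UN[OF kreg T(1) lssk[OF T(2)] dC])
        fix t assume t: "t \<in> elts T"
        have rCP: "hfst (hsnd t) \<in> elts CP" using tR[OF t] unfolding elts_Rs by blast
        show "lss (coord (hfst (hsnd t))) \<kappa>"
          by (rule lss_lep_trans[OF coord_in_M[OF CP_M[OF rCP]] lep_coord[OF CP_M[OF rCP]] lssk[OF lss_CP[OF rCP]]])
      qed
      then have "lss ?C (cof M \<kappa>)" unfolding kcof .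
      moreover have "elts ?C \<subseteq> elts \<kappa>"
      proof
        fix a assume "a \<in> elts ?C"
        then obtain t z where tz: "t \<in> elts T" "z \<in> elts (hfst (hsnd t))" "a = hfst (hsnd (hfst z))" unfolding eC by (auto simp: elts_coord)
        have "hfst z \<in> elts I0" using tR[OF tz(1)] tz(2) unfolding elts_Rs by blast
        then show "a \<in> elts \<kappa>" unfolding tz(3) I0_def by auto
      qed
      ultimately obtain \<beta> where b: "\<beta> \<in> elts \<kappa>" "elts ?C \<subseteq> elts \<beta>" using cof_bounded[OF kM kord CM] by blast
      have "elts ?Y \<subseteq> elts (hprod \<theta> (Rb \<beta>))"
      proof
        fix z assume "z \<in> elts ?Y"
        then have z: "z \<in> elts (hprod \<theta> (Rs I0))" "hpair (hfst z) (hpair (hsnd z) tag1) \<in> elts T" unfolding eY by blast+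
        then obtain \<xi> r where xr: "z = hpair \<xi> r" "\<xi> \<in> elts \<theta>" "r \<in> elts (Rs I0)" by auto
        have "elts (coord (hfst (hsnd (hpair (hfst z) (hpair (hsnd z) tag1))))) \<subseteq> elts ?C" unfolding eC using z(2) by blast
        then have "elts (coord r) \<subseteq> elts \<beta>" using b(2) xr(1) by simp
        then have "r \<in> elts (Rb \<beta>)" unfolding elts_Rb using xr by blast
        then show "z \<in> elts (hprod \<theta> (Rb \<beta>))" using xr by simp
      qed
      then have "?Y \<in> elts ?W" unfolding eW using b(1) YM by (intro UN_I[of \<beta>]) (simp_all del: elts_hprod)
      moreover have "decode \<theta> ?Y = x"
      proof (rule hc_eqI, intro equalityI subsetI)
        fix \<xi> assume "\<xi> \<in> elts (decode \<theta> ?Y)"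
        then obtain p where p: "\<xi> \<in> elts \<theta>" "p \<in> G" "hpair \<xi> p \<in> elts ?Y" unfolding elts_decode by blast
        then have "hpair \<xi> (hpair p tag1) \<in> elts T" unfolding eY by simp
        then have "tag1 = ap ?f \<xi>" using T(6) p(2) by blast
        then show "\<xi> \<in> elts x" using p(1) by (auto split: if_splits)
      next
        fix \<xi> assume xx: "\<xi> \<in> elts x"
        then have xt: "\<xi> \<in> elts \<theta>" using x by blast
        then obtain p where p: "p \<in> G" "hpair \<xi> (hpair p (ap ?f \<xi>)) \<in> elts T" using T(5) by blast
        then have p1: "hpair \<xi> (hpair p tag1) \<in> elts T" using xx xt by simp
        then have "p \<in> elts (Rs I0)" using tR[OF p1] by simp
        then have "hpair \<xi> p \<in> elts ?Y" unfolding eY using p1 xt by simp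
        then show "\<xi> \<in> elts (decode \<theta> ?Y)" unfolding elts_decode using xt p(1) by blast
      qed
      ultimately show "x \<in> decode \<theta> ` elts ?W" by blast
    qed
  qed
  then show ?thesis by (rule ext.lep_trans[OF PN _ lep_M_N[OF Wk]])
qed

lemma Pow_theta_lower: "ext.lep \<kappa> (ext.PowM \<theta>)"
proof (rule new_subsets[OF regularD(1)[OF th] kM, of tag0])
  show "elts (hprod (mk {tag0}) (hprod \<kappa> \<theta>)) \<subseteq> elts II" unfolding elts_II I0_def by blast
  show "lss (restr (hprod (mk {tag0}) (hprod \<kappa> \<theta>)) p) \<theta>" if "p \<in> elts CP" for p
    using that unfolding elts_CP I0_def by blast
qed simp

lemma Pow_l_lower: "ext.lep \<mu> (ext.PowM l)"
proof (rule new_subsets[OF regularD(1)[OF lr] muM, of tag1])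
  show "elts (hprod (mk {tag1}) (hprod \<mu> l)) \<subseteq> elts II" unfolding elts_II I1_def by blast
  show "lss (restr (hprod (mk {tag1}) (hprod \<mu> l)) p) l" if "p \<in> elts CP" for p
    using that unfolding elts_CP I1_def by blast
qed simp

lemma two_theta: "cexp N two \<theta> = \<kappa>"
  unfolding ext.cexp_eq
proof (rule ext.card_eqI[OF kreg_N(1)])
  have tN: "\<theta> \<in> N" using M_N[OF thM] .
  show FN: "ext.FunM \<theta> two \<in> N" using tN by simp
  show "ext.lep (ext.FunM \<theta> two) \<kappa>" by (rule ext.lep_trans[OF FN ext.lep_Fun_Pow[OF tN] Pow_theta_upper])
  show "ext.lep \<kappa> (ext.FunM \<theta> two)"
    by (rule ext.lep_trans[OF M_N[OF kM] Pow_theta_lower ext.lep_Pow_Fun[OF tN subset_refl ext.two_in_M]])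
qed

text \<open>The regular cardinals of the ground model are unbounded below \<mu>, and they stay
  regular. If \<mu> had a smaller size \<open>?c\<close> in the extension, a regular cardinal above
  the old cardinality of \<open>?c\<close> would inject into that cardinality.\<close>

lemma minf_N: "infinite_cardinal N \<mu>"
proof -
  have mN: "\<mu> \<in> N" using M_N[OF muM] .
  let ?c = "card_in N \<mu>"
  have co: "ordinal ?c" "?c \<in> N" "ext.lep \<mu> ?c" using ext.ordinal_card[OF mN] ext.card_in_M[OF mN] ext.lep_card(1)[OF mN] by auto
  have "?c = \<mu>"
  proof (rule ccontr)
    assume ne: "?c \<noteq> \<mu>"
    have "elts ?c \<subseteq> elts \<mu>" by (rule ext.card_le_ordinal[OF mN mord mN ext.lep_refl[OF mN]])
    then have cm: "?c \<in> elts \<mu>" using ordinal_subset_iff[OF co(1) mord] ne by blast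
    have cM: "?c \<in> M" using M_trans[OF cm muM] .
    have inf: "infinite (elts ?c)" using ext.lep_finite[OF co(3)] infinite_cardinalD(2)[OF minf] by blast
    let ?d = "card_in M ?c"
    have dc: "lep ?c ?d" using lep_card(1)[OF cM] .
    have dM: "?d \<in> M" using card_in_M[OF cM] .
    have dinf: "infinite_cardinal M ?d" unfolding infinite_cardinal_def using cardinal_card[OF cM] lep_finite[OF dc] inf by blast
    have "?d \<in> elts \<mu>" using lss_iff_card[OF mcard cM] lss_elem[OF minf cm] by blast
    then have "lss (PowM ?d) \<mu>" by (intro strong_limit_Pow[OF mus dM] lss_elem[OF minf])
    then obtain \<nu> where v: "\<nu> \<in> elts \<mu>" "cof M \<nu> = \<nu>" "?d \<in> elts \<nu>" using successor_regular[OF dinf mcard] by blast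
    have vo: "ordinal \<nu>" "\<nu> \<in> M" using ordinal_elem[OF mord v(1)] M_trans[OF v(1) muM] by auto
    have "cof N \<nu> = \<nu>" using same_cof[OF vo(2,1)] v(2) by simp
    then have vc: "cardinal N \<nu>" by (rule ext.cardinal_of_cof[OF M_N[OF vo(2)] vo(1)])
    have "ext.lep \<nu> \<mu>" by (rule ext.lep_subset[OF M_N[OF vo(2)] ordinal_sub[OF v(1) mord]])
    then have "ext.lep \<nu> ?c" by (rule ext.lep_trans[OF M_N[OF vo(2)] _ co(3)])
    then have "ext.lep \<nu> ?d" by (rule ext.lep_trans[OF M_N[OF vo(2)] _ lep_M_N[OF dc]])
    then have "ext.lss \<nu> \<nu>" by (rule ext.lssI[OF v(3)])
    then show False using ext.not_lss[OF vc M_N[OF vo(2)]] ext.lep_refl[OF M_N[OF vo(2)]] by blast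
  qed
  then have "cardinal N \<mu>" unfolding cardinal_def using mN mord by blast
  then show ?thesis unfolding infinite_cardinal_def using infinite_cardinalD(2)[OF minf] by blast
qed

text \<open>Koenig's theorem in the extension, applied to the old cofinal sequence in \<mu>.
  Sequences of that length are padded with 0 to length \<kappa>.\<close>

lemma mu_less: "\<mu> \<in> elts (cexp N \<mu> \<kappa>)"
proof -
  have mN: "\<mu> \<in> N" and kN: "\<kappa> \<in> N" and cN: "cof M \<mu> \<in> N" using M_N muM kM cofM by blast+
  let ?d = "cof M \<mu>"
  have F1: "ext.FunM ?d \<mu> \<in> N" "ext.FunM \<kappa> \<mu> \<in> N" using mN kN cN by simp_all
  have z: "mk {} \<in> elts \<mu>" using two_subset[OF minf] by (simp add: two_def)
  have "\<not> ext.lep (ext.FunM ?d \<mu>) \<mu>" by (rule ext.koenig[OF minf_N cN cofin_M_N[OF cof(3)[OF muM mord]]])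
  moreover have "ext.lep (ext.FunM ?d \<mu>) (ext.FunM \<kappa> \<mu>)"
  proof (rule ext.lepI[OF F1(1), of "\<lambda>f. lam \<kappa> (\<lambda>\<xi>. if \<xi> \<in> elts ?d then ap f \<xi> else mk {})"])
    let ?F = "\<lambda>f. lam \<kappa> (\<lambda>\<xi>. if \<xi> \<in> elts ?d then ap f \<xi> else mk {})"
    show d: "ext.dft (\<lambda>e. ?F (e 0))" by (intro dfn_intros kN cN ext.empty_in_M)
    show "?F f \<in> elts (ext.FunM \<kappa> \<mu>)" if "f \<in> elts (ext.FunM ?d \<mu>)" for f
    proof -
      have f: "f \<in> N" "is_fun f ?d \<mu>" using that by simp_all
      have "?F f \<in> N" by (rule ext.dft1_M[of ?F, OF d f(1)])
      moreover have "is_fun (?F f) \<kappa> \<mu>" by (rule is_fun_lam) (use is_fun_ap(2)[OF f(2)] z in simp)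
      ultimately show ?thesis by simp
    qed
    fix f g assume fg: "f \<in> elts (ext.FunM ?d \<mu>)" "g \<in> elts (ext.FunM ?d \<mu>)" "?F f = ?F g"
    have fg': "is_fun f ?d \<mu>" "is_fun g ?d \<mu>" using fg by simp_all
    show "f = g"
    proof (rule ext.is_fun_ext[OF fg'])
      fix a assume a: "a \<in> elts ?d"
      then have "a \<in> elts \<kappa>" using ordinal_sub[OF cofk kord] by blast
      moreover have "ap (?F f) a = ap (?F g) a" using fg(3) by simp
      ultimately show "ap f a = ap g a" using a by simp
    qed
  qed
  ultimately have no: "\<not> ext.lep (ext.FunM \<kappa> \<mu>) \<mu>" using ext.lep_trans[OF F1(1)] by blast
  let ?c = "card_in N (ext.FunM \<kappa> \<mu>)"
  have c: "ordinal ?c" "?c \<in> N" "ext.lep (ext.FunM \<kappa> \<mu>) ?c"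
    using ext.ordinal_card[OF F1(2)] ext.card_in_M[OF F1(2)] ext.lep_card(1)[OF F1(2)] by auto
  have "\<not> elts ?c \<subseteq> elts \<mu>" using no ext.lep_mono_r[OF F1(2) c(3)] by blast
  then show ?thesis unfolding ext.cexp_eq using ordinal_not_subset[OF c(1) mord] by blast
qed

text \<open>As \<mu> \<le> 2^\<open>l\<close> in the extension, \<mu>^\<kappa> \<le> 2^(\<kappa>
  \<times> \<open>l\<close>) = 2^\<kappa>: a function is coded by the subset of \<kappa> \<times>
  \<open>l\<close> whose sections are the subsets of \<open>l\<close> indexed by its values.\<close>

lemma cexp_equal: "cexp N two \<kappa> = cexp N \<mu> \<kappa>"
  unfolding ext.cexp_eq
proof (rule ext.card_eq)
  have mN: "\<mu> \<in> N" and kN: "\<kappa> \<in> N" and lN: "l \<in> N" using M_N muM kM lM by blast+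
  show F: "ext.FunM \<kappa> two \<in> N" and F': "ext.FunM \<kappa> \<mu> \<in> N" using mN kN by simp_all
  show "ext.lep (ext.FunM \<kappa> two) (ext.FunM \<kappa> \<mu>)"
  proof (rule ext.lep_subset[OF F])
    have "is_fun f \<kappa> \<mu>" if "is_fun f \<kappa> two" for f using that two_subset[OF minf] unfolding is_fun_def by blast
    then show "elts (ext.FunM \<kappa> two) \<subseteq> elts (ext.FunM \<kappa> \<mu>)" by auto
  qed
  obtain x where x: "x \<in> N" "ext.injf x \<mu> (ext.PowM l)" using Pow_l_lower unfolding ext.lep_def by blast
  let ?F = "\<lambda>f. mk {z \<in> elts (hprod \<kappa> l). hsnd z \<in> elts (ap x (ap f (hfst z)))}"
  have d: "ext.dft (\<lambda>e. ?F (e 0))" by (intro dfn_intros kN lN x)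
  have eF: "elts (?F f) = {z \<in> elts (hprod \<kappa> l). hsnd z \<in> elts (ap x (ap f (hfst z)))}" for f
    by (rule elts_mk) (intro countable_Collect countable_elts)
  have 1: "ext.lep (ext.FunM \<kappa> \<mu>) (ext.PowM (hprod \<kappa> l))"
  proof (rule ext.lepI[OF F' d])
    fix f assume "f \<in> elts (ext.FunM \<kappa> \<mu>)"
    then have "?F f \<in> N" by (intro ext.dft1_M[of ?F, OF d]) simp
    moreover have "elts (?F f) \<subseteq> elts (hprod \<kappa> l)" unfolding eF by blast
    ultimately show "?F f \<in> elts (ext.PowM (hprod \<kappa> l))" by (simp del: elts_hprod)
  next
    fix f g assume fg: "f \<in> elts (ext.FunM \<kappa> \<mu>)" "g \<in> elts (ext.FunM \<kappa> \<mu>)" "?F f = ?F g"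
    have fg': "is_fun f \<kappa> \<mu>" "is_fun g \<kappa> \<mu>" using fg by simp_all
    show "f = g"
    proof (rule ext.is_fun_ext[OF fg'])
      fix a assume a: "a \<in> elts \<kappa>"
      have m: "ap f a \<in> elts \<mu>" "ap g a \<in> elts \<mu>" using is_fun_ap(2)[OF _ a] fg' by blast+
      have s: "elts (ap x (ap f a)) \<subseteq> elts l" "elts (ap x (ap g a)) \<subseteq> elts l" using x(2) m unfolding ext.injf_def by auto
      have "s \<in> elts (ap x (ap f a)) \<longleftrightarrow> s \<in> elts (ap x (ap g a))" if sl: "s \<in> elts l" for s
      proof -
        have "hpair a s \<in> elts (?F f) \<longleftrightarrow> hpair a s \<in> elts (?F g)" unfolding fg(3) ..
        then show ?thesis unfolding eF using a sl by simp
      qed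
      then have "ap x (ap f a) = ap x (ap g a)" using s by (intro hc_eqI) blast
      then show "ap f a = ap g a" using x(2) m unfolding ext.injf_def by blast
    qed
  qed
  have kl: "ext.lep (hprod \<kappa> l) \<kappa>"
  proof (rule ext.lep_trans[OF _ _ ext.lep_square[OF kreg_N(2)]])
    show "hprod \<kappa> l \<in> N" using kN lN by simp
    show "ext.lep (hprod \<kappa> l) (hprod \<kappa> \<kappa>)"
      by (rule ext.lep_prod_mono[OF kN lN ext.lep_refl[OF kN] ext.lep_subset[OF lN ordinal_sub[OF lk kord]]])
  qed
  have "ext.lep (ext.PowM (hprod \<kappa> l)) (ext.PowM \<kappa>)" by (rule ext.lep_Pow_mono[OF _ kN kl]) (use kN lN in simp)
  then have "ext.lep (ext.FunM \<kappa> \<mu>) (ext.PowM \<kappa>)" by (rule ext.lep_trans[OF F' 1])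
  then show "ext.lep (ext.FunM \<kappa> \<mu>) (ext.FunM \<kappa> two)"
    by (rule ext.lep_trans[OF F' _ ext.lep_Pow_Fun[OF kN subset_refl ext.two_in_M]])
qed

section \<open>A generating family with at most mu codes\<close>

definition Pbd :: "hc \<Rightarrow> hc" where "Pbd \<zeta> = mk {p \<in> elts CP. elts (coord (restr I1 p)) \<subseteq> elts \<zeta>}"

lemma elts_Pbd: "elts (Pbd \<zeta>) = {p \<in> elts CP. elts (coord (restr I1 p)) \<subseteq> elts \<zeta>}" unfolding Pbd_def by simp

lemma dft_Pbd [dfn_intros]: "dft t \<Longrightarrow> dft (\<lambda>e. Pbd (t e))"
  unfolding Pbd_def by (rule dft1[of "\<lambda>\<zeta>. mk {p \<in> elts CP. elts (coord (restr I1 p)) \<subseteq> elts \<zeta>}"]) (intro dfn_intros I1_M CP_in_M)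

lemma Pbd_in_M: "\<zeta> \<in> M \<Longrightarrow> Pbd \<zeta> \<in> M" by (rule dft1_M[of Pbd]) (intro dfn_intros)

text \<open>The coordinates of the first factor number \<kappa> < \<mu>, and those of the second are
  cut off at \<zeta>, so these conditions are subsets of a set smaller than \<mu>; two power sets
  stay below the strong limit \<mu>.\<close>

lemma lss_Pbd: assumes z: "\<zeta> \<in> elts \<mu>" shows "lss (PowM (hprod \<kappa> (Pbd \<zeta>))) \<mu>"
proof -
  have zM: "\<zeta> \<in> M" using M_trans[OF z muM] .
  have PM: "Pbd \<zeta> \<in> M" using Pbd_in_M[OF zM] .
  let ?J = "hprod (mk {tag1}) (hprod \<zeta> l)"
  let ?Z = "hprod (mk (elts I0 \<union> elts ?J)) two"
  have JM: "?J \<in> M" "mk (elts I0 \<union> elts ?J) \<in> M" using zM lM by (simp_all del: elts_hprod)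
  then have ZM: "?Z \<in> M" by simp
  have f: "lss (mk {tag0}) \<mu>" "lss (mk {tag1}) \<mu>" "lss two \<mu>" by (rule lss_finite[OF minf]; simp add: two_def)+
  have s: "lss \<zeta> \<mu>" "lss \<theta> \<mu>" "lss l \<mu>" "lss \<kappa> \<mu>" using lss_elem[OF minf] z theta_mu lm km by blast+
  have "lss I0 \<mu>" unfolding I0_def by (intro lss_prod[OF minf] f s) (use kM thM in simp_all)
  moreover have "lss ?J \<mu>" by (intro lss_prod[OF minf] f s) (use zM lM in simp_all)
  ultimately have "lss (mk (elts I0 \<union> elts ?J)) \<mu>" by (rule lss_cup[OF minf I0_M JM(1)])
  then have "lss ?Z \<mu>" by (rule lss_prod[OF minf JM(2) two_in_M _ f(3)])
  then have P: "lss (PowM ?Z) \<mu>" by (rule strong_limit_Pow[OF mus ZM])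
  have "elts (Pbd \<zeta>) \<subseteq> elts (PowM ?Z)"
  proof
    fix p assume "p \<in> elts (Pbd \<zeta>)"
    then have p: "p \<in> elts CP" "elts (coord (restr I1 p)) \<subseteq> elts \<zeta>" unfolding elts_Pbd by blast+
    have "z \<in> elts ?Z" if z: "z \<in> elts p" for z
    proof -
      note zp = CP_pair[OF p(1) z]
      have "hfst z \<in> elts I0 \<or> hfst z \<in> elts ?J"
      proof (cases "hfst z \<in> elts I0")
        case False
        then have z1: "hfst z \<in> elts I1" using zp unfolding elts_II by blast
        then obtain a s where as: "hfst z = hpair tag1 (hpair a s)" "s \<in> elts l" unfolding I1_def by auto
        have "hfst (hsnd (hfst z)) \<in> elts \<zeta>" using p(2) z z1 unfolding elts_coord elts_restr by blast
        then show ?thesis using as by simp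
      qed blast
      then have "hfst z \<in> elts (mk (elts I0 \<union> elts ?J))" by (simp del: elts_hprod)
      then have "hpair (hfst z) (hsnd z) \<in> elts ?Z" using hprod_intro zp by blast
      then show ?thesis using zp by metis
    qed
    then show "p \<in> elts (PowM ?Z)" using CP_M[OF p(1)] by (auto simp del: elts_hprod)
  qed
  then have "lss (Pbd \<zeta>) \<mu>" using lss_lep_trans[OF PM lep_subset[OF PM] P] by blast
  then have "lss (hprod \<kappa> (Pbd \<zeta>)) \<mu>" by (rule lss_prod[OF minf kM PM s(4)])
  then show ?thesis by (rule strong_limit_Pow[OF mus, rotated]) (use kM PM in simp)
qed

definition W where "W = mk (\<Union>\<zeta>\<in>elts \<mu>. elts (PowM (hprod \<kappa> (Pbd \<zeta>))))"

lemma elts_W: "elts W = (\<Union>\<zeta>\<in>elts \<mu>. elts (PowM (hprod \<kappa> (Pbd \<zeta>))))"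
  unfolding W_def by (rule elts_mk) (intro countable_UN countable_elts)

lemma dft_W: "dft (\<lambda>e. PowM (hprod \<kappa> (Pbd (e 0))))" by (intro dfn_intros kM)

lemma W_in_M: "W \<in> M" unfolding W_def by (rule UN_in_M[OF muM dft_W])

lemma lep_W: "lep W \<mu>"
  unfolding W_def
proof (rule lep_UN[OF minf muM dft_W lep_refl[OF muM]])
  fix \<zeta> assume z: "\<zeta> \<in> elts \<mu>"
  have "PowM (hprod \<kappa> (Pbd \<zeta>)) \<in> M" using Pbd_in_M[OF M_trans[OF z muM]] kM by simp
  then show "lep (PowM (hprod \<kappa> (Pbd \<zeta>))) \<mu>" using lss_imp_lep[OF mord muM _ lss_Pbd[OF z]] by blast
qed

lemma D_uf: "ultrafilter_on M \<kappa> D" using D unfolding measure_on_def by blast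

text \<open>The bounds are drawn from a fixed cofinal sequence in \<mu>, so choosing one for each
  \<xi> colours \<kappa> with only cf(\<mu>) < \<kappa> colours, and one colour class belongs to
  \<open>D\<close>. A bound from the sequence exists for each \<xi> because at most \<open>l\<close>
  conditions, each of size below \<open>l\<close> on the second factor, use at most \<open>l\<close>
  < cf(\<mu>) coordinates.\<close>

lemma code_bound:
  assumes A: "A \<in> M" "\<forall>\<xi>\<in>elts \<kappa>. elts (ap A \<xi>) \<subseteq> elts CP \<and> lep (ap A \<xi>) l"
  shows "\<exists>B\<in>elts D. \<exists>\<zeta>\<in>elts \<mu>. \<forall>\<xi>\<in>elts B. elts (ap A \<xi>) \<subseteq> elts (Pbd \<zeta>)"
proof -
  let ?d = "cof M \<mu>"
  obtain c where c: "c \<in> M" "\<And>\<xi>. \<xi> \<in> elts ?d \<Longrightarrow> ap c \<xi> \<in> elts \<mu>" "\<And>\<beta>. \<beta> \<in> elts \<mu> \<Longrightarrow> \<exists>\<xi>\<in>elts ?d. elts \<beta> \<subseteq> elts (ap c \<xi>)"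
    using cof(3)[OF muM mord] unfolding cofin_def by blast
  have "\<exists>g\<in>M. \<forall>\<xi>\<in>elts \<kappa>. ap g \<xi> \<in> elts ?d \<and> elts (ap A \<xi>) \<subseteq> elts (Pbd (ap c (ap g \<xi>)))"
  proof (rule AC[OF kM, of "\<lambda>\<xi> \<eta>. \<eta> \<in> elts ?d \<and> elts (ap A \<xi>) \<subseteq> elts (Pbd (ap c \<eta>))"])
    show "dfn (\<lambda>e. e 1 \<in> elts ?d \<and> elts (ap A (e 0)) \<subseteq> elts (Pbd (ap c (e 1))))" by (intro dfn_intros cofM A c)
    fix \<xi> assume x: "\<xi> \<in> elts \<kappa>"
    let ?A = "ap A \<xi>"
    have AM: "?A \<in> M" using ap_in_M A(1) M_trans[OF x kM] by blast
    let ?C = "mk (\<Union>p\<in>elts ?A. elts (coord (restr I1 p)))"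
    have dC: "dft (\<lambda>e. coord (restr I1 (e 0)))" by (intro dfn_intros I1_M)
    have CM: "?C \<in> M" by (rule UN_in_M[OF AM dC])
    have eC: "elts ?C = (\<Union>p\<in>elts ?A. elts (coord (restr I1 p)))" by (rule elts_mk) (intro countable_UN countable_elts)
    have linf: "infinite_cardinal M l" and lo: "ordinal l" using regularD[OF lr] by blast+
    have "lep ?C l"
    proof (rule lep_UN[OF linf AM dC])
      show "lep ?A l" using A(2) x by blast
      fix p assume "p \<in> elts ?A"
      then have p: "p \<in> elts CP" using A(2) x by blast
      have rM: "restr I1 p \<in> M" using CP_M[OF p] by simp
      have "lep (coord (restr I1 p)) (restr I1 p)" by (rule lep_coord[OF rM])
      moreover have "lep (restr I1 p) l" using lss_imp_lep[OF lo lM rM] p unfolding elts_CP by blast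
      ultimately show "lep (coord (restr I1 p)) l" using lep_trans[OF coord_in_M[OF rM]] by blast
    qed
    then have "lss ?C ?d" by (rule lssI[OF lcof])
    moreover have "elts ?C \<subseteq> elts \<mu>"
    proof
      fix a assume "a \<in> elts ?C"
      then obtain p z where "z \<in> elts (restr I1 p)" "a = hfst (hsnd (hfst z))" unfolding eC by (auto simp: elts_coord)
      then have "hfst z \<in> elts I1" "a = hfst (hsnd (hfst z))" unfolding elts_restr by blast+
      then show "a \<in> elts \<mu>" unfolding I1_def by auto
    qed
    ultimately obtain \<gamma> where g: "\<gamma> \<in> elts \<mu>" "elts ?C \<subseteq> elts \<gamma>" using cof_bounded[OF muM mord CM] by blast
    obtain \<eta> where e: "\<eta> \<in> elts ?d" "elts \<gamma> \<subseteq> elts (ap c \<eta>)" using c(3)[OF g(1)] by blast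
    have "elts ?A \<subseteq> elts (Pbd (ap c \<eta>))"
    proof
      fix p assume p: "p \<in> elts ?A"
      then have "elts (coord (restr I1 p)) \<subseteq> elts ?C" unfolding eC by blast
      then show "p \<in> elts (Pbd (ap c \<eta>))" unfolding elts_Pbd using A(2) x p g(2) e(2) by blast
    qed
    then show "\<exists>y\<in>M. y \<in> elts ?d \<and> elts ?A \<subseteq> elts (Pbd (ap c y))" using e(1) M_trans[OF e(1) cofM] by blast
  qed
  then obtain g where g: "g \<in> M" "\<And>\<xi>. \<xi> \<in> elts \<kappa> \<Longrightarrow> ap g \<xi> \<in> elts ?d \<and> elts (ap A \<xi>) \<subseteq> elts (Pbd (ap c (ap g \<xi>)))" by blast
  have "\<exists>\<eta>\<in>elts ?d. mk {\<xi> \<in> elts \<kappa>. ap g \<xi> = \<eta>} \<in> elts D"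
    by (rule measure_partition[OF D kM cofk]) (intro dfn_intros g, use g in blast)
  then obtain \<eta> where e: "\<eta> \<in> elts ?d" "mk {\<xi> \<in> elts \<kappa>. ap g \<xi> = \<eta>} \<in> elts D" by blast
  have "\<forall>\<xi>\<in>elts (mk {\<xi> \<in> elts \<kappa>. ap g \<xi> = \<eta>}). elts (ap A \<xi>) \<subseteq> elts (Pbd (ap c \<eta>))" using g(2) by auto
  then show ?thesis using e(2) c(2)[OF e(1)] by blast
qed

lemma decode_cover:
  assumes A: "A \<in> N" "elts A \<subseteq> elts \<kappa>"
  shows "\<exists>B\<in>elts D. \<exists>Y\<in>elts W. decode \<kappa> Y = mk (elts A \<inter> elts B)"
proof -
  obtain \<tau> where t: "\<tau> \<in> M" "A = val G \<tau>" using N_name[OF A(1)] by blast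
  define S where "S \<xi> = mk {p \<in> elts CP. fmem p (chk \<xi>) \<tau>}" for \<xi>
  \<comment> \<open>\<open>S\<close> \<xi> consists of the conditions forcing \<xi> into
    \<open>A\<close>; predense subfamilies of these sets replace an arbitrary name by one with small
    supports.\<close>
  have dS: "dft (\<lambda>e. S (e 0))" unfolding S_def by (intro dfn_intros t CP_in_M)
  have eS: "elts (S \<xi>) = {p \<in> elts CP. fmem p (chk \<xi>) \<tau>}" for \<xi> unfolding S_def by simp
  have GS: "G \<inter> elts (S \<xi>) \<noteq> {} \<longleftrightarrow> \<xi> \<in> elts A" if "\<xi> \<in> elts \<kappa>" for \<xi>
    using fmem_truth[OF chk_in_M[OF M_trans[OF that kM]] t(1)] G_CP unfolding eS t(2) by auto
  have "\<exists>A\<in>M. \<forall>\<xi>\<in>elts \<kappa>. elts (ap A \<xi>) \<subseteq> elts (S \<xi>) \<and> lep (ap A \<xi>) l \<and> (G \<inter> elts (S \<xi>) \<noteq> {} \<longrightarrow> G \<inter> elts (ap A \<xi>) \<noteq> {})"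
  proof (rule cc_G[OF kM dS])
    show "elts (S \<xi>) \<subseteq> elts CP" for \<xi> unfolding eS by blast
    fix \<xi> p q assume "p \<in> elts (S \<xi>)" "q \<in> elts CP" "elts p \<subseteq> elts q"
    then show "q \<in> elts (S \<xi>)" unfolding eS using fmem_mono[of p _ _ q] Cleq_iff by blast
  qed
  then obtain C where C: "C \<in> M" "\<forall>\<xi>\<in>elts \<kappa>. elts (ap C \<xi>) \<subseteq> elts (S \<xi>) \<and> lep (ap C \<xi>) l \<and> (G \<inter> elts (S \<xi>) \<noteq> {} \<longrightarrow> G \<inter> elts (ap C \<xi>) \<noteq> {})"
    by blast
  have C': "\<forall>\<xi>\<in>elts \<kappa>. elts (ap C \<xi>) \<subseteq> elts CP \<and> lep (ap C \<xi>) l" using C(2) unfolding eS by blast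
  obtain B \<zeta> where B: "B \<in> elts D" "\<zeta> \<in> elts \<mu>" "\<forall>\<xi>\<in>elts B. elts (ap C \<xi>) \<subseteq> elts (Pbd \<zeta>)" using code_bound[OF C(1) C'] by blast
  have BM: "B \<in> M" "elts B \<subseteq> elts \<kappa>" using M_trans[OF B(1) ultrafilterD(1)[OF D_uf]] ultrafilterD(2)[OF D_uf B(1)] by blast+
  \<comment> \<open>Only the \<xi> in \<open>B\<close>, where the uniform bound holds, are kept; the
    code therefore decodes to \<open>A\<close> \<inter> \<open>B\<close> and not to
    \<open>A\<close>.\<close>
  let ?Y = "mk {z \<in> elts (hprod \<kappa> CP). hfst z \<in> elts B \<and> hsnd z \<in> elts (ap C (hfst z))}"
  have YM: "?Y \<in> M" by (rule sep_in_M) (use kM in simp, intro dfn_intros C BM)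
  have eY: "elts ?Y = {z \<in> elts (hprod \<kappa> CP). hfst z \<in> elts B \<and> hsnd z \<in> elts (ap C (hfst z))}"
    by (rule elts_mk) (intro countable_Collect countable_elts)
  have "elts ?Y \<subseteq> elts (hprod \<kappa> (Pbd \<zeta>))"
  proof
    fix z assume "z \<in> elts ?Y"
    then have z: "z \<in> elts (hprod \<kappa> CP)" "hfst z \<in> elts B" "hsnd z \<in> elts (ap C (hfst z))" unfolding eY by blast+
    then obtain a b where ab: "z = hpair a b" "a \<in> elts \<kappa>" by auto
    have "b \<in> elts (Pbd \<zeta>)" using z(2,3) B(3) unfolding ab(1) by auto
    then show "z \<in> elts (hprod \<kappa> (Pbd \<zeta>))" unfolding ab(1) by (rule hprod_intro[OF ab(2)])
  qed
  then have "?Y \<in> elts W" unfolding elts_W using B(2) YM by (intro UN_I[of \<zeta>]) (simp_all del: elts_hprod)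
  moreover have "decode \<kappa> ?Y = mk (elts A \<inter> elts B)"
  proof (rule hc_eqI, intro equalityI subsetI)
    fix \<xi> assume "\<xi> \<in> elts (decode \<kappa> ?Y)"
    then obtain p where p: "\<xi> \<in> elts \<kappa>" "p \<in> G" "hpair \<xi> p \<in> elts ?Y" unfolding elts_decode by blast
    have "\<xi> \<in> elts B" "p \<in> elts (ap C \<xi>)" using p(3) unfolding eY by auto
    moreover have "\<xi> \<in> elts A" using GS[OF p(1)] C(2) p(1,2) \<open>p \<in> elts (ap C \<xi>)\<close> by blast
    ultimately show "\<xi> \<in> elts (mk (elts A \<inter> elts B))" by simp
  next
    fix \<xi> assume "\<xi> \<in> elts (mk (elts A \<inter> elts B))"
    then have x: "\<xi> \<in> elts A" "\<xi> \<in> elts B" "\<xi> \<in> elts \<kappa>" using BM(2) by auto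
    then obtain p where p: "p \<in> G" "p \<in> elts (ap C \<xi>)" using C(2) GS by blast
    have "hpair \<xi> p \<in> elts ?Y" unfolding eY using x p G_CP[OF p(1)] by simp
    then show "\<xi> \<in> elts (decode \<kappa> ?Y)" unfolding elts_decode using x(3) p(1) by blast
  qed
  ultimately show ?thesis using B(1) by blast
qed

lemma ultrafilter_number_bound: "elts (ultrafilter_number N \<kappa>) \<subseteq> elts \<mu>"
proof -
  have kN: "\<kappa> \<in> N" and DN: "D \<in> N" and WN: "W \<in> N" using M_N kM ultrafilterD(1)[OF D_uf] W_in_M by blast+
  obtain U where U: "ultrafilter_on N \<kappa> U" "elts D \<subseteq> elts U"
    using ext.ultrafilter_extension[OF kN DN ultrafilterD(2-5)[OF D_uf]] by blast
  note u = ext.ultrafilterD[OF U(1)]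
  \<comment> \<open>A member of size less than \<kappa> would be bounded, \<kappa> being regular in
    the extension as well, and so disjoint from a final segment, which already belongs to
    \<open>D\<close>.\<close>
  have uni: "uniform N \<kappa> U" unfolding uniform_def
  proof
    fix A assume A: "A \<in> elts U"
    have AN: "A \<in> N" by (rule ext.M_trans[OF A u(1)])
    have "\<not> ext.lss A \<kappa>"
    proof
      assume "ext.lss A \<kappa>"
      then have "ext.lss A (cof N \<kappa>)" using ext.regularD(5)[OF kreg_N(3)] by simp
      then obtain \<beta> where b: "\<beta> \<in> elts \<kappa>" "elts A \<subseteq> elts \<beta>" using ext.cof_bounded[OF kN kord AN u(2)[OF A]] by blast
      have "mk (elts \<kappa> - elts \<beta>) \<in> elts U" using measure_cobounded[OF D kM kord b(1)] U(2) by blast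
      from u(5)[OF A this] have "mk {} \<in> elts U" using b(2) by (simp add: Diff_eq) (metis Diff_disjoint Diff_eq Int_Diff inf.absorb1 inf_commute)
      then show False using u(4) by simp
    qed
    then have "ext.lep \<kappa> A" using ext.not_lss[OF kreg_N(1) AN] by blast
    then show "card_in N A = \<kappa>" by (rule ext.card_eqI[OF kreg_N(1) AN ext.lep_subset[OF AN u(2)[OF A]]])
  qed
  \<comment> \<open>Not every code decodes to a member of \<open>U\<close>; those that do suffice,
    since \<open>A\<close> \<inter> \<open>B\<close> lies in \<open>U\<close> whenever
    \<open>A\<close> does and \<open>B\<close> is in \<open>D\<close>.\<close>
  let ?X = "mk {A \<in> elts U. \<exists>Y\<in>elts W. A = decode \<kappa> Y}"
  have XN: "?X \<in> N" by (rule ext.sep_in_M[OF u(1)]) (intro dfn_intros dft_decode kM WN)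
  have eX: "elts ?X = {A \<in> elts U. \<exists>Y\<in>elts W. A = decode \<kappa> Y}" by (rule elts_mk) (intro countable_Collect countable_elts)
  have gen: "generates N \<kappa> ?X U" unfolding generates_def
  proof (intro conjI XN equalityI subsetI CollectI)
    show "A \<in> elts U" if "A \<in> elts ?X" for A using that unfolding eX by blast
    fix A assume A: "A \<in> elts U"
    show AN: "A \<in> N" by (rule ext.M_trans[OF A u(1)])
    show "x \<in> elts \<kappa>" if "x \<in> elts A" for x using u(2)[OF A] that by blast
    obtain B Y where B: "B \<in> elts D" "Y \<in> elts W" "decode \<kappa> Y = mk (elts A \<inter> elts B)" using decode_cover[OF AN u(2)[OF A]] by blast
    have "mk (elts A \<inter> elts B) \<in> elts U" using u(5)[OF A] B(1) U(2) by blast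
    then have "mk (elts A \<inter> elts B) \<in> elts ?X" unfolding eX using B(2) B(3)[symmetric] by blast
    then show "\<exists>B\<in>elts ?X. elts B \<subseteq> elts A" by (rule bexI[rotated]) simp
  next
    fix A assume "A \<in> {A \<in> N. elts A \<subseteq> elts \<kappa> \<and> (\<exists>B\<in>elts ?X. elts B \<subseteq> elts A)}"
    then obtain B where B: "A \<in> N" "elts A \<subseteq> elts \<kappa>" "B \<in> elts U" "elts B \<subseteq> elts A" unfolding eX by blast
    show "A \<in> elts U" by (rule u(6)[OF B(3,1,4,2)])
  qed
  have "ext.lep ?X W"
    by (rule ext.lep_surj[OF WN XN, of "decode \<kappa>"]) (rule dft_decode[OF kM ext.dft_var], unfold eX, blast)
  then have "ext.lep ?X \<mu>" by (rule ext.lep_trans[OF XN _ lep_M_N[OF lep_W]])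
  then have c: "elts (card_in N ?X) \<subseteq> elts \<mu>" by (rule ext.card_le_ordinal[OF XN mord M_N[OF muM]])
  have "elts (ultrafilter_number N \<kappa>) \<subseteq> elts (card_in N ?X)" unfolding ultrafilter_number_def
    by (rule least_ord(3)[OF ext.ordinal_card[OF XN]]) (use ext.cardinal_card[OF XN] ext.ordinal_card[OF XN] U(1) uni gen in blast)+
  then show ?thesis using c by blast
qed

end

theorem theorem3p3:
  fixes M :: "hc set" and \<theta> lam \<kappa> \<mu> D :: hc
  assumes "ctm M"
    and "infinite_cardinal M \<theta>" and "infinite_cardinal M lam"
    and "infinite_cardinal M \<kappa>" and "infinite_cardinal M \<mu>"
    and "\<theta> \<in> elts lam" and "lam \<in> elts (cof M \<mu>)"
    and "cof M \<mu> \<in> elts \<kappa>" and "\<kappa> \<in> elts \<mu>"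
    and "regular_cardinal M \<theta>"
    and "cexp_less M two \<theta> = \<theta>"
    and "strong_limit M \<mu>"
    and "cexp_less M lam lam = lam"
    and "measurable_cardinal M \<kappa>"
    and "normal_measure M \<kappa> D"
  shows "\<exists>P leq one. forcing_notion M P leq one \<and>
    (\<forall>G. generic M P leq one G \<longrightarrow>
      (let N = generic_ext M P G in
        same_cofinalities M N \<and>
        cexp N two \<theta> = \<kappa> \<and>
        elts (ultrafilter_number N \<kappa>) \<subseteq> elts \<mu> \<and>
        cexp N two \<kappa> = cexp N \<mu> \<kappa> \<and>
        \<mu> \<in> elts (cexp N \<mu> \<kappa>)))"
proof -
  interpret ctm_model M by (rule ctm_modelI[OF assms(1)])
  have Dm: "measure_on M \<kappa> D" using assms(15) unfolding normal_measure_def by blast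
  have kM: "\<kappa> \<in> M" and mM: "\<mu> \<in> M" and lM: "lam \<in> M"
    using cardinalD(1)[OF infinite_cardinalD(1)] assms(3-5) by blast+
  \<comment> \<open>Regularity of \<open>lam\<close> comes from
    \<open>lam\<close>^{<\<open>lam\<close>} = \<open>lam\<close> through Koenig's theorem.\<close>
  have lr: "regular_cardinal M lam" by (rule regular_of_cexp_less[OF assms(3)]) (simp add: assms(13))
  have powth: "lep (PowM \<alpha>) \<theta>" if "\<alpha> \<in> elts \<theta>" for \<alpha>
    by (rule Pow_lep_of_cexp_less[OF assms(2) subset_refl two_in_M _ that]) (simp add: assms(11))
  have powl: "lep (PowM \<alpha>) lam" if "\<alpha> \<in> elts lam" for \<alpha>
    by (rule Pow_lep_of_cexp_less[OF assms(3) two_subset[OF assms(3)] lM _ that]) (simp add: assms(13))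
  interpret cohen M \<theta> lam \<kappa> \<mu> by unfold_locales (fact assms lr powth powl kM mM)+
  have "same_cofinalities M N \<and> cexp N two \<theta> = \<kappa> \<and> elts (ultrafilter_number N \<kappa>) \<subseteq> elts \<mu> \<and>
      cexp N two \<kappa> = cexp N \<mu> \<kappa> \<and> \<mu> \<in> elts (cexp N \<mu> \<kappa>)"
    if G: "generic M CP Cleq (mk {}) G" and N: "N = generic_ext M CP G" for G N
  proof -
    interpret s: small_ultrafilter M \<theta> lam \<kappa> \<mu> G D
      by unfold_locales (fact G assms Dm measure_regular[OF Dm assms(4)] measure_strong_limit[OF Dm assms(4)])+
    show ?thesis unfolding same_cofinalities_def N
      using s.same_cof s.two_theta s.ultrafilter_number_bound s.cexp_equal s.mu_less by auto
  qed
  then show ?thesis using notion unfolding Let_def by blast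
qed

end
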